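(* Let $\varphi_\lambda:\mathbb{R}^n\times\mathbb{R}\to\mathbb{R}^n$, $\lambda\in\mathbb{R}$, be a continuous family of flows and let $\Omega$ be a global attractor for all the flows $\varphi_\lambda$. Suppose that $K$ and $C$ are isolated invariant sets for every $\lambda$, that $(K,C)$ is a repeller-attractor decomposition of $\Omega$ for $\varphi_{\lambda_0}$, and that $(K,C)$ is an attractor-repeller decomposition of $\Omega$ for $\varphi_{\lambda_1}$, where $\lambda_0<\lambda_1$. Suppose, additionally, that for $\lambda_0<\lambda<\lambda_1$ the isolated invariant set $R_\lambda$ is a repeller of $\varphi_\lambda$ and that $(K\cup C,R_\lambda)$ is an attractor-repeller decomposition of $\Omega$ (for $\varphi_\lambda$). Denote by $r_k$ the rank of $H^k(K)$ and by $r_k'$ the rank of $H^k(C)$. Then the Morse equations are \[ r_0'+(r_1'+r_0'-1)t+\sum_{k\ge2}(r_k'+r_{k-1}')t^k=1+(1+t)Q_1(t) \] for the repeller-attractor decomposition $(K,C)$ of $\varphi_{\lambda_0}|_\Omega$, \[ r_0+r_0'+(r_1+r_0+r_1'+r_0'-1)t+\sum_{k\ge2}(r_k+r_{k-1}+r_k'+r_{k-1}')t^k=1+(1+t)Q_2(t) \] for the attractor-repeller decomposition $(K\cup C,R_\lambda)$ of $\varphi_\lambda|_\Omega$ with $\lambda_0<\lambda<\lambda_1$, and \[ r_0+(r_1+r_0-1)t+\sum_{k\ge2}(r_k+r_{k-1})t^k=1+(1+t)Q_3(t) \] for the attractor-repeller decomposition $(K,C)$ of $\varphi_{\lambda_1}|_\Omega$,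 where $Q_1,Q_2,Q_3$ are polynomials with non-negative integer coefficients.
   Context: Write $xt$ for the image of $x$ at time $t$. $\omega(x)=\bigcap_{t>0}\overline{x[t,\infty)}$, $\omega^*(x)=\bigcap_{t<0}\overline{x(-\infty,t]}$. An invariant compactum is stable (resp. negatively stable) if every neighborhood $U$ of it contains a neighborhood $V$ of it with $V[0,\infty)\subset U$ (resp. $V(-\infty,0]\subset U$); it is attracting (resp. repelling) if it has a neighborhood all of whose points have non-empty $\omega$-limit (resp. $\omega^*$-limit) contained in it. An attractor is a stable attracting compactum; a repeller is a negatively stable repelling compactum. A global attractor is an attractor $\Omega$ with $\emptyset\ne\omega(x)\subset\Omega$ for every $x\in\mathbb{R}^n$. An attractor-repeller decomposition $(A,R)$ of a compact invariant set $\Omega$ consists of an attractor $A$ of the flow restricted to $\Omega$ and its complementary (dual) repeller $R$, i.e. the complement in $\Omega$ of the basin of attraction of $A$ in $\Omega$. $(K,C)$ is a repeller-attractor decomposition if $(C,K)$ is an attractor-repeller decomposition. All the sets $K$, $C$, $R_\lambda$ are understood to be non-empty. $H^*$ is Čech cohomology with coefficients in $\mathbb{Z}$. An isolated invariant set $S$ is a compact invariant set that is the maximal invariant set in some compact neighborhood of itself. Its Conley index $h(S)$ is the pointed homotopy type of $(N/N^o,[N^o])$, where $N$ is an isolating block of $S$ with exit set $N^o$; $CH^*(S)=H^*(h(S))\cong H^*(N,N^o)$ is the cohomological Conley index, and $P_t(h(S))=\sum_{i\ge0}\operatorname{rk}CH^i(S)\,t^i$. The Morse equations of an attractor-repeller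 decomposition $(A,R)$ of $\Omega$ are the identity $P_t(h(A))+P_t(h(R))=P_t(h(\Omega))+(1+t)Q(t)$ with $Q$ a polynomial with non-negative integer coefficients. Thus the left-hand side of each displayed equation is the sum of the Poincaré polynomials $P_t(h(\cdot))$ of the attractor and the repeller, and the summand $1$ on the right is $P_t(h(\Omega))$; indices are computed with respect to $\varphi_\lambda$ in $\mathbb{R}^n$ for the corresponding $\lambda$. *)

theory Defs
  imports
    "HOL-Analysis.Analysis"
    "HOL-Algebra.Product_Groups"
    "HOL-Algebra.FiniteProduct"
    "HOL-Library.Extended_Nat"
    "HOL-Computational_Algebra.Polynomial_FPS"
begin

section \<open>Flows, attractors and repellers\<close>

text \<open>A flow is written in curried form: \<open>\<phi> x t\<close> is the image \<open>xt\<close> of \<open>x\<close> at time \<open>t\<close>.\<close>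

definition flow :: "('a::topological_space \<Rightarrow> real \<Rightarrow> 'a) \<Rightarrow> bool" where
  "flow \<phi> \<longleftrightarrow> continuous_on UNIV (\<lambda>(x, t). \<phi> x t) \<and>
     (\<forall>x. \<phi> x 0 = x) \<and> (\<forall>x s t. \<phi> (\<phi> x s) t = \<phi> x (s + t))"

definition continuous_flow_family :: "(real \<Rightarrow> 'a::topological_space \<Rightarrow> real \<Rightarrow> 'a) \<Rightarrow> bool" where
  "continuous_flow_family \<Phi> \<longleftrightarrow>
     (\<forall>l. flow (\<Phi> l)) \<and> continuous_on UNIV (\<lambda>(l, x, t). \<Phi> l x t)"

definition invariant :: "('a \<Rightarrow> real \<Rightarrow> 'a) \<Rightarrow> 'a set \<Rightarrow> bool" where
  "invariant \<phi> S \<longleftrightarrow> (\<forall>x\<in>S. \<forall>t. \<phi> x t \<in> S)"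

definition omega_limit :: "('a::topological_space \<Rightarrow> real \<Rightarrow> 'a) \<Rightarrow> 'a \<Rightarrow> 'a set" where
  "omega_limit \<phi> x = (\<Inter>t\<in>{0<..}. closure (\<phi> x ` {t..}))"

definition neg_omega_limit :: "('a::topological_space \<Rightarrow> real \<Rightarrow> 'a) \<Rightarrow> 'a \<Rightarrow> 'a set" where
  "neg_omega_limit \<phi> x = (\<Inter>t\<in>{..<0}. closure (\<phi> x ` {..t}))"

text \<open>
  The notions below are relative to a phase space \<open>M\<close>, which is either the whole space or a
  compact invariant set: \<open>M\<close> then stands for the flow restricted to \<open>M\<close>. As \<open>M\<close> is closed,
  limit sets of points of \<open>M\<close> are the same in \<open>M\<close> and in the whole space.
\<close>

definition nbhd_in :: "'a::topological_space set \<Rightarrow> 'a set \<Rightarrow> 'a set \<Rightarrow> bool" where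
  "nbhd_in M S U \<longleftrightarrow> U \<subseteq> M \<and> (\<exists>W. openin (top_of_set M) W \<and> S \<subseteq> W \<and> W \<subseteq> U)"

definition stable_in :: "'a::topological_space set \<Rightarrow> ('a \<Rightarrow> real \<Rightarrow> 'a) \<Rightarrow> 'a set \<Rightarrow> bool" where
  "stable_in M \<phi> S \<longleftrightarrow>
     (\<forall>U. nbhd_in M S U \<longrightarrow> (\<exists>V. nbhd_in M S V \<and> (\<forall>x\<in>V. \<forall>t\<ge>0. \<phi> x t \<in> U)))"

definition neg_stable_in :: "'a::topological_space set \<Rightarrow> ('a \<Rightarrow> real \<Rightarrow> 'a) \<Rightarrow> 'a set \<Rightarrow> bool" where
  "neg_stable_in M \<phi> S \<longleftrightarrow>
     (\<forall>U. nbhd_in M S U \<longrightarrow> (\<exists>V. nbhd_in M S V \<and> (\<forall>x\<in>V. \<forall>t\<le>0. \<phi> x t \<in> U)))"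

definition attracting_in :: "'a::topological_space set \<Rightarrow> ('a \<Rightarrow> real \<Rightarrow> 'a) \<Rightarrow> 'a set \<Rightarrow> bool" where
  "attracting_in M \<phi> S \<longleftrightarrow>
     (\<exists>U. nbhd_in M S U \<and> (\<forall>x\<in>U. omega_limit \<phi> x \<noteq> {} \<and> omega_limit \<phi> x \<subseteq> S))"

definition repelling_in :: "'a::topological_space set \<Rightarrow> ('a \<Rightarrow> real \<Rightarrow> 'a) \<Rightarrow> 'a set \<Rightarrow> bool" where
  "repelling_in M \<phi> S \<longleftrightarrow>
     (\<exists>U. nbhd_in M S U \<and> (\<forall>x\<in>U. neg_omega_limit \<phi> x \<noteq> {} \<and> neg_omega_limit \<phi> x \<subseteq> S))"

definition attractor_in :: "'a::topological_space set \<Rightarrow> ('a \<Rightarrow> real \<Rightarrow> 'a) \<Rightarrow> 'a set \<Rightarrow> bool" where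
  "attractor_in M \<phi> S \<longleftrightarrow> S \<subseteq> M \<and> compact S \<and> invariant \<phi> S \<and>
     stable_in M \<phi> S \<and> attracting_in M \<phi> S"

definition repeller_in :: "'a::topological_space set \<Rightarrow> ('a \<Rightarrow> real \<Rightarrow> 'a) \<Rightarrow> 'a set \<Rightarrow> bool" where
  "repeller_in M \<phi> S \<longleftrightarrow> S \<subseteq> M \<and> compact S \<and> invariant \<phi> S \<and>
     neg_stable_in M \<phi> S \<and> repelling_in M \<phi> S"

definition global_attractor :: "('a::topological_space \<Rightarrow> real \<Rightarrow> 'a) \<Rightarrow> 'a set \<Rightarrow> bool" where
  "global_attractor \<phi> \<Omega> \<longleftrightarrow> attractor_in UNIV \<phi> \<Omega> \<and>
     (\<forall>x. omega_limit \<phi> x \<noteq> {} \<and> omega_limit \<phi> x \<subseteq> \<Omega>)"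

definition basin_in :: "'a::topological_space set \<Rightarrow> ('a \<Rightarrow> real \<Rightarrow> 'a) \<Rightarrow> 'a set \<Rightarrow> 'a set" where
  "basin_in M \<phi> A = {x\<in>M. omega_limit \<phi> x \<noteq> {} \<and> omega_limit \<phi> x \<subseteq> A}"

definition attractor_repeller_decomposition ::
    "('a::topological_space \<Rightarrow> real \<Rightarrow> 'a) \<Rightarrow> 'a set \<Rightarrow> 'a set \<Rightarrow> 'a set \<Rightarrow> bool" where
  "attractor_repeller_decomposition \<phi> \<Omega> A R \<longleftrightarrow>
     compact \<Omega> \<and> invariant \<phi> \<Omega> \<and> attractor_in \<Omega> \<phi> A \<and> R = \<Omega> - basin_in \<Omega> \<phi> A"

definition repeller_attractor_decomposition ::
    "('a::topological_space \<Rightarrow> real \<Rightarrow> 'a) \<Rightarrow> 'a set \<Rightarrow> 'a set \<Rightarrow> 'a set \<Rightarrow> bool" where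
  "repeller_attractor_decomposition \<phi> \<Omega> R A \<longleftrightarrow> attractor_repeller_decomposition \<phi> \<Omega> A R"

definition maximal_invariant :: "('a \<Rightarrow> real \<Rightarrow> 'a) \<Rightarrow> 'a set \<Rightarrow> 'a set" where
  "maximal_invariant \<phi> N = \<Union>{T. T \<subseteq> N \<and> invariant \<phi> T}"

definition isolated_invariant :: "('a::topological_space \<Rightarrow> real \<Rightarrow> 'a) \<Rightarrow> 'a set \<Rightarrow> bool" where
  "isolated_invariant \<phi> S \<longleftrightarrow> compact S \<and> invariant \<phi> S \<and>
     (\<exists>N. compact N \<and> S \<subseteq> interior N \<and> S = maximal_invariant \<phi> N)"


section \<open>Direct limits and rank of abelian groups\<close>

text \<open>
  The direct limit of the abelian groups \<open>G i\<close> along all maps \<open>f \<in> F i j\<close> from \<open>G i\<close> to \<open>G j\<close>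
  is the direct sum modulo the subgroup generated by the differences of \<open>f x\<close> and \<open>x\<close>.
\<close>

definition sum_incl :: "'i set \<Rightarrow> ('i \<Rightarrow> 'g monoid) \<Rightarrow> 'i \<Rightarrow> 'g \<Rightarrow> 'i \<Rightarrow> 'g" where
  "sum_incl I G i x = (\<lambda>j\<in>I. if j = i then x else \<one>\<^bsub>G j\<^esub>)"

definition limit_relations ::
    "'i set \<Rightarrow> ('i \<Rightarrow> 'g monoid) \<Rightarrow> ('i \<Rightarrow> 'i \<Rightarrow> ('g \<Rightarrow> 'g) set) \<Rightarrow> ('i \<Rightarrow> 'g) set" where
  "limit_relations I G F =
     {sum_incl I G j (f x) \<otimes>\<^bsub>sum_group I G\<^esub> inv\<^bsub>sum_group I G\<^esub> (sum_incl I G i x) | i j f x.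
        i \<in> I \<and> j \<in> I \<and> f \<in> F i j \<and> x \<in> carrier (G i)}"

definition direct_limit ::
    "'i set \<Rightarrow> ('i \<Rightarrow> 'g monoid) \<Rightarrow> ('i \<Rightarrow> 'i \<Rightarrow> ('g \<Rightarrow> 'g) set) \<Rightarrow> ('i \<Rightarrow> 'g) set monoid" where
  "direct_limit I G F =
     sum_group I G Mod generate (sum_group I G) (limit_relations I G F)"

definition independent_in :: "('a, 'b) monoid_scheme \<Rightarrow> 'a set \<Rightarrow> bool" where
  "independent_in G B \<longleftrightarrow> finite B \<and> B \<subseteq> carrier G \<and>
     (\<forall>m::'a \<Rightarrow> int. finprod G (\<lambda>b. b [^]\<^bsub>G\<^esub> m b) B = \<one>\<^bsub>G\<^esub> \<longrightarrow> (\<forall>b\<in>B. m b = 0))"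

text \<open>The rank may be \<open>\<infinity>\<close>; there is no junk value for groups of infinite rank.\<close>

definition group_rank :: "('a, 'b) monoid_scheme \<Rightarrow> enat" where
  "group_rank G = Sup {enat (card B) | B. independent_in G B}"


section \<open>Cech cohomology with integer coefficients\<close>

text \<open>
  Cochains on the nerve of a cover are functions of ordered tuples of members of the cover with
  non-empty intersection (extended by \<open>0\<close> to all lists). For a closed subspace \<open>A\<close> of \<open>X\<close>, the
  relative cochains are those vanishing on the tuples whose intersection meets \<open>A\<close>, i.e. on the
  nerve of the induced cover of \<open>A\<close>; for \<open>A = {}\<close> this is the absolute theory.
\<close>

definition open_covers :: "'a topology \<Rightarrow> 'a set set set" where
  "open_covers X = {\<U>. (\<forall>U\<in>\<U>. openin X U) \<and> \<Union>\<U> = topspace X}"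

definition nerve_simplices :: "nat \<Rightarrow> 'a set set \<Rightarrow> 'a set list set" where
  "nerve_simplices p \<U> = {us. length us = Suc p \<and> set us \<subseteq> \<U> \<and> \<Inter>(set us) \<noteq> {}}"

definition cochains :: "nat \<Rightarrow> 'a set \<Rightarrow> 'a set set \<Rightarrow> ('a set list \<Rightarrow> int) set" where
  "cochains p A \<U> = {c. \<forall>us. c us \<noteq> 0 \<longrightarrow> us \<in> nerve_simplices p \<U> \<and> A \<inter> \<Inter>(set us) = {}}"

definition face :: "nat \<Rightarrow> 'b list \<Rightarrow> 'b list" where
  "face i us = take i us @ drop (Suc i) us"

definition coboundary ::
    "nat \<Rightarrow> 'a set set \<Rightarrow> ('a set list \<Rightarrow> int) \<Rightarrow> ('a set list \<Rightarrow> int)" where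
  "coboundary p \<U> c = (\<lambda>us. if us \<in> nerve_simplices (Suc p) \<U>
     then \<Sum>i\<le>Suc p. (- 1) ^ i * c (face i us) else 0)"

definition cocycle_set :: "nat \<Rightarrow> 'a set \<Rightarrow> 'a set set \<Rightarrow> ('a set list \<Rightarrow> int) set" where
  "cocycle_set p A \<U> = {c \<in> cochains p A \<U>. coboundary p \<U> c = (\<lambda>_. 0)}"

definition coboundary_set :: "nat \<Rightarrow> 'a set \<Rightarrow> 'a set set \<Rightarrow> ('a set list \<Rightarrow> int) set" where
  "coboundary_set p A \<U> =
     (case p of 0 \<Rightarrow> {\<lambda>_. 0} | Suc q \<Rightarrow> coboundary q \<U> ` cochains q A \<U>)"

definition cocycle_group :: "nat \<Rightarrow> 'a set \<Rightarrow> 'a set set \<Rightarrow> ('a set list \<Rightarrow> int) monoid" where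
  "cocycle_group p A \<U> =
     \<lparr>carrier = cocycle_set p A \<U>, mult = (\<lambda>c d us. c us + d us), one = (\<lambda>_. 0)\<rparr>"

definition nerve_cohomology ::
    "nat \<Rightarrow> 'a set \<Rightarrow> 'a set set \<Rightarrow> ('a set list \<Rightarrow> int) set monoid" where
  "nerve_cohomology p A \<U> = cocycle_group p A \<U> Mod coboundary_set p A \<U>"

definition refinement :: "'a set set \<Rightarrow> 'a set set \<Rightarrow> ('a set \<Rightarrow> 'a set) \<Rightarrow> bool" where
  "refinement \<U> \<V> \<pi> \<longleftrightarrow> (\<forall>V\<in>\<V>. \<pi> V \<in> \<U> \<and> V \<subseteq> \<pi> V)"

definition pullback ::
    "nat \<Rightarrow> 'a set set \<Rightarrow> ('a set \<Rightarrow> 'a set) \<Rightarrow> ('a set list \<Rightarrow> int) \<Rightarrow> ('a set list \<Rightarrow> int)" where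
  "pullback p \<V> \<pi> c = (\<lambda>vs. if vs \<in> nerve_simplices p \<V> then c (map \<pi> vs) else 0)"

text \<open>
  Elements of \<open>nerve_cohomology p A \<U>\<close> are cosets \<open>\<xi>\<close>, so the induced map sends \<open>\<xi>\<close> to the coset
  of the coboundaries on \<open>\<V>\<close> which contains the pullbacks of all representatives of \<open>\<xi>\<close>.
\<close>

definition refinement_maps ::
    "nat \<Rightarrow> 'a set \<Rightarrow> 'a set set \<Rightarrow> 'a set set \<Rightarrow>
       (('a set list \<Rightarrow> int) set \<Rightarrow> ('a set list \<Rightarrow> int) set) set" where
  "refinement_maps p A \<U> \<V> =
     {\<lambda>\<xi>. coboundary_set p A \<V> <#>\<^bsub>cocycle_group p A \<V>\<^esub> (pullback p \<V> \<pi> ` \<xi>) | \<pi>. refinement \<U> \<V> \<pi>}"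

definition cech_cohomology ::
    "nat \<Rightarrow> 'a topology \<Rightarrow> 'a set \<Rightarrow> ('a set set \<Rightarrow> ('a set list \<Rightarrow> int) set) set monoid" where
  "cech_cohomology p X A =
     direct_limit (open_covers X) (nerve_cohomology p A) (refinement_maps p A)"


section \<open>The Conley index\<close>

definition isolating_block ::
    "('a::topological_space \<Rightarrow> real \<Rightarrow> 'a) \<Rightarrow> 'a set \<Rightarrow> 'a set \<Rightarrow> 'a set \<Rightarrow> 'a set \<Rightarrow> bool" where
  "isolating_block \<phi> S N Ni No \<longleftrightarrow>
     compact N \<and> S \<subseteq> interior N \<and> S = maximal_invariant \<phi> N \<and>
     compact Ni \<and> compact No \<and> frontier N = Ni \<union> No \<and>
     (\<forall>x\<in>Ni. \<exists>e>0. \<forall>t\<in>{-e..<0}. \<phi> x t \<notin> N) \<and>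
     (\<forall>x\<in>No. \<exists>e>0. \<forall>t\<in>{0<..e}. \<phi> x t \<notin> N) \<and>
     (\<forall>x\<in>frontier N - Ni. \<exists>e>0. \<forall>t\<in>{-e..<0}. \<phi> x t \<in> interior N) \<and>
     (\<forall>x\<in>frontier N - No. \<exists>e>0. \<forall>t\<in>{0<..e}. \<phi> x t \<in> interior N)"

text \<open>
  The quotient \<open>N/L\<close>, with \<open>None\<close> as the base point \<open>[L]\<close>. If \<open>L = {}\<close>, then \<open>None\<close> is an
  additional isolated point.
\<close>

definition collapse :: "'a set \<Rightarrow> 'a \<Rightarrow> 'a option" where
  "collapse L x = (if x \<in> L then None else Some x)"

definition quotient_space :: "'a::topological_space set \<Rightarrow> 'a set \<Rightarrow> 'a option topology" where
  "quotient_space N L = topology (\<lambda>U. U \<subseteq> insert None (collapse L ` N) \<and>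
     openin (top_of_set N) {x\<in>N. collapse L x \<in> U})"

definition pointed_homotopy_equivalent ::
    "'a topology \<times> 'a \<Rightarrow> 'b topology \<times> 'b \<Rightarrow> bool" where
  "pointed_homotopy_equivalent = (\<lambda>(X, x0) (Y, y0). \<exists>f g.
     continuous_map X Y f \<and> f x0 = y0 \<and> continuous_map Y X g \<and> g y0 = x0 \<and>
     homotopic_with (\<lambda>k. k x0 = x0) X X (g \<circ> f) id \<and>
     homotopic_with (\<lambda>k. k y0 = y0) Y Y (f \<circ> g) id)"

text \<open>
  Pointed homotopy types are taken in the category of compact Hausdorff pointed spaces, to which
  the quotients \<open>N/No\<close> belong.
\<close>

definition conley_index ::
    "('a::topological_space \<Rightarrow> real \<Rightarrow> 'a) \<Rightarrow> 'a set \<Rightarrow> ('a option topology \<times> 'a option) set" where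
  "conley_index \<phi> S = {(Y, y). compact_space Y \<and> Hausdorff_space Y \<and> y \<in> topspace Y \<and>
     (\<exists>N Ni No. isolating_block \<phi> S N Ni No \<and>
        pointed_homotopy_equivalent (quotient_space N No, None) (Y, y))}"

text \<open>
  The cohomology of a pointed homotopy type is that of any of its members \<open>(Y, y)\<close>, relative to
  the base point. Coefficients are in \<^typ>\<open>enat\<close>. An equation with the finite series
  \<open>1 + (1 + fps_X) * natpoly_series Q\<close> forces all the ranks on the other side to be finite; its
  constant coefficient is then at least \<open>1\<close>, so that subtracting \<open>1\<close> from a sum
  containing it is never truncated.
\<close>

definition poincare_series :: "('b topology \<times> 'b) set \<Rightarrow> enat fps" where
  "poincare_series h = (let (Y, y) = (SOME Yy. Yy \<in> h) in
     Abs_fps (\<lambda>i. group_rank (cech_cohomology i Y {y})))"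

definition natpoly_series :: "nat poly \<Rightarrow> enat fps" where
  "natpoly_series Q = fps_of_poly (map_poly enat Q)"


section \<open>Well-formedness\<close>

lemma istopology_quotient_space:
  "istopology (\<lambda>U. U \<subseteq> insert None (collapse L ` N) \<and>
     openin (top_of_set N) {x\<in>N. collapse L x \<in> U})"
proof -
  have 1: "{x\<in>N. collapse L x \<in> S \<inter> T} = {x\<in>N. collapse L x \<in> S} \<inter> {x\<in>N. collapse L x \<in> T}" for S T
    by auto
  have 2: "{x\<in>N. collapse L x \<in> \<Union>\<K>} = \<Union>((\<lambda>K. {x\<in>N. collapse L x \<in> K}) ` \<K>)" for \<K>
    by auto
  show ?thesis
    unfolding istopology_def 1 2 by (auto intro!: openin_Int openin_Union)
qed

lemma openin_quotient_space:
  "openin (quotient_space N L) U \<longleftrightarrow> U \<subseteq> insert None (collapse L ` N) \<and>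
     openin (top_of_set N) {x\<in>N. collapse L x \<in> U}"
  unfolding quotient_space_def topology_inverse'[OF istopology_quotient_space] ..

lemma topspace_quotient_space: "topspace (quotient_space N L) = insert None (collapse L ` N)"
proof -
  have "{x\<in>N. collapse L x \<in> insert None (collapse L ` N)} = N"
    by auto
  then have "openin (quotient_space N L) (insert None (collapse L ` N))"
    by (simp add: openin_quotient_space)
  then show ?thesis
    by (metis openin_quotient_space openin_subset openin_topspace subset_antisym)
qed

lemma comm_group_cocycle_group: "comm_group (cocycle_group p A \<U>)"
proof (rule comm_groupI)
  fix c assume "c \<in> carrier (cocycle_group p A \<U>)"
  moreover have "coboundary p \<U> (\<lambda>us. - c us) = (\<lambda>us. - coboundary p \<U> c us)"
    by (auto simp: coboundary_def fun_eq_iff sum_negf simp del: sum.atMost_Suc)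
  ultimately have "(\<lambda>us. - c us) \<in> carrier (cocycle_group p A \<U>)"
    by (simp add: cocycle_group_def cocycle_set_def cochains_def)
  then show "\<exists>d\<in>carrier (cocycle_group p A \<U>). d \<otimes>\<^bsub>cocycle_group p A \<U>\<^esub> c = \<one>\<^bsub>cocycle_group p A \<U>\<^esub>"
    by (intro bexI) (auto simp: cocycle_group_def)
next
  fix c d assume cd: "c \<in> carrier (cocycle_group p A \<U>)" "d \<in> carrier (cocycle_group p A \<U>)"
  have 1: "coboundary p \<U> (\<lambda>us. c us + d us) = (\<lambda>us. coboundary p \<U> c us + coboundary p \<U> d us)"
    by (auto simp: coboundary_def fun_eq_iff distrib_left sum.distrib)
  have 2: "(\<lambda>us. c us + d us) \<in> cochains p A \<U>"
    using cd unfolding cocycle_group_def cocycle_set_def cochains_def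
    by simp (metis add.right_neutral)
  show "c \<otimes>\<^bsub>cocycle_group p A \<U>\<^esub> d \<in> carrier (cocycle_group p A \<U>)"
    using cd 1 2 by (simp add: cocycle_group_def cocycle_set_def)
qed (auto simp: cocycle_group_def cocycle_set_def cochains_def coboundary_def fun_eq_iff)

lemma face_face:
  assumes "i \<le> j" "Suc j < length us"
  shows "face j (face i us) = face i (face (Suc j) us)"
proof (rule nth_equalityI)
  show "length (face j (face i us)) = length (face i (face (Suc j) us))"
    using assms by (simp add: face_def)
  show "face j (face i us) ! k = face i (face (Suc j) us) ! k"
    if "k < length (face j (face i us))" for k
    using assms that by (auto simp: face_def nth_append min_def not_less)
qed

lemma face_nerve_simplices:
  assumes "us \<in> nerve_simplices (Suc p) \<U>" "i \<le> Suc p"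
  shows "face i us \<in> nerve_simplices p \<U>"
proof -
  have "set (face i us) \<subseteq> set us"
    by (auto simp: face_def dest: in_set_takeD in_set_dropD)
  moreover have "length (face i us) = Suc p"
    using assms by (simp add: nerve_simplices_def face_def)
  ultimately show ?thesis
    using assms unfolding nerve_simplices_def by blast
qed

lemma coboundary_coboundary: "coboundary (Suc p) \<U> (coboundary p \<U> c) = (\<lambda>_. 0)"
proof
  fix us
  show "coboundary (Suc p) \<U> (coboundary p \<U> c) us = 0"
  proof (cases "us \<in> nerve_simplices (Suc (Suc p)) \<U>")
    case True
    let ?f = "\<lambda>(i, j). (- 1) ^ (i + j) * c (face j (face i us))"
    let ?D = "{..Suc (Suc p)} \<times> {..Suc p}"
    let ?L = "{(i, j) \<in> ?D. i \<le> j}" and ?G = "{(i, j) \<in> ?D. j < i}"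
    have sign: "- ((- 1) ^ (a + b - Suc 0) * x) = (- 1) ^ (a + b) * x" if "b < a"
      for a b :: nat and x :: int
      using that by (cases a) auto
    have len: "length us = Suc (Suc (Suc p))"
      using True by (simp add: nerve_simplices_def)
    have "coboundary (Suc p) \<U> (coboundary p \<U> c) us =
        (\<Sum>i\<le>Suc (Suc p). (- 1) ^ i * (\<Sum>j\<le>Suc p. (- 1) ^ j * c (face j (face i us))))"
      unfolding coboundary_def[of "Suc p"] if_P[OF True]
      by (intro sum.cong refl) (use True in \<open>simp add: coboundary_def face_nerve_simplices\<close>)
    also have "\<dots> = sum ?f ?D"
      by (simp add: sum.cartesian_product[symmetric] sum_distrib_left power_add mult.assoc
               del: sum.atMost_Suc)
    also have "\<dots> = sum ?f ?L + sum ?f ?G"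
    proof -
      have fin: "finite ?L" "finite ?G"
        by (rule finite_subset[of _ ?D]; auto)+
      have "?D = ?L \<union> ?G" "?L \<inter> ?G = {}"
        by auto
      then show ?thesis
        using sum.union_disjoint[OF fin, of ?f] by (metis (no_types))
    qed
    also have "sum ?f ?G = (\<Sum>x\<in>?L. - ?f x)"
      by (rule sum.reindex_bij_witness[of _ "\<lambda>(i, j). (Suc j, i)" "\<lambda>(i, j). (j, i - 1)"])
         (auto simp: len face_face add.commute sign[symmetric])
    finally show ?thesis
      by (simp add: sum_negf)
  qed (simp add: coboundary_def)
qed

lemma coboundary_in_cochains:
  assumes "c \<in> cochains p A \<U>"
  shows "coboundary p \<U> c \<in> cochains (Suc p) A \<U>"
proof -
  have "coboundary p \<U> c us = 0" if "A \<inter> \<Inter>(set us) \<noteq> {}" for us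
  proof -
    have "c (face i us) = 0" for i
    proof -
      have "set (face i us) \<subseteq> set us"
        by (auto simp: face_def dest: in_set_takeD in_set_dropD)
      then have "A \<inter> \<Inter>(set (face i us)) \<noteq> {}"
        using that by blast
      then show ?thesis
        using assms by (auto simp: cochains_def)
    qed
    then show ?thesis
      by (simp add: coboundary_def)
  qed
  moreover have "us \<in> nerve_simplices (Suc p) \<U>" if "coboundary p \<U> c us \<noteq> 0" for us
    using that by (metis coboundary_def)
  ultimately show ?thesis
    unfolding cochains_def by blast
qed

lemma subgroup_coboundary_set: "subgroup (coboundary_set p A \<U>) (cocycle_group p A \<U>)"
proof -
  interpret comm_group "cocycle_group p A \<U>"
    by (rule comm_group_cocycle_group)
  have sub: "coboundary_set p A \<U> \<subseteq> carrier (cocycle_group p A \<U>)"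
  proof (cases p)
    case 0
    then show ?thesis
      by (auto simp: coboundary_set_def cocycle_group_def cocycle_set_def cochains_def coboundary_def)
  next
    case (Suc q)
    then show ?thesis
      by (auto simp: coboundary_set_def cocycle_group_def cocycle_set_def
          coboundary_in_cochains coboundary_coboundary)
  qed
  have zero: "(\<lambda>_. 0) \<in> coboundary_set p A \<U>"
  proof (cases p)
    case (Suc q)
    have "coboundary q \<U> (\<lambda>_. 0) = (\<lambda>_. 0)" "(\<lambda>_. 0) \<in> cochains q A \<U>"
      by (auto simp: coboundary_def cochains_def)
    then show ?thesis
      unfolding Suc coboundary_set_def nat.case
      by (intro image_eqI[of _ _ "\<lambda>_. 0"]) simp_all
  qed (simp add: coboundary_set_def)
  have diff: "(\<lambda>us. c us - d us) \<in> coboundary_set p A \<U>"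
    if cd: "c \<in> coboundary_set p A \<U>" "d \<in> coboundary_set p A \<U>" for c d
  proof (cases p)
    case 0
    then show ?thesis using cd by (simp add: coboundary_set_def)
  next
    case (Suc q)
    then obtain a b where ab: "a \<in> cochains q A \<U>" "b \<in> cochains q A \<U>"
        "c = coboundary q \<U> a" "d = coboundary q \<U> b"
      using cd by (auto simp: coboundary_set_def)
    have "(\<lambda>us. a us - b us) \<in> cochains q A \<U>"
      using ab(1,2) unfolding cochains_def mem_Collect_eq by (metis diff_self)
    moreover have "(\<lambda>us. c us - d us) = coboundary q \<U> (\<lambda>us. a us - b us)"
      using ab(3,4) by (auto simp: coboundary_def fun_eq_iff right_diff_distrib sum_subtractf
          simp del: sum.atMost_Suc)
    ultimately show ?thesis
      using Suc by (auto simp: coboundary_set_def)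
  qed
  have inv_eq: "inv\<^bsub>cocycle_group p A \<U>\<^esub> c = (\<lambda>us. - c us)" if c: "c \<in> coboundary_set p A \<U>" for c
  proof (rule inv_equality)
    have "(\<lambda>us. 0 - c us) \<in> coboundary_set p A \<U>"
      using diff[OF zero c] .
    then show "(\<lambda>us. - c us) \<in> carrier (cocycle_group p A \<U>)"
      using sub by auto
  qed (use c sub in \<open>auto simp: cocycle_group_def\<close>)
  show ?thesis
  proof
    show "c \<otimes>\<^bsub>cocycle_group p A \<U>\<^esub> d \<in> coboundary_set p A \<U>"
      if "c \<in> coboundary_set p A \<U>" "d \<in> coboundary_set p A \<U>" for c d
      using diff[OF that(1) diff[OF zero that(2)]] by (simp add: cocycle_group_def)
    show "inv\<^bsub>cocycle_group p A \<U>\<^esub> c \<in> coboundary_set p A \<U>" if "c \<in> coboundary_set p A \<U>" for c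
      using diff[OF zero that] that by (simp add: inv_eq)
  qed (use sub zero in \<open>auto simp: cocycle_group_def\<close>)
qed

lemma comm_group_nerve_cohomology: "comm_group (nerve_cohomology p A \<U>)"
  unfolding nerve_cohomology_def
  by (rule comm_group.abelian_FactGroup[OF comm_group_cocycle_group subgroup_coboundary_set])

lemma comm_group_direct_limit:
  assumes G: "\<And>i. i \<in> I \<Longrightarrow> comm_group (G i)"
    and F: "\<And>i j f x. \<lbrakk>i \<in> I; j \<in> I; f \<in> F i j; x \<in> carrier (G i)\<rbrakk> \<Longrightarrow> f x \<in> carrier (G j)"
  shows "comm_group (direct_limit I G F)"
proof -
  have grp: "group (G i)" if "i \<in> I" for i
    using G[OF that] by (simp add: comm_group_def)
  interpret S: group "sum_group I G"
    by (intro sum_group grp)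
  have "comm_group (sum_group I G)"
    by (intro S.group_comm_groupI)
       (auto simp: carrier_sum_group grp PiE_iff
         intro!: restrict_ext comm_monoid.m_comm comm_group.axioms(1) G)
  moreover have "sum_incl I G i x \<in> carrier (sum_group I G)" if "i \<in> I" "x \<in> carrier (G i)" for i x
  proof -
    have "finite {j \<in> I. sum_incl I G i x j \<noteq> \<one>\<^bsub>G j\<^esub>}"
      by (rule finite_subset[of _ "{i}"]) (auto simp: sum_incl_def)
    moreover have "sum_incl I G i x j \<in> carrier (G j)" if "j \<in> I" for j
      using grp[OF that] \<open>x \<in> carrier (G i)\<close> that
      by (auto simp: sum_incl_def group.is_monoid monoid.one_closed)
    ultimately show ?thesis
      using grp by (auto simp: carrier_sum_group PiE_iff sum_incl_def)
  qed
  then have "limit_relations I G F \<subseteq> carrier (sum_group I G)"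
    using F by (fastforce simp: limit_relations_def simp del: mult_sum_group)
  ultimately show ?thesis
    unfolding direct_limit_def
    by (intro comm_group.abelian_FactGroup S.generate_is_subgroup)
qed

lemma pullback_in_cochains:
  assumes "refinement \<U> \<V> \<pi>" "c \<in> cochains p A \<U>"
  shows "pullback p \<V> \<pi> c \<in> cochains p A \<V>"
proof -
  have "A \<inter> \<Inter>(set vs) = {}" if "vs \<in> nerve_simplices p \<V>" "c (map \<pi> vs) \<noteq> 0" for vs
  proof -
    have "\<Inter>(set vs) \<subseteq> \<Inter>(set (map \<pi> vs))"
      using assms(1) that(1) by (fastforce simp: refinement_def nerve_simplices_def)
    moreover have "A \<inter> \<Inter>(set (map \<pi> vs)) = {}"
      using assms(2) that(2) unfolding cochains_def by blast
    ultimately show ?thesis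
      by blast
  qed
  then show ?thesis
    by (auto simp: cochains_def pullback_def split: if_splits)
qed

lemma map_nerve_simplices:
  assumes "refinement \<U> \<V> \<pi>" "vs \<in> nerve_simplices p \<V>"
  shows "map \<pi> vs \<in> nerve_simplices p \<U>"
proof -
  have "\<Inter>(set vs) \<subseteq> \<Inter>(set (map \<pi> vs))"
    using assms by (fastforce simp: refinement_def nerve_simplices_def)
  moreover have "set (map \<pi> vs) \<subseteq> \<U>"
    using assms by (auto simp: refinement_def nerve_simplices_def)
  ultimately show ?thesis
    using assms(2) unfolding nerve_simplices_def by (simp del: set_map) blast
qed

lemma coboundary_pullback:
  assumes "refinement \<U> \<V> \<pi>"
  shows "coboundary p \<V> (pullback p \<V> \<pi> c) = pullback (Suc p) \<V> \<pi> (coboundary p \<U> c)"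
proof
  fix vs
  show "coboundary p \<V> (pullback p \<V> \<pi> c) vs = pullback (Suc p) \<V> \<pi> (coboundary p \<U> c) vs"
  proof (cases "vs \<in> nerve_simplices (Suc p) \<V>")
    case True
    have "face i (map \<pi> vs) = map \<pi> (face i vs)" for i
      by (simp add: face_def take_map drop_map)
    then show ?thesis
      unfolding coboundary_def pullback_def
      using True map_nerve_simplices[OF assms True]
      by (auto intro!: sum.cong simp: face_nerve_simplices simp del: sum.atMost_Suc)
  qed (simp add: coboundary_def pullback_def)
qed

lemma pullback_in_cocycle_set:
  assumes "refinement \<U> \<V> \<pi>" "c \<in> cocycle_set p A \<U>"
  shows "pullback p \<V> \<pi> c \<in> cocycle_set p A \<V>"
  using assms by (auto simp: cocycle_set_def pullback_in_cochains coboundary_pullback)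
    (simp add: pullback_def)

lemma pullback_in_coboundary_set:
  assumes "refinement \<U> \<V> \<pi>" "c \<in> coboundary_set p A \<U>"
  shows "pullback p \<V> \<pi> c \<in> coboundary_set p A \<V>"
proof (cases p)
  case 0
  then show ?thesis using assms(2) by (simp add: coboundary_set_def pullback_def)
next
  case (Suc q)
  then show ?thesis
    using assms by (auto simp: coboundary_set_def coboundary_pullback[symmetric] pullback_in_cochains)
qed

lemma refinement_map_coset:
  assumes \<pi>: "refinement \<U> \<V> \<pi>" and c: "c \<in> cocycle_set p A \<U>"
  shows "coboundary_set p A \<V> <#>\<^bsub>cocycle_group p A \<V>\<^esub>
      (pullback p \<V> \<pi> ` (coboundary_set p A \<U> #>\<^bsub>cocycle_group p A \<U>\<^esub> c))
    = coboundary_set p A \<V> #>\<^bsub>cocycle_group p A \<V>\<^esub> pullback p \<V> \<pi> c"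
    (is "?lhs = ?rhs")
proof
  have add: "pullback p \<V> \<pi> (\<lambda>us. b us + c us) = (\<lambda>us. pullback p \<V> \<pi> b us + pullback p \<V> \<pi> c us)" for b
    by (auto simp: pullback_def)
  note sub = subgroup_coboundary_set[of p A]
  show "?lhs \<subseteq> ?rhs"
  proof
    fix x assume "x \<in> ?lhs"
    then obtain b b' where b: "b \<in> coboundary_set p A \<V>" "b' \<in> coboundary_set p A \<U>"
      "x = (\<lambda>us. b us + (pullback p \<V> \<pi> b' us + pullback p \<V> \<pi> c us))"
      by (auto simp: set_mult_def r_coset_def cocycle_group_def add)
    have "(\<lambda>us. b us + pullback p \<V> \<pi> b' us) \<in> coboundary_set p A \<V>"
      using subgroup.m_closed[OF sub b(1) pullback_in_coboundary_set[OF \<pi> b(2)]]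
      by (simp add: cocycle_group_def)
    then show "x \<in> ?rhs"
      using b(3) by (force simp: r_coset_def cocycle_group_def add.assoc)
  qed
  show "?rhs \<subseteq> ?lhs"
  proof
    fix x assume "x \<in> ?rhs"
    then obtain b where b: "b \<in> coboundary_set p A \<V>" "x = (\<lambda>us. b us + pullback p \<V> \<pi> c us)"
      by (auto simp: r_coset_def cocycle_group_def)
    have "(\<lambda>_. 0) \<in> coboundary_set p A \<U>"
      using subgroup.one_closed[OF sub] by (simp add: cocycle_group_def)
    then have "c \<in> coboundary_set p A \<U> #>\<^bsub>cocycle_group p A \<U>\<^esub> c"
      by (force simp: r_coset_def cocycle_group_def)
    then show "x \<in> ?lhs"
      using b by (force simp: set_mult_def cocycle_group_def)
  qed
qed

lemma comm_group_cech_cohomology: "comm_group (cech_cohomology p X A)"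
  unfolding cech_cohomology_def
proof (rule comm_group_direct_limit)
  fix \<U> \<V> f \<xi>
  assume "f \<in> refinement_maps p A \<U> \<V>" and "\<xi> \<in> carrier (nerve_cohomology p A \<U>)"
  then obtain \<pi> c where "refinement \<U> \<V> \<pi>" "c \<in> cocycle_set p A \<U>"
    "f \<xi> = coboundary_set p A \<V> #>\<^bsub>cocycle_group p A \<V>\<^esub> pullback p \<V> \<pi> c"
    by (auto simp: refinement_maps_def nerve_cohomology_def FactGroup_def RCOSETS_def
        cocycle_group_def refinement_map_coset[unfolded cocycle_group_def])
  then show "f \<xi> \<in> carrier (nerve_cohomology p A \<V>)"
    using pullback_in_cocycle_set
    by (fastforce simp: nerve_cohomology_def FactGroup_def RCOSETS_def cocycle_group_def)
qed (rule comm_group_nerve_cohomology)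

end

theory Submission
  imports Defs
begin

text \<open>
  Cech cohomology of a compact space is computed by Alexander-Spanier cochains, i.e. by functions on
  lists of points which are only considered on lists of nearby points. Such cochains can be pulled
  back along discontinuous maps as long as these move nearby points to nearby points up to a given
  scale. In particular, if the compact invariant set \<open>S\<close> uniformly attracts a compact set \<open>Q\<close>
  containing it, then following the flow for a long time and moving to the nearest point of \<open>S\<close> is
  an approximate inverse of the inclusion of \<open>S\<close> into \<open>Q\<close>.

  On the quotient \<open>N/No\<close> of an isolating block the same argument shows that only the points
  whose backward orbits stay in \<open>N\<close> matter. For an attractor \<open>A\<close> these are the points of \<open>A\<close>, so
  that \<open>CH\<^sup>k(A) = H\<^sup>k(A)\<close>. For the dual repeller \<open>R\<close> the quotient becomes \<open>\<Omega>/D\<close>, where \<open>D\<close> is a compact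
  positively invariant set which is attracted by \<open>A\<close>; as \<open>\<Omega>\<close> is acyclic (it attracts its convex
  hull), the exact sequence of \<open>(\<Omega>, D)\<close> identifies \<open>CH\<^sup>k(R)\<close> with the reduced group \<open>H\<^sup>k\<^sup>-\<^sup>1(A)\<close>. Hence the
  sum of the two Poincare polynomials is \<open>1 + (1 + t) Q(t)\<close> with \<open>Q(t) = (b\<^sub>0 - 1) + \<Sum>\<^sub>k\<^sub>\<ge>\<^sub>1 b\<^sub>k t\<^sup>k\<close>,
  where \<open>b\<^sub>k\<close> is the rank of \<open>H\<^sup>k(A)\<close>. These ranks are finite, and eventually zero, since \<open>A\<close> is
  dominated by a finite union of balls. That \<open>A\<close> and \<open>R\<close> have isolating blocks, so that their indices
  are not empty, follows from Lyapunov functions for \<open>A\<close> and \<open>\<Omega>\<close>.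
\<close>

section \<open>Ranks of subquotients of function groups\<close>

text \<open>\<open>poincare_series\<close> evaluates an arbitrary member of
  \<open>conley_index\<close>. The ranks are therefore computed for every isolating block and for
  every compact Hausdorff space of the right homotopy type, and independence of the block is a
  result instead of an assumption. Groups are replaced by pairs of sets of integer functions, and
  exact sequences by filtrations of such sets, since only ranks are wanted.

  Two obstacles shape the proof. An attractor may be too wild to be a retract of a neighbourhood;
  but a cocycle lives at one scale, where a discontinuous map is good enough, and the map may change
  with the scale. Moreover \<open>A\<close> is assumed stable only inside \<Omega>. A backward orbit
  which stays near \<open>A\<close> is bounded, hence contained in \<Omega>, so that it must lie in
  \<open>A\<close>. This property, \<open>captures_backward\<close>, holds in the whole space and is
  all that stability, Lyapunov functions and blocks require.\<close>

definition additive_group :: "('x \<Rightarrow> int) set \<Rightarrow> bool" where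
  "additive_group Z \<longleftrightarrow> (\<lambda>_. 0) \<in> Z \<and> (\<forall>f\<in>Z. \<forall>g\<in>Z. (\<lambda>x. f x - g x) \<in> Z)"

definition additive_map :: "(('x \<Rightarrow> int) \<Rightarrow> ('y \<Rightarrow> int)) \<Rightarrow> bool" where
  "additive_map F \<longleftrightarrow> (\<forall>f g. F (\<lambda>x. f x - g x) = (\<lambda>y. F f y - F g y))"

definition lincomb :: "nat \<Rightarrow> (nat \<Rightarrow> int) \<Rightarrow> (nat \<Rightarrow> 'x \<Rightarrow> int) \<Rightarrow> 'x \<Rightarrow> int" where
  "lincomb n m v = (\<lambda>x. \<Sum>i<n. m i * v i x)"

text \<open>Independence of classes in the quotient group Z/B, tested on representatives. With
  indexed families instead of sets of cosets, maps and choices of lifts act on the members without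
  an injectivity argument.\<close>

definition independent_mod :: "('x \<Rightarrow> int) set \<Rightarrow> ('x \<Rightarrow> int) set \<Rightarrow> nat \<Rightarrow> (nat \<Rightarrow> 'x \<Rightarrow> int) \<Rightarrow> bool" where
  "independent_mod Z B n v \<longleftrightarrow> (\<forall>i<n. v i \<in> Z) \<and>
     (\<forall>m. lincomb n m v \<in> B \<longrightarrow> (\<forall>i<n. m i = 0))"

definition quotient_rank :: "('x \<Rightarrow> int) set \<Rightarrow> ('x \<Rightarrow> int) set \<Rightarrow> enat" where
  "quotient_rank Z B = Sup {enat n | n. \<exists>v. independent_mod Z B n v}"

lemma additive_groupD:
  assumes "additive_group Z"
  shows additive_group_zero: "(\<lambda>_. 0) \<in> Z"
    and additive_group_diff: "f \<in> Z \<Longrightarrow> g \<in> Z \<Longrightarrow> (\<lambda>x. f x - g x) \<in> Z"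
    and additive_group_uminus: "f \<in> Z \<Longrightarrow> (\<lambda>x. - f x) \<in> Z"
    and additive_group_add: "f \<in> Z \<Longrightarrow> g \<in> Z \<Longrightarrow> (\<lambda>x. f x + g x) \<in> Z"
proof -
  show z: "(\<lambda>_. 0) \<in> Z" and d: "\<And>f g. f \<in> Z \<Longrightarrow> g \<in> Z \<Longrightarrow> (\<lambda>x. f x - g x) \<in> Z"
    using assms by (auto simp: additive_group_def)
  show u: "(\<lambda>x. - f x) \<in> Z" if "f \<in> Z" for f
    using d[OF z that] by simp
  show "(\<lambda>x. f x + g x) \<in> Z" if "f \<in> Z" "g \<in> Z"
    using d[OF that(1) u[OF that(2)]] by simp
qed

lemma additive_group_scale:
  assumes Z: "additive_group Z" and f: "f \<in> Z"
  shows "(\<lambda>x. k * f x) \<in> Z"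
proof (induction k rule: int_induct[where k = 0])
  case base
  then show ?case using additive_group_zero[OF Z] by simp
next
  case (step1 i)
  then show ?case using additive_group_add[OF Z _ f] by (simp add: distrib_right)
next
  case (step2 i)
  then show ?case using additive_group_diff[OF Z _ f] by (simp add: left_diff_distrib)
qed

lemma additive_group_sum:
  assumes Z: "additive_group Z" and "finite I" "\<And>i. i \<in> I \<Longrightarrow> f i \<in> Z"
  shows "(\<lambda>x. \<Sum>i\<in>I. f i x) \<in> Z"
  using assms(2,3)
  by (induction I rule: finite_induct) (simp_all add: additive_group_zero[OF Z] additive_group_add[OF Z])

lemma lincomb_in:
  assumes "additive_group Z" "\<And>i. i < n \<Longrightarrow> v i \<in> Z"
  shows "lincomb n m v \<in> Z"
  unfolding lincomb_def using assms by (intro additive_group_sum additive_group_scale) auto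

lemma additive_mapD:
  assumes F: "additive_map F"
  shows additive_map_zero: "F (\<lambda>_. 0) = (\<lambda>_. 0)"
    and additive_map_diff: "F (\<lambda>x. f x - g x) = (\<lambda>y. F f y - F g y)"
    and additive_map_add: "F (\<lambda>x. f x + g x) = (\<lambda>y. F f y + F g y)"
proof -
  show d: "\<And>f g. F (\<lambda>x. f x - g x) = (\<lambda>y. F f y - F g y)"
    using F by (auto simp: additive_map_def)
  show z: "F (\<lambda>_. 0) = (\<lambda>_. 0)"
    using d[of "\<lambda>_. 0" "\<lambda>_. 0"] by simp
  have "F (\<lambda>x. - g x) = (\<lambda>y. - F g y)"
    using d[of "\<lambda>_. 0" g] z by simp
  then show "F (\<lambda>x. f x + g x) = (\<lambda>y. F f y + F g y)"
    using d[of f "\<lambda>x. - g x"] by simp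
qed

lemma additive_map_scale:
  assumes F: "additive_map F"
  shows "F (\<lambda>x. k * f x) = (\<lambda>y. k * F f y)"
proof (induction k rule: int_induct[where k = 0])
  case base
  then show ?case using additive_map_zero[OF F] by simp
next
  case (step1 i)
  then show ?case using additive_map_add[OF F, of "\<lambda>x. i * f x" f] by (simp add: distrib_right)
next
  case (step2 i)
  then show ?case using additive_map_diff[OF F, of "\<lambda>x. i * f x" f] by (simp add: left_diff_distrib)
qed

lemma additive_map_lincomb:
  assumes F: "additive_map F"
  shows "F (lincomb n m v) = lincomb n m (\<lambda>i. F (v i))"
proof (induction n)
  case 0
  then show ?case using additive_map_zero[OF F] by (simp add: lincomb_def)
next
  case (Suc n)
  then show ?case
    using additive_map_add[OF F, of "lincomb n m v" "\<lambda>x. m n * v n x"] additive_map_scale[OF F, of "m n" "v n"]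
    by (simp add: lincomb_def)
qed

lemma quotient_rank_le:
  "(\<And>n v. independent_mod Z B n v \<Longrightarrow> enat n \<le> r) \<Longrightarrow> quotient_rank Z B \<le> r"
  unfolding quotient_rank_def by (auto intro!: Sup_least)

lemma quotient_rank_ge: "independent_mod Z B n v \<Longrightarrow> enat n \<le> quotient_rank Z B"
  unfolding quotient_rank_def by (auto intro!: Sup_upper)

lemma quotient_rank_attained:
  assumes "quotient_rank Z B = enat n"
  obtains v where "independent_mod Z B n v"
proof -
  let ?N = "{n. \<exists>v. independent_mod Z B n v}"
  have le: "k \<le> n" if "k \<in> ?N" for k
    using that quotient_rank_ge assms by fastforce
  \<comment> \<open>The empty family makes the set of sizes nonempty, so that its maximum
    exists.\<close>
  have 0: "0 \<in> ?N" by (auto simp: independent_mod_def)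
  have fin: "finite ?N" using le by (meson finite_nat_set_iff_bounded_le)
  have "quotient_rank Z B \<le> enat (Max ?N)"
    using fin by (intro quotient_rank_le) (auto intro!: Max_ge)
  then have "n \<le> Max ?N" using assms by simp
  moreover have "Max ?N \<in> ?N" using fin 0 by (intro Max_in) auto
  ultimately have "n \<in> ?N" using le by (metis le_antisym)
  then show ?thesis using that by blast
qed

text \<open>A relation modulo \<open>B'\<close> among images pulls back to a relation modulo
  \<open>B\<close>, so independent families go to independent families.\<close>

lemma quotient_rank_injective:
  assumes F: "additive_map F" and Z: "additive_group Z"
    and maps: "\<And>f. f \<in> Z \<Longrightarrow> F f \<in> Z'"
    and inj: "\<And>f. f \<in> Z \<Longrightarrow> F f \<in> B' \<Longrightarrow> f \<in> B"
  shows "quotient_rank Z B \<le> quotient_rank Z' B'"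
proof (rule quotient_rank_le)
  fix n v assume v: "independent_mod Z B n v"
  have "independent_mod Z' B' n (\<lambda>i. F (v i))"
    using v inj[OF lincomb_in[OF Z]] maps
    unfolding independent_mod_def additive_map_lincomb[OF F, symmetric] by blast
  then show "enat n \<le> quotient_rank Z' B'" by (rule quotient_rank_ge)
qed

text \<open>Lifts of an independent family are independent: a relation among the lifts is mapped to
  a relation among the given elements, up to an error in \<open>B'\<close>.\<close>

lemma quotient_rank_surjective:
  assumes F: "additive_map F" and B': "additive_group B'"
    and maps: "\<And>f. f \<in> B \<Longrightarrow> F f \<in> B'"
    and surj: "\<And>g. g \<in> Z' \<Longrightarrow> \<exists>f\<in>Z. (\<lambda>x. F f x - g x) \<in> B'"
  shows "quotient_rank Z' B' \<le> quotient_rank Z B"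
proof (rule quotient_rank_le)
  fix n v assume v: "independent_mod Z' B' n v"
  have "\<forall>i. \<exists>f. i < n \<longrightarrow> f \<in> Z \<and> (\<lambda>x. F f x - v i x) \<in> B'"
    using v surj unfolding independent_mod_def by blast
  then obtain w where w: "i < n \<Longrightarrow> w i \<in> Z" "i < n \<Longrightarrow> (\<lambda>x. F (w i) x - v i x) \<in> B'" for i
    by metis
  have "independent_mod Z B n w"
    unfolding independent_mod_def
  proof safe
    fix m i assume m: "lincomb n m w \<in> B" and i: "i < n"
    have "F (lincomb n m w) \<in> B'" using maps m .
    moreover have "lincomb n m (\<lambda>i x. F (w i) x - v i x) \<in> B'"
      using w(2) by (rule lincomb_in[OF B'])
    ultimately have "(\<lambda>x. F (lincomb n m w) x - lincomb n m (\<lambda>i x. F (w i) x - v i x) x) \<in> B'"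
      by (rule additive_group_diff[OF B'])
    moreover have "(\<lambda>x. F (lincomb n m w) x - lincomb n m (\<lambda>i x. F (w i) x - v i x) x) = lincomb n m v"
      unfolding additive_map_lincomb[OF F]
      by (simp add: lincomb_def fun_eq_iff sum_subtractf[symmetric] algebra_simps)
    ultimately show "m i = 0" using v i by (auto simp: independent_mod_def)
  qed (use w in auto)
  then show "enat n \<le> quotient_rank Z B" by (rule quotient_rank_ge)
qed

lemma quotient_rank_iso:
  assumes F: "additive_map F" and Z: "additive_group Z" and B': "additive_group B'"
    and "\<And>f. f \<in> Z \<Longrightarrow> F f \<in> Z'" and "\<And>f. f \<in> B \<Longrightarrow> F f \<in> B'"
    and "\<And>f. f \<in> Z \<Longrightarrow> F f \<in> B' \<Longrightarrow> f \<in> B"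
    and "\<And>g. g \<in> Z' \<Longrightarrow> \<exists>f\<in>Z. (\<lambda>x. F f x - g x) \<in> B'"
  shows "quotient_rank Z B = quotient_rank Z' B'"
  by (intro antisym quotient_rank_injective[OF F Z] quotient_rank_surjective[OF F B']) (use assms in auto)

text \<open>Fraction-free elimination of one equation and one unknown.\<close>

lemma integer_system_nontrivial_solution:
  fixes a :: "'i \<Rightarrow> 'j \<Rightarrow> int"
  assumes "finite I" "finite J" "card I < card J"
  shows "\<exists>x. (\<exists>j\<in>J. x j \<noteq> 0) \<and> (\<forall>i\<in>I. (\<Sum>j\<in>J. a i j * x j) = 0)"
  using assms
proof (induction I arbitrary: J a rule: finite_induct)
  case empty
  then have "J \<noteq> {}" by auto
  then show ?case by (intro exI[of _ "\<lambda>_. 1"]) auto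
next
  case (insert i0 I)
  show ?case
  proof (cases "\<forall>j\<in>J. a i0 j = 0")
    case True
    obtain x where "\<exists>j\<in>J. x j \<noteq> 0" "\<forall>i\<in>I. (\<Sum>j\<in>J. a i j * x j) = 0"
      using insert.IH[of J a] insert.prems insert.hyps by (metis Suc_lessD card_insert_disjoint)
    then show ?thesis using True by (intro exI[of _ x]) auto
  next
    case False
    then obtain j0 where j0: "j0 \<in> J" "a i0 j0 \<noteq> 0" by blast
    let ?J = "J - {j0}" and ?p = "a i0 j0"
    \<comment> \<open>Row \<open>i\<close> times the pivot minus \<open>a i j0\<close> times the
      pivot row: the unknown \<open>j0\<close> drops out without a division.\<close>
    let ?a = "\<lambda>i j. ?p * a i j - a i j0 * a i0 j"
    have "card I < card ?J" using insert j0 by simp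
    then obtain y where y: "\<exists>j\<in>?J. y j \<noteq> 0" "\<And>i. i \<in> I \<Longrightarrow> (\<Sum>j\<in>?J. ?a i j * y j) = 0"
      using insert.IH[of ?J ?a] insert.prems by auto
    \<comment> \<open>Scaling the solution by the pivot makes the value which equation
      \<open>i0\<close> forces at \<open>j0\<close> an integer.\<close>
    define x where "x j = (if j = j0 then - (\<Sum>j\<in>?J. a i0 j * y j) else ?p * y j)" for j
    have split: "(\<Sum>j\<in>J. a i j * x j) = (\<Sum>j\<in>?J. ?a i j * y j)" for i
    proof -
      have "(\<Sum>j\<in>J. a i j * x j) = a i j0 * x j0 + (\<Sum>j\<in>?J. a i j * x j)"
        using insert.prems j0 by (simp add: sum.remove)
      also have "(\<Sum>j\<in>?J. a i j * x j) = (\<Sum>j\<in>?J. ?p * a i j * y j)"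
        by (intro sum.cong) (auto simp: x_def)
      also have "a i j0 * x j0 = - (\<Sum>j\<in>?J. a i j0 * a i0 j * y j)"
        by (simp add: x_def sum_distrib_left mult.assoc)
      finally show ?thesis by (simp add: sum_subtractf left_diff_distrib)
    qed
    have "(\<Sum>j\<in>?J. ?a i0 j * y j) = 0" by simp
    then have "\<forall>i\<in>insert i0 I. (\<Sum>j\<in>J. a i j * x j) = 0" using split y(2) by auto
    moreover have "\<exists>j\<in>J. x j \<noteq> 0" using y(1) j0 by (auto simp: x_def)
    ultimately show ?thesis by blast
  qed
qed

text \<open>For more than \<open>n\<close> elements the coefficient vectors with respect to
  \<open>w\<close> are dependent over the integers. Combining the elements accordingly cancels
  \<open>w\<close> and leaves a forbidden relation modulo \<open>B\<close>.\<close>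

lemma quotient_rank_le_spanning:
  assumes B: "additive_group B"
    and span: "\<And>z. z \<in> Z \<Longrightarrow> \<exists>p m. p \<noteq> 0 \<and> (\<lambda>x. p * z x - lincomb n m w x) \<in> B"
  shows "quotient_rank Z B \<le> enat n"
proof (rule quotient_rank_le)
  fix k v assume v: "independent_mod Z B k v"
  have "\<forall>j\<in>{..<k}. \<exists>pm. fst pm \<noteq> 0 \<and> (\<lambda>x. fst pm * v j x - lincomb n (snd pm) w x) \<in> B"
  proof
    fix j assume "j \<in> {..<k}"
    then have "v j \<in> Z" using v by (simp add: independent_mod_def)
    from span[OF this] show "\<exists>pm. fst pm \<noteq> 0 \<and> (\<lambda>x. fst pm * v j x - lincomb n (snd pm) w x) \<in> B"
      by simp
  qed
  from bchoice[OF this] obtain pm where pm: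
      "\<forall>j\<in>{..<k}. fst (pm j) \<noteq> 0 \<and> (\<lambda>x. fst (pm j) * v j x - lincomb n (snd (pm j)) w x) \<in> B" ..
  define p m where "p j = fst (pm j)" and "m j = snd (pm j)" for j
  have pm: "p j \<noteq> 0" "(\<lambda>x. p j * v j x - lincomb n (m j) w x) \<in> B" if "j < k" for j
    using pm that by (auto simp: p_def m_def)
  show "enat k \<le> enat n"
  proof (rule ccontr)
    assume "\<not> enat k \<le> enat n"
    then have "card {..<n} < card {..<k}" by simp
    then obtain y where y: "\<exists>j\<in>{..<k}. y j \<noteq> 0" "\<And>i. i < n \<Longrightarrow> (\<Sum>j<k. m j i * y j) = 0"
      using integer_system_nontrivial_solution[OF finite_lessThan finite_lessThan, of n k "\<lambda>i j. m j i"]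
      by auto
    have "lincomb k y (\<lambda>j x. p j * v j x - lincomb n (m j) w x) \<in> B"
      using pm(2) by (rule lincomb_in[OF B])
    moreover have "lincomb k y (\<lambda>j x. p j * v j x - lincomb n (m j) w x) = lincomb k (\<lambda>j. y j * p j) v"
    proof
      fix x
      have "(\<Sum>j<k. y j * lincomb n (m j) w x) = (\<Sum>j<k. \<Sum>i<n. (m j i * y j) * w i x)"
        unfolding lincomb_def sum_distrib_left by (intro sum.cong refl) (simp only: mult_ac)
      also have "\<dots> = (\<Sum>i<n. \<Sum>j<k. (m j i * y j) * w i x)"
        by (rule sum.swap)
      also have "\<dots> = (\<Sum>i<n. (\<Sum>j<k. m j i * y j) * w i x)"
        unfolding sum_distrib_right ..
      also have "\<dots> = 0"
        by (intro sum.neutral ballI) (simp only: y(2) lessThan_iff mult_zero_left)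
      finally have 0: "(\<Sum>j<k. y j * lincomb n (m j) w x) = 0" .
      have "(\<Sum>j<k. y j * (p j * v j x - lincomb n (m j) w x)) =
          (\<Sum>j<k. y j * p j * v j x) - (\<Sum>j<k. y j * lincomb n (m j) w x)"
        unfolding sum_subtractf[symmetric] by (intro sum.cong refl) (simp only: right_diff_distrib mult.assoc)
      then show "lincomb k y (\<lambda>j x. p j * v j x - lincomb n (m j) w x) x = lincomb k (\<lambda>j. y j * p j) v x"
        unfolding 0 by (simp only: lincomb_def diff_0_right)
    qed
    ultimately have "lincomb k (\<lambda>j. y j * p j) v \<in> B" by (simp only:)
    moreover have "lincomb k (\<lambda>j. y j * p j) v \<in> B \<longrightarrow> (\<forall>j<k. y j * p j = 0)"
      using v unfolding independent_mod_def by (elim conjE allE[of _ "\<lambda>j. y j * p j"])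
    ultimately have "\<forall>j<k. y j * p j = 0" by blast
    then show False using y(1) pm(1) by (metis lessThan_iff mult_eq_0_iff)
  qed
qed

text \<open>Appending \<open>z\<close> to a family of maximal size destroys independence, and the
  coefficient of \<open>z\<close> in the new relation cannot vanish.\<close>

lemma quotient_rank_maximal_spans:
  assumes r: "quotient_rank Z B = enat n" and v: "independent_mod Z B n v" and z: "z \<in> Z"
  shows "\<exists>p m. p \<noteq> 0 \<and> (\<lambda>x. p * z x - lincomb n m v x) \<in> B"
proof -
  let ?v = "v(n := z)"
  have "\<not> independent_mod Z B (Suc n) ?v"
    using r quotient_rank_ge[of Z B "Suc n" ?v] by auto
  then obtain m where m: "lincomb (Suc n) m ?v \<in> B" "\<exists>i<Suc n. m i \<noteq> 0"
    using v z by (auto simp: independent_mod_def less_Suc_eq)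
  have eq: "lincomb (Suc n) m ?v = (\<lambda>x. m n * z x - lincomb n (\<lambda>i. - m i) v x)"
    by (auto simp: lincomb_def sum_negf intro!: sum.cong)
  have "m n \<noteq> 0"
  proof
    assume "m n = 0"
    then have "lincomb (Suc n) m ?v = lincomb n m v"
      by (auto simp: lincomb_def intro!: sum.cong)
    with m(1) v have "\<forall>i<n. m i = 0" by (simp add: independent_mod_def)
    with m(2) \<open>m n = 0\<close> show False by (auto simp: less_Suc_eq)
  qed
  then show ?thesis using m(1) unfolding eq by blast
qed

lemma lincomb_append:
  "lincomb (n + k) m (\<lambda>i. if i < n then v i else w (i - n)) x =
     lincomb n m v x + lincomb k (\<lambda>i. m (n + i)) w x"
proof -
  have "(\<Sum>i<n + k. m i * (if i < n then v i else w (i - n)) x) =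
      (\<Sum>i<n. m i * (if i < n then v i else w (i - n)) x) + (\<Sum>i\<in>{n..<n + k}. m i * (if i < n then v i else w (i - n)) x)"
    by (subst sum.union_disjoint[symmetric]) (auto intro!: sum.cong)
  also have "(\<Sum>i\<in>{n..<n + k}. m i * (if i < n then v i else w (i - n)) x) = (\<Sum>i<k. m (n + i) * w i x)"
    by (rule sum.reindex_bij_witness[of _ "\<lambda>i. n + i" "\<lambda>i. i - n"]) auto
  finally show ?thesis by (simp add: lincomb_def)
qed

text \<open>Maximal families for the two steps of the filtration are concatenated. They span up to
  multiples because an element is reduced first modulo \<open>B'\<close> and its remainder modulo
  \<open>B\<close>; they are independent because a relation is tested first modulo
  \<open>B'\<close>.\<close>

theorem quotient_rank_additive:
  assumes B: "additive_group B" and B': "additive_group B'" and sub: "B \<subseteq> B'" "B' \<subseteq> Z"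
  shows "quotient_rank Z B = quotient_rank Z B' + quotient_rank B' B"
proof (rule antisym)
  show "quotient_rank Z B \<le> quotient_rank Z B' + quotient_rank B' B"
  proof (cases "quotient_rank Z B'"; cases "quotient_rank B' B")
    fix n k assume n: "quotient_rank Z B' = enat n" and k: "quotient_rank B' B = enat k"
    obtain v where v: "independent_mod Z B' n v" using quotient_rank_attained[OF n] .
    obtain w where w: "independent_mod B' B k w" using quotient_rank_attained[OF k] .
    have "quotient_rank Z B \<le> enat (n + k)"
    proof (rule quotient_rank_le_spanning[OF B])
      fix z assume "z \<in> Z"
      then obtain p m where 1: "p \<noteq> 0" "(\<lambda>x. p * z x - lincomb n m v x) \<in> B'"
        using quotient_rank_maximal_spans[OF n v] by blast
      then obtain q l where 2: "q \<noteq> 0" "(\<lambda>x. q * (p * z x - lincomb n m v x) - lincomb k l w x) \<in> B"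
        using quotient_rank_maximal_spans[OF k w] by blast
      let ?m = "\<lambda>i. if i < n then q * m i else l (i - n)"
      have "lincomb n ?m v x = q * lincomb n m v x" for x
        by (simp add: lincomb_def sum_distrib_left mult.assoc)
      then have "(\<lambda>x. q * p * z x - lincomb (n + k) ?m (\<lambda>i. if i < n then v i else w (i - n)) x) \<in> B"
        using 2(2) unfolding lincomb_append by (simp add: algebra_simps)
      moreover have "q * p \<noteq> 0" using 1 2 by simp
      ultimately show "\<exists>p m. p \<noteq> 0 \<and>
          (\<lambda>x. p * z x - lincomb (n + k) m (\<lambda>i. if i < n then v i else w (i - n)) x) \<in> B"
        by blast
    qed
    then show ?thesis by (simp add: n k)
  qed simp_all
  show "quotient_rank Z B' + quotient_rank B' B \<le> quotient_rank Z B"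
  proof (cases "quotient_rank Z B")
    case infinity
    then show ?thesis by (metis enat_ord_code(3))
  next
    case (enat N)
    have le: "enat (n + k) \<le> enat N" if v: "independent_mod Z B' n v" and w: "independent_mod B' B k w" for n k v w
    proof -
      have "independent_mod Z B (n + k) (\<lambda>i. if i < n then v i else w (i - n))"
        unfolding independent_mod_def
      proof safe
        fix i assume "i < n + k" then show "(if i < n then v i else w (i - n)) \<in> Z"
          using v w sub by (auto simp: independent_mod_def)
      next
        fix m i assume m: "lincomb (n + k) m (\<lambda>i. if i < n then v i else w (i - n)) \<in> B" and i: "i < n + k"
        let ?l = "lincomb k (\<lambda>i. m (n + i)) w"
        have l: "?l \<in> B'" using w by (intro lincomb_in[OF B']) (auto simp: independent_mod_def)
        have eq: "lincomb (n + k) m (\<lambda>i. if i < n then v i else w (i - n)) = (\<lambda>x. lincomb n m v x + ?l x)"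
          by (simp add: lincomb_append fun_eq_iff)
        have "(\<lambda>x. (lincomb n m v x + ?l x) - ?l x) \<in> B'"
          using additive_group_diff[OF B' _ l] m sub(1) unfolding eq by blast
        then have 0: "\<forall>i<n. m i = 0" using v by (simp add: independent_mod_def)
        then have "lincomb n m v = (\<lambda>_. 0)" by (simp add: lincomb_def)
        then have "?l \<in> B" using m unfolding eq by simp
        moreover have "?l \<in> B \<longrightarrow> (\<forall>j<k. m (n + j) = 0)"
          using w unfolding independent_mod_def by (elim conjE allE[of _ "\<lambda>i. m (n + i)"])
        ultimately have 1: "m (n + j) = 0" if "j < k" for j using that by blast
        show "m i = 0"
        proof (cases "i < n")
          case False
          then show ?thesis using 1[of "i - n"] i by simp
        qed (use 0 in simp)
      qed
      then show ?thesis using quotient_rank_ge enat by metis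
    qed
    \<comment> \<open>Padding with the empty family bounds each summand by \<open>N\<close>; only
      then are both ranks known to be finite and hence attained.\<close>
    have triv: "independent_mod Z' B'' 0 (\<lambda>_ _. 0)" for Z' B'' :: "('a \<Rightarrow> int) set"
      by (simp add: independent_mod_def)
    have "quotient_rank Z B' \<le> enat N" using le[OF _ triv] by (intro quotient_rank_le) simp
    moreover have "quotient_rank B' B \<le> enat N" using le[OF triv] by (intro quotient_rank_le) simp
    ultimately obtain n k where nk: "quotient_rank Z B' = enat n" "quotient_rank B' B = enat k"
      using enat_ile by metis
    obtain v where "independent_mod Z B' n v" using quotient_rank_attained[OF nk(1)] .
    moreover obtain w where "independent_mod B' B k w" using quotient_rank_attained[OF nk(2)] .
    ultimately show ?thesis using le[of n _ k] nk enat by simp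
  qed
qed

lemma quotient_rank_zero:
  assumes "Z \<subseteq> B"
  shows "quotient_rank Z B = 0"
proof -
  have "quotient_rank Z B \<le> enat 0"
  proof (rule quotient_rank_le)
    fix n v assume v: "independent_mod Z B n v"
    show "enat n \<le> enat 0"
    proof (rule ccontr)
      assume "\<not> enat n \<le> enat 0"
      then have n: "0 < n" by simp
      then have "v 0 \<in> B" using v assms by (auto simp: independent_mod_def)
      moreover have "lincomb n (\<lambda>i. if i = 0 then 1 else 0) v = v 0"
      proof
        fix x
        have "(\<Sum>i<n. (if i = 0 then 1 else 0) * v i x) = (\<Sum>i<n. if i = 0 then v i x else 0)"
          by (intro sum.cong) auto
        then show "lincomb n (\<lambda>i. if i = 0 then 1 else 0) v x = v 0 x"
          using n by (simp add: lincomb_def)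
      qed
      moreover have "lincomb n (\<lambda>i. if i = 0 then 1 else 0) v \<in> B \<longrightarrow>
          (\<forall>i<n. (if i = 0 then 1 else 0 :: int) = 0)"
        using v unfolding independent_mod_def by (elim conjE allE[of _ "\<lambda>i. if i = 0 then 1 else 0"])
      ultimately have "\<forall>i<n. (if i = 0 then 1 else 0 :: int) = 0" by simp
      then have "(if (0::nat) = 0 then 1 else 0 :: int) = 0" using n by blast
      then show False by simp
    qed
  qed
  then show ?thesis unfolding zero_enat_def[symmetric] by simp
qed

section \<open>Alexander-Spanier cochains\<close>

text \<open>\<open>cobd\<close> is the simplicial coboundary and \<open>prism f g\<close> the cochain homotopy between the pullbacks along \<open>f\<close> and \<open>g\<close>;
  recursion on the list hides the alternating signs.\<close>

fun cobd :: "('a list \<Rightarrow> int) \<Rightarrow> 'a list \<Rightarrow> int" where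
  "cobd c [] = 0"
| "cobd c (x # xs) = c xs - cobd (\<lambda>ys. c (x # ys)) xs"

fun prism :: "('a \<Rightarrow> 'b) \<Rightarrow> ('a \<Rightarrow> 'b) \<Rightarrow> ('b list \<Rightarrow> int) \<Rightarrow> 'a list \<Rightarrow> int" where
  "prism f g c [] = 0"
| "prism f g c (x # xs) = c (f x # g x # map g xs) - prism f g (\<lambda>ys. c (f x # ys)) xs"

lemma cobd_zero [simp]: "cobd (\<lambda>_. 0) xs = 0"
  by (induction xs) auto

lemma cobd_diff: "cobd (\<lambda>ys. c ys - d ys) xs = cobd c xs - cobd d xs"
  by (induction xs arbitrary: c d) auto

lemma cobd_add: "cobd (\<lambda>ys. c ys + d ys) xs = cobd c xs + cobd d xs"
  by (induction xs arbitrary: c d) auto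

lemma cobd_cobd: "cobd (cobd c) xs = 0"
  by (induction xs arbitrary: c) (simp_all add: cobd_diff)

lemma cobd_map: "cobd (\<lambda>ys. c (map f ys)) xs = cobd c (map f xs)"
  by (induction xs arbitrary: c) auto

lemma cobd_cong:
  "(\<And>ys. Suc (length ys) = length xs \<Longrightarrow> set ys \<subseteq> set xs \<Longrightarrow> c ys = d ys) \<Longrightarrow> cobd c xs = cobd d xs"
proof (induction xs arbitrary: c d)
  case (Cons x xs)
  have "cobd (\<lambda>ys. c (x # ys)) xs = cobd (\<lambda>ys. d (x # ys)) xs"
    by (rule Cons.IH) (auto intro!: Cons.prems)
  then show ?case using Cons.prems[of xs] by auto
qed simp

lemma cobd_eq_0:
  "(\<And>ys. Suc (length ys) = length xs \<Longrightarrow> set ys \<subseteq> set xs \<Longrightarrow> c ys = 0) \<Longrightarrow> cobd c xs = 0"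
  using cobd_cong[of xs c "\<lambda>_. 0"] by simp

lemma prism_diff: "prism f g (\<lambda>ys. c ys - d ys) xs = prism f g c xs - prism f g d xs"
  by (induction xs arbitrary: c d) auto

lemma cobd_prism: "cobd (prism f g c) xs + prism f g (cobd c) xs = c (map g xs) - c (map f xs)"
  by (induction xs arbitrary: c) (simp_all add: cobd_diff prism_diff cobd_map[symmetric] algebra_simps)

text \<open>The prism over a list evaluates \<open>c\<close> only on lists in the union of the two
  images. This locality is why contiguity is the right notion of closeness for two maps.\<close>

lemma prism_eq_0:
  "(\<And>ys. length ys = Suc (length xs) \<Longrightarrow> set ys \<subseteq> f ` set xs \<union> g ` set xs \<Longrightarrow> c ys = 0)
    \<Longrightarrow> prism f g c xs = 0"
proof (induction xs arbitrary: c)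
  case (Cons x xs)
  have "prism f g (\<lambda>ys. c (f x # ys)) xs = 0"
    by (rule Cons.IH) (auto intro!: Cons.prems)
  moreover have "c (f x # g x # map g xs) = 0"
    by (rule Cons.prems) auto
  ultimately show ?case by simp
qed simp

text \<open>
  A scale \<open>(s, a)\<close> consists of the small sets and of the small null sets: the cochains are only
  considered on lists of points of a set in \<open>s\<close>, and they vanish on lists of points of a set in \<open>a\<close>.
  With \<open>{} \<in> a\<close> the resulting cohomology is not augmented, with \<open>a = {}\<close> it is reduced. Lists of
  length \<open>m\<close> correspond to cohomological degree \<open>m - 1\<close>.
\<close>

type_synonym 'a scale = "'a set set \<times> 'a set set"

text \<open>Closure under subsets makes faces of admissible lists admissible,
  \<open>snd p \<subseteq> fst p\<close> makes coboundaries of relative cochains relative, and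
  directedness lets cochains be added at a common scale.\<close>

definition scale_system :: "'a scale set \<Rightarrow> bool" where
  "scale_system S \<longleftrightarrow> S \<noteq> {} \<and>
     (\<forall>p\<in>S. (\<forall>\<sigma>\<in>fst p. \<forall>\<tau>\<subseteq>\<sigma>. \<tau> \<in> fst p) \<and> (\<forall>\<sigma>\<in>snd p. \<forall>\<tau>\<subseteq>\<sigma>. \<tau> \<in> snd p) \<and> snd p \<subseteq> fst p) \<and>
     (\<forall>p\<in>S. \<forall>q\<in>S. \<exists>r\<in>S. fst r \<subseteq> fst p \<inter> fst q \<and> snd r \<subseteq> snd p \<inter> snd q)"

text \<open>Cochains are total functions with arbitrary values on lists which are not small. Two
  cochains that agree at some scale differ by a coboundary with primitive zero, so the quotient in
  \<open>hrank\<close> also performs the passage to germs.\<close>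

definition cocycle_at :: "nat \<Rightarrow> 'a scale \<Rightarrow> ('a list \<Rightarrow> int) \<Rightarrow> bool" where
  "cocycle_at m p c \<longleftrightarrow> (\<forall>xs. length xs = Suc m \<longrightarrow> set xs \<in> fst p \<longrightarrow> cobd c xs = 0) \<and>
     (\<forall>xs. length xs = m \<longrightarrow> set xs \<in> snd p \<longrightarrow> c xs = 0)"

definition coboundary_at :: "nat \<Rightarrow> 'a scale \<Rightarrow> ('a list \<Rightarrow> int) \<Rightarrow> ('a list \<Rightarrow> int) \<Rightarrow> bool" where
  "coboundary_at m p b c \<longleftrightarrow> (\<forall>xs. length xs = m \<longrightarrow> set xs \<in> fst p \<longrightarrow> c xs = cobd b xs) \<and>
     (\<forall>xs. Suc (length xs) = m \<longrightarrow> set xs \<in> snd p \<longrightarrow> b xs = 0)"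

definition cocycles :: "nat \<Rightarrow> 'a scale set \<Rightarrow> ('a list \<Rightarrow> int) set" where
  "cocycles m S = {c. \<exists>p\<in>S. cocycle_at m p c}"

definition coboundaries :: "nat \<Rightarrow> 'a scale set \<Rightarrow> ('a list \<Rightarrow> int) set" where
  "coboundaries m S = {c. \<exists>p\<in>S. \<exists>b. coboundary_at m p b c}"

definition hrank :: "nat \<Rightarrow> 'a scale set \<Rightarrow> enat" where
  "hrank m S = quotient_rank (cocycles m S) (coboundaries m S)"

lemma scale_system_downD:
  assumes "scale_system S" "p \<in> S" "\<tau> \<subseteq> \<sigma>"
  shows "\<sigma> \<in> fst p \<Longrightarrow> \<tau> \<in> fst p" "\<sigma> \<in> snd p \<Longrightarrow> \<tau> \<in> snd p"
  using assms unfolding scale_system_def by blast+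

lemma scale_system_null_subset: "scale_system S \<Longrightarrow> p \<in> S \<Longrightarrow> \<sigma> \<in> snd p \<Longrightarrow> \<sigma> \<in> fst p"
  unfolding scale_system_def by blast

lemma scale_system_refine:
  assumes "scale_system S" "p \<in> S" "q \<in> S"
  obtains r where "r \<in> S" "fst r \<subseteq> fst p" "fst r \<subseteq> fst q" "snd r \<subseteq> snd p" "snd r \<subseteq> snd q"
  using assms unfolding scale_system_def by (meson le_infE)

lemma cocycle_at_mono: "cocycle_at m p c \<Longrightarrow> fst q \<subseteq> fst p \<Longrightarrow> snd q \<subseteq> snd p \<Longrightarrow> cocycle_at m q c"
  unfolding cocycle_at_def by blast

lemma coboundary_at_mono:
  "coboundary_at m p b c \<Longrightarrow> fst q \<subseteq> fst p \<Longrightarrow> snd q \<subseteq> snd p \<Longrightarrow> coboundary_at m q b c"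
  unfolding coboundary_at_def by blast

lemma cocycle_at_diff: "cocycle_at m p c \<Longrightarrow> cocycle_at m p d \<Longrightarrow> cocycle_at m p (\<lambda>xs. c xs - d xs)"
  by (simp add: cocycle_at_def cobd_diff)

lemma coboundary_at_diff:
  "coboundary_at m p b c \<Longrightarrow> coboundary_at m p b' d \<Longrightarrow>
     coboundary_at m p (\<lambda>xs. b xs - b' xs) (\<lambda>xs. c xs - d xs)"
  by (simp add: coboundary_at_def cobd_diff)

lemma coboundary_at_add:
  "coboundary_at m p b c \<Longrightarrow> coboundary_at m p b' d \<Longrightarrow>
     coboundary_at m p (\<lambda>xs. b xs + b' xs) (\<lambda>xs. c xs + d xs)"
  by (simp add: coboundary_at_def cobd_add)

lemma additive_group_cocycles:
  assumes S: "scale_system S"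
  shows "additive_group (cocycles m S)"
  unfolding additive_group_def
proof safe
  show "(\<lambda>_. 0) \<in> cocycles m S"
    using S by (auto simp: cocycles_def cocycle_at_def scale_system_def)
next
  fix c d assume "c \<in> cocycles m S" "d \<in> cocycles m S"
  then obtain p q where "p \<in> S" "cocycle_at m p c" "q \<in> S" "cocycle_at m q d"
    by (auto simp: cocycles_def)
  moreover from this obtain r where
    "r \<in> S" "fst r \<subseteq> fst p" "fst r \<subseteq> fst q" "snd r \<subseteq> snd p" "snd r \<subseteq> snd q"
    using scale_system_refine[OF S] by metis
  ultimately show "(\<lambda>x. c x - d x) \<in> cocycles m S"
    unfolding cocycles_def using cocycle_at_diff cocycle_at_mono by blast
qed

lemma additive_group_coboundaries:
  assumes S: "scale_system S"
  shows "additive_group (coboundaries m S)"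
  unfolding additive_group_def
proof safe
  obtain p where "p \<in> S" using S by (auto simp: scale_system_def)
  moreover have "coboundary_at m p (\<lambda>_. 0) (\<lambda>_. 0)" by (simp add: coboundary_at_def)
  ultimately show "(\<lambda>_. 0) \<in> coboundaries m S"
    unfolding coboundaries_def by blast
next
  fix c d assume "c \<in> coboundaries m S" "d \<in> coboundaries m S"
  then obtain p q b b' where "p \<in> S" "coboundary_at m p b c" "q \<in> S" "coboundary_at m q b' d"
    by (auto simp: coboundaries_def)
  moreover from this obtain r where
    "r \<in> S" "fst r \<subseteq> fst p" "fst r \<subseteq> fst q" "snd r \<subseteq> snd p" "snd r \<subseteq> snd q"
    using scale_system_refine[OF S] by metis
  ultimately show "(\<lambda>x. c x - d x) \<in> coboundaries m S"
    unfolding coboundaries_def using coboundary_at_diff coboundary_at_mono by blast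
qed

lemma coboundaries_subset_cocycles:
  assumes S: "scale_system S"
  shows "coboundaries m S \<subseteq> cocycles m S"
proof
  fix c assume "c \<in> coboundaries m S"
  then obtain p b where p: "p \<in> S" and b: "coboundary_at m p b c"
    by (auto simp: coboundaries_def)
  have "cocycle_at m p c"
    unfolding cocycle_at_def
  proof safe
    fix xs assume xs: "length xs = Suc m" "set xs \<in> fst p"
    have "cobd c xs = cobd (cobd b) xs"
    proof (rule cobd_cong)
      fix ys assume "Suc (length ys) = length xs" "set ys \<subseteq> set xs"
      then show "c ys = cobd b ys"
        using xs b scale_system_downD(1)[OF S p] by (simp add: coboundary_at_def)
    qed
    then show "cobd c xs = 0" by (simp add: cobd_cobd)
  next
    fix xs assume xs: "m = length xs" "set xs \<in> snd p"
    have "cobd b xs = 0"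
    proof (rule cobd_eq_0)
      fix ys assume "Suc (length ys) = length xs" "set ys \<subseteq> set xs"
      then show "b ys = 0"
        using xs b scale_system_downD(2)[OF S p] by (simp add: coboundary_at_def)
    qed
    then show "c xs = 0"
      using b xs scale_system_null_subset[OF S p] by (simp add: coboundary_at_def)
  qed
  then show "c \<in> cocycles m S" using p by (auto simp: cocycles_def)
qed

section \<open>Contiguous maps and approximate inverses\<close>

text \<open>Contiguity as for simplicial maps; for \<open>f = g\<close> it says that
  \<open>f\<close> preserves small sets and null sets. Continuity does not enter.\<close>

definition contiguous :: "'a scale \<Rightarrow> 'b scale \<Rightarrow> ('a \<Rightarrow> 'b) \<Rightarrow> ('a \<Rightarrow> 'b) \<Rightarrow> bool" where
  "contiguous p q f g \<longleftrightarrow> (\<forall>\<sigma>\<in>fst p. f ` \<sigma> \<union> g ` \<sigma> \<in> fst q) \<and> (\<forall>\<sigma>\<in>snd p. f ` \<sigma> \<union> g ` \<sigma> \<in> snd q)"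

abbreviation scale_map :: "'a scale \<Rightarrow> 'b scale \<Rightarrow> ('a \<Rightarrow> 'b) \<Rightarrow> bool" where
  "scale_map p q f \<equiv> contiguous p q f f"

definition scale_homotopic :: "'a scale \<Rightarrow> 'b scale \<Rightarrow> ('a \<Rightarrow> 'b) \<Rightarrow> ('a \<Rightarrow> 'b) \<Rightarrow> bool" where
  "scale_homotopic p q = (contiguous p q)\<^sup>*\<^sup>*"

lemma cocycle_at_pullback:
  assumes "scale_map p q f" "cocycle_at m q c"
  shows "cocycle_at m p (\<lambda>xs. c (map f xs))"
  using assms by (simp add: cocycle_at_def contiguous_def cobd_map)

lemma coboundary_at_pullback:
  assumes "scale_map p q f" "coboundary_at m q b c"
  shows "coboundary_at m p (\<lambda>xs. b (map f xs)) (\<lambda>xs. c (map f xs))"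
  using assms by (simp add: coboundary_at_def contiguous_def cobd_map)

lemma contiguous_coboundary_at:
  assumes T: "scale_system T" "q \<in> T" and f: "contiguous p q f g" and c: "cocycle_at m q c"
  shows "coboundary_at m p (prism f g c) (\<lambda>xs. c (map g xs) - c (map f xs))"
  unfolding coboundary_at_def
proof (intro allI impI conjI)
  fix xs assume xs: "length xs = m" "set xs \<in> fst p"
  have "prism f g (cobd c) xs = 0"
  proof (rule prism_eq_0)
    fix ys assume ys: "length ys = Suc (length xs)" "set ys \<subseteq> f ` set xs \<union> g ` set xs"
    have "f ` set xs \<union> g ` set xs \<in> fst q" using f xs by (auto simp: contiguous_def)
    then show "cobd c ys = 0"
      using c ys xs scale_system_downD(1)[OF T ys(2)] by (simp add: cocycle_at_def)
  qed
  then show "c (map g xs) - c (map f xs) = cobd (prism f g c) xs"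
    using cobd_prism[of f g c xs] by simp
next
  fix xs assume xs: "Suc (length xs) = m" "set xs \<in> snd p"
  show "prism f g c xs = 0"
  proof (rule prism_eq_0)
    fix ys assume ys: "length ys = Suc (length xs)" "set ys \<subseteq> f ` set xs \<union> g ` set xs"
    have "f ` set xs \<union> g ` set xs \<in> snd q" using f xs by (auto simp: contiguous_def)
    then show "c ys = 0"
      using c ys xs scale_system_downD(2)[OF T ys(2)] by (simp add: cocycle_at_def)
  qed
qed

lemma scale_homotopic_coboundary_at:
  assumes T: "scale_system T" "q \<in> T" and f: "scale_homotopic p q f g" and c: "cocycle_at m q c"
  shows "\<exists>b. coboundary_at m p b (\<lambda>xs. c (map g xs) - c (map f xs))"
  using f unfolding scale_homotopic_def
proof (induction rule: rtranclp_induct)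
  case base
  show ?case by (intro exI[of _ "\<lambda>_. 0"]) (simp add: coboundary_at_def)
next
  case (step g h)
  then obtain b where "coboundary_at m p b (\<lambda>xs. c (map g xs) - c (map f xs))" by blast
  moreover have "coboundary_at m p (prism g h c) (\<lambda>xs. c (map h xs) - c (map g xs))"
    using contiguous_coboundary_at[OF T step(2) c] .
  ultimately show ?case
    using coboundary_at_add by fastforce
qed

text \<open>The lift of \<open>c\<close> is its pullback along an \<open>r\<close> that is chosen
  for the single scale at which \<open>c\<close> is a cocycle.\<close>

lemma scale_surjective:
  fixes S :: "'a scale set" and T :: "'b scale set"
  assumes S: "scale_system S" and T: "scale_system T"
    and r: "\<And>p. p \<in> S \<Longrightarrow> \<exists>r. \<exists>q'\<in>T. \<exists>p'\<in>S. scale_map q' p r \<and> scale_homotopic p' p (\<lambda>x. x) (\<lambda>x. r (i x))"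
    and c: "c \<in> cocycles m S"
  shows "\<exists>f\<in>cocycles m T. (\<lambda>xs. f (map i xs) - c xs) \<in> coboundaries m S"
proof -
  obtain p where p: "p \<in> S" "cocycle_at m p c"
    using c by (auto simp: cocycles_def)
  obtain r q' p' where r: "q' \<in> T" "p' \<in> S" "scale_map q' p r" "scale_homotopic p' p (\<lambda>x. x) (\<lambda>x. r (i x))"
    using r[OF p(1)] by blast
  obtain e where "coboundary_at m p' e (\<lambda>xs. c (map (\<lambda>x. r (i x)) xs) - c (map (\<lambda>x. x) xs))"
    using scale_homotopic_coboundary_at[OF S p(1) r(4) p(2)] by blast
  then have "(\<lambda>xs. c (map r (map i xs)) - c xs) \<in> coboundaries m S"
    using r(2) by (auto simp: coboundaries_def comp_def)
  moreover have "(\<lambda>xs. c (map r xs)) \<in> cocycles m T"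
    using r(1) cocycle_at_pullback[OF r(3) p(2)] by (auto simp: cocycles_def)
  ultimately show ?thesis by (intro bexI[of _ "\<lambda>xs. c (map r xs)"])
qed

definition approximate_inverse :: "'a scale set \<Rightarrow> 'b scale set \<Rightarrow> ('a \<Rightarrow> 'b) \<Rightarrow> 'a scale \<Rightarrow> 'b scale \<Rightarrow> bool" where
  "approximate_inverse S T i p q \<longleftrightarrow> (\<exists>r. \<exists>q'\<in>T. \<exists>p'\<in>S. scale_map q' p r \<and>
      scale_homotopic q' q (\<lambda>x. x) (\<lambda>x. i (r x)) \<and> scale_homotopic p' p (\<lambda>x. x) (\<lambda>x. r (i x)))"

lemma approximate_inverseI:
  assumes "q' \<in> T" "p' \<in> S" "scale_map q' p r"
    "scale_homotopic q' q (\<lambda>x. x) (\<lambda>x. i (r x))" "scale_homotopic p' p (\<lambda>x. x) (\<lambda>x. r (i x))"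
  shows "approximate_inverse S T i p q"
  using assms unfolding approximate_inverse_def by blast

text \<open>
  The maps \<open>r\<close> need not be continuous and may depend on the scale, which makes this one criterion
  cover homotopy invariance, continuity and excision.
\<close>

theorem hrank_approximate_equivalence:
  assumes S: "scale_system S" and T: "scale_system T"
    and i: "\<And>q. q \<in> T \<Longrightarrow> \<exists>p\<in>S. scale_map p q i"
    and r: "\<And>p q. p \<in> S \<Longrightarrow> q \<in> T \<Longrightarrow> approximate_inverse S T i p q"
  shows "hrank m S = hrank m T"
  unfolding hrank_def
proof (rule quotient_rank_iso[symmetric])
  let ?F = "\<lambda>c xs. c (map i xs)"
  show "additive_map ?F" by (simp add: additive_map_def)
  show "additive_group (cocycles m T)" "additive_group (coboundaries m S)"
    by (rule additive_group_cocycles[OF T] additive_group_coboundaries[OF S])+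
  show "?F c \<in> cocycles m S" if "c \<in> cocycles m T" for c
    using that i cocycle_at_pullback unfolding cocycles_def mem_Collect_eq by metis
  show "?F c \<in> coboundaries m S" if "c \<in> coboundaries m T" for c
    using that i coboundary_at_pullback unfolding coboundaries_def mem_Collect_eq by metis
next
  fix c assume "c \<in> cocycles m T" and "(\<lambda>xs. c (map i xs)) \<in> coboundaries m S"
  then obtain q p b where q: "q \<in> T" "cocycle_at m q c" and p: "p \<in> S"
    and b: "coboundary_at m p b (\<lambda>xs. c (map i xs))"
    by (auto simp: cocycles_def coboundaries_def)
  obtain r q' where r: "q' \<in> T" "scale_map q' p r" "scale_homotopic q' q (\<lambda>x. x) (\<lambda>x. i (r x))"
    using r[OF p q(1)] unfolding approximate_inverse_def by blast
  have 1: "coboundary_at m q' (\<lambda>xs. b (map r xs)) (\<lambda>xs. c (map i (map r xs)))"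
    using coboundary_at_pullback[OF r(2) b] .
  obtain e where 2: "coboundary_at m q' e (\<lambda>xs. c (map (\<lambda>x. i (r x)) xs) - c (map (\<lambda>x. x) xs))"
    using scale_homotopic_coboundary_at[OF T q(1) r(3) q(2)] by blast
  \<comment> \<open>The pullback of \<open>c\<close> along \<open>i\<close> and then
    \<open>r\<close> is the coboundary of the pulled back \<open>b\<close>, and it differs from
    \<open>c\<close> by the coboundary of \<open>e\<close>.\<close>
  have "coboundary_at m q' (\<lambda>xs. b (map r xs) - e xs) c"
    using coboundary_at_diff[OF 1 2] by (simp add: comp_def)
  then show "c \<in> coboundaries m T" using r(1) by (auto simp: coboundaries_def)
next
  obtain q where q: "q \<in> T" using T by (auto simp: scale_system_def)
  have "\<exists>r. \<exists>q'\<in>T. \<exists>p'\<in>S. scale_map q' p r \<and> scale_homotopic p' p (\<lambda>x. x) (\<lambda>x. r (i x))" if "p \<in> S" for p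
    using r[OF that q] unfolding approximate_inverse_def by blast
  then show "\<exists>f\<in>cocycles m T. (\<lambda>x. f (map i x) - c x) \<in> coboundaries m S" if "c \<in> cocycles m S" for c
    using scale_surjective[OF S T _ that] by blast
qed

lemma contiguous_imp_homotopic: "contiguous p q f g \<Longrightarrow> scale_homotopic p q f g"
  by (simp add: scale_homotopic_def)

lemma scale_homotopic_trans:
  "scale_homotopic p q f g \<Longrightarrow> scale_homotopic p q g h \<Longrightarrow> scale_homotopic p q f h"
  by (simp add: scale_homotopic_def)

lemma scale_homotopic_chain:
  assumes "\<And>j. j < n \<Longrightarrow> contiguous p q (f j) (f (Suc j))"
  shows "scale_homotopic p q (f 0) (f n)"
  using assms by (induction n) (auto simp: scale_homotopic_def intro: rtranclp.rtrancl_into_rtrancl)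

section \<open>Ranks of direct limits\<close>

definition cong_mod :: "('x \<Rightarrow> int) set \<Rightarrow> ('x \<Rightarrow> int) \<Rightarrow> ('x \<Rightarrow> int) \<Rightarrow> bool" where
  "cong_mod B f g \<longleftrightarrow> (\<lambda>x. f x - g x) \<in> B"

context
  fixes B :: "('x \<Rightarrow> int) set"
  assumes B: "additive_group B"
begin

lemma cong_mod_refl [simp]: "cong_mod B f f"
  by (simp add: cong_mod_def additive_group_zero[OF B])

lemma cong_mod_sym: "cong_mod B f g \<Longrightarrow> cong_mod B g f"
  using additive_group_uminus[OF B] by (fastforce simp: cong_mod_def)

lemma cong_mod_trans [trans]: "cong_mod B f g \<Longrightarrow> cong_mod B g h \<Longrightarrow> cong_mod B f h"
  using additive_group_add[OF B, of "\<lambda>x. f x - g x" "\<lambda>x. g x - h x"] by (simp add: cong_mod_def)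

lemma cong_mod_add:
  "cong_mod B f f' \<Longrightarrow> cong_mod B g g' \<Longrightarrow> cong_mod B (\<lambda>x. f x + g x) (\<lambda>x. f' x + g' x)"
  using additive_group_add[OF B, of "\<lambda>x. f x - f' x" "\<lambda>x. g x - g' x"]
  by (simp add: cong_mod_def algebra_simps)

lemma cong_mod_scale: "cong_mod B f g \<Longrightarrow> cong_mod B (\<lambda>x. k * f x) (\<lambda>x. k * g x)"
  using additive_group_scale[OF B, of "\<lambda>x. f x - g x"] by (simp add: cong_mod_def right_diff_distrib)

lemma cong_mod_mem: "cong_mod B f g \<Longrightarrow> f \<in> B \<longleftrightarrow> g \<in> B"
proof -
  have "g \<in> B" if "cong_mod B f g" "f \<in> B" for f g
    using additive_group_diff[OF B that(2) that(1)[unfolded cong_mod_def]] by simp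
  then show "cong_mod B f g \<Longrightarrow> f \<in> B \<longleftrightarrow> g \<in> B" using cong_mod_sym by blast
qed

lemma cong_mod_zero: "cong_mod B f (\<lambda>_. 0) \<longleftrightarrow> f \<in> B"
  by (simp add: cong_mod_def)

lemma cong_mod_sum:
  "finite I \<Longrightarrow> (\<And>i. i \<in> I \<Longrightarrow> cong_mod B (f i) (g i)) \<Longrightarrow>
     cong_mod B (\<lambda>x. \<Sum>i\<in>I. f i x) (\<lambda>x. \<Sum>i\<in>I. g i x)"
  by (induction I rule: finite_induct) (simp_all add: cong_mod_add)

context
  fixes Z :: "('x \<Rightarrow> int) set" and G :: "('g, 'm) monoid_scheme" and \<theta> :: "'g \<Rightarrow> 'x \<Rightarrow> int"
  assumes G: "comm_group G"
    and mult: "\<And>x y. x \<in> carrier G \<Longrightarrow> y \<in> carrier G \<Longrightarrow>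
        cong_mod B (\<theta> (x \<otimes>\<^bsub>G\<^esub> y)) (\<lambda>z. \<theta> x z + \<theta> y z)"
begin

interpretation G: comm_group G by (rule G)

lemma cong_mod_hom_one: "\<theta> \<one>\<^bsub>G\<^esub> \<in> B"
  using additive_group_uminus[OF B] mult[of "\<one>\<^bsub>G\<^esub>" "\<one>\<^bsub>G\<^esub>"] by (fastforce simp: cong_mod_def)

lemma cong_mod_hom_inv:
  assumes "x \<in> carrier G"
  shows "cong_mod B (\<theta> (inv\<^bsub>G\<^esub> x)) (\<lambda>z. - \<theta> x z)"
proof -
  have "cong_mod B (\<lambda>z. \<theta> x z + \<theta> (inv\<^bsub>G\<^esub> x) z) (\<lambda>_. 0)"
    using mult[of x "inv\<^bsub>G\<^esub> x"] assms cong_mod_hom_one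
    by (metis G.Units_r_inv G.inv_closed G.Units_eq cong_mod_sym cong_mod_trans cong_mod_zero)
  then show ?thesis by (simp add: cong_mod_def algebra_simps)
qed

lemma cong_mod_hom_int_pow:
  assumes x: "x \<in> carrier G"
  shows "cong_mod B (\<theta> (x [^]\<^bsub>G\<^esub> (k::int))) (\<lambda>z. k * \<theta> x z)"
proof (induction k rule: int_induct[where k = 0])
  case base
  then show ?case using cong_mod_hom_one by (simp add: cong_mod_zero)
next
  case (step1 i)
  have "x [^]\<^bsub>G\<^esub> (i + 1) = x [^]\<^bsub>G\<^esub> i \<otimes>\<^bsub>G\<^esub> x"
    using x by (metis G.int_pow_1 G.int_pow_mult)
  then have "cong_mod B (\<theta> (x [^]\<^bsub>G\<^esub> (i + 1))) (\<lambda>z. \<theta> (x [^]\<^bsub>G\<^esub> i) z + \<theta> x z)"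
    using mult x by simp
  also have "cong_mod B \<dots> (\<lambda>z. i * \<theta> x z + \<theta> x z)"
    by (rule cong_mod_add[OF step1(2) cong_mod_refl])
  finally show ?case by (simp add: distrib_right)
next
  case (step2 i)
  have "x [^]\<^bsub>G\<^esub> (i - 1) = x [^]\<^bsub>G\<^esub> i \<otimes>\<^bsub>G\<^esub> inv\<^bsub>G\<^esub> x"
    using x by (metis G.int_pow_1 G.int_pow_diff)
  then have "cong_mod B (\<theta> (x [^]\<^bsub>G\<^esub> (i - 1))) (\<lambda>z. \<theta> (x [^]\<^bsub>G\<^esub> i) z + \<theta> (inv\<^bsub>G\<^esub> x) z)"
    using mult x by simp
  also have "cong_mod B \<dots> (\<lambda>z. i * \<theta> x z + - \<theta> x z)"
    by (rule cong_mod_add[OF step2(2) cong_mod_hom_inv[OF x]])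
  finally show ?case by (simp add: left_diff_distrib)
qed

lemma cong_mod_hom_finprod:
  assumes "finite A" "\<And>a. a \<in> A \<Longrightarrow> x a \<in> carrier G"
  shows "cong_mod B (\<theta> (finprod G x A)) (\<lambda>z. \<Sum>a\<in>A. \<theta> (x a) z)"
  using assms
proof (induction A rule: finite_induct)
  case empty
  then show ?case using cong_mod_hom_one by (simp add: cong_mod_zero)
next
  case (insert a A)
  have "cong_mod B (\<theta> (finprod G x (insert a A))) (\<lambda>z. \<theta> (x a) z + \<theta> (finprod G x A) z)"
    using insert mult by (simp add: Pi_def)
  also have "cong_mod B \<dots> (\<lambda>z. \<theta> (x a) z + (\<Sum>a\<in>A. \<theta> (x a) z))"
    using insert by (intro cong_mod_add) auto
  finally show ?case using insert by simp
qed

lemma cong_mod_hom_lincomb: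
  assumes "finite A" "A \<subseteq> carrier G"
  shows "cong_mod B (\<theta> (finprod G (\<lambda>b. b [^]\<^bsub>G\<^esub> (m b::int)) A)) (\<lambda>z. \<Sum>a\<in>A. m a * \<theta> a z)"
proof -
  have "cong_mod B (\<theta> (finprod G (\<lambda>b. b [^]\<^bsub>G\<^esub> m b) A)) (\<lambda>z. \<Sum>a\<in>A. \<theta> (a [^]\<^bsub>G\<^esub> m a) z)"
    using assms by (intro cong_mod_hom_finprod) auto
  also have "cong_mod B \<dots> (\<lambda>z. \<Sum>a\<in>A. m a * \<theta> a z)"
    using assms by (intro cong_mod_sum cong_mod_hom_int_pow) auto
  finally show ?thesis .
qed

text \<open>The map \<open>\<theta>\<close> will select representatives of classes and is therefore
  additive only modulo \<open>B\<close>. Independent sets of \<open>G\<close> are enumerated into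
  families; in the other direction lifts of an independent family are automatically
  distinct.\<close>

lemma group_rank_eq_quotient_rank:
  assumes in_Z: "\<And>x. x \<in> carrier G \<Longrightarrow> \<theta> x \<in> Z"
    and surj: "\<And>f. f \<in> Z \<Longrightarrow> \<exists>x\<in>carrier G. cong_mod B (\<theta> x) f"
    and ker: "\<And>x. x \<in> carrier G \<Longrightarrow> \<theta> x \<in> B \<Longrightarrow> x = \<one>\<^bsub>G\<^esub>"
  shows "group_rank G = quotient_rank Z B"
proof (rule antisym)
  show "group_rank G \<le> quotient_rank Z B"
    unfolding group_rank_def
  proof (rule Sup_least, safe)
    fix A assume A: "independent_in G A"
    then have fin: "finite A" and sub: "A \<subseteq> carrier G" by (auto simp: independent_in_def)
    obtain e where e: "bij_betw e {..<card A} A"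
      using ex_bij_betw_nat_finite[OF fin] by (metis lessThan_atLeast0)
    define d where "d = the_inv_into {..<card A} e"
    have de: "d (e i) = i" if "i < card A" for i
      using e that by (auto simp: d_def bij_betw_def the_inv_into_f_f)
    have "independent_mod Z B (card A) (\<lambda>i. \<theta> (e i))"
      unfolding independent_mod_def
    proof safe
      fix i assume "i < card A"
      then show "\<theta> (e i) \<in> Z" using e sub in_Z by (meson bij_betwE lessThan_iff subsetD)
    next
      fix m i assume m: "lincomb (card A) m (\<lambda>i. \<theta> (e i)) \<in> B" and i: "i < card A"
      have "(\<Sum>a\<in>A. m (d a) * \<theta> a z) = lincomb (card A) m (\<lambda>i. \<theta> (e i)) z" for z
        unfolding lincomb_def
        by (rule sum.reindex_bij_betw[OF e, symmetric, THEN trans]) (simp add: de)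
      then have "\<theta> (finprod G (\<lambda>b. b [^]\<^bsub>G\<^esub> m (d b)) A) \<in> B"
        using cong_mod_mem[OF cong_mod_hom_lincomb[OF fin sub]] m by simp
      moreover have "finprod G (\<lambda>b. b [^]\<^bsub>G\<^esub> m (d b)) A \<in> carrier G"
        using sub by (intro G.finprod_closed) auto
      ultimately have "finprod G (\<lambda>b. b [^]\<^bsub>G\<^esub> m (d b)) A = \<one>\<^bsub>G\<^esub>" using ker by blast
      moreover have "finprod G (\<lambda>b. b [^]\<^bsub>G\<^esub> (\<lambda>b. m (d b)) b) A = \<one>\<^bsub>G\<^esub> \<longrightarrow> (\<forall>b\<in>A. (\<lambda>b. m (d b)) b = 0)"
        using A unfolding independent_in_def by (elim conjE allE[of _ "\<lambda>b. m (d b)"])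
      moreover have "e i \<in> A" using e i by (meson bij_betwE lessThan_iff)
      ultimately have "m (d (e i)) = 0" by blast
      then show "m i = 0" using de i by simp
    qed
    then show "enat (card A) \<le> quotient_rank Z B" by (rule quotient_rank_ge)
  qed
next
  show "quotient_rank Z B \<le> group_rank G"
  proof (rule quotient_rank_le)
    fix n v assume v: "independent_mod Z B n v"
    have vi: "lincomb n m v \<in> B \<Longrightarrow> i < n \<Longrightarrow> m i = 0" for m i
      using v by (simp add: independent_mod_def)
    have "\<forall>i\<in>{..<n}. \<exists>x. x \<in> carrier G \<and> cong_mod B (\<theta> x) (v i)"
    proof
      fix i assume "i \<in> {..<n}"
      then have "v i \<in> Z" using v by (simp add: independent_mod_def)
      from surj[OF this] show "\<exists>x. x \<in> carrier G \<and> cong_mod B (\<theta> x) (v i)" by blast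
    qed
    from bchoice[OF this] obtain x where
      x: "\<And>i. i < n \<Longrightarrow> x i \<in> carrier G" "\<And>i. i < n \<Longrightarrow> cong_mod B (\<theta> (x i)) (v i)"
      by auto
    have inj: "inj_on x {..<n}"
    proof (rule inj_onI, rule ccontr)
      fix i j assume ij: "i \<in> {..<n}" "j \<in> {..<n}" "x i = x j" "i \<noteq> j"
      \<comment> \<open>The resulting combination is \<open>v i - v j\<close>; it would lie in
        \<open>B\<close> if the two lifts coincided.\<close>
      let ?m = "\<lambda>k. (if k = i then 1 else 0) - (if k = j then 1 else 0 :: int)"
      have "lincomb n ?m v = (\<lambda>z. v i z - v j z)"
        using ij by (simp add: lincomb_def left_diff_distrib sum_subtractf if_distrib[of "\<lambda>x. x * _"] cong: if_cong)
      moreover have "cong_mod B (v i) (v j)"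
        using x(2)[of i] x(2)[of j] ij by (metis cong_mod_sym cong_mod_trans lessThan_iff)
      ultimately have "lincomb n ?m v \<in> B" by (simp add: cong_mod_def)
      from vi[OF this, of i] show False using ij by simp
    qed
    have "independent_in G (x ` {..<n})"
      unfolding independent_in_def
    proof (intro conjI allI impI)
      fix m assume m: "finprod G (\<lambda>b. b [^]\<^bsub>G\<^esub> (m b::int)) (x ` {..<n}) = \<one>\<^bsub>G\<^esub>"
      have "(\<lambda>z. \<Sum>a\<in>x ` {..<n}. m a * \<theta> a z) \<in> B"
        using cong_mod_mem[OF cong_mod_hom_lincomb, of "x ` {..<n}" m] cong_mod_hom_one x(1) m by fastforce
      moreover have "(\<lambda>z. \<Sum>a\<in>x ` {..<n}. m a * \<theta> a z) = (\<lambda>z. \<Sum>i<n. m (x i) * \<theta> (x i) z)"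
        by (simp add: sum.reindex[OF inj])
      moreover have "cong_mod B (\<lambda>z. \<Sum>i<n. m (x i) * \<theta> (x i) z) (\<lambda>z. \<Sum>i<n. m (x i) * v i z)"
        using x(2) by (intro cong_mod_sum cong_mod_scale) auto
      ultimately have "lincomb n (\<lambda>i. m (x i)) v \<in> B"
        unfolding lincomb_def by (simp only: cong_mod_mem[symmetric])
      from vi[OF this] show "\<forall>b\<in>x ` {..<n}. m b = 0" by auto
    qed (use x in auto)
    moreover have "card (x ` {..<n}) = n" using card_image[OF inj] by simp
    ultimately show "enat n \<le> group_rank G"
      unfolding group_rank_def by (intro Sup_upper) force
  qed
qed

end

end

section \<open>From the direct sum to the direct limit\<close>

lemma sum_incl_in_carrier:
  assumes "\<And>i. i \<in> I \<Longrightarrow> group (G i)" "i \<in> I" "x \<in> carrier (G i)"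
  shows "sum_incl I G i x \<in> carrier (sum_group I G)"
proof -
  have "finite {j \<in> I. sum_incl I G i x j \<noteq> \<one>\<^bsub>G j\<^esub>}"
    by (rule finite_subset[of _ "{i}"]) (auto simp: sum_incl_def)
  moreover have "sum_incl I G i x j \<in> carrier (G j)" if "j \<in> I" for j
    using assms(1)[OF that] that assms(3) by (auto simp: sum_incl_def group.is_monoid monoid.one_closed)
  ultimately show ?thesis
    using assms(1) by (auto simp: carrier_sum_group PiE_iff sum_incl_def)
qed

lemma comm_group_sum_group:
  assumes "\<And>i. i \<in> I \<Longrightarrow> comm_group (G i)"
  shows "comm_group (sum_group I G)"
proof -
  have grp: "group (G i)" if "i \<in> I" for i
    using assms[OF that] by (simp add: comm_group_def)
  interpret S: group "sum_group I G"
    by (intro sum_group grp)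
  show ?thesis
    by (intro S.group_comm_groupI)
       (auto simp: carrier_sum_group grp PiE_iff
         intro!: restrict_ext comm_monoid.m_comm comm_group.axioms(1) assms)
qed

text \<open>The maps \<open>\<theta> i\<close> form a compatible cone which is onto and whose kernel
  at each stage dies at another one. Directedness is used to represent every element of the limit at
  a single index.\<close>

theorem group_rank_direct_limit:
  fixes \<theta> :: "'i \<Rightarrow> 'g \<Rightarrow> 'x \<Rightarrow> int"
  assumes B: "additive_group B" and Z: "additive_group Z"
    and I: "I \<noteq> {}"
    and G: "\<And>i. i \<in> I \<Longrightarrow> comm_group (G i)"
    and F: "\<And>i j f. i \<in> I \<Longrightarrow> j \<in> I \<Longrightarrow> f \<in> F i j \<Longrightarrow> f \<in> hom (G i) (G j)"
    and directed: "\<And>i j. i \<in> I \<Longrightarrow> j \<in> I \<Longrightarrow> \<exists>k\<in>I. F i k \<noteq> {} \<and> F j k \<noteq> {}"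
    and in_Z: "\<And>i x. i \<in> I \<Longrightarrow> x \<in> carrier (G i) \<Longrightarrow> \<theta> i x \<in> Z"
    and mult: "\<And>i x y. i \<in> I \<Longrightarrow> x \<in> carrier (G i) \<Longrightarrow> y \<in> carrier (G i) \<Longrightarrow>
        cong_mod B (\<theta> i (x \<otimes>\<^bsub>G i\<^esub> y)) (\<lambda>z. \<theta> i x z + \<theta> i y z)"
    and compat: "\<And>i j f x. i \<in> I \<Longrightarrow> j \<in> I \<Longrightarrow> f \<in> F i j \<Longrightarrow> x \<in> carrier (G i) \<Longrightarrow>
        cong_mod B (\<theta> j (f x)) (\<theta> i x)"
    and surj: "\<And>c. c \<in> Z \<Longrightarrow> \<exists>i\<in>I. \<exists>x\<in>carrier (G i). cong_mod B (\<theta> i x) c"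
    and ker: "\<And>i x. i \<in> I \<Longrightarrow> x \<in> carrier (G i) \<Longrightarrow> \<theta> i x \<in> B \<Longrightarrow>
        \<exists>j\<in>I. \<exists>f\<in>F i j. f x = \<one>\<^bsub>G j\<^esub>"
  shows "group_rank (direct_limit I G F) = quotient_rank Z B"
proof -
  note [trans] = cong_mod_trans[OF B]
  let ?S = "sum_group I G"
  have grp: "group (G i)" if "i \<in> I" for i
    using G[OF that] by (simp add: comm_group_def)
  interpret S: comm_group ?S by (rule comm_group_sum_group[OF G])
  define N where "N = generate ?S (limit_relations I G F)"
  \<comment> \<open>With value exactly zero at the unit, the sum over the support does not change
    when it is taken over a larger finite index set.\<close>
  define \<theta>' where "\<theta>' i x = (if x = \<one>\<^bsub>G i\<^esub> then (\<lambda>_. 0) else \<theta> i x)" for i x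
  define \<Theta> where "\<Theta> \<xi> = (\<lambda>z. \<Sum>i\<in>{i \<in> I. \<xi> i \<noteq> \<one>\<^bsub>G i\<^esub>}. \<theta>' i (\<xi> i) z)" for \<xi>
  have \<theta>'1: "\<theta>' i \<one>\<^bsub>G i\<^esub> = (\<lambda>_. 0)" for i by (simp add: \<theta>'_def)
  have \<theta>': "cong_mod B (\<theta>' i x) (\<theta> i x)" if "i \<in> I" for i x
    using cong_mod_hom_one[OF B G[OF that] mult[OF that]] cong_mod_sym[OF B]
    by (auto simp: \<theta>'_def cong_mod_zero[OF B] cong_mod_refl[OF B])
  have \<theta>'Z: "\<theta>' i x \<in> Z" if "i \<in> I" "x \<in> carrier (G i)" for i x
    using in_Z[OF that] additive_group_zero[OF Z] by (simp add: \<theta>'_def)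
  have mult': "cong_mod B (\<theta>' i (x \<otimes>\<^bsub>G i\<^esub> y)) (\<lambda>z. \<theta>' i x z + \<theta>' i y z)"
    if i: "i \<in> I" and "x \<in> carrier (G i)" "y \<in> carrier (G i)" for i x y
  proof -
    have "cong_mod B (\<theta>' i (x \<otimes>\<^bsub>G i\<^esub> y)) (\<theta> i (x \<otimes>\<^bsub>G i\<^esub> y))" by (rule \<theta>'[OF i])
    also have "cong_mod B \<dots> (\<lambda>z. \<theta> i x z + \<theta> i y z)" by (rule mult[OF that])
    also have "cong_mod B (\<lambda>z. \<theta> i x z + \<theta> i y z) (\<lambda>z. \<theta>' i x z + \<theta>' i y z)"
      by (intro cong_mod_add[OF B] cong_mod_sym[OF B \<theta>'[OF i]])
    finally show ?thesis .
  qed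
  have \<Theta>_eq: "\<Theta> \<xi> z = (\<Sum>i\<in>J. \<theta>' i (\<xi> i) z)"
    if "finite J" "J \<subseteq> I" "{i \<in> I. \<xi> i \<noteq> \<one>\<^bsub>G i\<^esub>} \<subseteq> J" for \<xi> J z
    unfolding \<Theta>_def using that \<theta>'1 by (intro sum.mono_neutral_left) auto
  have carr: "\<xi> i \<in> carrier (G i)" "finite {i \<in> I. \<xi> i \<noteq> \<one>\<^bsub>G i\<^esub>}"
    if "\<xi> \<in> carrier ?S" "i \<in> I" for \<xi> i
    using that by (auto simp: carrier_sum_group grp)
  have fin: "finite {i \<in> I. \<xi> i \<noteq> \<one>\<^bsub>G i\<^esub>}" if "\<xi> \<in> carrier ?S" for \<xi>
    using carr(2)[OF that] I by blast
  have \<Theta>Z: "\<Theta> \<xi> \<in> Z" if "\<xi> \<in> carrier ?S" for \<xi>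
    unfolding \<Theta>_def using fin[OF that] carr(1)[OF that] \<theta>'Z by (intro additive_group_sum[OF Z]) auto
  have \<Theta>_mult: "cong_mod B (\<Theta> (\<xi> \<otimes>\<^bsub>?S\<^esub> \<eta>)) (\<lambda>z. \<Theta> \<xi> z + \<Theta> \<eta> z)"
    if \<xi>: "\<xi> \<in> carrier ?S" and \<eta>: "\<eta> \<in> carrier ?S" for \<xi> \<eta>
  proof -
    let ?J = "{i \<in> I. \<xi> i \<noteq> \<one>\<^bsub>G i\<^esub>} \<union> {i \<in> I. \<eta> i \<noteq> \<one>\<^bsub>G i\<^esub>}"
    have J: "finite ?J" "?J \<subseteq> I" using fin \<xi> \<eta> by auto
    have "{i \<in> I. (\<xi> \<otimes>\<^bsub>?S\<^esub> \<eta>) i \<noteq> \<one>\<^bsub>G i\<^esub>} \<subseteq> ?J"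
      using grp by (auto simp: group.is_monoid)
    then have 1: "\<Theta> (\<xi> \<otimes>\<^bsub>?S\<^esub> \<eta>) z = (\<Sum>i\<in>?J. \<theta>' i ((\<xi> \<otimes>\<^bsub>?S\<^esub> \<eta>) i) z)" for z
      by (rule \<Theta>_eq[OF J])
    have "\<Theta> (\<xi> \<otimes>\<^bsub>?S\<^esub> \<eta>) = (\<lambda>z. \<Sum>i\<in>?J. \<theta>' i (\<xi> i \<otimes>\<^bsub>G i\<^esub> \<eta> i) z)"
      unfolding 1 by (intro ext sum.cong refl) auto
    moreover have "(\<lambda>z. \<Sum>i\<in>?J. \<theta>' i (\<xi> i) z + \<theta>' i (\<eta> i) z) = (\<lambda>z. \<Theta> \<xi> z + \<Theta> \<eta> z)"
      by (simp add: sum.distrib \<Theta>_eq[OF J])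
    moreover have "cong_mod B (\<lambda>z. \<Sum>i\<in>?J. \<theta>' i (\<xi> i \<otimes>\<^bsub>G i\<^esub> \<eta> i) z)
        (\<lambda>z. \<Sum>i\<in>?J. \<theta>' i (\<xi> i) z + \<theta>' i (\<eta> i) z)"
      using J(2) \<xi> \<eta> by (intro cong_mod_sum[OF B J(1)] mult' carr) auto
    ultimately show ?thesis by (simp only:)
  qed
  have incl: "sum_incl I G i x \<in> carrier ?S" if "i \<in> I" "x \<in> carrier (G i)" for i x
    by (rule sum_incl_in_carrier) (use grp that in auto)
  have \<Theta>_incl: "\<Theta> (sum_incl I G i x) = \<theta>' i x" if "i \<in> I" for i x
  proof
    fix z
    have "{j \<in> I. sum_incl I G i x j \<noteq> \<one>\<^bsub>G j\<^esub>} \<subseteq> {i}" by (auto simp: sum_incl_def)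
    then have "\<Theta> (sum_incl I G i x) z = (\<Sum>j\<in>{i}. \<theta>' j (sum_incl I G i x j) z)"
      using that by (intro \<Theta>_eq) auto
    then show "\<Theta> (sum_incl I G i x) z = \<theta>' i x z" using that by (simp add: sum_incl_def)
  qed
  have Fx: "f x \<in> carrier (G j)" if "i \<in> I" "j \<in> I" "f \<in> F i j" "x \<in> carrier (G i)" for i j f x
    using F[OF that(1-3)] that(4) by (auto simp: hom_def)
  have rel_carr: "limit_relations I G F \<subseteq> carrier ?S"
    unfolding limit_relations_def using incl Fx by (blast intro: S.m_closed S.inv_closed)
  have \<Theta>_inv: "cong_mod B (\<Theta> (inv\<^bsub>?S\<^esub> \<xi>)) (\<lambda>z. - \<Theta> \<xi> z)" if "\<xi> \<in> carrier ?S" for \<xi>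
    by (rule cong_mod_hom_inv[where \<theta> = \<Theta>, OF B S.comm_group_axioms \<Theta>_mult that])
  have \<Theta>_rel: "\<Theta> \<xi> \<in> B" if \<xi>_rel: "\<xi> \<in> limit_relations I G F" for \<xi>
  proof -
    obtain i j f x where \<xi>: "\<xi> = sum_incl I G j (f x) \<otimes>\<^bsub>?S\<^esub> inv\<^bsub>?S\<^esub> (sum_incl I G i x)"
      and *: "i \<in> I" "j \<in> I" "f \<in> F i j" "x \<in> carrier (G i)"
      using \<xi>_rel unfolding limit_relations_def mem_Collect_eq by (elim exE conjE) (rule that)
    have "cong_mod B (\<Theta> \<xi>) (\<lambda>z. \<Theta> (sum_incl I G j (f x)) z + \<Theta> (inv\<^bsub>?S\<^esub> (sum_incl I G i x)) z)"
      unfolding \<xi> using incl * Fx[OF *] by (intro \<Theta>_mult S.inv_closed) auto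
    also have "cong_mod B \<dots> (\<lambda>z. \<theta>' i x z + - \<theta>' i x z)"
    proof (rule cong_mod_add[OF B])
      have "cong_mod B (\<theta>' j (f x)) (\<theta> j (f x))" using \<theta>' * by simp
      also have "cong_mod B (\<theta> j (f x)) (\<theta> i x)" using compat * by simp
      also have "cong_mod B (\<theta> i x) (\<theta>' i x)" using \<theta>' * cong_mod_sym[OF B] by simp
      finally show "cong_mod B (\<Theta> (sum_incl I G j (f x))) (\<theta>' i x)"
        using \<Theta>_incl * by simp
      show "cong_mod B (\<Theta> (inv\<^bsub>?S\<^esub> (sum_incl I G i x))) (\<lambda>z. - \<theta>' i x z)"
        using \<Theta>_inv[OF incl] * \<Theta>_incl by simp
    qed
    finally show ?thesis by (simp add: cong_mod_zero[OF B])
  qed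
  have N: "subgroup N ?S" unfolding N_def by (rule S.generate_is_subgroup[OF rel_carr])
  interpret N: normal N ?S using S.subgroup_imp_normal[OF N] .
  have \<Theta>_N: "\<Theta> \<xi> \<in> B" if "\<xi> \<in> N" for \<xi>
    using that unfolding N_def
  proof (induction rule: generate.induct)
    case one
    show ?case by (rule cong_mod_hom_one[where \<theta> = \<Theta>, OF B S.comm_group_axioms \<Theta>_mult])
  next
    case (incl h)
    then show ?case by (rule \<Theta>_rel)
  next
    case (inv h)
    then have "(\<lambda>z. - \<Theta> h z) \<in> B" using \<Theta>_rel additive_group_uminus[OF B] by blast
    then show ?case using cong_mod_mem[OF B \<Theta>_inv] inv rel_carr by blast
  next
    case (eng h1 h2)
    then have "h1 \<in> carrier ?S" "h2 \<in> carrier ?S"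
      using N.subset unfolding N_def by auto
    moreover have "(\<lambda>z. \<Theta> h1 z + \<Theta> h2 z) \<in> B" using eng additive_group_add[OF B] by blast
    ultimately show ?case using cong_mod_mem[OF B \<Theta>_mult] by blast
  qed
  have rel: "N #>\<^bsub>?S\<^esub> sum_incl I G j (f x) = N #>\<^bsub>?S\<^esub> sum_incl I G i x"
    if "i \<in> I" "j \<in> I" "f \<in> F i j" "x \<in> carrier (G i)" for i j f x
  proof -
    let ?a = "sum_incl I G j (f x)" and ?b = "sum_incl I G i x"
    have "?a \<otimes>\<^bsub>?S\<^esub> inv\<^bsub>?S\<^esub> ?b \<in> limit_relations I G F"
      using that unfolding limit_relations_def by blast
    then have "?a \<otimes>\<^bsub>?S\<^esub> inv\<^bsub>?S\<^esub> ?b \<in> N" unfolding N_def by (rule generate.incl)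
    moreover note a = incl[OF that(2) Fx[OF that]] and b = incl[OF that(1,4)]
    ultimately have "N #>\<^bsub>?S\<^esub> (?a \<otimes>\<^bsub>?S\<^esub> inv\<^bsub>?S\<^esub> ?b) = N"
      using S.coset_join2 N by blast
    then have "N #>\<^bsub>?S\<^esub> ((?a \<otimes>\<^bsub>?S\<^esub> inv\<^bsub>?S\<^esub> ?b) \<otimes>\<^bsub>?S\<^esub> ?b) = N #>\<^bsub>?S\<^esub> ?b"
      using S.coset_mult_assoc[OF N.subset S.m_closed[OF a S.inv_closed[OF b]] b] by metis
    moreover have "(?a \<otimes>\<^bsub>?S\<^esub> inv\<^bsub>?S\<^esub> ?b) \<otimes>\<^bsub>?S\<^esub> ?b = ?a"
      using S.inv_solve_right'[OF _ a b] a b S.m_closed S.inv_closed by metis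
    ultimately show ?thesis by metis
  qed
  have incl_mult: "sum_incl I G i (x \<otimes>\<^bsub>G i\<^esub> y) = sum_incl I G i x \<otimes>\<^bsub>?S\<^esub> sum_incl I G i y" if "i \<in> I" for i x y
    using grp by (auto simp: sum_incl_def group.is_monoid fun_eq_iff)
  have incl_one: "sum_incl I G i \<one>\<^bsub>G i\<^esub> = \<one>\<^bsub>?S\<^esub>" for i
    by (auto simp: sum_incl_def)
  \<comment> \<open>Induction on the support: the component at \<open>j\<close> is split off, and
    both parts are moved to a common index \<open>l\<close>, where they can be multiplied.\<close>
  have single: "\<exists>k\<in>I. \<exists>x\<in>carrier (G k). N #>\<^bsub>?S\<^esub> \<xi> = N #>\<^bsub>?S\<^esub> sum_incl I G k x"
    if "finite J" "\<xi> \<in> carrier ?S" "{i \<in> I. \<xi> i \<noteq> \<one>\<^bsub>G i\<^esub>} \<subseteq> J" for \<xi> J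
    using that
  proof (induction J arbitrary: \<xi> rule: finite_induct)
    case empty
    obtain k where k: "k \<in> I" using I by blast
    have "\<xi> = \<one>\<^bsub>?S\<^esub>"
      using empty by (auto simp: fun_eq_iff carrier_sum_group grp PiE_iff extensional_def)
    then show ?case
      using incl_one[of k] k group.is_monoid[OF grp[OF k]] by (metis monoid.one_closed)
  next
    case (insert j J)
    show ?case
    proof (cases "j \<in> I")
      case False
      then show ?thesis using insert by (intro insert.IH) auto
    next
      case True
      define \<eta> where "\<eta> = \<xi>(j := \<one>\<^bsub>G j\<^esub>)"
      have sub: "{i \<in> I. \<eta> i \<noteq> \<one>\<^bsub>G i\<^esub>} \<subseteq> {i \<in> I. \<xi> i \<noteq> \<one>\<^bsub>G i\<^esub>} - {j}"
        by (auto simp: \<eta>_def)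
      have \<eta>: "\<eta> \<in> carrier ?S"
        using insert.prems(1) True finite_subset[OF sub] group.is_monoid[OF grp[OF True]]
        by (auto simp: carrier_sum_group grp PiE_iff extensional_def \<eta>_def monoid.one_closed)
      have y: "\<xi> j \<in> carrier (G j)" using carr(1)[OF insert.prems(1) True] .
      have eq: "\<xi> = \<eta> \<otimes>\<^bsub>?S\<^esub> sum_incl I G j (\<xi> j)"
        using insert.prems(1) grp y
        by (auto simp: fun_eq_iff carrier_sum_group PiE_iff extensional_def \<eta>_def sum_incl_def
            group.is_monoid monoid.l_one monoid.r_one)
      obtain k x where k: "k \<in> I" "x \<in> carrier (G k)" "N #>\<^bsub>?S\<^esub> \<eta> = N #>\<^bsub>?S\<^esub> sum_incl I G k x"
        using insert.IH[OF \<eta>] sub insert.prems(2) by blast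
      obtain l f g where l: "l \<in> I" and f: "f \<in> F k l" and g: "g \<in> F j l"
        using directed[OF k(1) True] by blast
      have "N #>\<^bsub>?S\<^esub> \<xi> = (N #>\<^bsub>?S\<^esub> \<eta>) <#>\<^bsub>?S\<^esub> (N #>\<^bsub>?S\<^esub> sum_incl I G j (\<xi> j))"
        using N.rcos_sum[OF \<eta> incl[OF True y]] eq by metis
      also have "\<dots> = (N #>\<^bsub>?S\<^esub> sum_incl I G l (f x)) <#>\<^bsub>?S\<^esub> (N #>\<^bsub>?S\<^esub> sum_incl I G l (g (\<xi> j)))"
        using rel[OF k(1) l f k(2)] rel[OF True l g y] k(3) by metis
      also have "\<dots> = N #>\<^bsub>?S\<^esub> sum_incl I G l (f x \<otimes>\<^bsub>G l\<^esub> g (\<xi> j))"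
        using N.rcos_sum[OF incl[OF l Fx[OF k(1) l f k(2)]] incl[OF l Fx[OF True l g y]]] incl_mult[OF l] by metis
      finally show ?thesis
        using l monoid.m_closed[OF group.is_monoid[OF grp[OF l]] Fx[OF k(1) l f k(2)] Fx[OF True l g y]] by blast
    qed
  qed
  define D where "D = ?S Mod N"
  have D: "comm_group D" unfolding D_def by (rule S.abelian_FactGroup[OF N])
  have D_carr: "d \<in> carrier D \<longleftrightarrow> (\<exists>\<xi>\<in>carrier ?S. d = N #>\<^bsub>?S\<^esub> \<xi>)" for d
    by (auto simp: D_def FactGroup_def RCOSETS_def)
  \<comment> \<open>The representative of the coset is arbitrary; another one changes the value by
    an element of \<open>B\<close> because \<open>\<Theta>\<close> maps \<open>N\<close> into
    \<open>B\<close>.\<close>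
  define \<theta>D where "\<theta>D d = \<Theta> (SOME \<xi>. \<xi> \<in> carrier ?S \<and> d = N #>\<^bsub>?S\<^esub> \<xi>)" for d
  have \<theta>D: "cong_mod B (\<theta>D (N #>\<^bsub>?S\<^esub> \<xi>)) (\<Theta> \<xi>)" and \<theta>D_Z: "\<theta>D (N #>\<^bsub>?S\<^esub> \<xi>) \<in> Z"
    if \<xi>: "\<xi> \<in> carrier ?S" for \<xi>
  proof -
    define \<eta> where "\<eta> = (SOME \<eta>. \<eta> \<in> carrier ?S \<and> N #>\<^bsub>?S\<^esub> \<xi> = N #>\<^bsub>?S\<^esub> \<eta>)"
    have "\<eta> \<in> carrier ?S \<and> N #>\<^bsub>?S\<^esub> \<xi> = N #>\<^bsub>?S\<^esub> \<eta>"
      unfolding \<eta>_def by (rule someI[of _ \<xi>]) (use \<xi> in auto)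
    then have \<eta>: "\<eta> \<in> carrier ?S" "N #>\<^bsub>?S\<^esub> \<xi> = N #>\<^bsub>?S\<^esub> \<eta>" by auto
    have eq: "\<theta>D (N #>\<^bsub>?S\<^esub> \<xi>) = \<Theta> \<eta>" by (simp add: \<theta>D_def \<eta>_def)
    have "\<xi> \<in> N #>\<^bsub>?S\<^esub> \<eta>" using S.rcos_self[OF \<xi> N] \<eta>(2) by metis
    then obtain n where n: "n \<in> N" "\<xi> = n \<otimes>\<^bsub>?S\<^esub> \<eta>" unfolding r_coset_def by blast
    have "cong_mod B (\<Theta> \<xi>) (\<lambda>z. \<Theta> n z + \<Theta> \<eta> z)"
      unfolding n(2) using n(1) N.subset \<eta>(1) by (intro \<Theta>_mult) auto
    also have "cong_mod B \<dots> (\<lambda>z. 0 + \<Theta> \<eta> z)"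
      using \<Theta>_N[OF n(1)] by (intro cong_mod_add[OF B] cong_mod_refl[OF B]) (simp add: cong_mod_zero[OF B])
    finally have "cong_mod B (\<Theta> \<xi>) (\<Theta> \<eta>)" by simp
    then show "cong_mod B (\<theta>D (N #>\<^bsub>?S\<^esub> \<xi>)) (\<Theta> \<xi>)" unfolding eq by (rule cong_mod_sym[OF B])
    show "\<theta>D (N #>\<^bsub>?S\<^esub> \<xi>) \<in> Z" unfolding eq by (rule \<Theta>Z[OF \<eta>(1)])
  qed
  have "group_rank D = quotient_rank Z B"
  proof (rule group_rank_eq_quotient_rank[where \<theta> = \<theta>D, OF B D])
    fix d e assume "d \<in> carrier D" "e \<in> carrier D"
    then obtain \<xi> \<eta> where \<xi>: "\<xi> \<in> carrier ?S" "d = N #>\<^bsub>?S\<^esub> \<xi>" and \<eta>: "\<eta> \<in> carrier ?S" "e = N #>\<^bsub>?S\<^esub> \<eta>"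
      unfolding D_carr by blast
    have "d \<otimes>\<^bsub>D\<^esub> e = N #>\<^bsub>?S\<^esub> (\<xi> \<otimes>\<^bsub>?S\<^esub> \<eta>)"
      unfolding D_def mult_FactGroup \<xi>(2) \<eta>(2) by (rule N.rcos_sum[OF \<xi>(1) \<eta>(1)])
    then have "cong_mod B (\<theta>D (d \<otimes>\<^bsub>D\<^esub> e)) (\<Theta> (\<xi> \<otimes>\<^bsub>?S\<^esub> \<eta>))"
      using \<theta>D[OF S.m_closed[OF \<xi>(1) \<eta>(1)]] by metis
    also have "cong_mod B \<dots> (\<lambda>z. \<Theta> \<xi> z + \<Theta> \<eta> z)" by (rule \<Theta>_mult[OF \<xi>(1) \<eta>(1)])
    also have "cong_mod B \<dots> (\<lambda>z. \<theta>D d z + \<theta>D e z)"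
      unfolding \<xi>(2) \<eta>(2) by (rule cong_mod_add[OF B cong_mod_sym[OF B \<theta>D[OF \<xi>(1)]] cong_mod_sym[OF B \<theta>D[OF \<eta>(1)]]])
    finally show "cong_mod B (\<theta>D (d \<otimes>\<^bsub>D\<^esub> e)) (\<lambda>z. \<theta>D d z + \<theta>D e z)" .
  next
    fix d assume "d \<in> carrier D"
    then show "\<theta>D d \<in> Z" unfolding D_carr using \<theta>D_Z by blast
  next
    fix c assume "c \<in> Z"
    then obtain i x where x: "i \<in> I" "x \<in> carrier (G i)" "cong_mod B (\<theta> i x) c" using surj by metis
    have "cong_mod B (\<theta>D (N #>\<^bsub>?S\<^esub> sum_incl I G i x)) (\<Theta> (sum_incl I G i x))"
      by (rule \<theta>D[OF incl[OF x(1,2)]])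
    also have "cong_mod B (\<Theta> (sum_incl I G i x)) (\<theta> i x)" using \<Theta>_incl \<theta>' x by simp
    also note x(3)
    finally show "\<exists>d\<in>carrier D. cong_mod B (\<theta>D d) c"
      using incl[OF x(1,2)] D_carr by blast
  next
    fix d assume d: "d \<in> carrier D" "\<theta>D d \<in> B"
    then obtain \<xi> where \<xi>: "\<xi> \<in> carrier ?S" "d = N #>\<^bsub>?S\<^esub> \<xi>" unfolding D_carr by blast
    obtain k x where k: "k \<in> I" "x \<in> carrier (G k)" "d = N #>\<^bsub>?S\<^esub> sum_incl I G k x"
      using single[OF fin[OF \<xi>(1)] \<xi>(1) subset_refl] \<xi>(2) by metis
    have "cong_mod B (\<theta>D d) (\<Theta> (sum_incl I G k x))"
      unfolding k(3) by (rule \<theta>D[OF incl[OF k(1,2)]])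
    also have "cong_mod B (\<Theta> (sum_incl I G k x)) (\<theta> k x)" using \<Theta>_incl \<theta>' k by simp
    finally have "\<theta> k x \<in> B" using d(2) cong_mod_mem[OF B] by blast
    then obtain j f where j: "j \<in> I" "f \<in> F k j" "f x = \<one>\<^bsub>G j\<^esub>" using ker[OF k(1,2)] by blast
    have "d = N #>\<^bsub>?S\<^esub> \<one>\<^bsub>?S\<^esub>"
      using rel[OF k(1) j(1,2) k(2)] j(3) k(3) incl_one by metis
    then show "d = \<one>\<^bsub>D\<^esub>"
      using S.coset_join2[OF S.one_closed N N.one_closed] by (simp add: D_def one_FactGroup del: one_sum_group)
  qed
  then show ?thesis by (simp add: D_def direct_limit_def N_def)
qed

section \<open>Cech cohomology of compact Hausdorff spaces\<close>

lemma cobd_eq_sum: "cobd c us = (\<Sum>i<length us. (- 1) ^ i * c (face i us))"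
proof (induction us arbitrary: c)
  case (Cons u us)
  have "(\<Sum>i<length (u # us). (- 1) ^ i * c (face i (u # us))) =
      c (face 0 (u # us)) + (\<Sum>i<length us. (- 1) ^ Suc i * c (face (Suc i) (u # us)))"
    unfolding list.size(4) add_Suc_right add_0_right by (subst sum.lessThan_Suc_shift) simp
  also have "\<dots> = c us - (\<Sum>i<length us. (- 1) ^ i * c (u # face i us))"
    by (simp add: face_def sum_negf)
  finally show ?case by (simp add: Cons.IH)
qed simp

lemma coboundary_eq_cobd:
  "us \<in> nerve_simplices (Suc p) \<U> \<Longrightarrow> coboundary p \<U> c us = cobd c us"
  by (simp add: coboundary_def cobd_eq_sum nerve_simplices_def lessThan_Suc_atMost del: sum.atMost_Suc sum.lessThan_Suc)

text \<open>The empty set is listed separately because the empty family covers the empty space. As a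
  null set it suppresses the augmentation.\<close>

definition cover_scale :: "'a set \<Rightarrow> 'a set set \<Rightarrow> 'a scale" where
  "cover_scale A W = ({\<sigma>. \<sigma> = {} \<or> (\<exists>w\<in>W. \<sigma> \<subseteq> w)}, {\<sigma>. \<sigma> = {} \<or> \<sigma> \<subseteq> A \<and> (\<exists>w\<in>W. \<sigma> \<subseteq> w)})"

definition cover_system :: "'a topology \<Rightarrow> 'a set \<Rightarrow> 'a scale set" where
  "cover_system X A = cover_scale A ` open_covers X"

text \<open>The vertices are the members of the cover. The clause for the empty set keeps it null
  when \<open>A\<close> is empty, so that absolute nerve cohomology is not augmented.\<close>

definition nerve_scale :: "'a set \<Rightarrow> 'a set set \<Rightarrow> 'a set scale" where
  "nerve_scale A \<U> = ({\<sigma>. \<sigma> \<subseteq> \<U> \<and> (\<sigma> = {} \<or> \<Inter>\<sigma> \<noteq> {})}, {\<sigma>. \<sigma> \<subseteq> \<U> \<and> (\<sigma> = {} \<or> A \<inter> \<Inter>\<sigma> \<noteq> {})})"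

lemma open_covers_refine:
  assumes "V \<in> open_covers X" "W \<in> open_covers X"
  obtains U where "U \<in> open_covers X" "\<And>u. u \<in> U \<Longrightarrow> \<exists>v\<in>V. u \<subseteq> v" "\<And>u. u \<in> U \<Longrightarrow> \<exists>w\<in>W. u \<subseteq> w"
proof (rule that[of "{v \<inter> w | v w. v \<in> V \<and> w \<in> W}"])
  show "{v \<inter> w | v w. v \<in> V \<and> w \<in> W} \<in> open_covers X"
  proof -
    have "\<Union>{v \<inter> w | v w. v \<in> V \<and> w \<in> W} = \<Union>V \<inter> \<Union>W" by blast
    then show ?thesis using assms unfolding open_covers_def by auto
  qed
qed auto

lemma scale_system_cover_system: "scale_system (cover_system X A)"
  unfolding scale_system_def
proof (intro conjI ballI)
  have "{topspace X} \<in> open_covers X" by (auto simp: open_covers_def)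
  then show "cover_system X A \<noteq> {}" by (auto simp: cover_system_def)
next
  fix p q assume "p \<in> cover_system X A" "q \<in> cover_system X A"
  then obtain V W where VW: "V \<in> open_covers X" "p = cover_scale A V" "W \<in> open_covers X" "q = cover_scale A W"
    by (auto simp: cover_system_def)
  obtain U where U: "U \<in> open_covers X" "\<And>u. u \<in> U \<Longrightarrow> \<exists>v\<in>V. u \<subseteq> v" "\<And>u. u \<in> U \<Longrightarrow> \<exists>w\<in>W. u \<subseteq> w"
    by (rule open_covers_refine[OF VW(1,3)]) (rule that)
  have "fst (cover_scale A U) \<subseteq> fst p \<inter> fst q" "snd (cover_scale A U) \<subseteq> snd p \<inter> snd q"
    using U(2,3) by (auto simp: VW cover_scale_def; meson order_trans)+
  then show "\<exists>r\<in>cover_system X A. fst r \<subseteq> fst p \<inter> fst q \<and> snd r \<subseteq> snd p \<inter> snd q"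
    using U(1) by (auto simp: cover_system_def)
qed (auto simp: cover_system_def cover_scale_def; blast)+

lemma scale_system_nerve: "scale_system {nerve_scale A \<U>}"
proof -
  have "\<tau> \<in> fst (nerve_scale A \<U>)" if "\<sigma> \<in> fst (nerve_scale A \<U>)" "\<tau> \<subseteq> \<sigma>" for \<sigma> \<tau>
    using that Inter_anti_mono[OF that(2)] unfolding nerve_scale_def by auto
  moreover have "\<tau> \<in> snd (nerve_scale A \<U>)" if "\<sigma> \<in> snd (nerve_scale A \<U>)" "\<tau> \<subseteq> \<sigma>" for \<sigma> \<tau>
    using that Inter_anti_mono[OF that(2)] unfolding nerve_scale_def by auto
  moreover have "snd (nerve_scale A \<U>) \<subseteq> fst (nerve_scale A \<U>)" by (auto simp: nerve_scale_def)
  ultimately show ?thesis unfolding scale_system_def by blast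
qed

section \<open>Nerve cochains as cochains at one scale\<close>

lemma nerve_simplices_iff:
  "us \<in> nerve_simplices p \<U> \<longleftrightarrow> length us = Suc p \<and> set us \<in> fst (nerve_scale A \<U>)"
  by (auto simp: nerve_simplices_def nerve_scale_def)

text \<open>Nerve cochains vanish off the nerve, whereas cochains at a scale are arbitrary there;
  truncation turns the latter into the former.\<close>

definition nerve_restrict :: "nat \<Rightarrow> 'a set set \<Rightarrow> ('a set list \<Rightarrow> int) \<Rightarrow> 'a set list \<Rightarrow> int" where
  "nerve_restrict p \<U> c = (\<lambda>us. if us \<in> nerve_simplices p \<U> then c us else 0)"

lemma cocycle_at_nerve_scale:
  assumes "c \<in> cocycle_set p A \<U>"
  shows "cocycle_at (Suc p) (nerve_scale A \<U>) c"
  unfolding cocycle_at_def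
proof (intro conjI allI impI)
  fix us assume "length us = Suc (Suc p)" "set us \<in> fst (nerve_scale A \<U>)"
  then have "us \<in> nerve_simplices (Suc p) \<U>" by (simp add: nerve_simplices_iff[of us _ _ A])
  then show "cobd c us = 0"
    using assms coboundary_eq_cobd[of us p \<U> c] by (simp add: cocycle_set_def)
next
  fix us assume us: "length us = Suc p" "set us \<in> snd (nerve_scale A \<U>)"
  then have "A \<inter> \<Inter>(set us) \<noteq> {}" by (auto simp: nerve_scale_def)
  then show "c us = 0" using assms by (auto simp: cocycle_set_def cochains_def)
qed

lemma nerve_restrict_cochains:
  assumes "\<And>us. length us = Suc p \<Longrightarrow> set us \<in> snd (nerve_scale A \<U>) \<Longrightarrow> c us = 0"
  shows "nerve_restrict p \<U> c \<in> cochains p A \<U>"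
  using assms by (auto simp: cochains_def nerve_restrict_def nerve_simplices_def nerve_scale_def)

lemma coboundary_nerve_restrict:
  "coboundary p \<U> (nerve_restrict p \<U> c) = nerve_restrict (Suc p) \<U> (cobd c)"
proof
  fix us
  show "coboundary p \<U> (nerve_restrict p \<U> c) us = nerve_restrict (Suc p) \<U> (cobd c) us"
  proof (cases "us \<in> nerve_simplices (Suc p) \<U>")
    case True
    have "cobd (nerve_restrict p \<U> c) us = cobd c us"
    proof (rule cobd_cong)
      fix ys assume "Suc (length ys) = length us" "set ys \<subseteq> set us"
      then have "ys \<in> nerve_simplices p \<U>"
        using True Inter_anti_mono[of "set ys" "set us"] by (auto simp: nerve_simplices_def)
      then show "nerve_restrict p \<U> c ys = c ys" by (simp add: nerve_restrict_def)
    qed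
    then show ?thesis using True by (simp add: coboundary_eq_cobd nerve_restrict_def)
  qed (simp add: coboundary_def nerve_restrict_def)
qed

lemma nerve_restrict_cocycle_set:
  assumes "cocycle_at (Suc p) (nerve_scale A \<U>) c"
  shows "nerve_restrict p \<U> c \<in> cocycle_set p A \<U>"
proof -
  have "nerve_restrict (Suc p) \<U> (cobd c) = (\<lambda>_. 0)"
    using assms by (auto simp: fun_eq_iff nerve_restrict_def cocycle_at_def nerve_simplices_iff[of _ _ _ A])
  then show ?thesis
    using assms nerve_restrict_cochains[of p A \<U> c]
    by (simp add: cocycle_set_def coboundary_nerve_restrict cocycle_at_def)
qed

lemma coboundary_at_nerve_scale:
  assumes "c \<in> coboundary_set p A \<U>"
  shows "\<exists>b. coboundary_at (Suc p) (nerve_scale A \<U>) b c"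
proof (cases p)
  case 0
  then show ?thesis
    using assms by (intro exI[of _ "\<lambda>_. 0"]) (simp add: coboundary_set_def coboundary_at_def)
next
  case (Suc q)
  then obtain b where b: "b \<in> cochains q A \<U>" "c = coboundary q \<U> b"
    using assms by (auto simp: coboundary_set_def)
  have "coboundary_at (Suc p) (nerve_scale A \<U>) b c"
    unfolding coboundary_at_def
  proof (intro conjI allI impI)
    fix us assume "length us = Suc p" "set us \<in> fst (nerve_scale A \<U>)"
    then have "us \<in> nerve_simplices (Suc q) \<U>" by (simp add: nerve_simplices_iff[of us _ _ A] Suc)
    then show "c us = cobd b us" using coboundary_eq_cobd b(2) by simp
  next
    fix us assume "Suc (length us) = Suc p" "set us \<in> snd (nerve_scale A \<U>)"
    then have "A \<inter> \<Inter>(set us) \<noteq> {}" using Suc by (auto simp: nerve_scale_def)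
    then show "b us = 0" using b(1) by (auto simp: cochains_def)
  qed
  then show ?thesis by blast
qed

lemma nerve_restrict_coboundary_set:
  assumes b: "coboundary_at (Suc p) (nerve_scale A \<U>) b c"
  shows "nerve_restrict p \<U> c \<in> coboundary_set p A \<U>"
proof (cases p)
  case 0
  \<comment> \<open>In degree 0 the primitive is a function of the empty list, which is null; this
    matches the trivial group of coboundaries in that degree.\<close>
  have "b [] = 0" using b 0 by (simp add: coboundary_at_def nerve_scale_def)
  then have "c us = 0" if "us \<in> nerve_simplices 0 \<U>" for us
    using b 0 that by (auto simp: coboundary_at_def nerve_simplices_iff[of _ _ _ A] length_Suc_conv)
  then show ?thesis using 0 by (auto simp: coboundary_set_def nerve_restrict_def)
next
  case (Suc q)
  have "nerve_restrict p \<U> c = coboundary q \<U> (nerve_restrict q \<U> b)"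
    unfolding coboundary_nerve_restrict
    using b Suc by (auto simp: fun_eq_iff nerve_restrict_def coboundary_at_def nerve_simplices_iff[of _ _ _ A])
  moreover have "nerve_restrict q \<U> b \<in> cochains q A \<U>"
    using b Suc by (intro nerve_restrict_cochains) (simp add: coboundary_at_def)
  ultimately show ?thesis using Suc by (simp add: coboundary_set_def)
qed

text \<open>The members of the refinement are cut out by finitely many closed sets whose interiors cover the space.\<close>

lemma barycentric_refinement:
  assumes X: "compact_space X" "Hausdorff_space X" and \<U>: "\<U> \<in> open_covers X"
  obtains \<V> where "\<V> \<in> open_covers X" "\<And>y. y \<in> topspace X \<Longrightarrow> \<exists>u\<in>\<U>. \<forall>v\<in>\<V>. y \<in> v \<longrightarrow> v \<subseteq> u"
proof -
  have reg: "regular_space X" using compact_Hausdorff_imp_regular_space X by blast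
  have "\<forall>x\<in>topspace X. \<exists>t. openin X (fst t) \<and> closedin X (fst (snd t)) \<and> snd (snd t) \<in> \<U> \<and>
      x \<in> fst t \<and> fst t \<subseteq> fst (snd t) \<and> fst (snd t) \<subseteq> snd (snd t)"
  proof
    fix x assume x: "x \<in> topspace X"
    then obtain u where u: "u \<in> \<U>" "x \<in> u" "openin X u" using \<U> by (auto simp: open_covers_def)
    obtain N F where "openin X N" "closedin X F" "x \<in> N" "N \<subseteq> F" "F \<subseteq> u"
      using reg u unfolding neighbourhood_base_of_closedin[symmetric] neighbourhood_base_of
      by meson
    then show "\<exists>t. openin X (fst t) \<and> closedin X (fst (snd t)) \<and> snd (snd t) \<in> \<U> \<and>
      x \<in> fst t \<and> fst t \<subseteq> fst (snd t) \<and> fst (snd t) \<subseteq> snd (snd t)"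
      using u(1) by (intro exI[of _ "(N, F, u)"]) auto
  qed
  from bchoice[OF this] obtain t where t: "\<forall>x\<in>topspace X. openin X (fst (t x)) \<and>
      closedin X (fst (snd (t x))) \<and> snd (snd (t x)) \<in> \<U> \<and>
      x \<in> fst (t x) \<and> fst (t x) \<subseteq> fst (snd (t x)) \<and> fst (snd (t x)) \<subseteq> snd (snd (t x))" ..
  define N F u where "N x = fst (t x)" and "F x = fst (snd (t x))" and "u x = snd (snd (t x))" for x
  have N: "openin X (N x)" "closedin X (F x)" "u x \<in> \<U>" "x \<in> N x" "N x \<subseteq> F x" "F x \<subseteq> u x" if "x \<in> topspace X" for x
    using t that unfolding N_def F_def u_def by blast+
  have "\<exists>\<F>. finite \<F> \<and> \<F> \<subseteq> N ` topspace X \<and> topspace X \<subseteq> \<Union>\<F>"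
  proof -
    have "(\<forall>U\<in>N ` topspace X. openin X U) \<and> topspace X \<subseteq> \<Union>(N ` topspace X)" using N(1,4) by blast
    then show ?thesis using X(1) unfolding compact_space_alt by blast
  qed
  then obtain J where J: "finite J" "J \<subseteq> topspace X" "topspace X \<subseteq> (\<Union>x\<in>J. N x)"
    by (metis finite_subset_image)
  \<comment> \<open>The set \<open>V z\<close> avoids every \<open>F x\<close> that does not contain
    \<open>z\<close>. Hence a member which meets \<open>F x\<close> belongs to some \<open>z\<close>
    in \<open>F x\<close> and lies in \<open>u x\<close>, so all members through a point of
    \<open>F x\<close> do.\<close>
  define V where "V z = topspace X \<inter> (\<Inter>x\<in>{x\<in>J. z \<in> F x}. u x) \<inter> (\<Inter>x\<in>{x\<in>J. z \<notin> F x}. topspace X - F x)" for z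
  have open_u: "openin X (u x)" if "x \<in> J" for x
    using N(3) J(2) that \<U> by (auto simp: open_covers_def)
  have open_V: "openin X (V z)" for z
  proof -
    have "openin X (topspace X \<inter> \<Inter>(insert (topspace X) (u ` {x\<in>J. z \<in> F x} \<union> (\<lambda>x. topspace X - F x) ` {x\<in>J. z \<notin> F x})))"
      using J open_u N(2) by (intro openin_Int openin_Inter) (auto intro!: openin_diff)
    also have "\<dots> = V z" unfolding V_def by auto
    finally show ?thesis .
  qed
  show ?thesis
  proof (rule that[of "V ` topspace X"])
    have "z \<in> V z" if "z \<in> topspace X" for z using that N(6) J(2) by (auto simp: V_def)
    then show "V ` topspace X \<in> open_covers X"
      using open_V openin_subset by (fastforce simp: open_covers_def)
  next
    fix y assume "y \<in> topspace X"
    then obtain x where x: "x \<in> J" "y \<in> F x" using J N(5) by blast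
    have "v \<subseteq> u x" if v: "v \<in> V ` topspace X" "y \<in> v" for v
    proof -
      obtain z where z: "v = V z" using v by blast
      have "z \<in> F x" using v(2) x unfolding z V_def by blast
      then show ?thesis using x unfolding z V_def by blast
    qed
    then show "\<exists>u\<in>\<U>. \<forall>v\<in>V ` topspace X. y \<in> v \<longrightarrow> v \<subseteq> u"
      using N(3) J(2) x by blast
  qed
qed

lemma nerve_restrict_refinement:
  assumes "refinement \<U> \<V> \<pi>"
  shows "scale_map (nerve_scale A \<V>) (nerve_scale A \<U>) \<pi>"
proof -
  have *: "\<pi> ` \<sigma> \<subseteq> \<U> \<and> \<Inter>\<sigma> \<subseteq> \<Inter>(\<pi> ` \<sigma>)" if "\<sigma> \<subseteq> \<V>" for \<sigma>
    using assms that unfolding refinement_def by blast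
  show ?thesis
    unfolding contiguous_def nerve_scale_def using * by (simp; blast)
qed

section \<open>Classes in nerve cohomology and refinement maps\<close>

definition nerve_class :: "nat \<Rightarrow> 'a set \<Rightarrow> 'a set set \<Rightarrow> ('a set list \<Rightarrow> int) \<Rightarrow> ('a set list \<Rightarrow> int) set" where
  "nerve_class p A \<U> c = coboundary_set p A \<U> #>\<^bsub>cocycle_group p A \<U>\<^esub> c"

lemma normal_coboundary_set: "normal (coboundary_set p A \<U>) (cocycle_group p A \<U>)"
  by (rule comm_group.subgroup_imp_normal[OF comm_group_cocycle_group subgroup_coboundary_set])

lemma carrier_nerve_cohomology:
  "carrier (nerve_cohomology p A \<U>) = nerve_class p A \<U> ` cocycle_set p A \<U>"
  by (auto simp: nerve_cohomology_def FactGroup_def RCOSETS_def nerve_class_def cocycle_group_def)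

lemma nerve_class_mult:
  assumes "c \<in> cocycle_set p A \<U>" "d \<in> cocycle_set p A \<U>"
  shows "nerve_class p A \<U> c \<otimes>\<^bsub>nerve_cohomology p A \<U>\<^esub> nerve_class p A \<U> d = nerve_class p A \<U> (\<lambda>us. c us + d us)"
  using normal.rcos_sum[OF normal_coboundary_set, of c p A \<U> d] assms
  by (simp add: nerve_cohomology_def nerve_class_def cocycle_group_def)

lemma cocycle_set_add:
  assumes "c \<in> cocycle_set p A \<U>" "d \<in> cocycle_set p A \<U>"
  shows "(\<lambda>us. c us + d us) \<in> cocycle_set p A \<U>"
proof -
  interpret comm_group "cocycle_group p A \<U>" by (rule comm_group_cocycle_group)
  show ?thesis using m_closed[of c d] assms by (simp add: cocycle_group_def)
qed

lemma nerve_class_eq_one: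
  assumes "c \<in> coboundary_set p A \<U>"
  shows "nerve_class p A \<U> c = \<one>\<^bsub>nerve_cohomology p A \<U>\<^esub>"
proof -
  interpret comm_group "cocycle_group p A \<U>" by (rule comm_group_cocycle_group)
  have "c \<in> carrier (cocycle_group p A \<U>)"
    using assms subgroup.subset[OF subgroup_coboundary_set] by blast
  then show ?thesis
    using coset_join2[OF _ subgroup_coboundary_set assms]
    by (simp add: nerve_cohomology_def nerve_class_def)
qed

lemma nerve_class_rep:
  assumes "d \<in> nerve_class p A \<U> c"
  shows "(\<lambda>us. d us - c us) \<in> coboundary_set p A \<U>"
  using assms by (auto simp: nerve_class_def r_coset_def cocycle_group_def)

lemma nerve_class_self:
  "c \<in> nerve_class p A \<U> c"
proof -
  have "(\<lambda>_. 0) \<in> coboundary_set p A \<U>"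
    using subgroup.one_closed[OF subgroup_coboundary_set, of p A \<U>] by (simp add: cocycle_group_def)
  then show ?thesis by (force simp: nerve_class_def r_coset_def cocycle_group_def)
qed

lemma refinement_map_nerve_class:
  assumes "f \<in> refinement_maps p A \<U> \<V>"
  obtains \<pi> where "refinement \<U> \<V> \<pi>"
    "\<And>c. c \<in> cocycle_set p A \<U> \<Longrightarrow> f (nerve_class p A \<U> c) = nerve_class p A \<V> (pullback p \<V> \<pi> c)"
proof -
  obtain \<pi> where \<pi>: "refinement \<U> \<V> \<pi>"
    "f = (\<lambda>\<xi>. coboundary_set p A \<V> <#>\<^bsub>cocycle_group p A \<V>\<^esub> (pullback p \<V> \<pi> ` \<xi>))"
    using assms by (auto simp: refinement_maps_def)
  show ?thesis
    by (rule that[OF \<pi>(1)]) (simp add: \<pi>(2) nerve_class_def refinement_map_coset[OF \<pi>(1)])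
qed

section \<open>Comparison of nerve cochains with Alexander-Spanier cochains\<close>

text \<open>Such a \<open>u\<close> sends points to members of the cover, and pulling back along it
  turns nerve cochains into functions on lists of points. All points of one \<open>v\<close> are
  sent to members containing \<open>v\<close>, so small lists become simplices of the nerve.\<close>

definition star_choice :: "'a topology \<Rightarrow> 'a set set \<Rightarrow> ('a \<Rightarrow> 'a set) \<Rightarrow> bool" where
  "star_choice X \<U> u \<longleftrightarrow> (\<exists>\<V>\<in>open_covers X. \<forall>v\<in>\<V>. \<forall>x\<in>v. u x \<in> \<U> \<and> v \<subseteq> u x)"

text \<open>For points \<open>x\<close>, \<open>y\<close> of one member of a common refinement,
  \<open>u x\<close> and \<open>u' y\<close> both contain that member. Hence the comparison map on
  classes does not depend on the choice.\<close>

lemma star_choice_contiguous: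
  assumes "star_choice X \<U> u" "star_choice X \<U> u'"
  obtains \<V> where "\<V> \<in> open_covers X" "\<And>A. contiguous (cover_scale A \<V>) (nerve_scale A \<U>) u u'"
proof -
  obtain V W where V: "V \<in> open_covers X" "\<forall>v\<in>V. \<forall>x\<in>v. u x \<in> \<U> \<and> v \<subseteq> u x"
    and W: "W \<in> open_covers X" "\<forall>v\<in>W. \<forall>x\<in>v. u' x \<in> \<U> \<and> v \<subseteq> u' x"
    using assms unfolding star_choice_def by (elim bexE) (rule that)
  obtain \<V> where \<V>: "\<V> \<in> open_covers X" "\<And>u. u \<in> \<V> \<Longrightarrow> \<exists>v\<in>V. u \<subseteq> v" "\<And>u. u \<in> \<V> \<Longrightarrow> \<exists>w\<in>W. u \<subseteq> w"
    by (rule open_covers_refine[OF V(1) W(1)]) (rule that)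
  have *: "u ` \<sigma> \<union> u' ` \<sigma> \<subseteq> \<U> \<and> \<sigma> \<subseteq> \<Inter>(u ` \<sigma> \<union> u' ` \<sigma>)" if v: "v \<in> \<V>" "\<sigma> \<subseteq> v" for v \<sigma>
  proof -
    obtain w1 where w1: "w1 \<in> V" "v \<subseteq> w1" using \<V>(2)[OF v(1)] ..
    obtain w2 where w2: "w2 \<in> W" "v \<subseteq> w2" using \<V>(3)[OF v(1)] ..
    have "u x \<in> \<U> \<and> u' x \<in> \<U> \<and> \<sigma> \<subseteq> u x \<and> \<sigma> \<subseteq> u' x" if "x \<in> \<sigma>" for x
    proof -
      have "x \<in> w1" "x \<in> w2" using that w1(2) w2(2) v(2) by auto
      then have "u x \<in> \<U> \<and> w1 \<subseteq> u x" "u' x \<in> \<U> \<and> w2 \<subseteq> u' x"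
        using V(2) W(2) w1(1) w2(1) by simp_all
      then show ?thesis using w1(2) w2(2) v(2) by auto
    qed
    then show ?thesis by blast
  qed
  show ?thesis
  proof (rule that[OF \<V>(1)])
    fix A show "contiguous (cover_scale A \<V>) (nerve_scale A \<U>) u u'"
      unfolding contiguous_def
    proof (intro conjI ballI)
      fix \<sigma> assume \<sigma>: "\<sigma> \<in> fst (cover_scale A \<V>)"
      show "u ` \<sigma> \<union> u' ` \<sigma> \<in> fst (nerve_scale A \<U>)"
      proof (cases "\<sigma> = {}")
        case False
        then obtain v where "v \<in> \<V>" "\<sigma> \<subseteq> v" using \<sigma> by (auto simp: cover_scale_def)
        from *[OF this] have "u ` \<sigma> \<union> u' ` \<sigma> \<subseteq> \<U>" "\<Inter>(u ` \<sigma> \<union> u' ` \<sigma>) \<noteq> {}"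
          using False by (simp_all only:) (metis subset_empty)
        then show ?thesis unfolding nerve_scale_def fst_conv mem_Collect_eq by (intro conjI disjI2)
      qed (simp add: nerve_scale_def)
    next
      fix \<sigma> assume \<sigma>: "\<sigma> \<in> snd (cover_scale A \<V>)"
      show "u ` \<sigma> \<union> u' ` \<sigma> \<in> snd (nerve_scale A \<U>)"
      proof (cases "\<sigma> = {}")
        case False
        then obtain v where "v \<in> \<V>" "\<sigma> \<subseteq> v" "\<sigma> \<subseteq> A" using \<sigma> by (auto simp: cover_scale_def)
        from *[OF this(1,2)] \<open>\<sigma> \<subseteq> A\<close> have "u ` \<sigma> \<union> u' ` \<sigma> \<subseteq> \<U>" "\<sigma> \<subseteq> A \<inter> \<Inter>(u ` \<sigma> \<union> u' ` \<sigma>)"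
          by (simp_all only: Int_greatest)
        then show ?thesis using False unfolding nerve_scale_def snd_conv mem_Collect_eq
          by (intro conjI disjI2) (simp_all only:, metis subset_empty)
      qed (simp add: nerve_scale_def)
    qed
  qed
qed

context
  fixes X :: "'a topology"
  assumes X: "compact_space X" "Hausdorff_space X"
begin

lemma star_choice_exists:
  assumes "\<U> \<in> open_covers X"
  shows "\<exists>u. star_choice X \<U> u"
proof -
  obtain \<V> where \<V>: "\<V> \<in> open_covers X" "\<And>y. y \<in> topspace X \<Longrightarrow> \<exists>u\<in>\<U>. \<forall>v\<in>\<V>. y \<in> v \<longrightarrow> v \<subseteq> u"
    by (rule barycentric_refinement[OF X assms]) (rule that)
  have "\<forall>y\<in>topspace X. \<exists>u. u \<in> \<U> \<and> (\<forall>v\<in>\<V>. y \<in> v \<longrightarrow> v \<subseteq> u)" using \<V>(2) by blast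
  from bchoice[OF this] obtain u where "\<forall>y\<in>topspace X. u y \<in> \<U> \<and> (\<forall>v\<in>\<V>. y \<in> v \<longrightarrow> v \<subseteq> u y)" ..
  moreover have "v \<subseteq> topspace X" if "v \<in> \<V>" for v using \<V>(1) that by (auto simp: open_covers_def)
  ultimately have "\<forall>v\<in>\<V>. \<forall>x\<in>v. u x \<in> \<U> \<and> v \<subseteq> u x" by blast
  then show ?thesis using \<V>(1) unfolding star_choice_def by blast
qed

text \<open>The comparison in the other direction picks a point of each member, and a point of
  \<open>A\<close> whenever there is one, so that relative cochains stay relative. The barycentric
  property of the cover makes the chosen points close to each other.\<close>

lemma point_choice_exists:
  assumes "\<W> \<in> open_covers X"
  obtains \<V> \<xi> where "\<V> \<in> open_covers X" "scale_map (nerve_scale A \<V>) (cover_scale A \<W>) \<xi>"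
    "\<And>v. v \<in> \<V> \<Longrightarrow> v \<noteq> {} \<Longrightarrow> \<xi> v \<in> v" "\<And>v. v \<in> \<V> \<Longrightarrow> v \<inter> A \<noteq> {} \<Longrightarrow> \<xi> v \<in> A"
    "\<And>y. y \<in> topspace X \<Longrightarrow> \<exists>w\<in>\<W>. \<forall>v\<in>\<V>. y \<in> v \<longrightarrow> v \<subseteq> w"
proof -
  obtain \<V> where \<V>: "\<V> \<in> open_covers X" "\<And>y. y \<in> topspace X \<Longrightarrow> \<exists>w\<in>\<W>. \<forall>v\<in>\<V>. y \<in> v \<longrightarrow> v \<subseteq> w"
    by (rule barycentric_refinement[OF X assms]) (rule that)
  define \<xi> where "\<xi> v = (if v \<inter> A \<noteq> {} then SOME x. x \<in> v \<inter> A else SOME x. x \<in> v)" for v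
  have \<xi>A: "\<xi> v \<in> v \<inter> A" if "v \<inter> A \<noteq> {}" for v
    unfolding \<xi>_def if_P[OF that] by (rule iffD2[OF some_in_eq that])
  have \<xi>: "\<xi> v \<in> v" if "v \<noteq> {}" for v
  proof (cases "v \<inter> A = {}")
    case True
    then show ?thesis using that by (simp add: \<xi>_def some_in_eq)
  qed (use \<xi>A in blast)
  have small: "\<exists>w\<in>\<W>. \<xi> ` \<sigma> \<subseteq> w" if \<sigma>: "\<sigma> \<subseteq> \<V>" "\<sigma> \<noteq> {}" "\<Inter>\<sigma> \<noteq> {}" for \<sigma>
  proof -
    obtain y where y: "y \<in> \<Inter>\<sigma>" using \<sigma>(3) by blast
    moreover obtain v where "v \<in> \<sigma>" using \<sigma>(2) by blast
    ultimately have "y \<in> topspace X" using \<V>(1) \<sigma>(1) unfolding open_covers_def by blast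
    from \<V>(2)[OF this] obtain w where w: "w \<in> \<W>" "\<forall>v\<in>\<V>. y \<in> v \<longrightarrow> v \<subseteq> w" ..
    have "\<xi> v \<in> w" if v: "v \<in> \<sigma>" for v
    proof -
      have "v \<in> \<V>" "y \<in> v" using v \<sigma>(1) y by auto
      then have "v \<subseteq> w" "\<xi> v \<in> v" using w(2) \<xi>[of v] by auto
      then show ?thesis by auto
    qed
    then show ?thesis using w(1) by auto
  qed
  have "scale_map (nerve_scale A \<V>) (cover_scale A \<W>) \<xi>"
    unfolding contiguous_def
  proof (intro conjI ballI)
    fix \<sigma> assume "\<sigma> \<in> fst (nerve_scale A \<V>)"
    then show "\<xi> ` \<sigma> \<union> \<xi> ` \<sigma> \<in> fst (cover_scale A \<W>)"
      using small[of \<sigma>] by (auto simp: nerve_scale_def cover_scale_def)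
  next
    fix \<sigma> assume \<sigma>: "\<sigma> \<in> snd (nerve_scale A \<V>)"
    then have "\<xi> ` \<sigma> \<subseteq> A" using \<xi>A by (auto simp: nerve_scale_def)
    then show "\<xi> ` \<sigma> \<union> \<xi> ` \<sigma> \<in> snd (cover_scale A \<W>)"
      using small[of \<sigma>] \<sigma> by (auto simp: nerve_scale_def cover_scale_def)
  qed
  then show ?thesis
    by (rule that[OF \<V>(1)]) (use \<xi> \<xi>A \<V>(2) in \<open>simp_all add: Int_commute\<close>)
qed

text \<open>The cone is pullback along star choices. Point choices invert it: a star choice followed
  by a point choice is contiguous to the identity of \<open>X\<close>, and in the opposite order to
  a refinement map.\<close>

theorem group_rank_cech_cohomology:
  "group_rank (cech_cohomology p X A) = hrank (Suc p) (cover_system X A)"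
proof -
  let ?S = "cover_system X A"
  let ?B = "coboundaries (Suc p) ?S" and ?Z = "cocycles (Suc p) ?S"
  note S = scale_system_cover_system[of X A]
  note B = additive_group_coboundaries[OF S, of "Suc p"]
  note Z = additive_group_cocycles[OF S, of "Suc p"]
  note [trans] = cong_mod_trans[OF B]
  define u where "u \<U> = (SOME u. star_choice X \<U> u)" for \<U>
  have u: "star_choice X \<U> (u \<U>)" if "\<U> \<in> open_covers X" for \<U>
    unfolding u_def using star_choice_exists[OF that] by (rule someI_ex)
  have in_S: "cover_scale A \<V> \<in> ?S" if "\<V> \<in> open_covers X" for \<V>
    using that by (simp add: cover_system_def)
  have pull_Z: "(\<lambda>xs. c (map f xs)) \<in> ?Z" if f: "star_choice X \<U> f" "c \<in> cocycle_set p A \<U>" for \<U> f c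
  proof -
    obtain \<V> where "\<V> \<in> open_covers X" "\<And>A. contiguous (cover_scale A \<V>) (nerve_scale A \<U>) f f"
      by (rule star_choice_contiguous[OF f(1) f(1)]) (rule that)
    then show ?thesis
      using cocycle_at_pullback[OF _ cocycle_at_nerve_scale[OF f(2)]] in_S unfolding cocycles_def by blast
  qed
  have pull_B: "(\<lambda>xs. c (map f xs)) \<in> ?B" if f: "star_choice X \<U> f" "c \<in> coboundary_set p A \<U>" for \<U> f c
  proof -
    obtain \<V> where \<V>: "\<V> \<in> open_covers X" "\<And>A. contiguous (cover_scale A \<V>) (nerve_scale A \<U>) f f"
      by (rule star_choice_contiguous[OF f(1) f(1)]) (rule that)
    obtain b where "coboundary_at (Suc p) (nerve_scale A \<U>) b c"
      using coboundary_at_nerve_scale[OF f(2)] by blast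
    from coboundary_at_pullback[OF \<V>(2) this] show ?thesis
      using in_S[OF \<V>(1)] unfolding coboundaries_def by blast
  qed
  have pull_cong: "cong_mod ?B (\<lambda>xs. c (map g xs)) (\<lambda>xs. c (map f xs))"
    if fg: "star_choice X \<U> f" "star_choice X \<U> g" and c: "c \<in> cocycle_set p A \<U>" for \<U> f g c
  proof -
    obtain \<V> where \<V>: "\<V> \<in> open_covers X" "\<And>A. contiguous (cover_scale A \<V>) (nerve_scale A \<U>) f g"
      by (rule star_choice_contiguous[OF fg]) (rule that)
    from contiguous_coboundary_at[OF scale_system_nerve _ \<V>(2) cocycle_at_nerve_scale[OF c]]
    show ?thesis using in_S[OF \<V>(1)] unfolding cong_mod_def coboundaries_def by blast
  qed
  \<comment> \<open>A class is a coset, so a representative has to be chosen; another one changes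
    the pullback by a coboundary.\<close>
  define \<theta> :: "'a set set \<Rightarrow> ('a set list \<Rightarrow> int) set \<Rightarrow> 'a list \<Rightarrow> int"
    where "\<theta> \<U> \<eta> = (\<lambda>xs. (SOME c. c \<in> \<eta>) (map (u \<U>) xs))" for \<U> \<eta>
  have \<theta>: "cong_mod ?B (\<theta> \<U> (nerve_class p A \<U> c)) (\<lambda>xs. c (map (u \<U>) xs))" if "\<U> \<in> open_covers X" for \<U> c
  proof -
    have "(SOME d. d \<in> nerve_class p A \<U> c) \<in> nerve_class p A \<U> c"
      by (rule someI[where P = "\<lambda>d. d \<in> nerve_class p A \<U> c", OF nerve_class_self])
    from pull_B[OF u[OF that] nerve_class_rep[OF this]] show ?thesis
      by (simp add: cong_mod_def \<theta>_def)
  qed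
  show ?thesis
    unfolding cech_cohomology_def hrank_def
  proof (rule group_rank_direct_limit[where \<theta> = \<theta>, OF B Z])
    have "{topspace X} \<in> open_covers X" by (auto simp: open_covers_def)
    then show "open_covers X \<noteq> {}" by blast
  next
    fix \<U> show "comm_group (nerve_cohomology p A \<U>)" by (rule comm_group_nerve_cohomology)
  next
    fix \<U> \<V> f assume f: "f \<in> refinement_maps p A \<U> \<V>"
    obtain \<pi> where \<pi>: "refinement \<U> \<V> \<pi>"
      "\<And>c. c \<in> cocycle_set p A \<U> \<Longrightarrow> f (nerve_class p A \<U> c) = nerve_class p A \<V> (pullback p \<V> \<pi> c)"
      by (rule refinement_map_nerve_class[OF f]) (rule that)
    show "f \<in> hom (nerve_cohomology p A \<U>) (nerve_cohomology p A \<V>)"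
    proof (rule homI)
      fix x assume "x \<in> carrier (nerve_cohomology p A \<U>)"
      then show "f x \<in> carrier (nerve_cohomology p A \<V>)"
        using \<pi>(2) pullback_in_cocycle_set[OF \<pi>(1)] by (auto simp: carrier_nerve_cohomology)
    next
      fix x y assume "x \<in> carrier (nerve_cohomology p A \<U>)" "y \<in> carrier (nerve_cohomology p A \<U>)"
      then obtain c d where c: "c \<in> cocycle_set p A \<U>" "x = nerve_class p A \<U> c"
        and d: "d \<in> cocycle_set p A \<U>" "y = nerve_class p A \<U> d"
        by (auto simp: carrier_nerve_cohomology)
      have "pullback p \<V> \<pi> (\<lambda>us. c us + d us) = (\<lambda>us. pullback p \<V> \<pi> c us + pullback p \<V> \<pi> d us)"
        by (auto simp: pullback_def)
      then show "f (x \<otimes>\<^bsub>nerve_cohomology p A \<U>\<^esub> y) = f x \<otimes>\<^bsub>nerve_cohomology p A \<V>\<^esub> f y"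
        using c d \<pi>(2) pullback_in_cocycle_set[OF \<pi>(1)] cocycle_set_add[OF c(1) d(1)]
        by (simp add: nerve_class_mult)
    qed
  next
    fix \<U> \<V> assume UV: "\<U> \<in> open_covers X" "\<V> \<in> open_covers X"
    obtain \<W> where \<W>: "\<W> \<in> open_covers X" "\<And>w. w \<in> \<W> \<Longrightarrow> \<exists>u\<in>\<U>. w \<subseteq> u" "\<And>w. w \<in> \<W> \<Longrightarrow> \<exists>v\<in>\<V>. w \<subseteq> v"
      by (rule open_covers_refine[OF UV]) (rule that)
    have ex: "refinement_maps p A \<U>' \<W> \<noteq> {}" if "\<And>w. w \<in> \<W> \<Longrightarrow> \<exists>u\<in>\<U>'. w \<subseteq> u" for \<U>'
    proof -
      have "\<forall>w\<in>\<W>. \<exists>u. u \<in> \<U>' \<and> w \<subseteq> u" using that by blast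
      from bchoice[OF this] obtain \<pi> where "\<forall>w\<in>\<W>. \<pi> w \<in> \<U>' \<and> w \<subseteq> \<pi> w" ..
      then show ?thesis by (auto simp: refinement_maps_def refinement_def)
    qed
    show "\<exists>k\<in>open_covers X. refinement_maps p A \<U> k \<noteq> {} \<and> refinement_maps p A \<V> k \<noteq> {}"
      using \<W>(1) ex[OF \<W>(2)] ex[OF \<W>(3)] by blast
  next
    fix \<U> x assume \<U>: "\<U> \<in> open_covers X" and "x \<in> carrier (nerve_cohomology p A \<U>)"
    then obtain c where c: "c \<in> cocycle_set p A \<U>" "x = nerve_class p A \<U> c"
      by (auto simp: carrier_nerve_cohomology)
    have 1: "(\<lambda>xs. \<theta> \<U> x xs - c (map (u \<U>) xs)) \<in> ?Z"
      using \<theta>[OF \<U>, of c] coboundaries_subset_cocycles[OF S] unfolding c(2) cong_mod_def by blast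
    show "\<theta> \<U> x \<in> ?Z"
      using additive_group_add[OF Z 1 pull_Z[OF u[OF \<U>] c(1)]] by simp
  next
    fix \<U> x y assume \<U>: "\<U> \<in> open_covers X"
      and "x \<in> carrier (nerve_cohomology p A \<U>)" "y \<in> carrier (nerve_cohomology p A \<U>)"
    then obtain c d where c: "c \<in> cocycle_set p A \<U>" "x = nerve_class p A \<U> c"
      and d: "d \<in> cocycle_set p A \<U>" "y = nerve_class p A \<U> d"
      by (auto simp: carrier_nerve_cohomology)
    have "cong_mod ?B (\<theta> \<U> (x \<otimes>\<^bsub>nerve_cohomology p A \<U>\<^esub> y)) (\<lambda>xs. c (map (u \<U>) xs) + d (map (u \<U>) xs))"
      unfolding c(2) d(2) nerve_class_mult[OF c(1) d(1)] by (rule \<theta>[OF \<U>])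
    also have "cong_mod ?B \<dots> (\<lambda>xs. \<theta> \<U> x xs + \<theta> \<U> y xs)"
      unfolding c(2) d(2) by (rule cong_mod_add[OF B cong_mod_sym[OF B \<theta>[OF \<U>]] cong_mod_sym[OF B \<theta>[OF \<U>]]])
    finally show "cong_mod ?B (\<theta> \<U> (x \<otimes>\<^bsub>nerve_cohomology p A \<U>\<^esub> y)) (\<lambda>xs. \<theta> \<U> x xs + \<theta> \<U> y xs)" .
  next
    fix \<U> \<V> f x assume UV: "\<U> \<in> open_covers X" "\<V> \<in> open_covers X"
      and f: "f \<in> refinement_maps p A \<U> \<V>" and "x \<in> carrier (nerve_cohomology p A \<U>)"
    then obtain c where c: "c \<in> cocycle_set p A \<U>" "x = nerve_class p A \<U> c"
      by (auto simp: carrier_nerve_cohomology)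
    obtain \<pi> where \<pi>: "refinement \<U> \<V> \<pi>"
      "\<And>c. c \<in> cocycle_set p A \<U> \<Longrightarrow> f (nerve_class p A \<U> c) = nerve_class p A \<V> (pullback p \<V> \<pi> c)"
      by (rule refinement_map_nerve_class[OF f]) (rule that)
    obtain \<W> where \<W>: "\<W> \<in> open_covers X" "\<forall>v\<in>\<W>. \<forall>x\<in>v. u \<V> x \<in> \<V> \<and> v \<subseteq> u \<V> x"
      using u[OF UV(2)] by (auto simp: star_choice_def)
    have "star_choice X \<U> (\<lambda>x. \<pi> (u \<V> x))"
      using \<W> \<pi>(1) unfolding star_choice_def refinement_def by (intro bexI[of _ \<W>]) (blast, blast)
    note 1 = pull_cong[OF u[OF UV(1)] this c(1)]
    \<comment> \<open>\<open>pullback\<close> is zero off the nerve. On lists that are small for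
      \<open>\<W>\<close> the two cochains coincide, so they differ by a coboundary with primitive
      zero.\<close>
    have 2: "(\<lambda>xs. pullback p \<V> \<pi> c (map (u \<V>) xs) - c (map (\<lambda>x. \<pi> (u \<V> x)) xs)) \<in> ?B"
    proof -
      have "pullback p \<V> \<pi> c (map (u \<V>) xs) - c (map (\<lambda>x. \<pi> (u \<V> x)) xs) = 0"
        if xs: "length xs = Suc p" "set xs \<in> fst (cover_scale A \<W>)" for xs
      proof -
        obtain x where x: "x \<in> set xs" using xs(1) by (cases xs) auto
        then obtain w where w: "w \<in> \<W>" "set xs \<subseteq> w" using xs(2) by (auto simp: cover_scale_def)
        have "map (u \<V>) xs \<in> nerve_simplices p \<V>"
          using \<W>(2) w x xs(1) by (auto simp: nerve_simplices_def; blast)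
        then show ?thesis by (simp add: pullback_def comp_def)
      qed
      then have "coboundary_at (Suc p) (cover_scale A \<W>) (\<lambda>_. 0)
          (\<lambda>xs. pullback p \<V> \<pi> c (map (u \<V>) xs) - c (map (\<lambda>x. \<pi> (u \<V> x)) xs))"
        by (simp add: coboundary_at_def)
      then show ?thesis using in_S[OF \<W>(1)] unfolding coboundaries_def by blast
    qed
    have "cong_mod ?B (\<theta> \<V> (f x)) (\<lambda>xs. pullback p \<V> \<pi> c (map (u \<V>) xs))"
      unfolding c(2) \<pi>(2)[OF c(1)] by (rule \<theta>[OF UV(2)])
    also have "cong_mod ?B \<dots> (\<lambda>xs. c (map (\<lambda>x. \<pi> (u \<V> x)) xs))" unfolding cong_mod_def by (rule 2)
    also note 1
    also have "cong_mod ?B (\<lambda>xs. c (map (u \<U>) xs)) (\<theta> \<U> x)"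
      unfolding c(2) by (rule cong_mod_sym[OF B \<theta>[OF UV(1)]])
    finally show "cong_mod ?B (\<theta> \<V> (f x)) (\<theta> \<U> x)" .
  next
    fix c assume "c \<in> ?Z"
    then obtain \<W> where \<W>: "\<W> \<in> open_covers X" "cocycle_at (Suc p) (cover_scale A \<W>) c"
      by (auto simp: cocycles_def cover_system_def)
    obtain \<V> \<xi> where \<V>: "\<V> \<in> open_covers X" and \<xi>: "scale_map (nerve_scale A \<V>) (cover_scale A \<W>) \<xi>"
      "\<And>v. v \<in> \<V> \<Longrightarrow> v \<noteq> {} \<Longrightarrow> \<xi> v \<in> v" "\<And>v. v \<in> \<V> \<Longrightarrow> v \<inter> A \<noteq> {} \<Longrightarrow> \<xi> v \<in> A"
      and star: "\<And>y. y \<in> topspace X \<Longrightarrow> \<exists>w\<in>\<W>. \<forall>v\<in>\<V>. y \<in> v \<longrightarrow> v \<subseteq> w"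
      by (rule point_choice_exists[OF \<W>(1), of A]) (rule that)
    let ?c = "nerve_restrict p \<V> (\<lambda>us. c (map \<xi> us))"
    have c: "?c \<in> cocycle_set p A \<V>"
      by (rule nerve_restrict_cocycle_set[OF cocycle_at_pullback[OF \<xi>(1) \<W>(2)]])
    obtain \<V>' where \<V>': "\<V>' \<in> open_covers X" "\<forall>v\<in>\<V>'. \<forall>x\<in>v. u \<V> x \<in> \<V> \<and> v \<subseteq> u \<V> x"
      using u[OF \<V>] by (auto simp: star_choice_def)
    \<comment> \<open>For the points \<open>x\<close> of a set inside \<open>v\<close> the members
      \<open>u \<V> x\<close> share a point, so by the star property they lie in one member of
      \<open>\<W>\<close>, together with \<open>x\<close> and
      \<open>\<xi> (u \<V> x)\<close>.\<close>
    have cont: "contiguous (cover_scale A \<V>') (cover_scale A \<W>) (\<lambda>x. x) (\<lambda>x. \<xi> (u \<V> x))"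
    proof -
      have "\<exists>w\<in>\<W>. \<sigma> \<union> (\<lambda>x. \<xi> (u \<V> x)) ` \<sigma> \<subseteq> w" if v: "v \<in> \<V>'" "\<sigma> \<subseteq> v" "\<sigma> \<noteq> {}" for v \<sigma>
      proof -
        obtain y where y: "y \<in> \<sigma>" using v(3) by blast
        have "y \<in> topspace X" using y v \<V>'(1) by (auto simp: open_covers_def)
        from star[OF this] obtain w where w: "w \<in> \<W>" "\<forall>v\<in>\<V>. y \<in> v \<longrightarrow> v \<subseteq> w" ..
        have "x \<in> w \<and> \<xi> (u \<V> x) \<in> w" if x: "x \<in> \<sigma>" for x
        proof -
          have "x \<in> v" "y \<in> v" using v(2) x y by auto
          then have V: "u \<V> x \<in> \<V>" "v \<subseteq> u \<V> x" using \<V>'(2) v(1) by simp_all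
          then have xy: "y \<in> u \<V> x" "x \<in> u \<V> x" using \<open>x \<in> v\<close> \<open>y \<in> v\<close> by auto
          then have "u \<V> x \<subseteq> w" using w(2) V(1) by simp
          moreover have "\<xi> (u \<V> x) \<in> u \<V> x" using \<xi>(2)[OF V(1)] xy by auto
          ultimately show ?thesis using xy by auto
        qed
        then show ?thesis using w(1) by blast
      qed
      note small = this
      have null: "\<xi> (u \<V> x) \<in> A" if v: "v \<in> \<V>'" "x \<in> v" "x \<in> A" for v x
      proof -
        have "u \<V> x \<in> \<V>" "v \<subseteq> u \<V> x" using \<V>'(2) v(1,2) by simp_all
        then show ?thesis using v by (intro \<xi>(3)) auto
      qed
      show ?thesis
        unfolding contiguous_def
      proof (intro conjI ballI)
        fix \<sigma> assume "\<sigma> \<in> fst (cover_scale A \<V>')"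
        then show "(\<lambda>x. x) ` \<sigma> \<union> (\<lambda>x. \<xi> (u \<V> x)) ` \<sigma> \<in> fst (cover_scale A \<W>)"
          using small by (cases "\<sigma> = {}") (auto simp: cover_scale_def)
      next
        fix \<sigma> assume \<sigma>: "\<sigma> \<in> snd (cover_scale A \<V>')"
        show "(\<lambda>x. x) ` \<sigma> \<union> (\<lambda>x. \<xi> (u \<V> x)) ` \<sigma> \<in> snd (cover_scale A \<W>)"
        proof (cases "\<sigma> = {}")
          case False
          then obtain v where v: "v \<in> \<V>'" "\<sigma> \<subseteq> v" "\<sigma> \<subseteq> A" using \<sigma> by (auto simp: cover_scale_def)
          have "(\<lambda>x. \<xi> (u \<V> x)) ` \<sigma> \<subseteq> A" using null[OF v(1)] v(2,3) by auto
          then show ?thesis using small[OF v(1,2) False] v(3) by (simp add: cover_scale_def)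
        qed (simp add: cover_scale_def)
      qed
    qed
    have 1: "(\<lambda>xs. c (map (\<lambda>x. \<xi> (u \<V> x)) xs) - c (map (\<lambda>x. x) xs)) \<in> ?B"
      using contiguous_coboundary_at[OF S in_S[OF \<W>(1)] cont \<W>(2)] in_S[OF \<V>'(1)]
      unfolding coboundaries_def by blast
    have 2: "(\<lambda>xs. ?c (map (u \<V>) xs) - c (map (\<lambda>x. \<xi> (u \<V> x)) xs)) \<in> ?B"
    proof -
      have "?c (map (u \<V>) xs) - c (map (\<lambda>x. \<xi> (u \<V> x)) xs) = 0"
        if xs: "length xs = Suc p" "set xs \<in> fst (cover_scale A \<V>')" for xs
      proof -
        obtain x where x: "x \<in> set xs" using xs(1) by (cases xs) auto
        then obtain w where w: "w \<in> \<V>'" "set xs \<subseteq> w" using xs(2) by (auto simp: cover_scale_def)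
        have "map (u \<V>) xs \<in> nerve_simplices p \<V>"
          using \<V>'(2) w x xs(1) by (auto simp: nerve_simplices_def; blast)
        then show ?thesis by (simp add: nerve_restrict_def comp_def)
      qed
      then have "coboundary_at (Suc p) (cover_scale A \<V>') (\<lambda>_. 0)
          (\<lambda>xs. ?c (map (u \<V>) xs) - c (map (\<lambda>x. \<xi> (u \<V> x)) xs))"
        by (simp add: coboundary_at_def)
      then show ?thesis using in_S[OF \<V>'(1)] unfolding coboundaries_def by blast
    qed
    have "cong_mod ?B (\<theta> \<V> (nerve_class p A \<V> ?c)) (\<lambda>xs. ?c (map (u \<V>) xs))" by (rule \<theta>[OF \<V>])
    also have "cong_mod ?B \<dots> (\<lambda>xs. c (map (\<lambda>x. \<xi> (u \<V> x)) xs))" unfolding cong_mod_def by (rule 2)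
    also have "cong_mod ?B \<dots> c" using 1 by (simp add: cong_mod_def)
    finally show "\<exists>\<V>\<in>open_covers X. \<exists>x\<in>carrier (nerve_cohomology p A \<V>). cong_mod ?B (\<theta> \<V> x) c"
      using \<V> c by (auto simp: carrier_nerve_cohomology)
  next
    fix \<U> x assume \<U>: "\<U> \<in> open_covers X" and "x \<in> carrier (nerve_cohomology p A \<U>)" and x: "\<theta> \<U> x \<in> ?B"
    then obtain c where c: "c \<in> cocycle_set p A \<U>" "x = nerve_class p A \<U> c"
      by (auto simp: carrier_nerve_cohomology)
    have "(\<lambda>xs. c (map (u \<U>) xs)) \<in> ?B"
      using cong_mod_mem[OF B \<theta>[OF \<U>, of c]] x c(2) by simp
    then obtain W0 b where W0: "W0 \<in> open_covers X" "coboundary_at (Suc p) (cover_scale A W0) b (\<lambda>xs. c (map (u \<U>) xs))"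
      by (auto simp: coboundaries_def cover_system_def)
    obtain W1 where W1: "W1 \<in> open_covers X" "\<forall>v\<in>W1. \<forall>x\<in>v. u \<U> x \<in> \<U> \<and> v \<subseteq> u \<U> x"
      using u[OF \<U>] by (auto simp: star_choice_def)
    obtain \<W> where \<W>: "\<W> \<in> open_covers X" "\<And>w. w \<in> \<W> \<Longrightarrow> \<exists>v\<in>W0. w \<subseteq> v" "\<And>w. w \<in> \<W> \<Longrightarrow> \<exists>v\<in>W1. w \<subseteq> v"
      by (rule open_covers_refine[OF W0(1) W1(1)]) (rule that)
    obtain \<V> \<xi> where \<V>: "\<V> \<in> open_covers X" and \<xi>: "scale_map (nerve_scale A \<V>) (cover_scale A \<W>) \<xi>"
      "\<And>v. v \<in> \<V> \<Longrightarrow> v \<noteq> {} \<Longrightarrow> \<xi> v \<in> v" "\<And>v. v \<in> \<V> \<Longrightarrow> v \<inter> A \<noteq> {} \<Longrightarrow> \<xi> v \<in> A"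
      and star: "\<And>y. y \<in> topspace X \<Longrightarrow> \<exists>w\<in>\<W>. \<forall>v\<in>\<V>. y \<in> v \<longrightarrow> v \<subseteq> w"
      by (rule point_choice_exists[OF \<W>(1), of A]) (rule that)
    obtain \<V>' where \<V>': "\<V>' \<in> open_covers X" "\<And>v. v \<in> \<V>' \<Longrightarrow> \<exists>v'\<in>\<V>. v \<subseteq> v'" "\<And>v. v \<in> \<V>' \<Longrightarrow> \<exists>u\<in>\<U>. v \<subseteq> u"
      by (rule open_covers_refine[OF \<V> \<U>]) (rule that)
    have "\<forall>v\<in>\<V>'. \<exists>u. u \<in> \<U> \<and> v \<subseteq> u" "\<forall>v\<in>\<V>'. \<exists>v'. v' \<in> \<V> \<and> v \<subseteq> v'" using \<V>'(2,3) by blast+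
    from this[THEN bchoice] obtain \<pi> \<rho> where \<pi>: "\<forall>v\<in>\<V>'. \<pi> v \<in> \<U> \<and> v \<subseteq> \<pi> v" and \<rho>: "\<forall>v\<in>\<V>'. \<rho> v \<in> \<V> \<and> v \<subseteq> \<rho> v"
      by (elim exE) (rule that)
    have ref: "refinement \<U> \<V>' \<pi>" "refinement \<V> \<V>' \<rho>" using \<pi> \<rho> by (auto simp: refinement_def)
    let ?\<xi> = "\<lambda>v. \<xi> (\<rho> v)"
    have "scale_map (nerve_scale A \<V>') (cover_scale A W0) ?\<xi>"
    proof -
      have "scale_map (nerve_scale A \<V>') (cover_scale A \<W>) ?\<xi>"
        using nerve_restrict_refinement[OF ref(2), of A] \<xi>(1) unfolding contiguous_def by (simp add: image_image[symmetric])
      moreover have "fst (cover_scale A \<W>) \<subseteq> fst (cover_scale A W0)" "snd (cover_scale A \<W>) \<subseteq> snd (cover_scale A W0)"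
        using \<W>(2) by (auto simp: cover_scale_def; meson order_trans)+
      ultimately show ?thesis unfolding contiguous_def by blast
    qed
    note 1 = coboundary_at_pullback[OF this W0(2)]
    \<comment> \<open>The class dies in the refinement \<open>\<V>'\<close>: there
      \<open>\<pi>\<close> is contiguous to the map through points and back, along which
      \<open>c\<close> is already a coboundary.\<close>
    have cont: "contiguous (nerve_scale A \<V>') (nerve_scale A \<U>) (\<lambda>v. u \<U> (?\<xi> v)) \<pi>"
    proof -
      have *: "u \<U> (?\<xi> v) \<in> \<U> \<and> \<pi> v \<in> \<U> \<and> y \<in> u \<U> (?\<xi> v) \<and> y \<in> \<pi> v" if v: "v \<in> \<V>'" "y \<in> v" for v y
      proof -
        have y: "y \<in> \<rho> v" "\<rho> v \<in> \<V>" using \<rho> v by auto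
        then have "y \<in> topspace X" using \<V> by (auto simp: open_covers_def)
        from star[OF this] obtain w where w: "w \<in> \<W>" "\<forall>v\<in>\<V>. y \<in> v \<longrightarrow> v \<subseteq> w" ..
        obtain w1 where w1: "w1 \<in> W1" "w \<subseteq> w1" using \<W>(3)[OF w(1)] ..
        have "\<rho> v \<subseteq> w" using w(2) y by simp
        moreover have "?\<xi> v \<in> \<rho> v" using \<xi>(2)[OF y(2)] y(1) by auto
        ultimately have "?\<xi> v \<in> w1" "y \<in> w1" using y(1) w1(2) by auto
        then have "u \<U> (?\<xi> v) \<in> \<U>" "y \<in> u \<U> (?\<xi> v)" using W1(2) w1(1) by auto
        then show ?thesis using \<pi> v by auto
      qed
      then have **: "(\<lambda>v. u \<U> (?\<xi> v)) ` \<sigma> \<union> \<pi> ` \<sigma> \<subseteq> \<U>" "\<Inter>\<sigma> \<subseteq> \<Inter>((\<lambda>v. u \<U> (?\<xi> v)) ` \<sigma> \<union> \<pi> ` \<sigma>)"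
        if "\<sigma> \<subseteq> \<V>'" "\<Inter>\<sigma> \<noteq> {}" for \<sigma>
        using that by blast+
      show ?thesis
        unfolding contiguous_def
      proof (intro conjI ballI)
        fix \<sigma> assume \<sigma>: "\<sigma> \<in> fst (nerve_scale A \<V>')"
        show "(\<lambda>v. u \<U> (?\<xi> v)) ` \<sigma> \<union> \<pi> ` \<sigma> \<in> fst (nerve_scale A \<U>)"
        proof (cases "\<sigma> = {}")
          case False
          then have \<sigma>': "\<sigma> \<subseteq> \<V>'" "\<Inter>\<sigma> \<noteq> {}" using \<sigma> by (auto simp: nerve_scale_def)
          have "\<Inter>((\<lambda>v. u \<U> (?\<xi> v)) ` \<sigma> \<union> \<pi> ` \<sigma>) \<noteq> {}"
            using **(2)[OF \<sigma>'] \<sigma>'(2) by (metis subset_empty)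
          then show ?thesis using **(1)[OF \<sigma>'] unfolding nerve_scale_def fst_conv mem_Collect_eq by (intro conjI disjI2)
        qed (simp add: nerve_scale_def)
      next
        fix \<sigma> assume \<sigma>: "\<sigma> \<in> snd (nerve_scale A \<V>')"
        show "(\<lambda>v. u \<U> (?\<xi> v)) ` \<sigma> \<union> \<pi> ` \<sigma> \<in> snd (nerve_scale A \<U>)"
        proof (cases "\<sigma> = {}")
          case False
          then have \<sigma>': "\<sigma> \<subseteq> \<V>'" "A \<inter> \<Inter>\<sigma> \<noteq> {}" using \<sigma> by (auto simp: nerve_scale_def)
          then have "\<Inter>\<sigma> \<noteq> {}" by (metis inf_bot_right)
          note * = **[OF \<sigma>'(1) this]
          have "A \<inter> \<Inter>\<sigma> \<subseteq> A \<inter> \<Inter>((\<lambda>v. u \<U> (?\<xi> v)) ` \<sigma> \<union> \<pi> ` \<sigma>)"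
            by (rule Int_mono[OF subset_refl *(2)])
          then have "A \<inter> \<Inter>((\<lambda>v. u \<U> (?\<xi> v)) ` \<sigma> \<union> \<pi> ` \<sigma>) \<noteq> {}"
            using \<sigma>'(2) by (metis subset_empty)
          then show ?thesis using *(1) unfolding nerve_scale_def snd_conv mem_Collect_eq by (intro conjI disjI2)
        qed (simp add: nerve_scale_def)
      qed
    qed
    have "coboundary_at (Suc p) (nerve_scale A \<V>') (prism (\<lambda>v. u \<U> (?\<xi> v)) \<pi> c)
        (\<lambda>vs. c (map \<pi> vs) - c (map (\<lambda>v. u \<U> (?\<xi> v)) vs))"
      by (rule contiguous_coboundary_at[OF scale_system_nerve _ cont cocycle_at_nerve_scale[OF c(1)]]) simp
    from coboundary_at_add[OF this 1]
    have "coboundary_at (Suc p) (nerve_scale A \<V>')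
        (\<lambda>vs. prism (\<lambda>v. u \<U> (?\<xi> v)) \<pi> c vs + b (map ?\<xi> vs)) (\<lambda>vs. c (map \<pi> vs))"
      by (simp add: comp_def)
    then have "pullback p \<V>' \<pi> c \<in> coboundary_set p A \<V>'"
      using nerve_restrict_coboundary_set[of p A \<V>'] unfolding nerve_restrict_def pullback_def by metis
    then have one: "nerve_class p A \<V>' (pullback p \<V>' \<pi> c) = \<one>\<^bsub>nerve_cohomology p A \<V>'\<^esub>"
      by (rule nerve_class_eq_one)
    let ?f = "\<lambda>\<eta>. coboundary_set p A \<V>' <#>\<^bsub>cocycle_group p A \<V>'\<^esub> (pullback p \<V>' \<pi> ` \<eta>)"
    have "?f \<in> refinement_maps p A \<U> \<V>'" using ref(1) by (auto simp: refinement_maps_def)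
    moreover have "?f x = \<one>\<^bsub>nerve_cohomology p A \<V>'\<^esub>"
      using refinement_map_coset[OF ref(1) c(1)] one by (simp add: c(2) nerve_class_def)
    ultimately have "\<exists>f\<in>refinement_maps p A \<U> \<V>'. f x = \<one>\<^bsub>nerve_cohomology p A \<V>'\<^esub>" by (intro bexI[of _ ?f])
    then show "\<exists>\<V>\<in>open_covers X. \<exists>f\<in>refinement_maps p A \<U> \<V>. f x = \<one>\<^bsub>nerve_cohomology p A \<V>\<^esub>"
      by (rule bexI[OF _ \<V>'(1)])
  qed
qed

end

section \<open>Subsets of metric spaces\<close>

definition small :: "'a::metric_space set \<Rightarrow> real \<Rightarrow> 'a set set" where
  "small M e = {\<sigma>. \<sigma> \<subseteq> M \<and> (\<forall>x\<in>\<sigma>. \<forall>y\<in>\<sigma>. dist x y < e)}"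

definition near :: "'a::metric_space set \<Rightarrow> real \<Rightarrow> 'a set" where
  "near D e = {x. \<exists>d\<in>D. dist x d < e}"

definition metric_system :: "'a::metric_space set \<Rightarrow> 'a set \<Rightarrow> 'a scale set" where
  "metric_system M D = (\<lambda>e. (small M e, small D e)) ` {0<..}"

definition reduced_system :: "'a::metric_space set \<Rightarrow> 'a scale set" where
  "reduced_system M = (\<lambda>e. (small M e, {})) ` {0<..}"

text \<open>Null sets lie in a shrinking neighbourhood of \<open>D\<close> instead of in
  \<open>D\<close> itself. Cochains that vanish there extend by zero to the collapsed space.\<close>

definition near_system :: "'a::metric_space set \<Rightarrow> 'a set \<Rightarrow> 'a scale set" where
  "near_system M D = (\<lambda>e. (small M e, small (M \<inter> near D e) e)) ` {0<..}"

definition collapsed :: "'a::metric_space set \<Rightarrow> 'a set \<Rightarrow> real \<Rightarrow> 'a option set set" where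
  "collapsed M D e = Pow (insert None (Some ` (M \<inter> near D e)))"

abbreviation pointed_small :: "'a::metric_space set \<Rightarrow> 'a set \<Rightarrow> real \<Rightarrow> 'a option set set" where
  "pointed_small M D e \<equiv> (`) Some ` small M e \<union> collapsed M D e"

text \<open>\<open>pointed_system M D\<close> models the pointed space \<open>M/D\<close>: \<open>None\<close> is the collapsed set \<open>D\<close>, and points near \<open>D\<close> are close to
  it and hence to one another.\<close>

definition pointed_system :: "'a::metric_space set \<Rightarrow> 'a set \<Rightarrow> 'a option scale set" where
  "pointed_system M D = (\<lambda>e. (pointed_small M D e, Pow {None})) ` {0<..}"

text \<open>The intermediate stage between \<open>pointed_system\<close> and
  \<open>near_system\<close>: all points near \<open>D\<close> become null along with the base
  point.\<close>

definition collapsed_system :: "'a::metric_space set \<Rightarrow> 'a set \<Rightarrow> 'a option scale set" where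
  "collapsed_system M D = (\<lambda>e. (pointed_small M D e, collapsed M D e)) ` {0<..}"

lemma small_mono: "e \<le> e' \<Longrightarrow> M \<subseteq> M' \<Longrightarrow> \<sigma> \<in> small M e \<Longrightarrow> \<sigma> \<in> small M' e'"
  by (force simp: small_def)

lemma small_subset: "\<sigma> \<in> small M e \<Longrightarrow> \<tau> \<subseteq> \<sigma> \<Longrightarrow> \<tau> \<in> small M e"
  unfolding small_def by blast

lemma smallD: "\<sigma> \<in> small M e \<Longrightarrow> x \<in> \<sigma> \<Longrightarrow> y \<in> \<sigma> \<Longrightarrow> dist x y < e" "\<sigma> \<in> small M e \<Longrightarrow> \<sigma> \<subseteq> M"
  by (auto simp: small_def)

lemma near_mono: "e \<le> e' \<Longrightarrow> near D e \<subseteq> near D e'"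
  by (force simp: near_def)

lemma near_self: "0 < e \<Longrightarrow> D \<subseteq> near D e"
  by (force simp: near_def)

lemma near_step: "x \<in> near D e \<Longrightarrow> dist y x < e' \<Longrightarrow> y \<in> near D (e' + e)"
proof -
  assume "x \<in> near D e" "dist y x < e'"
  then obtain d where "d \<in> D" "dist x d < e" by (auto simp: near_def)
  then show ?thesis using dist_triangle[of y d x] \<open>dist y x < e'\<close> by (auto simp: near_def intro!: bexI[of _ d])
qed

lemma collapsed_mono: "e \<le> e' \<Longrightarrow> \<sigma> \<in> collapsed M D e \<Longrightarrow> \<sigma> \<in> collapsed M D e'"
  using near_mono[of e e' D] unfolding collapsed_def by blast

lemma scale_system_metricI:
  fixes f :: "real \<Rightarrow> 'a set set" and g :: "real \<Rightarrow> 'a set set"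
  assumes "\<And>e \<sigma> \<tau>. \<sigma> \<in> f e \<Longrightarrow> \<tau> \<subseteq> \<sigma> \<Longrightarrow> \<tau> \<in> f e" "\<And>e \<sigma> \<tau>. \<sigma> \<in> g e \<Longrightarrow> \<tau> \<subseteq> \<sigma> \<Longrightarrow> \<tau> \<in> g e"
    "\<And>e. 0 < e \<Longrightarrow> g e \<subseteq> f e" "\<And>d e. 0 < d \<Longrightarrow> d \<le> e \<Longrightarrow> f d \<subseteq> f e" "\<And>d e. 0 < d \<Longrightarrow> d \<le> e \<Longrightarrow> g d \<subseteq> g e"
  shows "scale_system ((\<lambda>e. (f e, g e)) ` {0<..})"
  unfolding scale_system_def
proof (intro conjI ballI)
  show "(\<lambda>e. (f e, g e)) ` {0::real<..} \<noteq> {}" by (auto intro: exI[of _ 1])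
next
  fix p q assume "p \<in> (\<lambda>e. (f e, g e)) ` {0::real<..}" "q \<in> (\<lambda>e. (f e, g e)) ` {0::real<..}"
  then obtain d e where *: "0 < d" "p = (f d, g d)" "0 < e" "q = (f e, g e)" by auto
  show "\<exists>r\<in>(\<lambda>e. (f e, g e)) ` {0<..}. fst r \<subseteq> fst p \<inter> fst q \<and> snd r \<subseteq> snd p \<inter> snd q"
    using * assms(4,5)[of "min d e"] by (intro bexI[of _ "(f (min d e), g (min d e))"]) auto
next
  fix p \<sigma> assume "p \<in> (\<lambda>e. (f e, g e)) ` {0::real<..}"
  then obtain e where "0 < e" "p = (f e, g e)" by auto
  then show "snd p \<subseteq> fst p" "\<sigma> \<in> fst p \<Longrightarrow> \<forall>\<tau>\<subseteq>\<sigma>. \<tau> \<in> fst p" "\<sigma> \<in> snd p \<Longrightarrow> \<forall>\<tau>\<subseteq>\<sigma>. \<tau> \<in> snd p"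
    using assms(1,2) assms(3)[of e] by auto
qed

lemma scale_system_metric: "D \<subseteq> M \<Longrightarrow> scale_system (metric_system M D)"
  unfolding metric_system_def
  by (rule scale_system_metricI) (auto intro: small_mono small_subset)

lemma scale_system_reduced: "scale_system (reduced_system M)"
  unfolding reduced_system_def
  by (rule scale_system_metricI) (auto intro: small_mono small_subset)

lemma scale_system_near: "scale_system (near_system M D)"
  unfolding near_system_def
proof (rule scale_system_metricI)
  fix d e :: real assume "d \<le> e"
  then show "small (M \<inter> near D d) d \<subseteq> small (M \<inter> near D e) e"
    using near_mono[of d e D] small_mono[of d e "M \<inter> near D d" "M \<inter> near D e"] by blast
qed (auto intro: small_mono small_subset)

lemma image_Some_small_subset:
  assumes "\<sigma> \<in> pointed_small M D e" "\<tau> \<subseteq> \<sigma>"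
  shows "\<tau> \<in> pointed_small M D e"
proof (cases "\<sigma> \<in> collapsed M D e")
  case False
  then obtain \<sigma>' where \<sigma>': "\<sigma>' \<in> small M e" "\<sigma> = Some ` \<sigma>'" using assms(1) by blast
  then obtain \<tau>' where "\<tau>' \<subseteq> \<sigma>'" "\<tau> = Some ` \<tau>'" using assms(2) by (meson subset_imageE)
  then show ?thesis using small_subset[OF \<sigma>'(1)] by blast
qed (use assms(2) in \<open>auto simp: collapsed_def\<close>)

lemma scale_system_pointed: "scale_system (pointed_system M D)"
  unfolding pointed_system_def
proof (rule scale_system_metricI)
  fix e and \<sigma> \<tau> :: "'a option set" assume "\<sigma> \<in> pointed_small M D e" "\<tau> \<subseteq> \<sigma>"
  then show "\<tau> \<in> pointed_small M D e" by (rule image_Some_small_subset)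
next
  fix d e :: real assume "d \<le> e"
  then show "pointed_small M D d \<subseteq> pointed_small M D e"
    using small_mono[of d e M M] collapsed_mono[of d e _ M D] by blast
qed (auto simp: collapsed_def)

lemma scale_system_collapsed: "scale_system (collapsed_system M D)"
  unfolding collapsed_system_def
proof (rule scale_system_metricI)
  fix e and \<sigma> \<tau> :: "'a option set" assume "\<sigma> \<in> pointed_small M D e" "\<tau> \<subseteq> \<sigma>"
  then show "\<tau> \<in> pointed_small M D e" by (rule image_Some_small_subset)
next
  fix d e :: real assume "d \<le> e"
  then show "pointed_small M D d \<subseteq> pointed_small M D e"
    "collapsed M D d \<subseteq> collapsed M D e"
    using small_mono[of d e M M] collapsed_mono[of d e _ M D] by blast+
qed (auto simp: collapsed_def)

section \<open>Cofinal systems and compact metric spaces\<close>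

text \<open>Such systems have the same cocycles and the same coboundaries as sets, not only the same
  ranks.\<close>

lemma hrank_cofinal:
  assumes "\<And>q. q \<in> T \<Longrightarrow> \<exists>p\<in>S. fst p \<subseteq> fst q \<and> snd p \<subseteq> snd q"
    and "\<And>p. p \<in> S \<Longrightarrow> \<exists>q\<in>T. fst q \<subseteq> fst p \<and> snd q \<subseteq> snd p"
  shows "hrank m S = hrank m T"
proof -
  have "cocycles m S \<subseteq> cocycles m T" if "\<And>p. p \<in> S \<Longrightarrow> \<exists>q\<in>T. fst q \<subseteq> fst p \<and> snd q \<subseteq> snd p"
    for S T :: "'a scale set" unfolding cocycles_def using that cocycle_at_mono by blast
  moreover have "coboundaries m S \<subseteq> coboundaries m T" if "\<And>p. p \<in> S \<Longrightarrow> \<exists>q\<in>T. fst q \<subseteq> fst p \<and> snd q \<subseteq> snd p"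
    for S T :: "'a scale set" unfolding coboundaries_def using that coboundary_at_mono by blast
  ultimately show ?thesis unfolding hrank_def using assms by (metis subset_antisym)
qed

lemma open_cover_small:
  assumes M: "compact M" and W: "W \<in> open_covers (top_of_set M)"
  obtains e where "0 < e" "\<And>\<sigma>. \<sigma> \<in> small M e \<Longrightarrow> \<sigma> = {} \<or> (\<exists>w\<in>W. \<sigma> \<subseteq> w)"
proof -
  let ?G = "{T. open T \<and> M \<inter> T \<in> W}"
  have sub: "M \<subseteq> \<Union>?G"
  proof
    fix x assume "x \<in> M"
    then obtain w where w: "w \<in> W" "x \<in> w" using W unfolding open_covers_def by auto
    then have "openin (top_of_set M) w" using W by (auto simp: open_covers_def)
    then obtain T where "open T" "w = M \<inter> T" by (auto simp: openin_open)
    then show "x \<in> \<Union>?G" using w by auto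
  qed
  have op: "open G" if "G \<in> ?G" for G using that by simp
  obtain e where e: "0 < e" "\<And>x. x \<in> M \<Longrightarrow> \<exists>G\<in>?G. ball x e \<subseteq> G"
    by (rule Heine_Borel_lemma[OF M sub op], assumption) (rule that)
  have "\<sigma> = {} \<or> (\<exists>w\<in>W. \<sigma> \<subseteq> w)" if \<sigma>: "\<sigma> \<in> small M e" for \<sigma>
  proof (cases "\<sigma> = {}")
    case False
    then obtain x where x: "x \<in> \<sigma>" by blast
    then have "x \<in> M" using smallD(2)[OF \<sigma>] by blast
    from e(2)[OF this] obtain G where "G \<in> ?G" "ball x e \<subseteq> G" ..
    moreover have "\<sigma> \<subseteq> M \<inter> ball x e" using smallD[OF \<sigma>] x by auto
    ultimately have "M \<inter> G \<in> W" "\<sigma> \<subseteq> M \<inter> G" by auto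
    then show ?thesis by (intro disjI2 bexI)
  qed simp
  then show ?thesis by (rule that[OF e(1)])
qed

text \<open>Balls of radius \<open>e/2\<close> form a cover whose members contain only pairs at
  distance less than \<open>e\<close>; conversely, a Lebesgue number makes small sets subordinate to
  a given cover.\<close>

lemma cover_system_compact_metric:
  assumes M: "compact M"
  shows "hrank m (cover_system (top_of_set M) {}) = hrank m (metric_system M {})"
proof (rule hrank_cofinal)
  fix q assume "q \<in> metric_system M {}"
  then obtain e where e: "0 < e" "q = (small M e, small {} e)" by (auto simp: metric_system_def)
  let ?W = "(\<lambda>x. M \<inter> ball x (e/2)) ` M"
  have "?W \<in> open_covers (top_of_set M)"
    using e(1) by (auto simp: open_covers_def)
  moreover have "fst (cover_scale {} ?W) \<subseteq> fst q"
  proof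
    fix \<sigma> assume \<sigma>: "\<sigma> \<in> fst (cover_scale {} ?W)"
    show "\<sigma> \<in> fst q"
    proof (cases "\<sigma> = {}")
      case False
      then obtain x where x: "\<sigma> \<subseteq> M \<inter> ball x (e/2)" using \<sigma> by (auto simp: cover_scale_def)
      have "dist y z < e" if "y \<in> \<sigma>" "z \<in> \<sigma>" for y z
      proof -
        have "dist x y < e/2" "dist x z < e/2" using that x by auto
        then show ?thesis by (rule dist_triangle_half_r)
      qed
      then show ?thesis using x by (auto simp: e(2) small_def)
    qed (simp add: e(2) small_def)
  qed
  moreover have "snd (cover_scale {} ?W) \<subseteq> snd q" by (auto simp: e(2) cover_scale_def small_def)
  ultimately show "\<exists>p\<in>cover_system (top_of_set M) {}. fst p \<subseteq> fst q \<and> snd p \<subseteq> snd q"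
    unfolding cover_system_def by blast
next
  fix p assume "p \<in> cover_system (top_of_set M) {}"
  then obtain W where W: "W \<in> open_covers (top_of_set M)" "p = cover_scale {} W"
    by (auto simp: cover_system_def)
  obtain e where e: "0 < e" "\<And>\<sigma>. \<sigma> \<in> small M e \<Longrightarrow> \<sigma> = {} \<or> (\<exists>w\<in>W. \<sigma> \<subseteq> w)"
    by (rule open_cover_small[OF M W(1)]) (rule that)
  have "small M e \<subseteq> fst p" "small {} e \<subseteq> snd p"
    using e(2) by (auto simp: W(2) cover_scale_def small_def[of "{}"])
  then show "\<exists>q\<in>metric_system M {}. fst q \<subseteq> fst p \<and> snd q \<subseteq> snd p"
    using e(1) by (auto simp: metric_system_def)
qed

section \<open>The collapsed space M/D and the pair (M, D)\<close>

text \<open>The approximate inverse sends the points near \<open>D\<close> to the base point. It is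
  contiguous to the identity because points near \<open>D\<close> count as close to
  \<open>None\<close>.\<close>

lemma collapsed_system_pointed: "hrank m (pointed_system M D) = hrank m (collapsed_system M D)"
proof (rule hrank_approximate_equivalence[where i = "\<lambda>x. x", OF scale_system_pointed scale_system_collapsed])
  fix q assume "q \<in> collapsed_system M D"
  then obtain e where "0 < e" "q = (pointed_small M D e, collapsed M D e)"
    by (auto simp: collapsed_system_def)
  then show "\<exists>p\<in>pointed_system M D. scale_map p q (\<lambda>x. x)"
    by (intro bexI[of _ "(pointed_small M D e, Pow {None})"])
       (auto simp: pointed_system_def contiguous_def collapsed_def)
next
  fix p q assume "p \<in> pointed_system M D" "q \<in> collapsed_system M D"
  then obtain d e where d: "0 < d" "p = (pointed_small M D d, Pow {None})"
    and e: "0 < e" "q = (pointed_small M D e, collapsed M D e)"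
    by (auto simp: collapsed_system_def pointed_system_def)
  \<comment> \<open>Half of the scale: a set of size \<open>t\<close> which meets the neighbourhood
    of radius \<open>t\<close> of \<open>D\<close> lies in the one of radius
    \<open>t + t\<close>.\<close>
  define t where "t = min d e / 2"
  have t: "0 < t" "t + t \<le> d" "t + t \<le> e" "t \<le> d" "t \<le> e" using d(1) e(1) by (auto simp: t_def)
  define r :: "'a option \<Rightarrow> 'a option" where "r y = (if y \<in> Some ` near D t then None else y)" for y
  let ?s = "pointed_small M D t"
  let ?q = "(?s, collapsed M D t)" and ?p = "(?s, Pow {None :: 'a option})"
  have r_null: "\<sigma> \<union> r ` \<sigma> \<in> collapsed M D t" "r ` \<sigma> \<subseteq> {None}" if "\<sigma> \<in> collapsed M D t" for \<sigma>
    using that by (auto simp: collapsed_def r_def)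
  have r_small: "\<sigma> \<union> r ` \<sigma> \<in> pointed_small M D a" if \<sigma>: "\<sigma> \<in> ?s" and a: "t + t \<le> a" for \<sigma> a
  proof (cases "\<sigma> \<in> collapsed M D t")
    case True
    have "t \<le> a" using a t(1) by simp
    then show ?thesis by (intro UnI2 collapsed_mono[OF _ r_null(1)[OF True]])
  next
    case False
    then obtain \<tau> where \<tau>: "\<tau> \<in> small M t" "\<sigma> = Some ` \<tau>" using \<sigma> by blast
    show ?thesis
    proof (cases "\<tau> \<inter> near D t = {}")
      case True
      then have "r ` \<sigma> = \<sigma>" by (force simp: \<tau>(2) r_def)
      then show ?thesis using \<tau> small_mono[OF _ _ \<tau>(1), of a M] a t(1) by auto
    next
      case False
      then obtain x where x: "x \<in> \<tau>" "x \<in> near D t" by blast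
      have "\<tau> \<subseteq> M \<inter> near D a"
        using near_step[OF x(2)] smallD[OF \<tau>(1)] x(1) near_mono[OF a] by blast
      then have "\<sigma> \<union> r ` \<sigma> \<in> collapsed M D a" by (auto simp: \<tau>(2) r_def collapsed_def)
      then show ?thesis by blast
    qed
  qed
  have 1: "scale_map ?q p r"
    unfolding contiguous_def d(2) fst_conv snd_conv Un_absorb
  proof (intro conjI ballI)
    fix \<sigma> assume "\<sigma> \<in> ?s"
    from image_Some_small_subset[OF r_small[OF this t(2)] Un_upper2]
    show "r ` \<sigma> \<in> pointed_small M D d" .
  qed (use r_null(2) in simp)
  have 2: "contiguous ?q q (\<lambda>x. x) (\<lambda>x. r x)"
    unfolding contiguous_def e(2) fst_conv snd_conv image_ident
    by (intro conjI ballI r_small[OF _ t(3)] collapsed_mono[OF t(5) r_null(1)])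
  have 3: "contiguous ?p p (\<lambda>x. x) (\<lambda>x. r x)"
    unfolding contiguous_def d(2) fst_conv snd_conv image_ident
    by (intro conjI ballI r_small[OF _ t(2)]) (auto simp: r_def)
  have "?q \<in> collapsed_system M D" "?p \<in> pointed_system M D"
    using t(1) by (auto simp: collapsed_system_def pointed_system_def)
  then show "approximate_inverse (pointed_system M D) (collapsed_system M D) (\<lambda>x. x) p q"
    by (rule approximate_inverseI[where i = "\<lambda>x. x", OF _ _ 1 contiguous_imp_homotopic[OF 2] contiguous_imp_homotopic[OF 3]])
qed

text \<open>Excision: cochains on the collapsed system are cochains on \<open>M\<close> extended by zero.\<close>

lemma collapsed_system_near: "hrank m (collapsed_system M D) = hrank m (near_system M D)"
proof -
  let ?F = "\<lambda>c xs. c (map Some xs)"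
  \<comment> \<open>A list containing both \<open>None\<close> and a point away from
    \<open>D\<close> is never small, so the undefined value \<open>the None\<close> has no
    influence.\<close>
  define ext :: "real \<Rightarrow> ('a list \<Rightarrow> int) \<Rightarrow> 'a option list \<Rightarrow> int"
    where "ext e c = (\<lambda>xs. if set xs \<subseteq> insert None (Some ` near D e) then 0 else c (map the xs))" for e c
  let ?s = "\<lambda>e. pointed_small M D e"
  have map: "scale_map (small M e, small (M \<inter> near D e) e) (?s e, collapsed M D e) Some" for e
    by (auto simp: contiguous_def collapsed_def small_def)
  have ext_null: "ext e c xs = 0" if "set xs \<in> collapsed M D e" for e c xs
    using that by (auto simp: ext_def collapsed_def)
  have ext_Some: "ext e c (map Some ys) = c ys"
    if "set ys \<in> small M e" "set ys \<in> small (M \<inter> near D e) e \<Longrightarrow> c ys = 0" for e c ys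
  proof -
    have "Some ` set ys \<subseteq> insert None (Some ` near D e) \<longleftrightarrow> set ys \<subseteq> near D e" by auto
    then show ?thesis using that by (auto simp: ext_def comp_def small_def)
  qed
  have cobd_ext: "cobd (ext e c) (map Some ys) = cobd c ys"
    if "set ys \<in> small M e"
      "\<And>zs. Suc (length zs) = length ys \<Longrightarrow> set zs \<in> small (M \<inter> near D e) e \<Longrightarrow> c zs = 0" for e c ys
  proof -
    have "cobd (ext e c) (map Some ys) = cobd (\<lambda>zs. ext e c (map Some zs)) ys" by (simp add: cobd_map)
    also have "\<dots> = cobd c ys"
    proof (rule cobd_cong)
      fix zs assume zs: "Suc (length zs) = length ys" "set zs \<subseteq> set ys"
      show "ext e c (map Some zs) = c zs"
        by (rule ext_Some[OF small_subset[OF that(1) zs(2)]]) (use that(2) zs(1) in auto)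
    qed
    finally show ?thesis .
  qed
  have cobd_ext_null: "cobd (ext e c) xs = 0" if "set xs \<in> collapsed M D e" for e c xs
    by (rule cobd_eq_0) (use that in \<open>auto simp: collapsed_def ext_def\<close>)
  have cases: "set xs \<in> collapsed M D e \<or> (\<exists>ys. xs = map Some ys \<and> set ys \<in> small M e)" if xs: "set xs \<in> ?s e" for xs e
  proof (cases "set xs \<in> collapsed M D e")
    case False
    then obtain \<tau> where "\<tau> \<in> small M e" "set xs = Some ` \<tau>" using xs by blast
    moreover have "map Some (map the xs) = xs"
      using calculation(2) by (auto intro!: map_idI)
    moreover have "set (map the xs) = \<tau>" using calculation(2) by (simp add: image_image)
    ultimately show ?thesis by metis
  qed simp
  show ?thesis
    unfolding hrank_def
  proof (rule quotient_rank_iso[where F = ?F])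
  show "additive_map ?F" by (simp add: additive_map_def)
  show "additive_group (cocycles m (collapsed_system M D))" "additive_group (coboundaries m (near_system M D))"
    by (rule additive_group_cocycles[OF scale_system_collapsed] additive_group_coboundaries[OF scale_system_near])+
  show "?F c \<in> cocycles m (near_system M D)" if c: "c \<in> cocycles m (collapsed_system M D)" for c
  proof -
    obtain e where "0 < e" "cocycle_at m (?s e, collapsed M D e) c"
      using c by (auto simp: cocycles_def collapsed_system_def)
    then show ?thesis using cocycle_at_pullback[OF map] by (auto simp: cocycles_def near_system_def)
  qed
  show "?F c \<in> coboundaries m (near_system M D)" if c: "c \<in> coboundaries m (collapsed_system M D)" for c
  proof -
    obtain e b where e: "0 < e" "coboundary_at m (?s e, collapsed M D e) b c"
      using c by (auto simp: coboundaries_def collapsed_system_def)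
    from coboundary_at_pullback[OF map e(2)] show ?thesis using e(1) unfolding coboundaries_def near_system_def by blast
  qed
next
  fix c assume "c \<in> cocycles m (collapsed_system M D)" "(\<lambda>xs. c (map Some xs)) \<in> coboundaries m (near_system M D)"
  then obtain e0 e1 b where e0: "0 < e0" "cocycle_at m (?s e0, collapsed M D e0) c"
    and e1: "0 < e1" "coboundary_at m (small M e1, small (M \<inter> near D e1) e1) b (\<lambda>xs. c (map Some xs))"
    by (auto simp: cocycles_def coboundaries_def collapsed_system_def near_system_def)
  define e where "e = min e0 e1"
  have e: "0 < e" "e \<le> e0" "e \<le> e1" using e0(1) e1(1) by (auto simp: e_def)
  have "coboundary_at m (?s e, collapsed M D e) (ext e b) c"
    unfolding coboundary_at_def
  proof (intro conjI allI impI)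
    fix xs assume xs: "length xs = m" "set xs \<in> fst (?s e, collapsed M D e)"
    show "c xs = cobd (ext e b) xs"
    proof (cases "set xs \<in> collapsed M D e")
      case True
      then have "set xs \<in> collapsed M D e0" using collapsed_mono e(2) by blast
      then show ?thesis using cobd_ext_null[OF True] e0(2) xs(1) by (simp add: cocycle_at_def)
    next
      case False
      then have "\<exists>ys. xs = map Some ys \<and> set ys \<in> small M e" using cases[of xs e] xs(2) by simp
      then obtain ys where ys: "xs = map Some ys" "set ys \<in> small M e" by blast
      have "b zs = 0" if "Suc (length zs) = length ys" "set zs \<in> small (M \<inter> near D e) e" for zs
      proof -
        have "set zs \<in> small (M \<inter> near D e1) e1"
          using small_mono[OF e(3) _ that(2)] near_mono[OF e(3)] by blast
        then show ?thesis using e1(2) that(1) ys(1) xs(1) by (simp add: coboundary_at_def)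
      qed
      then have "cobd (ext e b) xs = cobd b ys" unfolding ys(1) by (rule cobd_ext[OF ys(2)])
      moreover have "c xs = cobd b ys"
        using e1(2) small_mono[OF e(3) subset_refl ys(2)] ys(1) xs(1) by (simp add: coboundary_at_def)
      ultimately show ?thesis by simp
    qed
  qed (simp add: ext_null)
  then show "c \<in> coboundaries m (collapsed_system M D)"
    using e(1) by (auto simp: coboundaries_def collapsed_system_def)
next
  fix c assume "c \<in> cocycles m (near_system M D)"
  then obtain e where e: "0 < e" "cocycle_at m (small M e, small (M \<inter> near D e) e) c"
    by (auto simp: cocycles_def near_system_def)
  have "cocycle_at m (?s e, collapsed M D e) (ext e c)"
    unfolding cocycle_at_def
  proof (intro conjI allI impI)
    fix xs assume xs: "length xs = Suc m" "set xs \<in> fst (?s e, collapsed M D e)"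
    show "cobd (ext e c) xs = 0"
    proof (cases "set xs \<in> collapsed M D e")
      case False
      then have "\<exists>ys. xs = map Some ys \<and> set ys \<in> small M e" using cases[of xs e] xs(2) by simp
      then obtain ys where ys: "xs = map Some ys" "set ys \<in> small M e" by blast
      have "cobd (ext e c) xs = cobd c ys" unfolding ys(1)
        by (rule cobd_ext[OF ys(2)]) (use e(2) ys(1) xs(1) in \<open>simp add: cocycle_at_def\<close>)
      then show ?thesis using e(2) ys xs(1) by (simp add: cocycle_at_def)
    qed (rule cobd_ext_null)
  qed (simp add: ext_null)
  then have "ext e c \<in> cocycles m (collapsed_system M D)"
    using e(1) by (auto simp: cocycles_def collapsed_system_def)
  moreover have "coboundary_at m (small M e, small (M \<inter> near D e) e) (\<lambda>_. 0) (\<lambda>x. ext e c (map Some x) - c x)"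
    using ext_Some e(2) by (simp add: coboundary_at_def cocycle_at_def)
  then have "(\<lambda>x. ext e c (map Some x) - c x) \<in> coboundaries m (near_system M D)"
    using e(1) by (auto simp: coboundaries_def near_system_def)
  ultimately show "\<exists>f\<in>cocycles m (collapsed_system M D). (\<lambda>x. f (map Some x) - c x) \<in> coboundaries m (near_system M D)"
    by blast
  qed
qed

text \<open>Points within \<open>t\<close> of \<open>D\<close> are moved into \<open>D\<close>, all
  others stay. The displacement is below the scale, so this discontinuous map is contiguous to the
  identity.\<close>

lemma near_system_metric:
  assumes D: "D \<subseteq> M"
  shows "hrank m (metric_system M D) = hrank m (near_system M D)"
proof (rule hrank_approximate_equivalence[where i = "\<lambda>x. x", OF scale_system_metric[OF D] scale_system_near])
  fix q assume "q \<in> near_system M D"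
  then obtain e where e: "0 < e" "q = (small M e, small (M \<inter> near D e) e)"
    by (auto simp: near_system_def)
  have "small D e \<subseteq> small (M \<inter> near D e) e"
    using small_mono[OF order_refl, of D "M \<inter> near D e"] near_self[OF e(1), of D] D by blast
  then show "\<exists>p\<in>metric_system M D. scale_map p q (\<lambda>x. x)"
    using e by (intro bexI[of _ "(small M e, small D e)"]) (auto simp: metric_system_def contiguous_def)
next
  fix p q assume "p \<in> metric_system M D" "q \<in> near_system M D"
  then obtain d e where d: "0 < d" "p = (small M d, small D d)"
    and e: "0 < e" "q = (small M e, small (M \<inter> near D e) e)"
    by (auto simp: near_system_def metric_system_def)
  \<comment> \<open>The distance of two moved points is estimated by three terms, each below
    \<open>t\<close>.\<close>
  define t where "t = min d e / 3"
  have t: "0 < t" "t + t + t \<le> d" "t + t + t \<le> e" using d(1) e(1) by (auto simp: t_def)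
  define r where "r x = (if x \<in> near D t then SOME y. y \<in> D \<and> dist x y < t else x)" for x
  have r_near: "r x \<in> D \<and> dist x (r x) < t" if "x \<in> near D t" for x
  proof -
    have "\<exists>y. y \<in> D \<and> dist x y < t" using that by (auto simp: near_def)
    from someI_ex[OF this] show ?thesis using that by (simp add: r_def)
  qed
  have r_dist: "dist x (r x) < t" for x using r_near[of x] t(1) by (cases "x \<in> near D t") (auto simp: r_def)
  have r_M: "r x \<in> M" if "x \<in> M" for x using r_near[of x] that D by (cases "x \<in> near D t") (auto simp: r_def)
  have small_Un: "\<sigma> \<union> r ` \<sigma> \<in> small N a" if \<sigma>: "\<sigma> \<in> small M t" and a: "t + t + t \<le> a" and N: "\<sigma> \<union> r ` \<sigma> \<subseteq> N" for \<sigma> a N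
  proof -
    have *: "dist x y < a \<and> dist x (r y) < a \<and> dist (r x) y < a \<and> dist (r x) (r y) < a" if "x \<in> \<sigma>" "y \<in> \<sigma>" for x y
    proof -
      have "dist x y < t" using smallD(1)[OF \<sigma>] that by blast
      moreover note r_dist[of x] r_dist[of y]
      moreover have "dist x (r y) \<le> dist x y + dist y (r y)" "dist (r x) y \<le> dist x (r x) + dist x y"
        "dist (r x) (r y) \<le> dist x (r x) + dist x (r y)"
        by (rule dist_triangle dist_triangle3)+
      ultimately show ?thesis using a t(1) by linarith
    qed
    then show ?thesis using N by (auto simp: small_def)
  qed
  let ?q = "(small M t, small (M \<inter> near D t) t)" and ?p = "(small M t, small D t)"
  have 1: "scale_map ?q p r"
    unfolding contiguous_def d(2) fst_conv snd_conv Un_absorb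
  proof (intro conjI ballI)
    fix \<sigma> assume \<sigma>: "\<sigma> \<in> small M t"
    have "\<sigma> \<union> r ` \<sigma> \<in> small M d" using r_M smallD(2)[OF \<sigma>] by (intro small_Un[OF \<sigma> t(2)]) auto
    then show "r ` \<sigma> \<in> small M d" by (rule small_subset) auto
  next
    fix \<sigma> assume \<sigma>: "\<sigma> \<in> small (M \<inter> near D t) t"
    then have \<sigma>': "\<sigma> \<in> small M t" using small_mono by blast
    have "\<sigma> \<union> r ` \<sigma> \<in> small M d" using r_M smallD(2)[OF \<sigma>'] by (intro small_Un[OF \<sigma>' t(2)]) auto
    moreover have "r ` \<sigma> \<subseteq> D" using smallD(2)[OF \<sigma>] r_near by blast
    ultimately show "r ` \<sigma> \<in> small D d" by (auto simp: small_def)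
  qed
  have 2: "contiguous ?q q (\<lambda>x. x) (\<lambda>x. r x)"
    unfolding contiguous_def e(2) fst_conv snd_conv image_ident
  proof (intro conjI ballI)
    fix \<sigma> assume \<sigma>: "\<sigma> \<in> small M t"
    show "\<sigma> \<union> r ` \<sigma> \<in> small M e" using r_M smallD(2)[OF \<sigma>] by (intro small_Un[OF \<sigma> t(3)]) auto
  next
    fix \<sigma> assume \<sigma>: "\<sigma> \<in> small (M \<inter> near D t) t"
    then have \<sigma>': "\<sigma> \<in> small M t" using small_mono by blast
    have "near D t \<subseteq> near D e" "D \<subseteq> near D e" using near_mono[of t e D] near_self[of e D] t e(1) by auto
    then have "\<sigma> \<union> r ` \<sigma> \<subseteq> M \<inter> near D e" using smallD(2)[OF \<sigma>] r_near r_M by blast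
    then show "\<sigma> \<union> r ` \<sigma> \<in> small (M \<inter> near D e) e" by (rule small_Un[OF \<sigma>' t(3)])
  qed
  have 3: "contiguous ?p p (\<lambda>x. x) (\<lambda>x. r x)"
    unfolding contiguous_def d(2) fst_conv snd_conv image_ident
  proof (intro conjI ballI)
    fix \<sigma> assume \<sigma>: "\<sigma> \<in> small M t"
    show "\<sigma> \<union> r ` \<sigma> \<in> small M d" using r_M smallD(2)[OF \<sigma>] by (intro small_Un[OF \<sigma> t(2)]) auto
  next
    fix \<sigma> assume \<sigma>: "\<sigma> \<in> small D t"
    then have \<sigma>': "\<sigma> \<in> small M t" using small_mono D by blast
    show "\<sigma> \<union> r ` \<sigma> \<in> small D d"
      using smallD(2)[OF \<sigma>] r_near near_self[OF t(1), of D] by (intro small_Un[OF \<sigma>' t(2)]) blast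
  qed
  have "?q \<in> near_system M D" "?p \<in> metric_system M D"
    using t(1) by (auto simp: near_system_def metric_system_def)
  then show "approximate_inverse (metric_system M D) (near_system M D) (\<lambda>x. x) p q"
    by (rule approximate_inverseI[where i = "\<lambda>x. x", OF _ _ 1 contiguous_imp_homotopic[OF 2] contiguous_imp_homotopic[OF 3]])
qed

theorem hrank_pointed_system: "D \<subseteq> M \<Longrightarrow> hrank m (pointed_system M D) = hrank m (metric_system M D)"
  using collapsed_system_pointed collapsed_system_near near_system_metric by metis

section \<open>The exact sequence of a pair and reduced cohomology\<close>

lemma cocycles_metric_iff:
  "c \<in> cocycles m (metric_system M D) \<longleftrightarrow> (\<exists>e>0. cocycle_at m (small M e, small D e) c)"
  by (auto simp: cocycles_def metric_system_def)

lemma coboundaries_metric_iff: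
  "c \<in> coboundaries m (metric_system M D) \<longleftrightarrow> (\<exists>e>0. \<exists>b. coboundary_at m (small M e, small D e) b c)"
  by (auto simp: coboundaries_def metric_system_def)

lemma cocycles_reduced_iff:
  "c \<in> cocycles m (reduced_system M) \<longleftrightarrow> (\<exists>e>0. cocycle_at m (small M e, {}) c)"
  by (auto simp: cocycles_def reduced_system_def)

lemma coboundaries_reduced_iff:
  "c \<in> coboundaries m (reduced_system M) \<longleftrightarrow> (\<exists>e>0. \<exists>b. coboundary_at m (small M e, {}) b c)"
  by (auto simp: coboundaries_def reduced_system_def)

lemma small_empty_iff [simp]: "\<sigma> \<in> small {} e \<longleftrightarrow> \<sigma> = {}"
  by (auto simp: small_def)

lemma empty_small [simp]: "{} \<in> small M e"
  by (auto simp: small_def)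

text \<open>The value \<open>m = 0\<close> stands for degree -1, where the condition forces
  \<open>M\<close> to be nonempty.\<close>

definition acyclic_set :: "'a::metric_space set \<Rightarrow> bool" where
  "acyclic_set M \<longleftrightarrow> (\<forall>m. cocycles m (reduced_system M) \<subseteq> coboundaries m (reduced_system M))"

text \<open>The isomorphism is the connecting homomorphism of the pair \<open>(M, D)\<close>: extend a cochain from \<open>D\<close> to \<open>M\<close> by zero and
  take the coboundary.\<close>

theorem hrank_pair_acyclic:
  fixes M :: "'a::metric_space set"
  assumes M: "acyclic_set M" and D: "D \<subseteq> M"
  shows "hrank (Suc m) (metric_system M D) = hrank m (reduced_system D)"
proof -
  define ext :: "('a list \<Rightarrow> int) \<Rightarrow> 'a list \<Rightarrow> int" where "ext c = (\<lambda>xs. if set xs \<subseteq> D then c xs else 0)" for c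
  let ?F = "\<lambda>c. cobd (ext c)"
  have ext_D: "ext c xs = c xs" if "set xs \<subseteq> D" for c xs using that by (simp add: ext_def)
  have cobd_ext: "cobd (ext c) xs = cobd c xs" if "set xs \<subseteq> D" for c xs
    using that by (intro cobd_cong) (auto simp: ext_def)
  have sub: "small D e' \<subseteq> small M e" if "e' \<le> e" for e e' using small_mono[OF that D] by blast
  have "quotient_rank (cocycles m (reduced_system D)) (coboundaries m (reduced_system D)) =
      quotient_rank (cocycles (Suc m) (metric_system M D)) (coboundaries (Suc m) (metric_system M D))"
  proof (rule quotient_rank_iso[where F = ?F])
    have ext_diff: "ext (\<lambda>x. f x - g x) = (\<lambda>x. ext f x - ext g x)" for f g by (auto simp: ext_def)
    show "additive_map ?F" unfolding additive_map_def ext_diff by (auto simp: cobd_diff)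
    show "additive_group (cocycles m (reduced_system D))" "additive_group (coboundaries (Suc m) (metric_system M D))"
      by (rule additive_group_cocycles[OF scale_system_reduced] additive_group_coboundaries[OF scale_system_metric[OF D]])+
  next
    fix c assume "c \<in> cocycles m (reduced_system D)"
    then obtain e where e: "0 < e" "cocycle_at m (small D e, {}) c" by (auto simp: cocycles_reduced_iff)
    have "cocycle_at (Suc m) (small M e, small D e) (?F c)"
      unfolding cocycle_at_def
    proof (intro conjI allI impI)
      fix xs assume xs: "length xs = Suc m" "set xs \<in> snd (small M e, small D e)"
      then have "set xs \<subseteq> D" by (simp add: small_def)
      then show "?F c xs = 0" using cobd_ext e(2) xs by (simp add: cocycle_at_def)
    qed (simp add: cobd_cobd)
    then show "?F c \<in> cocycles (Suc m) (metric_system M D)" using e(1) by (auto simp: cocycles_metric_iff)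
  next
    fix c assume "c \<in> coboundaries m (reduced_system D)"
    then obtain e b where e: "0 < e" "coboundary_at m (small D e, {}) b c" by (auto simp: coboundaries_reduced_iff)
    \<comment> \<open>On \<open>D\<close> the two terms cancel, which makes the primitive relative;
      its coboundary is that of \<open>ext c\<close> because \<open>cobd\<close> squares to
      zero.\<close>
    have "coboundary_at (Suc m) (small M e, small D e) (\<lambda>xs. ext c xs - cobd (ext b) xs) (?F c)"
      unfolding coboundary_at_def
    proof (intro conjI allI impI)
      fix xs assume xs: "Suc (length xs) = Suc m" "set xs \<in> snd (small M e, small D e)"
      then have "set xs \<subseteq> D" by (simp add: small_def)
      then show "ext c xs - cobd (ext b) xs = 0"
        using cobd_ext ext_D e(2) xs by (simp add: coboundary_at_def)
    qed (simp add: cobd_diff cobd_cobd)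
    then show "?F c \<in> coboundaries (Suc m) (metric_system M D)" using e(1) by (auto simp: coboundaries_metric_iff)
  next
    fix c assume "c \<in> cocycles m (reduced_system D)" "?F c \<in> coboundaries (Suc m) (metric_system M D)"
    then obtain e b where e: "0 < e" "coboundary_at (Suc m) (small M e, small D e) b (?F c)"
      by (auto simp: coboundaries_metric_iff)
    \<comment> \<open>\<open>ext c\<close> and \<open>b\<close> have the same coboundary. Acyclicity
      makes their difference exact, and on \<open>D\<close>, where \<open>b\<close> vanishes, this
      difference is \<open>c\<close>.\<close>
    have "cocycle_at m (small M e, {}) (\<lambda>xs. ext c xs - b xs)"
      using e(2) by (simp add: cocycle_at_def coboundary_at_def cobd_diff)
    then have "(\<lambda>xs. ext c xs - b xs) \<in> coboundaries m (reduced_system M)"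
      using M e(1) unfolding acyclic_set_def subset_iff cocycles_reduced_iff by blast
    then obtain e' g where e': "0 < e'" "coboundary_at m (small M e', {}) g (\<lambda>xs. ext c xs - b xs)"
      by (auto simp: coboundaries_reduced_iff)
    define t where "t = min e e'"
    have "coboundary_at m (small D t, {}) g c"
      unfolding coboundary_at_def
    proof (intro conjI allI impI)
      fix xs assume xs: "length xs = m" "set xs \<in> fst (small D t, {})"
      then have "set xs \<in> small D e" "set xs \<in> small M e'" "set xs \<subseteq> D"
        using small_mono[of t e D D] sub[of t e'] by (auto simp: t_def small_def)
      then have "b xs = 0" "ext c xs = c xs" using e(2) xs(1) ext_D by (auto simp: coboundary_at_def)
      moreover have "ext c xs - b xs = cobd g xs"
        using e'(2) xs(1) \<open>set xs \<in> small M e'\<close> unfolding coboundary_at_def fst_conv by blast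
      ultimately show "c xs = cobd g xs" by simp
    qed simp
    then show "c \<in> coboundaries m (reduced_system D)"
      using e(1) e'(1) by (auto simp: coboundaries_reduced_iff t_def intro!: exI[of _ "min e e'"])
  next
    fix z assume "z \<in> cocycles (Suc m) (metric_system M D)"
    then obtain e where e: "0 < e" "cocycle_at (Suc m) (small M e, small D e) z" by (auto simp: cocycles_metric_iff)
    then have "cocycle_at (Suc m) (small M e, {}) z" by (simp add: cocycle_at_def)
    then have "z \<in> coboundaries (Suc m) (reduced_system M)"
      using M e(1) unfolding acyclic_set_def subset_iff cocycles_reduced_iff by blast
    then obtain e' b where e': "0 < e'" "coboundary_at (Suc m) (small M e', {}) b z"
      by (auto simp: coboundaries_reduced_iff)
    define t where "t = min e e'"
    have t: "0 < t" "t \<le> e" "t \<le> e'" using e(1) e'(1) by (auto simp: t_def)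
    have z: "z xs = cobd b xs" if "length xs = Suc m" "set xs \<in> small M t" for xs
      using e'(2) that small_mono[OF t(3), of M M] by (simp add: coboundary_at_def)
    \<comment> \<open>Acyclicity gave a primitive \<open>b\<close> of \<open>z\<close> on all of
      \<open>M\<close>. As \<open>z\<close> vanishes on \<open>D\<close>, \<open>b\<close> is a
      cocycle there, and its image differs from \<open>z\<close> by the coboundary of
      \<open>ext b - b\<close>, which is zero on \<open>D\<close>.\<close>
    have "cocycle_at m (small D t, {}) b"
      unfolding cocycle_at_def
    proof (intro conjI allI impI)
      fix xs assume xs: "length xs = Suc m" "set xs \<in> fst (small D t, {})"
      then have "z xs = 0" using e(2) small_mono[OF t(2), of D D] by (simp add: cocycle_at_def)
      then show "cobd b xs = 0" using z[OF xs(1)] sub[of t t] xs(2) by auto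
    qed simp
    then have "b \<in> cocycles m (reduced_system D)" using t(1) by (auto simp: cocycles_reduced_iff)
    moreover have "coboundary_at (Suc m) (small M t, small D t) (\<lambda>xs. ext b xs - b xs) (\<lambda>xs. ?F b xs - z xs)"
      unfolding coboundary_at_def
    proof (intro conjI allI impI)
      fix xs assume xs: "Suc (length xs) = Suc m" "set xs \<in> snd (small M t, small D t)"
      then have "set xs \<subseteq> D" by (simp add: small_def)
      then show "ext b xs - b xs = 0" using ext_D by simp
    qed (simp add: cobd_diff z)
    then have "(\<lambda>xs. ?F b xs - z xs) \<in> coboundaries (Suc m) (metric_system M D)"
      using t(1) by (auto simp: coboundaries_metric_iff)
    ultimately show "\<exists>f\<in>cocycles m (reduced_system D). (\<lambda>x. ?F f x - z x) \<in> coboundaries (Suc m) (metric_system M D)"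
      by (intro bexI[of _ b])
  qed
  then show ?thesis by (simp add: hrank_def)
qed

text \<open>This is degree -1: for a point \<open>x\<close> of \<open>M\<close> the cocycle
  condition on \<open>[x]\<close> reads \<open>c [] = 0\<close>.\<close>

lemma hrank_reduced_zero:
  assumes "M \<noteq> {}"
  shows "hrank 0 (reduced_system M) = 0"
  unfolding hrank_def
proof (rule quotient_rank_zero, rule subsetI)
  fix c assume "c \<in> cocycles 0 (reduced_system M)"
  then obtain e where e: "0 < e" "cocycle_at 0 (small M e, {}) c" by (auto simp: cocycles_reduced_iff)
  obtain x where "x \<in> M" using assms by blast
  then have "{x} \<in> small M e" using e(1) by (simp add: small_def)
  then have "set [x] \<in> small M e" by simp
  then have "cobd c [x] = 0" using e(2) unfolding cocycle_at_def fst_conv by (metis length_Cons list.size(3))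
  then have "coboundary_at 0 (small M e, {}) (\<lambda>_. 0) c" by (simp add: coboundary_at_def)
  then show "c \<in> coboundaries 0 (reduced_system M)" using e(1) by (auto simp: coboundaries_reduced_iff)
qed

lemma hrank_reduced_ge_2: "hrank (Suc (Suc m)) (reduced_system M) = hrank (Suc (Suc m)) (metric_system M {})"
proof -
  have 1: "cocycle_at (Suc (Suc m)) (small M e, small {} e) c \<longleftrightarrow> cocycle_at (Suc (Suc m)) (small M e, {}) c" for e c
    by (auto simp: cocycle_at_def)
  have 2: "coboundary_at (Suc (Suc m)) (small M e, small {} e) b c \<longleftrightarrow> coboundary_at (Suc (Suc m)) (small M e, {}) b c" for e b c
    by (auto simp: coboundary_at_def)
  show ?thesis
    unfolding hrank_def
    by (rule arg_cong2[where f = quotient_rank])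
       (auto simp only: set_eq_iff cocycles_metric_iff cocycles_reduced_iff coboundaries_metric_iff coboundaries_reduced_iff 1 2)
qed

text \<open>In degree 0 both theories have the same cocycles, but the augmentation turns the
  constant functions into coboundaries, and these have rank 1.\<close>

lemma hrank_reduced_1:
  fixes M :: "'a::metric_space set"
  assumes "M \<noteq> {}"
  shows "hrank 1 (metric_system M {}) = hrank 1 (reduced_system M) + 1"
proof -
  let ?Z = "cocycles 1 (metric_system M {})" and ?B = "coboundaries 1 (metric_system M {})"
    and ?B' = "coboundaries 1 (reduced_system M)"
  have Z: "cocycles 1 (reduced_system M) = ?Z"
  proof -
    have "cocycle_at 1 (small M e, small {} e) c \<longleftrightarrow> cocycle_at 1 (small M e, {}) c" for e c
      by (auto simp: cocycle_at_def simp del: One_nat_def)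
    then show ?thesis unfolding set_eq_iff cocycles_metric_iff cocycles_reduced_iff by simp
  qed
  have sub: "?B \<subseteq> ?B'"
  proof -
    have "coboundary_at 1 (small M e, {}) b c" if "coboundary_at 1 (small M e, small {} e) b c" for e b c
      using coboundary_at_mono[OF that] by simp
    then show ?thesis unfolding subset_iff coboundaries_metric_iff coboundaries_reduced_iff by metis
  qed
  have sub': "?B' \<subseteq> ?Z"
    using coboundaries_subset_cocycles[OF scale_system_reduced, of 1 M] Z by simp
  note B = additive_group_coboundaries[OF scale_system_metric[OF empty_subsetI], of 1 M]
  note B' = additive_group_coboundaries[OF scale_system_reduced, of 1 M]
  have B_iff: "c \<in> ?B \<longleftrightarrow> (\<forall>x\<in>M. c [x] = 0)" for c
  proof -
    have eq: "coboundary_at 1 (small M e, small {} e) b c \<longleftrightarrow> b [] = 0 \<and> (\<forall>x\<in>M. c [x] = 0)" if "0 < e" for e b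
      using that by (auto simp: coboundary_at_def length_Suc_conv small_def)
    show ?thesis
    proof
      assume "c \<in> ?B"
      then show "\<forall>x\<in>M. c [x] = 0" unfolding coboundaries_metric_iff using eq by blast
    next
      assume "\<forall>x\<in>M. c [x] = 0"
      then have "coboundary_at 1 (small M 1, small {} 1) (\<lambda>_. 0) c" using eq[of 1] by simp
      then show "c \<in> ?B" unfolding coboundaries_metric_iff using zero_less_one by blast
    qed
  qed
  have B'_D: "\<exists>k. \<forall>x\<in>M. c [x] = k" if "c \<in> ?B'" for c
  proof -
    obtain e b where "0 < e" "coboundary_at 1 (small M e, {}) b c" using \<open>c \<in> ?B'\<close> by (auto simp: coboundaries_reduced_iff)
    then have "\<forall>x\<in>M. c [x] = b []" by (auto simp: coboundary_at_def small_def)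
    then show ?thesis by blast
  qed
  have "quotient_rank ?B' ?B = enat 1"
  proof (rule antisym)
    show "quotient_rank ?B' ?B \<le> enat 1"
    proof (rule quotient_rank_le_spanning[OF B])
      fix c assume "c \<in> ?B'"
      then obtain k where k: "\<forall>x\<in>M. c [x] = k" using B'_D by blast
      have "(\<lambda>x. 1 * c x - lincomb 1 (\<lambda>_. k) (\<lambda>_ _. 1) x) \<in> ?B"
        unfolding B_iff using k by (simp add: lincomb_def)
      then show "\<exists>p m. p \<noteq> 0 \<and> (\<lambda>x. p * c x - lincomb 1 m (\<lambda>_ _. 1) x) \<in> ?B" by (metis zero_neq_one)
    qed
    have "coboundary_at 1 (small M 1, {}) (\<lambda>_. 1) (\<lambda>_::'a list. 1)"
      by (auto simp: coboundary_at_def length_Suc_conv)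
    then have "(\<lambda>_::'a list. 1) \<in> ?B'" unfolding coboundaries_reduced_iff using zero_less_one by blast
    moreover have "m 0 = 0" if "lincomb 1 m (\<lambda>_ _. 1) \<in> ?B" for m
    proof -
      obtain x where "x \<in> M" using assms by blast
      with that[unfolded B_iff] have "lincomb 1 m (\<lambda>_ _. 1) [x] = 0" by blast
      then show ?thesis by (simp add: lincomb_def)
    qed
    ultimately have "independent_mod ?B' ?B 1 (\<lambda>_ _. 1)" by (simp add: independent_mod_def)
    then show "enat 1 \<le> quotient_rank ?B' ?B" by (rule quotient_rank_ge)
  qed
  then show ?thesis
    using quotient_rank_additive[OF B B' sub sub'] unfolding hrank_def Z by (simp add: one_enat_def)
qed

lemma cobd_const: "cobd (\<lambda>_. k) xs = (if odd (length xs) then k else 0)"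
  by (induction xs) auto

text \<open>Pulling back along the constant map leaves a constant \<open>k\<close>. In odd length it
  is the coboundary of a constant; in even length the cocycle condition on a repeated point gives
  \<open>k = 0\<close>.\<close>

lemma acyclic_setI:
  fixes M :: "'a::metric_space set"
  assumes "\<And>e. 0 < e \<Longrightarrow> \<exists>d>0. \<exists>q\<in>M. scale_homotopic (small M d, {}) (small M e, {}) (\<lambda>x. x) (\<lambda>_. q)"
  shows "acyclic_set M"
  unfolding acyclic_set_def
proof (intro allI subsetI)
  fix m c assume "c \<in> cocycles m (reduced_system M)"
  then obtain e where e: "0 < e" "cocycle_at m (small M e, {}) c" by (auto simp: cocycles_reduced_iff)
  obtain d q where d: "0 < d" "q \<in> M" "scale_homotopic (small M d, {}) (small M e, {}) (\<lambda>x. x) (\<lambda>_. q)"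
    using assms[OF e(1)] by blast
  have "(small M e, {}) \<in> reduced_system M" using e(1) by (simp add: reduced_system_def)
  then obtain b where b: "coboundary_at m (small M d, {}) b (\<lambda>xs. c (map (\<lambda>_. q) xs) - c (map (\<lambda>x. x) xs))"
    using scale_homotopic_coboundary_at[OF scale_system_reduced _ d(3) e(2)] by blast
  define k where "k = c (replicate m q)"
  have map: "map (\<lambda>_. q) xs = replicate (length xs) q" for xs :: "'a list" by (induction xs) auto
  have "set (replicate (Suc m) q) \<in> small M e" using d(2) e(1) by (auto simp: small_def)
  then have "cobd c (replicate (Suc m) q) = 0" using e(2) unfolding cocycle_at_def fst_conv by (metis length_replicate)
  moreover have "cobd c (replicate (Suc m) q) = cobd (\<lambda>_. k) (replicate (Suc m) q)"
  proof (rule cobd_cong)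
    fix ys assume "Suc (length ys) = length (replicate (Suc m) q)" "set ys \<subseteq> set (replicate (Suc m) q)"
    then have "ys = replicate m q" by (intro replicate_eqI) auto
    then show "c ys = k" by (simp add: k_def)
  qed
  ultimately have k: "k = 0" if "even m" using that cobd_const[of k "replicate (Suc m) q"] by (auto simp del: replicate_Suc)
  have "coboundary_at m (small M d, {}) (\<lambda>xs. k - b xs) c"
    unfolding coboundary_at_def
  proof (intro conjI allI impI)
    fix xs assume xs: "length xs = m" "set xs \<in> fst (small M d, {})"
    have "k - c xs = cobd b xs" using b xs unfolding coboundary_at_def map k_def by simp
    moreover have "cobd (\<lambda>xs. k - b xs) xs = cobd (\<lambda>_. k) xs - cobd b xs" by (rule cobd_diff)
    moreover have "cobd (\<lambda>_. k) xs = k" using k xs(1) by (simp add: cobd_const)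
    ultimately show "c xs = cobd (\<lambda>xs. k - b xs) xs" by simp
  qed simp
  then show "c \<in> coboundaries m (reduced_system M)" using d(1) by (auto simp: coboundaries_reduced_iff)
qed

lemma hrank_acyclic:
  assumes "acyclic_set M" "M \<noteq> {}"
  shows "hrank (Suc m) (metric_system M {}) = (if m = 0 then 1 else 0)"
proof -
  have 0: "hrank k (reduced_system M) = 0" for k
    unfolding hrank_def using assms(1) by (intro quotient_rank_zero) (simp add: acyclic_set_def)
  show ?thesis
  proof (cases m)
    case 0
    then show ?thesis using hrank_reduced_1[OF assms(2)] \<open>\<And>k. hrank k (reduced_system M) = 0\<close> by simp
  next
    case (Suc n)
    then show ?thesis using hrank_reduced_ge_2[of n M] \<open>\<And>k. hrank k (reduced_system M) = 0\<close> by simp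
  qed
qed

section \<open>Unions of two compact sets\<close>

definition finite_hrank :: "'a::metric_space set \<Rightarrow> nat \<Rightarrow> bool" where
  "finite_hrank M q \<longleftrightarrow> (\<forall>m. hrank (Suc m) (metric_system M {}) < \<infinity> \<and> (m \<ge> q \<longrightarrow> hrank (Suc m) (metric_system M {}) = 0))"

text \<open>In a sequence of counterexamples the pairs converge, along a subsequence, to a single
  point. It lies in both closed sets and is eventually close to both members of the pair.\<close>

lemma compact_intersection_uniform:
  assumes "compact A" "compact B" "0 < e"
  shows "\<exists>d>0. \<forall>x\<in>A. \<forall>y\<in>B. dist x y < d \<longrightarrow> (\<exists>z\<in>A \<inter> B. dist x z < e \<and> dist y z < e)"
proof (rule ccontr)
  assume no: "\<not> ?thesis"
  have "\<forall>n::nat. \<exists>p. fst p \<in> A \<and> snd p \<in> B \<and> dist (fst p) (snd p) < inverse (Suc n) \<and>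
      (\<forall>z\<in>A \<inter> B. \<not> (dist (fst p) z < e \<and> dist (snd p) z < e))"
  proof
    fix n :: nat
    have "0 < inverse (real (Suc n))" by simp
    with no obtain x y where "x \<in> A" "y \<in> B" "dist x y < inverse (Suc n)"
      "\<not> (\<exists>z\<in>A \<inter> B. dist x z < e \<and> dist y z < e)" by blast
    then show "\<exists>p. fst p \<in> A \<and> snd p \<in> B \<and> dist (fst p) (snd p) < inverse (Suc n) \<and>
      (\<forall>z\<in>A \<inter> B. \<not> (dist (fst p) z < e \<and> dist (snd p) z < e))"
      by (intro exI[of _ "(x, y)"]) simp
  qed
  from choice[OF this] obtain p where p: "\<forall>n::nat. fst (p n) \<in> A \<and> snd (p n) \<in> B \<and> dist (fst (p n)) (snd (p n)) < inverse (Suc n) \<and>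
      (\<forall>z\<in>A \<inter> B. \<not> (dist (fst (p n)) z < e \<and> dist (snd (p n)) z < e))" ..
  define x y where "x n = fst (p n)" and "y n = snd (p n)" for n
  have xy: "x n \<in> A" "y n \<in> B" "dist (x n) (y n) < inverse (Suc n)" "z \<in> A \<inter> B \<Longrightarrow> \<not> (dist (x n) z < e \<and> dist (y n) z < e)" for n z
    using p[rule_format, of n] by (auto simp: x_def y_def)
  obtain l r where l: "l \<in> A" "strict_mono r" "(x \<circ> r) \<longlonglongrightarrow> l"
    using assms(1) xy(1) unfolding compact_def by blast
  have d0: "(\<lambda>n. dist ((x \<circ> r) n) ((y \<circ> r) n)) \<longlonglongrightarrow> 0"
  proof (rule tendsto_sandwich[OF _ _ tendsto_const])
    show "\<forall>\<^sub>F n in sequentially. dist ((x \<circ> r) n) ((y \<circ> r) n) \<le> inverse (real (Suc n))"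
    proof (intro always_eventually allI)
      fix n
      have "dist (x (r n)) (y (r n)) < inverse (Suc (r n))" by (rule xy(3))
      also have "\<dots> \<le> inverse (real (Suc n))" using seq_suble[OF l(2), of n] by (simp add: le_imp_inverse_le)
      finally show "dist ((x \<circ> r) n) ((y \<circ> r) n) \<le> inverse (real (Suc n))" by simp
    qed
    show "(\<lambda>n. inverse (real (Suc n))) \<longlonglongrightarrow> 0" by (rule LIMSEQ_inverse_real_of_nat)
  qed simp
  have sum0: "(\<lambda>n. dist ((x \<circ> r) n) ((y \<circ> r) n) + dist ((x \<circ> r) n) l) \<longlonglongrightarrow> 0 + 0"
    using d0 iffD1[OF tendsto_dist_iff l(3)] by (rule tendsto_add)
  have yl: "(y \<circ> r) \<longlonglongrightarrow> l"
  proof (rule metric_tendsto_imp_tendsto[OF sum0], intro always_eventually allI)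
    fix n
    show "dist ((y \<circ> r) n) l \<le> dist (dist ((x \<circ> r) n) ((y \<circ> r) n) + dist ((x \<circ> r) n) l) (0 + 0)"
      using dist_triangle3[of "(y \<circ> r) n" l "(x \<circ> r) n"] by (simp add: dist_real_def)
  qed
  moreover have "closed B" using assms(2) by (rule compact_imp_closed)
  ultimately have "l \<in> B"
    using closed_sequentially[of B "y \<circ> r" l] xy(2) yl by simp
  have "\<forall>\<^sub>F n in sequentially. dist ((x \<circ> r) n) l < e \<and> dist ((y \<circ> r) n) l < e"
    using tendstoD[OF l(3) assms(3)] tendstoD[OF yl assms(3)] by (rule eventually_conj)
  then obtain n where "dist ((x \<circ> r) n) l < e \<and> dist ((y \<circ> r) n) l < e"
    using eventually_happens'[OF sequentially_bot] by blast
  then show False using xy(4)[of l "r n"] l(1) \<open>l \<in> B\<close> by simp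
qed

lemma small_null [simp]: "small {} e = {{}}" by (auto simp: small_def)

text \<open>Small sets have to lie inside \<open>A\<close> or inside \<open>B\<close>. Over this
  system cochains on the union can be glued from cochains on the two sets which agree on the
  intersection.\<close>

definition pair_system :: "'a::metric_space set \<Rightarrow> 'a set \<Rightarrow> 'a scale set" where
  "pair_system A B = (\<lambda>e. (small A e \<union> small B e, {{}})) ` {0<..}"

lemma scale_system_pair: "scale_system (pair_system A B)"
  unfolding pair_system_def
  by (rule scale_system_metricI) (auto intro: small_mono small_subset)

text \<open>Only sets with a point off \<open>A\<close> and a point off \<open>B\<close> need
  repair. When they are small enough, all their points are near the intersection, and
  \<open>r\<close> moves them into it.\<close>

lemma hrank_pair_system:
  fixes A B :: "'a::metric_space set"
  assumes A: "compact A" and B: "compact B"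
  shows "hrank m (pair_system A B) = hrank m (metric_system (A \<union> B) {})"
proof (rule hrank_approximate_equivalence[where i = "\<lambda>x. x", OF scale_system_pair scale_system_metric[OF empty_subsetI]])
  fix q assume "q \<in> metric_system (A \<union> B) {}"
  then obtain e where e: "0 < e" "q = (small (A \<union> B) e, {{}})" by (auto simp: metric_system_def)
  have "small A e \<union> small B e \<subseteq> small (A \<union> B) e" using small_mono[OF order_refl, of _ "A \<union> B"] by blast
  then show "\<exists>p\<in>pair_system A B. scale_map p q (\<lambda>x. x)"
    using e by (intro bexI[of _ "(small A e \<union> small B e, {{}})"]) (auto simp: contiguous_def pair_system_def)
next
  fix p q assume "p \<in> pair_system A B" "q \<in> metric_system (A \<union> B) {}"
  then obtain d e where d: "0 < d" "p = (small A d \<union> small B d, {{}})"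
    and e: "0 < e" "q = (small (A \<union> B) e, {{}})"
    by (auto simp: metric_system_def pair_system_def)
  define t where "t = min d e / 3"
  have t: "0 < t" "t + t + t \<le> d" "t + t + t \<le> e" using d(1) e(1) by (auto simp: t_def)
  obtain s0 where s0: "0 < s0" "\<forall>x\<in>A. \<forall>y\<in>B. dist x y < s0 \<longrightarrow> (\<exists>z\<in>A \<inter> B. dist x z < t \<and> dist y z < t)"
    using compact_intersection_uniform[OF A B t(1)] by blast
  define s where "s = min s0 t"
  have s: "0 < s" "s \<le> s0" "s \<le> t" using s0(1) t(1) by (auto simp: s_def)
  let ?I = "A \<inter> B"
  define r where "r x = (if x \<in> near ?I t then SOME y. y \<in> ?I \<and> dist x y < t else x)" for x
  have r_near: "r x \<in> ?I \<and> dist x (r x) < t" if "x \<in> near ?I t" for x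
  proof -
    have "\<exists>y. y \<in> ?I \<and> dist x y < t" using that by (auto simp: near_def)
    from someI_ex[OF this] show ?thesis using that by (simp add: r_def)
  qed
  have r_dist: "dist x (r x) < t" for x using r_near[of x] t(1) by (cases "x \<in> near ?I t") (auto simp: r_def)
  have r_A: "r x \<in> A" if "x \<in> A" for x using r_near[of x] that by (cases "x \<in> near ?I t") (auto simp: r_def)
  have r_B: "r x \<in> B" if "x \<in> B" for x using r_near[of x] that by (cases "x \<in> near ?I t") (auto simp: r_def)
  have small_Un: "\<sigma> \<union> r ` \<sigma> \<in> small N a" if \<sigma>: "\<sigma> \<in> small M s" and a: "t + t + t \<le> a" and N: "\<sigma> \<union> r ` \<sigma> \<subseteq> N" for M \<sigma> a N
  proof -
    have *: "dist x y < a \<and> dist x (r y) < a \<and> dist (r x) y < a \<and> dist (r x) (r y) < a" if "x \<in> \<sigma>" "y \<in> \<sigma>" for x y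
    proof -
      have "dist x y < s" using smallD(1)[OF \<sigma>] that by blast
      moreover note r_dist[of x] r_dist[of y]
      moreover have "dist x (r y) \<le> dist x y + dist y (r y)" "dist (r x) y \<le> dist x (r x) + dist x y"
        "dist (r x) (r y) \<le> dist x (r x) + dist x (r y)"
        by (rule dist_triangle dist_triangle3)+
      ultimately show ?thesis using a t(1) s by linarith
    qed
    then show ?thesis using N by (auto simp: small_def)
  qed
  have r_small: "r ` \<sigma> \<in> small A d \<union> small B d" if \<sigma>: "\<sigma> \<in> small (A \<union> B) s" for \<sigma>
  proof -
    have sm: "r ` \<sigma> \<in> small (A \<union> B) d"
      using small_subset[OF small_Un[OF \<sigma> t(2), of "A \<union> B"], of "r ` \<sigma>"] smallD(2)[OF \<sigma>] r_A r_B by auto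
    consider "\<sigma> \<subseteq> A" | "\<sigma> \<subseteq> B" | x y where "x \<in> \<sigma>" "x \<notin> A" "y \<in> \<sigma>" "y \<notin> B" by blast
    then have "r ` \<sigma> \<subseteq> A \<or> r ` \<sigma> \<subseteq> B"
    proof cases
      case 3
      then have xy: "x \<in> B" "y \<in> A" using smallD(2)[OF \<sigma>] by auto
      have "w \<in> near ?I t" if w: "w \<in> \<sigma>" for w
      proof (cases "w \<in> A")
        case True
        have "dist w x < s0" using smallD(1)[OF \<sigma> w 3(1)] s(2) by simp
        with s0(2) True xy(1) have "\<exists>z\<in>?I. dist w z < t \<and> dist x z < t" by simp
        then show ?thesis by (auto simp: near_def)
      next
        case False
        then have "w \<in> B" using w smallD(2)[OF \<sigma>] by auto
        have "dist y w < s0" using smallD(1)[OF \<sigma> 3(3) w] s(2) by simp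
        with s0(2) xy(2) \<open>w \<in> B\<close> have "\<exists>z\<in>?I. dist y z < t \<and> dist w z < t" by simp
        then show ?thesis by (auto simp: near_def)
      qed
      then show ?thesis using r_near by blast
    qed (use r_A r_B in blast)+
    then show ?thesis using sm by (auto simp: small_def)
  qed
  let ?q = "(small (A \<union> B) s, {{}})" and ?p = "(small A s \<union> small B s, {{}})"
  have 1: "scale_map ?q p r"
    using r_small unfolding contiguous_def d(2) fst_conv snd_conv Un_absorb by simp
  have 2: "contiguous ?q q (\<lambda>x. x) (\<lambda>x. r x)"
    unfolding contiguous_def e(2) fst_conv snd_conv image_ident
  proof (intro conjI ballI)
    fix \<sigma> assume \<sigma>: "\<sigma> \<in> small (A \<union> B) s"
    show "\<sigma> \<union> r ` \<sigma> \<in> small (A \<union> B) e" using r_A r_B smallD(2)[OF \<sigma>] by (intro small_Un[OF \<sigma> t(3)]) auto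
  qed simp
  have 3: "contiguous ?p p (\<lambda>x. x) (\<lambda>x. r x)"
    unfolding contiguous_def d(2) fst_conv snd_conv image_ident
  proof (intro conjI ballI)
    fix \<sigma> assume "\<sigma> \<in> small A s \<union> small B s"
    then show "\<sigma> \<union> r ` \<sigma> \<in> small A d \<union> small B d"
    proof
      assume \<sigma>: "\<sigma> \<in> small A s"
      have "\<sigma> \<union> r ` \<sigma> \<in> small A d" using r_A smallD(2)[OF \<sigma>] by (intro small_Un[OF \<sigma> t(2)]) auto
      then show ?thesis by simp
    next
      assume \<sigma>: "\<sigma> \<in> small B s"
      have "\<sigma> \<union> r ` \<sigma> \<in> small B d" using r_B smallD(2)[OF \<sigma>] by (intro small_Un[OF \<sigma> t(2)]) auto
      then show ?thesis by simp
    qed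
  qed simp
  have "?q \<in> metric_system (A \<union> B) {}" "?p \<in> pair_system A B"
    using s(1) by (auto simp: pair_system_def metric_system_def)
  then show "approximate_inverse (pair_system A B) (metric_system (A \<union> B) {}) (\<lambda>x. x) p q"
    by (rule approximate_inverseI[where i = "\<lambda>x. x", OF _ _ 1 contiguous_imp_homotopic[OF 2] contiguous_imp_homotopic[OF 3]])
qed

lemma cocycles_pair_iff:
  "c \<in> cocycles m (pair_system A B) \<longleftrightarrow> (\<exists>e>0. cocycle_at m (small A e \<union> small B e, {{}}) c)"
  by (auto simp: cocycles_def pair_system_def)

lemma coboundaries_pair_iff:
  "c \<in> coboundaries m (pair_system A B) \<longleftrightarrow> (\<exists>e>0. \<exists>b. coboundary_at m (small A e \<union> small B e, {{}}) b c)"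
  by (auto simp: coboundaries_def pair_system_def)

text \<open>The inequality is exactness of the Mayer-Vietoris sequence of \<open>A\<close> and \<open>B\<close> at the cohomology of the union.\<close>

theorem hrank_Mayer_Vietoris:
  fixes A B :: "'a::metric_space set"
  assumes A: "compact A" and B: "compact B"
  shows "hrank (Suc m) (metric_system (A \<union> B) {}) \<le>
     hrank (Suc m) (metric_system A {}) + hrank (Suc m) (metric_system B {}) + hrank m (metric_system (A \<inter> B) {})"
proof -
  let ?n = "Suc m" and ?I = "A \<inter> B"
  let ?Z = "cocycles ?n (pair_system A B)" and ?B = "coboundaries ?n (pair_system A B)"
  let ?ZA = "cocycles ?n (metric_system A {})" and ?BA = "coboundaries ?n (metric_system A {})"
  let ?ZB = "cocycles ?n (metric_system B {})" and ?BB = "coboundaries ?n (metric_system B {})"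
  note sys = scale_system_metric[OF empty_subsetI]
  note G = additive_group_coboundaries[OF scale_system_pair, of ?n A B]
  note GZ = additive_group_cocycles[OF scale_system_pair, of ?n A B]
  note GA = additive_group_coboundaries[OF sys, of ?n A]
  note GB = additive_group_coboundaries[OF sys, of ?n B]
  have Int: "additive_group (P \<inter> Q)" if "additive_group P" "additive_group Q" for P Q :: "('a list \<Rightarrow> int) set"
    using that by (auto simp: additive_group_def)
  have ZM: "?Z \<subseteq> cocycles ?n (metric_system M {})" and BM: "?B \<subseteq> coboundaries ?n (metric_system M {})"
    if M: "M = A \<or> M = B" for M
  proof -
    have le: "fst (small M e, small {} e) \<subseteq> fst (small A e \<union> small B e, {{}})"
      "snd (small M e, small {} e) \<subseteq> snd (small A e \<union> small B e, {{}})" for e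
      using M by auto
    show "?Z \<subseteq> cocycles ?n (metric_system M {})"
      unfolding subset_iff cocycles_pair_iff cocycles_metric_iff using cocycle_at_mono[OF _ le] by blast
    show "?B \<subseteq> coboundaries ?n (metric_system M {})"
      unfolding subset_iff coboundaries_pair_iff coboundaries_metric_iff using coboundary_at_mono[OF _ le] by blast
  qed
  have ZA: "?Z \<subseteq> ?ZA" and ZB: "?Z \<subseteq> ?ZB" and BA: "?B \<subseteq> ?BA" and BB: "?B \<subseteq> ?BB"
    using ZM[of A] ZM[of B] BM[of A] BM[of B] by simp_all
  have sub: "?B \<subseteq> ?Z" by (rule coboundaries_subset_cocycles[OF scale_system_pair])
  \<comment> \<open>A filtration of \<open>?Z\<close>: the first quotient embeds in the cohomology
    of \<open>A\<close>, the second in that of \<open>B\<close>, and the classes that vanish on both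
    sets come from the intersection in one degree less.\<close>
  let ?B1 = "?Z \<inter> ?BA" and ?B2 = "?Z \<inter> ?BA \<inter> ?BB"
  have id: "additive_map (\<lambda>f::'a list \<Rightarrow> int. f)" by (simp add: additive_map_def)
  have "quotient_rank ?Z ?B = quotient_rank ?Z ?B1 + quotient_rank ?B1 ?B"
    by (rule quotient_rank_additive[OF G Int[OF GZ GA]]) (use sub BA in auto)
  also have "quotient_rank ?B1 ?B = quotient_rank ?B1 ?B2 + quotient_rank ?B2 ?B"
    by (rule quotient_rank_additive[OF G Int[OF Int[OF GZ GA] GB]]) (use sub BA BB in auto)
  also have "quotient_rank ?Z ?B1 \<le> quotient_rank ?ZA ?BA"
    by (rule quotient_rank_injective[OF id GZ]) (use ZA in auto)
  also have "quotient_rank ?B1 ?B2 \<le> quotient_rank ?ZB ?BB"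
    by (rule quotient_rank_injective[OF id Int[OF GZ GA]]) (use ZB in auto)
  also have "quotient_rank ?B2 ?B \<le> quotient_rank (cocycles m (metric_system ?I {})) (coboundaries m (metric_system ?I {}))"
  proof -
    define ext :: "('a list \<Rightarrow> int) \<Rightarrow> 'a list \<Rightarrow> int" where "ext c = (\<lambda>xs. if set xs \<subseteq> ?I then c xs else 0)" for c
    \<comment> \<open>The connecting map: extend by zero, take the coboundary on lists in
      \<open>A\<close>, and put zero on all others.\<close>
    define F where "F c = (\<lambda>xs. if set xs \<subseteq> A then cobd (ext c) xs else 0)" for c
    have cobd_ext: "cobd (ext c) xs = cobd c xs" if "set xs \<subseteq> ?I" for c xs
      using that by (intro cobd_cong) (auto simp: ext_def)
    have ext_diff: "ext (\<lambda>x. f x - g x) = (\<lambda>x. ext f x - ext g x)" for f g by (auto simp: ext_def)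
    have F: "additive_map F" unfolding additive_map_def F_def ext_diff by (auto simp: cobd_diff)
    have small_cases: "set xs \<in> small A e \<or> set xs \<subseteq> ?I \<or> set xs \<in> small B e \<and> \<not> set xs \<subseteq> A"
      if "set xs \<in> small A e \<union> small B e" for xs :: "'a list" and e
      using that by (auto simp: small_def)
    show ?thesis
    proof (rule quotient_rank_surjective[OF F G])
      fix c assume "c \<in> coboundaries m (metric_system ?I {})"
      then obtain e b where e: "0 < e" "coboundary_at m (small ?I e, {{}}) b c"
        by (auto simp: coboundaries_metric_iff)
      let ?b = "\<lambda>xs. if set xs \<subseteq> A then ext c xs - cobd (ext b) xs else 0"
      have null: "ext c xs - cobd (ext b) xs = 0" if "length xs = m" "set xs \<in> small ?I e" for xs
      proof -
        have "set xs \<subseteq> ?I" using that(2) by (simp add: small_def)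
        then show ?thesis using that e(2) cobd_ext[of xs b] by (simp add: coboundary_at_def ext_def)
      qed
      have "coboundary_at ?n (small A e \<union> small B e, {{}}) ?b (F c)"
        unfolding coboundary_at_def
      proof (intro conjI allI impI)
        fix xs assume xs: "length xs = ?n" "set xs \<in> fst (small A e \<union> small B e, {{}})"
        show "F c xs = cobd ?b xs"
        proof (cases "set xs \<subseteq> A")
          case True
          then have "cobd ?b xs = cobd (\<lambda>xs. ext c xs - cobd (ext b) xs) xs" by (intro cobd_cong) auto
          then show ?thesis using True by (simp add: F_def cobd_diff cobd_cobd)
        next
          case False
          then have B: "set xs \<in> small B e" using xs(2) by (auto simp: small_def)
          have "cobd ?b xs = 0"
          proof (rule cobd_eq_0)
            fix ys assume ys: "Suc (length ys) = length xs" "set ys \<subseteq> set xs"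
            show "?b ys = 0"
            proof (cases "set ys \<subseteq> A")
              case True
              then have "set ys \<in> small ?I e" using small_subset[OF B ys(2)] by (auto simp: small_def)
              then show ?thesis using null[of ys] ys(1) xs(1) by simp
            qed simp
          qed
          then show ?thesis using False by (simp add: F_def)
        qed
      next
        fix xs :: "'a list" assume "Suc (length xs) = ?n" "set xs \<in> snd (small A e \<union> small B e, {{}})"
        then show "?b xs = 0" using null[of xs] by auto
      qed
      then show "F c \<in> ?B" using e(1) by (auto simp: coboundaries_pair_iff)
    next
      fix c assume c: "c \<in> ?B2"
      then obtain e1 b1 where e1: "0 < e1" "coboundary_at ?n (small A e1, {{}}) b1 c"
        by (auto simp: coboundaries_metric_iff)
      obtain e2 b2 where e2: "0 < e2" "coboundary_at ?n (small B e2, {{}}) b2 c"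
        using c by (auto simp: coboundaries_metric_iff)
      define e where "e = min e1 e2"
      have e: "0 < e" "e \<le> e1" "e \<le> e2" using e1(1) e2(1) by (auto simp: e_def)
      have b1: "coboundary_at ?n (small A e, {{}}) b1 c"
        by (rule coboundary_at_mono[OF e1(2)]) (use small_mono[OF e(2) subset_refl] in auto)
      have b2: "coboundary_at ?n (small B e, {{}}) b2 c"
        by (rule coboundary_at_mono[OF e2(2)]) (use small_mono[OF e(3) subset_refl] in auto)
      have IA: "small ?I e \<subseteq> small A e" "small ?I e \<subseteq> small B e" by (auto simp: small_def)
      let ?f = "\<lambda>xs. b1 xs - b2 xs"
      have "cocycle_at m (small ?I e, {{}}) ?f"
        unfolding cocycle_at_def
      proof (intro conjI allI impI)
        fix xs assume xs: "length xs = Suc m" "set xs \<in> fst (small ?I e, {{}})"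
        then have "c xs = cobd b1 xs" "c xs = cobd b2 xs" using b1 b2 IA by (auto simp: coboundary_at_def)
        then show "cobd ?f xs = 0" by (simp add: cobd_diff)
      next
        fix xs :: "'a list" assume "length xs = m" "set xs \<in> snd (small ?I e, {{}})"
        then show "?f xs = 0" using b1 b2 by (auto simp: coboundary_at_def)
      qed
      then have "?f \<in> cocycles m (metric_system ?I {})" using e(1) by (auto simp: cocycles_metric_iff)
      moreover
      \<comment> \<open>On the intersection \<open>ext ?f - b1\<close> equals \<open>- b2\<close>,
        so the two formulas fit together to a primitive over the pair.\<close>
      let ?b = "\<lambda>xs. if set xs \<subseteq> A then ext ?f xs - b1 xs else - b2 xs"
      have b_B: "?b ys = - b2 ys" if "set ys \<subseteq> B" for ys using that by (auto simp: ext_def)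
      have "coboundary_at ?n (small A e \<union> small B e, {{}}) ?b (\<lambda>xs. F ?f xs - c xs)"
        unfolding coboundary_at_def
      proof (intro conjI allI impI)
        fix xs assume xs: "length xs = ?n" "set xs \<in> fst (small A e \<union> small B e, {{}})"
        show "F ?f xs - c xs = cobd ?b xs"
        proof (cases "set xs \<subseteq> A")
          case True
          then have "set xs \<in> small A e" using xs(2) by (auto simp: small_def)
          then have "c xs = cobd b1 xs" using b1 xs(1) by (simp add: coboundary_at_def)
          moreover have "cobd ?b xs = cobd (\<lambda>xs. ext ?f xs - b1 xs) xs" using True by (intro cobd_cong) auto
          ultimately show ?thesis using True by (simp add: F_def cobd_diff)
        next
          case False
          then have B: "set xs \<in> small B e" using xs(2) by (auto simp: small_def)
          then have "c xs = cobd b2 xs" using b2 xs(1) by (simp add: coboundary_at_def)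
          moreover have "cobd ?b xs = cobd (\<lambda>xs. 0 - b2 xs) xs"
          proof (rule cobd_cong)
            fix ys assume "set ys \<subseteq> set xs"
            then have "set ys \<subseteq> B" using smallD(2)[OF B] by blast
            then show "?b ys = 0 - b2 ys" unfolding diff_0 by (rule b_B)
          qed
          ultimately show ?thesis using False by (simp only: F_def cobd_diff) simp
        qed
      next
        fix xs :: "'a list" assume xs: "Suc (length xs) = ?n" "set xs \<in> snd (small A e \<union> small B e, {{}})"
        then have "?b xs = - b2 xs" by (intro b_B) auto
        then show "?b xs = 0" using b2 xs by (auto simp: coboundary_at_def)
      qed
      then have "(\<lambda>xs. F ?f xs - c xs) \<in> ?B" using e(1) unfolding coboundaries_pair_iff by blast
      ultimately show "\<exists>f\<in>cocycles m (metric_system ?I {}). (\<lambda>x. F f x - c x) \<in> ?B"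
        by (intro bexI[of _ ?f])
    qed
  qed
  finally show ?thesis
    using hrank_pair_system[OF A B, of ?n] by (simp add: hrank_def add.assoc)
qed

text \<open>The filtration begins as in the Mayer-Vietoris argument. Now a cocycle on one set
  extends by zero to the other and primitives on the two sets glue, so the quotients are the full
  groups.\<close>

lemma hrank_disjoint_union:
  fixes A B :: "'a::metric_space set"
  assumes A: "compact A" and B: "compact B" and AB: "A \<inter> B = {}"
  shows "hrank (Suc m) (metric_system (A \<union> B) {}) =
     hrank (Suc m) (metric_system A {}) + hrank (Suc m) (metric_system B {})"
proof -
  let ?n = "Suc m"
  let ?Z = "cocycles ?n (pair_system A B)" and ?B = "coboundaries ?n (pair_system A B)"
  let ?ZA = "cocycles ?n (metric_system A {})" and ?BA = "coboundaries ?n (metric_system A {})"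
  let ?ZB = "cocycles ?n (metric_system B {})" and ?BB = "coboundaries ?n (metric_system B {})"
  note sys = scale_system_metric[OF empty_subsetI]
  note G = additive_group_coboundaries[OF scale_system_pair, of ?n A B]
  note GZ = additive_group_cocycles[OF scale_system_pair, of ?n A B]
  note GA = additive_group_coboundaries[OF sys, of ?n A]
  note GB = additive_group_coboundaries[OF sys, of ?n B]
  have Int: "additive_group (P \<inter> Q)" if "additive_group P" "additive_group Q" for P Q :: "('a list \<Rightarrow> int) set"
    using that by (auto simp: additive_group_def)
  have ZM: "?Z \<subseteq> cocycles ?n (metric_system M {})" and BM: "?B \<subseteq> coboundaries ?n (metric_system M {})"
    if M: "M = A \<or> M = B" for M
  proof -
    have le: "fst (small M e, small {} e) \<subseteq> fst (small A e \<union> small B e, {{}})"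
      "snd (small M e, small {} e) \<subseteq> snd (small A e \<union> small B e, {{}})" for e
      using M by auto
    show "?Z \<subseteq> cocycles ?n (metric_system M {})"
      unfolding subset_iff cocycles_pair_iff cocycles_metric_iff using cocycle_at_mono[OF _ le] by blast
    show "?B \<subseteq> coboundaries ?n (metric_system M {})"
      unfolding subset_iff coboundaries_pair_iff coboundaries_metric_iff using coboundary_at_mono[OF _ le] by blast
  qed
  have ZA: "?Z \<subseteq> ?ZA" and ZB: "?Z \<subseteq> ?ZB" and BA: "?B \<subseteq> ?BA" and BB: "?B \<subseteq> ?BB"
    using ZM[of A] ZM[of B] BM[of A] BM[of B] by simp_all
  have sub: "?B \<subseteq> ?Z" by (rule coboundaries_subset_cocycles[OF scale_system_pair])
  let ?B1 = "?Z \<inter> ?BA"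
  have id: "additive_map (\<lambda>f::'a list \<Rightarrow> int. f)" by (simp add: additive_map_def)
  have ext: "\<exists>f\<in>?Z. (\<lambda>xs. f xs - g xs) \<in> coboundaries ?n (metric_system M {}) \<and> f \<in> coboundaries ?n (metric_system N {})"
    if g: "g \<in> cocycles ?n (metric_system M {})" and MN: "M = A \<and> N = B \<or> M = B \<and> N = A" for g M N
  proof -
    obtain e where e: "0 < e" "cocycle_at ?n (small M e, {{}}) g" using g by (auto simp: cocycles_metric_iff)
    define f where "f xs = (if set xs \<subseteq> M \<and> xs \<noteq> [] then g xs else 0)" for xs
    have disj: "M \<inter> N = {}" using MN AB by auto
    have fM: "f xs = g xs" if "length xs = ?n" "set xs \<subseteq> M" for xs using that by (auto simp: f_def)
    have fN: "f xs = 0" if "set xs \<subseteq> N" for xs using that disj by (cases xs) (auto simp: f_def)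
    have "cocycle_at ?n (small A e \<union> small B e, {{}}) f"
      unfolding cocycle_at_def
    proof (intro conjI allI impI)
      fix xs assume xs: "length xs = Suc ?n" "set xs \<in> fst (small A e \<union> small B e, {{}})"
      then have "set xs \<in> small M e \<or> set xs \<in> small N e" using MN by auto
      then show "cobd f xs = 0"
      proof
        assume M: "set xs \<in> small M e"
        have "cobd f xs = cobd g xs"
        proof (rule cobd_cong)
          fix ys assume "Suc (length ys) = length xs" "set ys \<subseteq> set xs"
          then show "f ys = g ys" using xs(1) smallD(2)[OF M] by (intro fM) auto
        qed
        then show ?thesis using e(2) xs(1) M by (simp add: cocycle_at_def)
      next
        assume N: "set xs \<in> small N e"
        show ?thesis by (rule cobd_eq_0, rule fN) (use smallD(2)[OF N] in blast)
      qed
    qed (auto simp: f_def)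
    then have "f \<in> ?Z" using e(1) by (auto simp: cocycles_pair_iff)
    moreover have "coboundary_at ?n (small M e, small {} e) (\<lambda>_. 0) (\<lambda>xs. f xs - g xs)"
      using fM by (auto simp: coboundary_at_def dest: smallD(2))
    moreover have "coboundary_at ?n (small N e, small {} e) (\<lambda>_. 0) f"
      using fN by (auto simp: coboundary_at_def dest: smallD(2))
    ultimately show ?thesis using e(1) unfolding coboundaries_metric_iff by blast
  qed
  have kernel: "c \<in> ?B" if "c \<in> ?BA" "c \<in> ?BB" for c
  proof -
    obtain e1 b1 where e1: "0 < e1" "coboundary_at ?n (small A e1, {{}}) b1 c"
      using \<open>c \<in> ?BA\<close> by (auto simp: coboundaries_metric_iff)
    obtain e2 b2 where e2: "0 < e2" "coboundary_at ?n (small B e2, {{}}) b2 c"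
      using \<open>c \<in> ?BB\<close> by (auto simp: coboundaries_metric_iff)
    define e where "e = min e1 e2"
    have e: "0 < e" "e \<le> e1" "e \<le> e2" using e1(1) e2(1) by (auto simp: e_def)
    have b1: "coboundary_at ?n (small A e, {{}}) b1 c"
      by (rule coboundary_at_mono[OF e1(2)]) (use small_mono[OF e(2) subset_refl] in auto)
    have b2: "coboundary_at ?n (small B e, {{}}) b2 c"
      by (rule coboundary_at_mono[OF e2(2)]) (use small_mono[OF e(3) subset_refl] in auto)
    let ?b = "\<lambda>xs. if set xs \<subseteq> A then b1 xs else b2 xs"
    have b_B: "?b ys = b2 ys" if "set ys \<subseteq> B" "Suc (length ys) = ?n" for ys
    \<comment> \<open>Only the empty list lies in both sets, and there both primitives
      vanish.\<close>
    proof (cases "ys = []")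
      case True
      then show ?thesis using b1 b2 that(2) by (simp add: coboundary_at_def)
    next
      case False
      then have "\<not> set ys \<subseteq> A" using that(1) AB by (cases ys) auto
      then show ?thesis by simp
    qed
    have "coboundary_at ?n (small A e \<union> small B e, {{}}) ?b c"
      unfolding coboundary_at_def
    proof (intro conjI allI impI)
      fix xs assume xs: "length xs = ?n" "set xs \<in> fst (small A e \<union> small B e, {{}})"
      then have "set xs \<in> small A e \<or> set xs \<in> small B e" by auto
      then show "c xs = cobd ?b xs"
      proof
        assume M: "set xs \<in> small A e"
        have "cobd ?b xs = cobd b1 xs" using smallD(2)[OF M] by (intro cobd_cong) auto
        then show ?thesis using b1 xs(1) M by (simp add: coboundary_at_def)
      next
        assume N: "set xs \<in> small B e"
        have "cobd ?b xs = cobd b2 xs"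
        proof (rule cobd_cong)
          fix ys assume ys: "Suc (length ys) = length xs" "set ys \<subseteq> set xs"
          then have "set ys \<subseteq> B" "Suc (length ys) = ?n" using smallD(2)[OF N] xs(1) by auto
          then show "?b ys = b2 ys" by (rule b_B)
        qed
        then show ?thesis using b2 xs(1) N by (simp add: coboundary_at_def)
      qed
    next
      fix xs :: "'a list" assume "Suc (length xs) = ?n" "set xs \<in> snd (small A e \<union> small B e, {{}})"
      then show "?b xs = 0" using b1 by (simp add: coboundary_at_def)
    qed
    then show ?thesis using e(1) by (auto simp: coboundaries_pair_iff)
  qed
  have "quotient_rank ?Z ?B = quotient_rank ?Z ?B1 + quotient_rank ?B1 ?B"
    by (rule quotient_rank_additive[OF G Int[OF GZ GA]]) (use sub BA in auto)
  also have "quotient_rank ?Z ?B1 = quotient_rank ?ZA ?BA"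
  proof (rule quotient_rank_iso[OF id GZ GA])
    show "\<exists>f\<in>?Z. (\<lambda>x. f x - g x) \<in> ?BA" if "g \<in> ?ZA" for g using ext[OF that] by blast
  qed (use ZA in auto)
  also have "quotient_rank ?B1 ?B = quotient_rank ?ZB ?BB"
  proof (rule quotient_rank_iso[OF id Int[OF GZ GA] GB])
    show "\<exists>f\<in>?B1. (\<lambda>x. f x - g x) \<in> ?BB" if "g \<in> ?ZB" for g using ext[OF that] by blast
  qed (use ZB BB kernel in auto)
  finally show ?thesis
    using hrank_pair_system[OF A B, of ?n] by (simp add: hrank_def)
qed

lemma hrank_empty: "hrank m (metric_system {} {}) = 0"
  unfolding hrank_def
proof (rule quotient_rank_zero, rule subsetI)
  fix c :: "'a list \<Rightarrow> int" assume "c \<in> cocycles m (metric_system {} {})"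
  then obtain e where e: "0 < e" "cocycle_at m (small {} e, small {} e) c" by (auto simp: cocycles_metric_iff)
  have "coboundary_at m (small {} e, small {} e) (\<lambda>_. 0) c"
    using e(2) by (auto simp: coboundary_at_def cocycle_at_def)
  then show "c \<in> coboundaries m (metric_system {} {})" using e(1) by (auto simp: coboundaries_metric_iff)
qed

section \<open>Convex sets and their finite unions\<close>

text \<open>The straight-line contraction to \<open>q\<close> is cut into finitely many steps; each
  map shrinks distances and each step moves points by less than \<open>e / 2\<close>.\<close>

lemma acyclic_convex:
  fixes M :: "'a::real_normed_vector set"
  assumes M: "convex M" "compact M" "M \<noteq> {}"
  shows "acyclic_set M"
proof (rule acyclic_setI)
  fix e :: real assume e: "0 < e"
  obtain q where q: "q \<in> M" using M(3) by blast
  obtain b where b: "0 < b" "\<And>x. x \<in> M \<Longrightarrow> norm x \<le> b"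
    using compact_imp_bounded[OF M(2)] by (auto simp: bounded_pos)
  \<comment> \<open>Distances in \<open>M\<close> are at most \<open>2 * b\<close>, so this number
    of equal steps makes each step shorter than \<open>e / 2\<close>.\<close>
  obtain n :: nat where n: "4 * b / e < real n" using reals_Archimedean2 by blast
  have n0: "0 < real n" using n b(1) e by (meson divide_pos_pos less_trans mult_pos_pos zero_less_numeral)
  define f where "f j x = x + (real j / real n) *\<^sub>R (q - x)" for j :: nat and x
  have f_conv: "f j x = (1 - real j / real n) *\<^sub>R x + (real j / real n) *\<^sub>R q" for j x
    by (simp add: f_def algebra_simps)
  have f_M: "f j x \<in> M" if "x \<in> M" "j \<le> n" for j x
    unfolding f_conv using that n0 by (intro convexD[OF M(1)]) (auto simp: q)
  have f_dist: "dist (f j x) (f j y) \<le> dist x y" if "j \<le> n" for j x y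
  proof -
    have "f j x - f j y = (1 - real j / real n) *\<^sub>R (x - y)" by (simp add: f_def algebra_simps)
    then have "dist (f j x) (f j y) = \<bar>1 - real j / real n\<bar> * dist x y" by (simp add: dist_norm)
    also have "\<dots> \<le> 1 * dist x y" using that n0 by (intro mult_right_mono) auto
    finally show ?thesis by simp
  qed
  have f_step: "dist (f j x) (f (Suc j) x) < e / 2" if "x \<in> M" for j x
  proof -
    have "f (Suc j) x - f j x = (1 / real n) *\<^sub>R (q - x)"
      by (simp add: f_def add_divide_distrib algebra_simps)
    moreover have "dist (f j x) (f (Suc j) x) = norm (f (Suc j) x - f j x)"
      by (simp add: dist_norm norm_minus_commute)
    ultimately have "dist (f j x) (f (Suc j) x) = (1 / real n) * norm (q - x)" by simp
    also have "\<dots> \<le> (1 / real n) * (b + b)"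
      using b(2)[OF q] b(2)[OF that] norm_triangle_ineq4[of q x] n0 by (intro mult_left_mono) auto
    also have "\<dots> < e / 2" using n n0 e by (simp add: field_simps)
    finally show ?thesis .
  qed
  have cont: "contiguous (small M (e/2), {}) (small M e, {}) (f j) (f (Suc j))" if j: "j < n" for j
    unfolding contiguous_def fst_conv snd_conv
  proof (intro conjI ballI)
    fix \<sigma> assume \<sigma>: "\<sigma> \<in> small M (e/2)"
    have *: "dist (f i x) (f k y) < e" if "i \<in> {j, Suc j}" "k \<in> {j, Suc j}" "x \<in> \<sigma>" "y \<in> \<sigma>" for i k x y
    proof -
      have xM: "x \<in> M" "y \<in> M" using that smallD(2)[OF \<sigma>] by auto
      have "dist (f i x) (f k x) < e / 2"
        using f_step[OF xM(1), of j] that(1,2) e by (auto simp: dist_commute)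
      moreover have "dist (f k x) (f k y) < e / 2"
        using f_dist[of k x y] smallD(1)[OF \<sigma> that(3,4)] that(2) j by auto
      ultimately show ?thesis using dist_triangle[of "f i x" "f k y" "f k x"] by linarith
    qed
    have "f j ` \<sigma> \<union> f (Suc j) ` \<sigma> \<subseteq> M" using smallD(2)[OF \<sigma>] f_M j by auto
    then show "f j ` \<sigma> \<union> f (Suc j) ` \<sigma> \<in> small M e" using * unfolding small_def by auto
  qed simp
  have "scale_homotopic (small M (e/2), {}) (small M e, {}) (f 0) (f n)"
    by (rule scale_homotopic_chain[where f = f, OF cont])
  moreover have "f 0 = (\<lambda>x. x)" "f n = (\<lambda>_. q)" using n0 by (auto simp: f_def)
  ultimately show "\<exists>d>0. \<exists>q\<in>M. scale_homotopic (small M d, {}) (small M e, {}) (\<lambda>x. x) (\<lambda>_. q)"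
    using e q by (intro exI[of _ "e/2"] conjI bexI[of _ q]) auto
qed

lemma hrank_0: "hrank 0 (metric_system M {}) = 0"
  unfolding hrank_def
proof (rule quotient_rank_zero, rule subsetI)
  fix c :: "'a list \<Rightarrow> int" assume "c \<in> cocycles 0 (metric_system M {})"
  then obtain e where e: "0 < e" "cocycle_at 0 (small M e, small {} e) c" by (auto simp: cocycles_metric_iff)
  have "coboundary_at 0 (small M e, small {} e) (\<lambda>_. 0) c"
    using e(2) by (auto simp: coboundary_at_def cocycle_at_def)
  then show "c \<in> coboundaries 0 (metric_system M {})" using e(1) by (auto simp: coboundaries_metric_iff)
qed

lemma hrank_convex:
  fixes X :: "'a::real_normed_vector set"
  assumes "convex X" "compact X"
  shows "hrank (Suc m) (metric_system X {}) = (if X \<noteq> {} \<and> m = 0 then 1 else 0)"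
  using hrank_acyclic[OF acyclic_convex[OF assms]] hrank_empty by (cases "X = {}") auto

text \<open>Split off one set \<open>X\<close>. The remaining union and its intersection with
  \<open>X\<close> are unions of fewer compact convex sets, and the degree shift in the
  Mayer-Vietoris inequality raises the vanishing bound by one per set.\<close>

theorem finite_hrank_union_convex:
  fixes \<C> :: "'a::real_normed_vector set set"
  assumes "finite \<C>" "\<And>X. X \<in> \<C> \<Longrightarrow> convex X \<and> compact X"
  shows "finite_hrank (\<Union>\<C>) (card \<C>)"
  using assms
proof (induction "card \<C>" arbitrary: \<C> rule: less_induct)
  case less
  show ?case
  proof (cases "\<C> = {}")
    case True
    then show ?thesis by (simp add: finite_hrank_def hrank_empty)
  next
    case False
    then obtain X where X: "X \<in> \<C>" by blast
    define \<D> where "\<D> = \<C> - {X}"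
    have \<D>: "finite \<D>" "card \<C> = Suc (card \<D>)"
      using less.prems(1) card_Suc_Diff1[OF less.prems(1) X] by (simp_all add: \<D>_def)
    have cX: "convex X" "compact X" using less.prems(2)[OF X] by auto
    have cD: "convex Y \<and> compact Y" if "Y \<in> \<D>" for Y using less.prems(2) that by (auto simp: \<D>_def)
    have compD: "compact (\<Union>\<D>)" using cD \<D>(1) by (intro compact_Union) auto
    have h1: "finite_hrank (\<Union>\<D>) (card \<D>)" using less.hyps[OF _ \<D>(1) cD] \<D>(2) by simp
    let ?I = "(\<lambda>Y. Y \<inter> X) ` \<D>"
    have cI: "card ?I \<le> card \<D>" by (rule card_image_le[OF \<D>(1)])
    have "convex Y \<and> compact Y" if "Y \<in> ?I" for Y
      using that cD cX by (auto intro: convex_Int compact_Int)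
    then have "finite_hrank (\<Union>?I) (card ?I)" using less.hyps[of ?I] \<D> cI by simp
    moreover have "\<Union>?I = \<Union>\<D> \<inter> X" by blast
    \<comment> \<open>Different members may have the same intersection with \<open>X\<close>, so
      \<open>?I\<close> may be smaller than \<open>\<D>\<close>; the vanishing bound can be
      weakened.\<close>
    ultimately have h2: "finite_hrank (\<Union>\<D> \<inter> X) (card \<D>)" using cI by (simp add: finite_hrank_def)
    have eq: "\<Union>\<C> = \<Union>\<D> \<union> X" using X by (auto simp: \<D>_def)
    show ?thesis
      unfolding finite_hrank_def eq
    proof (intro allI conjI impI)
      fix m
      note MV = hrank_Mayer_Vietoris[OF compD cX(2), of m]
      have I: "hrank m (metric_system (\<Union>\<D> \<inter> X) {}) < \<infinity>"
        using h2 by (cases m) (simp_all add: hrank_0 finite_hrank_def)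
      have X: "hrank (Suc m) (metric_system X {}) < \<infinity>" by (simp add: hrank_convex[OF cX] one_enat_def zero_enat_def)
      have D: "hrank (Suc m) (metric_system (\<Union>\<D>) {}) < \<infinity>" using h1 by (simp add: finite_hrank_def)
      show "hrank (Suc m) (metric_system (\<Union>\<D> \<union> X) {}) < \<infinity>"
        using I X D by (intro le_less_trans[OF MV]) (auto simp: less_infinityE elim!: less_infinityE)
      assume m: "card \<C> \<le> m"
      then obtain k where k: "m = Suc k" "card \<D> \<le> k" using \<D>(2) by (cases m) auto
      have "hrank m (metric_system (\<Union>\<D> \<inter> X) {}) = 0" using h2 k by (simp add: finite_hrank_def)
      moreover have "hrank (Suc m) (metric_system X {}) = 0" using k(1) by (simp add: hrank_convex[OF cX])
      moreover have "hrank (Suc m) (metric_system (\<Union>\<D>) {}) = 0" using h1 k by (simp add: finite_hrank_def)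
      ultimately show "hrank (Suc m) (metric_system (\<Union>\<D> \<union> X) {}) = 0" using MV by simp
    qed
  qed
qed

section \<open>Flows and domination\<close>

text \<open>One notation for both theories: \<open>a = {{}}\<close> gives unreduced and
  \<open>a = {}\<close> reduced cohomology, so that each geometric argument is made once.\<close>

definition absolute_system :: "'a::metric_space set set \<Rightarrow> 'a set \<Rightarrow> 'a scale set" where
  "absolute_system a M = (\<lambda>e. (small M e, a)) ` {0<..}"

lemma metric_system_absolute: "metric_system M {} = absolute_system {{}} M"
  by (simp add: metric_system_def absolute_system_def)

lemma reduced_system_absolute: "reduced_system M = absolute_system {} M"
  by (simp add: reduced_system_def absolute_system_def)

lemma scale_system_absolute: "a \<subseteq> {{}} \<Longrightarrow> scale_system (absolute_system a M)"
  unfolding absolute_system_def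
  by (rule scale_system_metricI) (auto intro: small_mono small_subset)

lemma contiguous_absoluteI:
  assumes "a \<subseteq> {{}}" "\<And>\<sigma>. \<sigma> \<in> s \<Longrightarrow> f ` \<sigma> \<union> g ` \<sigma> \<in> t"
  shows "contiguous (s, a) (t, a) f g"
proof -
  have "f ` \<sigma> \<union> g ` \<sigma> = \<sigma>" if "\<sigma> \<in> a" for \<sigma> using assms(1) that by auto
  then show ?thesis using assms(2) by (auto simp: contiguous_def)
qed

lemma scale_homotopic_mono:
  assumes "scale_homotopic p q f g" "fst p' \<subseteq> fst p" "snd p' \<subseteq> snd p"
  shows "scale_homotopic p' q f g"
proof -
  have "contiguous p q \<le> contiguous p' q" using assms(2,3) unfolding contiguous_def le_fun_def le_bool_def by blast
  from rtranclp_mono[OF this] show ?thesis using assms(1) by (auto simp: scale_homotopic_def)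
qed

text \<open>Only \<open>r\<close> after \<open>i\<close> has to be homotopic to the identity.
  Pullback along \<open>i\<close> is then onto in cohomology, which bounds the rank and transports
  vanishing.\<close>

lemma hrank_dominated:
  fixes S :: "'a scale set" and T :: "'b scale set"
  assumes S: "scale_system S" and T: "scale_system T"
    and i: "\<And>q. q \<in> T \<Longrightarrow> \<exists>p\<in>S. scale_map p q i"
    and r: "\<And>p. p \<in> S \<Longrightarrow> \<exists>r. \<exists>q'\<in>T. \<exists>p'\<in>S. scale_map q' p r \<and> scale_homotopic p' p (\<lambda>x. x) (\<lambda>x. r (i x))"
  shows "hrank m S \<le> hrank m T"
    and "cocycles m T \<subseteq> coboundaries m T \<Longrightarrow> cocycles m S \<subseteq> coboundaries m S"
proof -
  have maps: "(\<lambda>xs. c (map i xs)) \<in> coboundaries m S" if c: "c \<in> coboundaries m T" for c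
  proof -
    obtain q b where q: "q \<in> T" "coboundary_at m q b c" using c by (auto simp: coboundaries_def)
    obtain p where p: "p \<in> S" "scale_map p q i" using i[OF q(1)] ..
    from coboundary_at_pullback[OF p(2) q(2)] p(1) show ?thesis unfolding coboundaries_def by blast
  qed
  note surj = scale_surjective[OF S T r]
  show "hrank m S \<le> hrank m T"
    unfolding hrank_def
  proof (rule quotient_rank_surjective[where F = "\<lambda>c xs. c (map i xs)"])
    show "additive_map (\<lambda>c xs. c (map i xs))" by (simp add: additive_map_def)
  qed (use maps surj additive_group_coboundaries[OF S] in auto)
  assume T0: "cocycles m T \<subseteq> coboundaries m T"
  show "cocycles m S \<subseteq> coboundaries m S"
  proof
    fix c assume "c \<in> cocycles m S"
    then obtain f where f: "f \<in> cocycles m T" "(\<lambda>xs. f (map i xs) - c xs) \<in> coboundaries m S"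
      using surj by blast
    have "(\<lambda>xs. f (map i xs)) \<in> coboundaries m S" using maps T0 f(1) by blast
    from additive_group_diff[OF additive_group_coboundaries[OF S] this f(2)]
    show "c \<in> coboundaries m S" by simp
  qed
qed

text \<open>In general a discontinuous choice, which approximate inverses tolerate.\<close>

definition nearest :: "'a::heine_borel set \<Rightarrow> 'a \<Rightarrow> 'a" where
  "nearest A x = (SOME y. y \<in> A \<and> infdist x A = dist x y)"

lemma nearest:
  assumes "compact A" "A \<noteq> {}"
  shows "nearest A x \<in> A" "dist x (nearest A x) = infdist x A"
proof -
  obtain y where "y \<in> A" "infdist x A = dist x y"
    by (rule infdist_attains_inf[OF compact_imp_closed[OF assms(1)] assms(2)]) (rule that)
  then have "\<exists>y. y \<in> A \<and> infdist x A = dist x y" by blast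
  from someI_ex[OF this] show "nearest A x \<in> A" "dist x (nearest A x) = infdist x A"
    by (simp_all add: nearest_def)
qed

lemma nearest_self: "compact A \<Longrightarrow> x \<in> A \<Longrightarrow> nearest A x = x"
  using nearest(2)[of A x] by fastforce

lemma open_infdist_subset:
  fixes A :: "'a::heine_borel set"
  assumes A: "compact A" "A \<noteq> {}" and U: "open U" "A \<subseteq> U"
  obtains e where "0 < e" "\<And>x. infdist x A \<le> e \<Longrightarrow> x \<in> U"
proof -
  obtain e where e: "0 < e" "(\<Union>x\<in>A. cball x e) \<subseteq> U"
    by (rule compact_subset_open_imp_cball_epsilon_subset[OF A(1) U]) (rule that)
  have "x \<in> U" if "infdist x A \<le> e" for x
  proof -
    have "nearest A x \<in> A" "x \<in> cball (nearest A x) e" using nearest[OF A, of x] that by (auto simp: dist_commute)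
    then show ?thesis using e(2) by blast
  qed
  then show ?thesis by (rule that[OF e(1)])
qed

section \<open>Uniform estimates along a flow\<close>

locale continuous_flow =
  fixes \<phi> :: "'a::euclidean_space \<Rightarrow> real \<Rightarrow> 'a"
  assumes flow: "flow \<phi>"
begin

lemma flow_0 [simp]: "\<phi> x 0 = x"
  and flow_flow [simp]: "\<phi> (\<phi> x s) t = \<phi> x (s + t)"
  using flow by (auto simp: flow_def)

lemma continuous_on_flow [continuous_intros]:
  assumes "continuous_on S f" "continuous_on S g"
  shows "continuous_on S (\<lambda>x. \<phi> (f x) (g x))"
proof -
  have "continuous_on UNIV (\<lambda>p. \<phi> (fst p) (snd p))" using flow by (simp add: flow_def case_prod_beta)
  from continuous_on_compose2[OF this continuous_on_Pair[OF assms]] show ?thesis by simp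
qed

lemma flow_uniform:
  assumes Y: "compact Y" and e: "0 < e"
  shows "\<exists>d>0. \<forall>x\<in>Y. \<forall>y\<in>Y. \<forall>s\<in>{-T..T}. \<forall>t\<in>{-T..T}. dist x y < d \<longrightarrow> \<bar>s - t\<bar> < d \<longrightarrow> dist (\<phi> x s) (\<phi> y t) < e"
proof -
  have "uniformly_continuous_on (Y \<times> {-T..T}) (\<lambda>p. \<phi> (fst p) (snd p))"
    using Y by (intro compact_uniformly_continuous continuous_intros compact_Times) auto
  then obtain d where d: "0 < d" "\<And>p q. p \<in> Y \<times> {-T..T} \<Longrightarrow> q \<in> Y \<times> {-T..T} \<Longrightarrow> dist q p < d \<Longrightarrow> dist (\<phi> (fst q) (snd q)) (\<phi> (fst p) (snd p)) < e"
    using e unfolding uniformly_continuous_on_def by meson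
  have "dist (\<phi> x s) (\<phi> y t) < e"
    if "x \<in> Y" "y \<in> Y" "s \<in> {-T..T}" "t \<in> {-T..T}" "dist x y < d/2" "\<bar>s - t\<bar> < d/2" for x y s t
  proof -
    have "dist (x, s) (y, t) \<le> dist x y + dist s t" unfolding dist_Pair_Pair by (rule sqrt_sum_squares_le_sum) auto
    then have "dist (x, s) (y, t) < d" using that(5,6) by (simp add: dist_real_def)
    then show ?thesis using d(2)[of "(y, t)" "(x, s)"] that by simp
  qed
  then show ?thesis using d(1) by (intro exI[of _ "d/2"]) simp
qed

text \<open>To be in \<open>U\<close> at a fixed time is an open condition, so finitely many times
  suffice for a compact set.\<close>

lemma compact_hit_time:
  assumes Q: "compact Q" and U: "open U" and hit: "\<And>x. x \<in> Q \<Longrightarrow> \<exists>t\<in>S. \<phi> x t \<in> U"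
  obtains T where "0 \<le> T" "\<And>x. x \<in> Q \<Longrightarrow> \<exists>t\<in>S. \<bar>t\<bar> \<le> T \<and> \<phi> x t \<in> U"
proof -
  let ?O = "\<lambda>t. (\<lambda>x. \<phi> x t) -` U"
  have "open (?O t)" for t
    by (intro open_vimage[OF U] continuous_intros)
  moreover have "Q \<subseteq> (\<Union>t\<in>S. ?O t)" using hit by blast
  ultimately obtain S' where S': "S' \<subseteq> S" "finite S'" "Q \<subseteq> (\<Union>t\<in>S'. ?O t)"
    using compactE_image[OF Q, of S ?O] by metis
  define T where "T = (\<Sum>t\<in>S'. \<bar>t\<bar>)"
  have "0 \<le> T" by (simp add: T_def sum_nonneg)
  moreover have "\<bar>t\<bar> \<le> T" if "t \<in> S'" for t
    unfolding T_def by (rule member_le_sum[OF that _ S'(2)]) simp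
  then have "\<exists>t\<in>S. \<bar>t\<bar> \<le> T \<and> \<phi> x t \<in> U" if "x \<in> Q" for x
    using S' that by blast
  ultimately show ?thesis by (rule that)
qed

lemma compact_stay_near:
  assumes A: "compact A" "A \<noteq> {}" and inv: "invariant \<phi> A" and e: "0 < e"
  shows "\<exists>d>0. \<forall>x. infdist x A \<le> d \<longrightarrow> (\<forall>t\<in>{-T..T}. infdist (\<phi> x t) A < e)"
proof -
  have comp: "compact {x. infdist x A \<le> 1}" by (rule compact_infdist_le[OF A(2,1)]) simp
  obtain d where d: "0 < d" "\<forall>x\<in>{x. infdist x A \<le> 1}. \<forall>y\<in>{x. infdist x A \<le> 1}. \<forall>s\<in>{-T..T}. \<forall>t\<in>{-T..T}.
      dist x y < d \<longrightarrow> \<bar>s - t\<bar> < d \<longrightarrow> dist (\<phi> x s) (\<phi> y t) < e"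
    using flow_uniform[OF comp e, of T] by blast
  have "infdist (\<phi> x t) A < e" if x: "infdist x A \<le> min 1 (d/2)" and t: "t \<in> {-T..T}" for x t
  proof -
    let ?y = "nearest A x"
    have y: "?y \<in> A" "dist x ?y < d" using nearest[OF A, of x] x d(1) by auto
    have "dist (\<phi> x t) (\<phi> ?y t) < e" using d x t y by simp
    moreover have "\<phi> ?y t \<in> A" using inv y(1) by (auto simp: invariant_def)
    ultimately show ?thesis using infdist_le[of "\<phi> ?y t" A "\<phi> x t"] by simp
  qed
  then show ?thesis using d(1) by (intro exI[of _ "min 1 (d/2)"]) auto
qed

text \<open>The time interval is divided into steps shorter than the modulus of uniform continuity;
  consecutive time maps are then contiguous. Positive invariance keeps them inside
  \<open>X\<close>.\<close>

lemma flow_homotopic: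
  assumes X: "compact X" and inv: "\<And>x t. x \<in> X \<Longrightarrow> 0 \<le> t \<Longrightarrow> \<phi> x t \<in> X"
    and T: "0 \<le> T" and e: "0 < e" and a: "a \<subseteq> {{}}"
  shows "\<exists>d>0. scale_homotopic (small X d, a) (small X e, a) (\<lambda>x. x) (\<lambda>x. \<phi> x T)"
proof -
  obtain d where d: "0 < d" "\<forall>x\<in>X. \<forall>y\<in>X. \<forall>s\<in>{-T..T}. \<forall>t\<in>{-T..T}.
      dist x y < d \<longrightarrow> \<bar>s - t\<bar> < d \<longrightarrow> dist (\<phi> x s) (\<phi> y t) < e"
    using flow_uniform[OF X e, of T] by blast
  obtain n :: nat where n: "T / d < real n" using reals_Archimedean2 by blast
  have n0: "0 < real n" using n T d(1) by (meson divide_nonneg_pos le_less_trans)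
  have step: "T / real n < d" using n n0 d(1) by (simp add: field_simps)
  define f where "f j x = \<phi> x (real j * T / real n)" for j :: nat and x
  have "contiguous (small X d, a) (small X e, a) (f j) (f (Suc j))" if j: "j < n" for j
  proof (rule contiguous_absoluteI[OF a])
    fix \<sigma> assume \<sigma>: "\<sigma> \<in> small X d"
    have time: "real i * T / real n \<in> {-T..T}" "0 \<le> real i * T / real n" if "i \<le> n" for i
    proof -
      have "real i * T \<le> real n * T" using that T by (intro mult_right_mono) auto
      then have "real i * T / real n \<le> T" using n0 by (simp add: divide_le_eq mult.commute)
      moreover show "0 \<le> real i * T / real n" using T by simp
      ultimately show "real i * T / real n \<in> {-T..T}" unfolding atLeastAtMost_iff using T by linarith
    qed
    have eq: "real (Suc j) * T / real n - real j * T / real n = T / real n" using n0 by (simp add: field_simps)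
    have fwd: "\<bar>real (Suc j) * T / real n - real j * T / real n\<bar> < d" unfolding eq using step T n0 by simp
    have diff: "\<bar>real i * T / real n - real k * T / real n\<bar> < d" if ik: "i \<in> {j, Suc j}" "k \<in> {j, Suc j}" for i k
    proof -
      consider "i = k" | "i = Suc j" "k = j" | "i = j" "k = Suc j" using ik by auto
      then show ?thesis
      proof cases
        case 3
        show ?thesis unfolding 3 by (subst abs_minus_commute) (rule fwd)
      qed (use fwd d(1) in simp_all)
    qed
    have "dist (f i x) (f k y) < e" if "i \<in> {j, Suc j}" "k \<in> {j, Suc j}" "x \<in> \<sigma>" "y \<in> \<sigma>" for i k x y
    proof -
      have "x \<in> X" "y \<in> X" "dist x y < d" using smallD[OF \<sigma>] that by auto
      moreover have "i \<le> n" "k \<le> n" using that j by auto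
      ultimately show ?thesis using d(2) time(1) diff[OF that(1,2)] unfolding f_def by blast
    qed
    moreover have "f j ` \<sigma> \<union> f (Suc j) ` \<sigma> \<subseteq> X"
      using smallD(2)[OF \<sigma>] inv time(2)[of j] time(2)[of "Suc j"] j by (auto simp: f_def)
    ultimately show "f j ` \<sigma> \<union> f (Suc j) ` \<sigma> \<in> small X e" unfolding small_def by auto
  qed
  then have "scale_homotopic (small X d, a) (small X e, a) (f 0) (f n)"
    by (rule scale_homotopic_chain)
  moreover have "f 0 = (\<lambda>x. x)" "f n = (\<lambda>x. \<phi> x T)" using n0 by (auto simp: f_def)
  ultimately show ?thesis using d(1) by auto
qed

lemma nearest_flow_small:
  assumes X: "compact X" "X \<noteq> {}" and Y: "compact Y" and T: "0 \<le> T"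
    and near: "\<And>y. y \<in> Y \<Longrightarrow> infdist (\<phi> y T) X \<le> e / 3" and e: "0 < e"
  shows "\<exists>d>0. \<forall>\<sigma>\<in>small Y d. (\<lambda>y. nearest X (\<phi> y T)) ` \<sigma> \<in> small X e"
proof -
  have e3: "0 < e / 3" using e by simp
  obtain d where d: "0 < d" "\<forall>x\<in>Y. \<forall>y\<in>Y. \<forall>s\<in>{-T..T}. \<forall>t\<in>{-T..T}.
      dist x y < d \<longrightarrow> \<bar>s - t\<bar> < d \<longrightarrow> dist (\<phi> x s) (\<phi> y t) < e / 3"
    using flow_uniform[OF Y e3, of T] by blast
  have "dist (nearest X (\<phi> x T)) (nearest X (\<phi> y T)) < e" if "x \<in> Y" "y \<in> Y" "dist x y < d" for x y
  proof -
    have "dist (\<phi> x T) (\<phi> y T) < e / 3" using d that T by auto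
    moreover have "dist (\<phi> x T) (nearest X (\<phi> x T)) \<le> e / 3" "dist (\<phi> y T) (nearest X (\<phi> y T)) \<le> e / 3"
      using nearest(2)[OF X] near that by auto
    moreover have "dist (nearest X (\<phi> x T)) (nearest X (\<phi> y T)) \<le>
        dist (\<phi> x T) (nearest X (\<phi> x T)) + dist (\<phi> x T) (nearest X (\<phi> y T))" by (rule dist_triangle3)
    moreover have "dist (\<phi> x T) (nearest X (\<phi> y T)) \<le> dist (\<phi> x T) (\<phi> y T) + dist (\<phi> y T) (nearest X (\<phi> y T))"
      by (rule dist_triangle)
    ultimately show ?thesis by linarith
  qed
  note close = this
  have "(\<lambda>y. nearest X (\<phi> y T)) ` \<sigma> \<in> small X e" if \<sigma>: "\<sigma> \<in> small Y d" for \<sigma>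
  proof -
    have "dist (nearest X (\<phi> x T)) (nearest X (\<phi> y T)) < e" if "x \<in> \<sigma>" "y \<in> \<sigma>" for x y
      using smallD[OF \<sigma>] that by (intro close) auto
    then show ?thesis using nearest(1)[OF X] by (auto simp: small_def)
  qed
  then show ?thesis using d(1) by blast
qed

section \<open>Domination by uniform attraction\<close>

definition uniformly_attracts :: "'a set \<Rightarrow> 'a set \<Rightarrow> bool" where
  "uniformly_attracts X Y \<longleftrightarrow> (\<forall>e>0. \<exists>T\<ge>0. \<forall>y\<in>Y. infdist (\<phi> y T) X \<le> e)"

text \<open>The approximate inverse flows for a long time \<open>T\<close> and then moves to a
  nearest point of \<open>X\<close>. On \<open>X\<close> the second step does nothing, and the flow
  itself joins the identity of \<open>X\<close> to its time \<open>T\<close> map.\<close>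

lemma absolute_domination:
  assumes X: "compact X" "X \<noteq> {}" "invariant \<phi> X" and Y: "compact Y" "X \<subseteq> Y"
    and att: "uniformly_attracts X Y" and a: "a \<subseteq> {{}}"
  shows "hrank m (absolute_system a X) \<le> hrank m (absolute_system a Y)"
    and "cocycles m (absolute_system a Y) \<subseteq> coboundaries m (absolute_system a Y) \<Longrightarrow>
      cocycles m (absolute_system a X) \<subseteq> coboundaries m (absolute_system a X)"
proof -
  have i: "\<exists>p\<in>absolute_system a X. scale_map p q (\<lambda>x. x)" if q: "q \<in> absolute_system a Y" for q
  proof -
    obtain e where e: "0 < e" "q = (small Y e, a)" using q by (auto simp: absolute_system_def)
    have "scale_map (small X e, a) q (\<lambda>x. x)"
      unfolding e(2) by (rule contiguous_absoluteI[OF a]) (use small_mono[OF order_refl Y(2)] in simp)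
    then show ?thesis using e(1) by (auto simp: absolute_system_def)
  qed
  have r: "\<exists>r. \<exists>q'\<in>absolute_system a Y. \<exists>p'\<in>absolute_system a X. scale_map q' p r \<and>
      scale_homotopic p' p (\<lambda>x. x) (\<lambda>x. r x)" if p: "p \<in> absolute_system a X" for p
  proof -
    obtain e where e: "0 < e" "p = (small X e, a)" using p by (auto simp: absolute_system_def)
    have "0 < e / 3" using e(1) by simp
    then obtain T where T: "0 \<le> T" "\<forall>y\<in>Y. infdist (\<phi> y T) X \<le> e / 3"
      using att unfolding uniformly_attracts_def by blast
    let ?r = "\<lambda>y. nearest X (\<phi> y T)"
    have near: "infdist (\<phi> y T) X \<le> e / 3" if "y \<in> Y" for y using T(2) that by blast
    obtain d where d: "0 < d" "\<forall>\<sigma>\<in>small Y d. ?r ` \<sigma> \<in> small X e"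
      using nearest_flow_small[OF X(1,2) Y(1) T(1) near e(1)] by blast
    have 1: "scale_map (small Y d, a) p ?r"
      unfolding e(2) by (rule contiguous_absoluteI[OF a]) (use d(2) in simp)
    have inv: "\<phi> x t \<in> X" if "x \<in> X" for x t using X(3) that by (auto simp: invariant_def)
    obtain d' where d': "0 < d'" "scale_homotopic (small X d', a) p (\<lambda>x. x) (\<lambda>x. \<phi> x T)"
      using flow_homotopic[OF X(1) inv T(1) e(1) a] unfolding e(2) by blast
    define t where "t = min d d'"
    have t: "0 < t" "t \<le> d" "t \<le> d'" using d(1) d'(1) by (auto simp: t_def)
    have "contiguous (small X t, a) (small X e, a) (\<lambda>x. \<phi> x T) ?r"
    proof (rule contiguous_absoluteI[OF a])
      fix \<sigma> assume \<sigma>: "\<sigma> \<in> small X t"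
      have "?r ` \<sigma> = (\<lambda>x. \<phi> x T) ` \<sigma>"
        using smallD(2)[OF \<sigma>] nearest_self[OF X(1)] inv by (intro image_cong) auto
      moreover have "?r ` \<sigma> \<in> small X e" using d(2) small_mono[OF t(2) Y(2) \<sigma>] by blast
      ultimately show "(\<lambda>x. \<phi> x T) ` \<sigma> \<union> ?r ` \<sigma> \<in> small X e" by simp
    qed
    moreover have "scale_homotopic (small X t, a) p (\<lambda>x. x) (\<lambda>x. \<phi> x T)"
      by (rule scale_homotopic_mono[OF d'(2)]) (use small_mono[OF t(3) subset_refl] in auto)
    ultimately have 2: "scale_homotopic (small X t, a) p (\<lambda>x. x) ?r"
      unfolding e(2) using contiguous_imp_homotopic scale_homotopic_trans by blast
    have "(small Y d, a) \<in> absolute_system a Y" "(small X t, a) \<in> absolute_system a X"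
      using d(1) t(1) by (auto simp: absolute_system_def)
    then show ?thesis using 1 2 by blast
  qed
  show "hrank m (absolute_system a X) \<le> hrank m (absolute_system a Y)"
    by (rule hrank_dominated(1)[OF scale_system_absolute[OF a] scale_system_absolute[OF a] i r])
  show "cocycles m (absolute_system a X) \<subseteq> coboundaries m (absolute_system a X)"
    if "cocycles m (absolute_system a Y) \<subseteq> coboundaries m (absolute_system a Y)"
    by (rule hrank_dominated(2)[OF scale_system_absolute[OF a] scale_system_absolute[OF a] i r that])
qed

lemma acyclic_dominated:
  assumes X: "compact X" "X \<noteq> {}" "invariant \<phi> X" and Y: "compact Y" "X \<subseteq> Y"
    and "uniformly_attracts X Y" "acyclic_set Y"
  shows "acyclic_set X"
  using absolute_domination(2)[OF X Y assms(6) empty_subsetI] assms(7)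
  unfolding acyclic_set_def reduced_system_absolute by blast

lemma hrank_dominated_metric:
  assumes X: "compact X" "X \<noteq> {}" "invariant \<phi> X" and Y: "compact Y" "X \<subseteq> Y"
    and "uniformly_attracts X Y"
  shows "hrank m (metric_system X {}) \<le> hrank m (metric_system Y {})"
  using absolute_domination(1)[OF X Y assms(6) subset_refl] unfolding metric_system_absolute .

text \<open>Positive invariance keeps the homotopy from the identity to the time \<open>T\<close>
  map inside \<open>Y\<close>, so the approximate inverse also works on the side of
  \<open>Y\<close>. Hence a cocycle on \<open>Y\<close> that is a coboundary on \<open>X\<close> is
  one on \<open>Y\<close>.\<close>

lemma hrank_reduced_retract:
  assumes X: "compact X" "X \<noteq> {}" "invariant \<phi> X" and Y: "compact Y" "X \<subseteq> Y"
    and att: "uniformly_attracts X Y" and pos: "\<And>y t. y \<in> Y \<Longrightarrow> 0 \<le> t \<Longrightarrow> \<phi> y t \<in> Y"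
  shows "hrank m (reduced_system Y) = hrank m (reduced_system X)"
proof (rule antisym)
  show "hrank m (reduced_system X) \<le> hrank m (reduced_system Y)"
    using absolute_domination(1)[OF X Y att empty_subsetI] unfolding reduced_system_absolute .
  show "hrank m (reduced_system Y) \<le> hrank m (reduced_system X)"
    unfolding hrank_def
  \<comment> \<open>Cochains are total functions, so restriction to \<open>X\<close> is the identity
    on them.\<close>
  proof (rule quotient_rank_injective[where F = "\<lambda>c. c"])
    show "additive_map (\<lambda>c::'a list \<Rightarrow> int. c)" by (simp add: additive_map_def)
    show "additive_group (cocycles m (reduced_system Y))" by (rule additive_group_cocycles[OF scale_system_reduced])
    show "c \<in> cocycles m (reduced_system X)" if "c \<in> cocycles m (reduced_system Y)" for c
    proof -
      obtain e where e: "0 < e" "cocycle_at m (small Y e, {}) c" using \<open>c \<in> _\<close> by (auto simp: cocycles_reduced_iff)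
      have "cocycle_at m (small X e, {}) c"
        by (rule cocycle_at_mono[OF e(2)]) (use small_mono[OF order_refl Y(2)] in auto)
      then show ?thesis using e(1) by (auto simp: cocycles_reduced_iff)
    qed
    fix c assume "c \<in> cocycles m (reduced_system Y)" "c \<in> coboundaries m (reduced_system X)"
    then obtain e1 e2 b where e1: "0 < e1" "cocycle_at m (small Y e1, {}) c"
      and e2: "0 < e2" "coboundary_at m (small X e2, {}) b c"
      by (auto simp: cocycles_reduced_iff coboundaries_reduced_iff)
    define e where "e = min e1 e2 / 3"
    have e: "0 < e" "e + e + e \<le> e1" "e \<le> e2" using e1(1) e2(1) by (auto simp: e_def)
    have e3: "0 < e / 3" using e(1) by simp
    obtain T where T: "0 \<le> T" "\<forall>y\<in>Y. infdist (\<phi> y T) X \<le> e / 3"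
      using att e3 unfolding uniformly_attracts_def by blast
    let ?r = "\<lambda>y. nearest X (\<phi> y T)"
    have near: "infdist (\<phi> y T) X \<le> e / 3" if "y \<in> Y" for y using T(2) that by blast
    obtain d where d: "0 < d" "\<forall>\<sigma>\<in>small Y d. ?r ` \<sigma> \<in> small X e"
      using nearest_flow_small[OF X(1,2) Y(1) T(1) near e(1)] by blast
    obtain d' where d': "0 < d'" "scale_homotopic (small Y d', {}) (small Y e1, {}) (\<lambda>x. x) (\<lambda>x. \<phi> x T)"
      using flow_homotopic[OF Y(1) pos T(1) e1(1) empty_subsetI] by blast
    define t where "t = min d d'"
    have t: "0 < t" "t \<le> d" "t \<le> d'" using d(1) d'(1) by (auto simp: t_def)
    have "contiguous (small Y t, {}) (small Y e1, {}) (\<lambda>x. \<phi> x T) ?r"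
    proof (rule contiguous_absoluteI[OF empty_subsetI])
      fix \<sigma> assume \<sigma>: "\<sigma> \<in> small Y t"
      have r: "?r ` \<sigma> \<in> small X e" using d(2) small_mono[OF t(2) subset_refl \<sigma>] by blast
      have close: "dist (\<phi> x T) (?r x) \<le> e / 3" if "x \<in> \<sigma>" for x
        using near[of x] nearest(2)[OF X(1,2), of "\<phi> x T"] smallD(2)[OF \<sigma>] that by auto
      have rr: "dist (?r x) (?r y) < e" if "x \<in> \<sigma>" "y \<in> \<sigma>" for x y
        using smallD(1)[OF r] that by blast
      have "dist (\<phi> x T) (?r y) < e1 \<and> dist (\<phi> x T) (\<phi> y T) < e1 \<and> dist (?r x) (?r y) < e1 \<and> dist (?r x) (\<phi> y T) < e1"
        if "x \<in> \<sigma>" "y \<in> \<sigma>" for x y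
      proof -
        have "dist (\<phi> x T) (?r y) \<le> dist (\<phi> x T) (?r x) + dist (?r x) (?r y)" by (rule dist_triangle)
        moreover have "dist (\<phi> x T) (\<phi> y T) \<le> dist (\<phi> x T) (?r y) + dist (\<phi> y T) (?r y)" by (rule dist_triangle2)
        moreover have "dist (?r x) (\<phi> y T) \<le> dist (?r x) (?r y) + dist (\<phi> y T) (?r y)" by (rule dist_triangle2)
        ultimately show ?thesis using close[OF that(1)] close[OF that(2)] rr[OF that] e(1,2) by linarith
      qed
      moreover have "(\<lambda>x. \<phi> x T) ` \<sigma> \<union> ?r ` \<sigma> \<subseteq> Y"
        using smallD(2)[OF \<sigma>] pos T(1) nearest(1)[OF X(1,2)] Y(2) by auto
      ultimately show "(\<lambda>x. \<phi> x T) ` \<sigma> \<union> ?r ` \<sigma> \<in> small Y e1" unfolding small_def by auto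
    qed
    moreover have "scale_homotopic (small Y t, {}) (small Y e1, {}) (\<lambda>x. x) (\<lambda>x. \<phi> x T)"
      by (rule scale_homotopic_mono[OF d'(2)]) (use small_mono[OF t(3) subset_refl] in auto)
    ultimately have hom: "scale_homotopic (small Y t, {}) (small Y e1, {}) (\<lambda>x. x) ?r"
      using contiguous_imp_homotopic scale_homotopic_trans by blast
    have "(small Y e1, {}) \<in> reduced_system Y" using e1(1) by (simp add: reduced_system_def)
    from scale_homotopic_coboundary_at[OF scale_system_reduced this hom e1(2)]
    obtain g where g: "coboundary_at m (small Y t, {}) g (\<lambda>xs. c (map ?r xs) - c (map (\<lambda>x. x) xs))" ..
    have "scale_map (small Y t, {}) (small X e2, {}) ?r"
    proof (rule contiguous_absoluteI[OF empty_subsetI])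
      fix \<sigma> assume \<sigma>: "\<sigma> \<in> small Y t"
      have "?r ` \<sigma> \<in> small X e" using d(2) small_mono[OF t(2) subset_refl \<sigma>] by blast
      then show "?r ` \<sigma> \<union> ?r ` \<sigma> \<in> small X e2" using small_mono[OF e(3) subset_refl] by simp
    qed
    from coboundary_at_diff[OF coboundary_at_pullback[OF this e2(2)] g]
    have "coboundary_at m (small Y t, {}) (\<lambda>xs. b (map ?r xs) - g xs) c" by simp
    then show "c \<in> coboundaries m (reduced_system Y)" using t(1) by (auto simp: coboundaries_reduced_iff)
  qed
qed

end

section \<open>Attractors, Lyapunov functions and isolating blocks\<close>

context continuous_flow
begin

definition stable_on :: "'a set \<Rightarrow> 'a set \<Rightarrow> bool" where
  "stable_on M S \<longleftrightarrow> (\<forall>e>0. \<exists>d>0. \<forall>x\<in>M. infdist x S \<le> d \<longrightarrow> (\<forall>t\<ge>0. infdist (\<phi> x t) S \<le> e))"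

text \<open>For an attractor of the global attractor this property passes to the whole space, where it
  implies stability and uniform attraction.\<close>

definition captures_backward :: "'a set \<Rightarrow> real \<Rightarrow> bool" where
  "captures_backward A \<delta> \<longleftrightarrow> compact A \<and> A \<noteq> {} \<and> invariant \<phi> A \<and> 0 < \<delta> \<and>
     (\<forall>y. (\<forall>t\<le>0. infdist (\<phi> y t) A \<le> \<delta>) \<longrightarrow> y \<in> A)"

lemma flow_persists:
  assumes "open U" "x \<in> U"
  obtains e where "0 < e" "\<And>t. \<bar>t\<bar> \<le> e \<Longrightarrow> \<phi> x t \<in> U"
proof -
  have "open ((\<lambda>t. \<phi> x t) -` U)" by (intro open_vimage assms(1) continuous_intros)
  moreover have "0 \<in> (\<lambda>t. \<phi> x t) -` U" using assms(2) by simp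
  ultimately obtain e where e: "0 < e" "cball 0 e \<subseteq> (\<lambda>t. \<phi> x t) -` U"
    by (meson open_contains_cball)
  have "\<phi> x t \<in> U" if "\<bar>t\<bar> \<le> e" for t
  proof -
    have "t \<in> cball 0 e" using that by simp
    then show ?thesis using e(2) by blast
  qed
  then show ?thesis by (rule that[OF e(1)])
qed

lemma stable_in_stable_on:
  assumes S: "compact S" "S \<noteq> {}" "S \<subseteq> M" and st: "stable_in M \<phi> S"
  shows "stable_on M S"
  unfolding stable_on_def
proof (intro allI impI)
  fix e :: real assume e: "0 < e"
  let ?U = "{x \<in> M. infdist x S \<le> e}"
  have "openin (top_of_set M) (M \<inter> {x. infdist x S < e})"
    by (intro openin_open_Int open_Collect_less continuous_intros)
  moreover have "S \<subseteq> M \<inter> {x. infdist x S < e}" using S(3) e by auto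
  ultimately have "nbhd_in M S ?U" unfolding nbhd_in_def by (intro conjI exI[of _ "M \<inter> {x. infdist x S < e}"]) auto
  then obtain V where V: "nbhd_in M S V" "\<forall>x\<in>V. \<forall>t\<ge>0. \<phi> x t \<in> ?U"
    using st unfolding stable_in_def by blast
  obtain W where W: "openin (top_of_set M) W" "S \<subseteq> W" "W \<subseteq> V" using V(1) unfolding nbhd_in_def by blast
  obtain G where G: "open G" "W = M \<inter> G" using W(1) by (auto simp: openin_open)
  have "S \<subseteq> G" using W(2) G(2) by blast
  obtain d where d: "0 < d" "\<And>x. infdist x S \<le> d \<Longrightarrow> x \<in> G"
    by (rule open_infdist_subset[OF S(1,2) G(1) \<open>S \<subseteq> G\<close>]) (rule that)
  have "infdist (\<phi> x t) S \<le> e" if x: "x \<in> M" "infdist x S \<le> d" "0 \<le> t" for x t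
  proof -
    have "x \<in> V" using d(2)[OF x(2)] x(1) G(2) W(3) by blast
    then show ?thesis using V(2) x(3) by blast
  qed
  then show "\<exists>d>0. \<forall>x\<in>M. infdist x S \<le> d \<longrightarrow> (\<forall>t\<ge>0. infdist (\<phi> x t) S \<le> e)"
    using d(1) by blast
qed

lemma omega_limit_infdist:
  assumes "omega_limit \<phi> x \<noteq> {}" "omega_limit \<phi> x \<subseteq> A" "0 < e"
  shows "\<exists>t\<ge>0. infdist (\<phi> x t) A < e"
proof -
  obtain y where y: "y \<in> omega_limit \<phi> x" "y \<in> A" using assms by blast
  have "y \<in> closure (\<phi> x ` {1..})" using y(1) unfolding omega_limit_def by auto
  then obtain t where t: "1 \<le> t" "dist (\<phi> x t) y < e" using assms(3) by (auto simp: closure_approachable)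
  then have "infdist (\<phi> x t) A < e" using infdist_le[OF y(2), of "\<phi> x t"] by linarith
  then show ?thesis using t(1) by (intro exI[of _ t]) auto
qed

section \<open>Backward orbits, stability and uniform attraction\<close>

text \<open>The point \<open>z\<close> is a limit of the backward orbit along integer times;
  continuity of the flow carries the convergence over to every time shift \<open>s\<close>.\<close>

lemma backward_limit:
  assumes B: "compact B" and y: "\<And>t. t \<le> 0 \<Longrightarrow> \<phi> y t \<in> B"
  shows "\<exists>z. (\<forall>s. \<phi> z s \<in> B) \<and> (\<forall>s. \<forall>e>0. \<exists>t\<le>0. dist (\<phi> y t) (\<phi> z s) < e)"
proof -
  have yB: "\<forall>n. \<phi> y (- real n) \<in> B" using y by simp
  obtain z r where z: "z \<in> B" "strict_mono r" "((\<lambda>n. \<phi> y (- real n)) \<circ> r) \<longlonglongrightarrow> z"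
    by (rule seq_compactE[OF compact_imp_seq_compact[OF B] yB]) (rule that)
  have lim: "(\<lambda>n. \<phi> y (s - real (r n))) \<longlonglongrightarrow> \<phi> z s" for s
  proof -
    have "continuous_on UNIV (\<lambda>x. \<phi> x s)" by (intro continuous_intros)
    then have "isCont (\<lambda>x. \<phi> x s) z" by (simp add: continuous_on_eq_continuous_at)
    from isCont_tendsto_compose[OF this z(3)] show ?thesis by (simp add: comp_def algebra_simps)
  qed
  have ev: "\<forall>\<^sub>F n in sequentially. s - real (r n) \<le> 0" for s
  proof -
    obtain N :: nat where N: "s \<le> real N" using real_arch_simple by blast
    have "s - real (r n) \<le> 0" if "N \<le> n" for n
      using N that seq_suble[OF z(2), of n] by simp
    then show ?thesis by (rule eventually_sequentiallyI)
  qed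
  have 1: "\<phi> z s \<in> B" for s
  proof (rule Lim_in_closed_set[OF compact_imp_closed[OF B] _ sequentially_bot lim])
    show "\<forall>\<^sub>F n in sequentially. \<phi> y (s - real (r n)) \<in> B" using ev[of s] by (rule eventually_mono) (rule y)
  qed
  have 2: "\<exists>t\<le>0. dist (\<phi> y t) (\<phi> z s) < e" if e: "0 < e" for s e
  proof -
    have "\<forall>\<^sub>F n in sequentially. dist (\<phi> y (s - real (r n))) (\<phi> z s) < e \<and> s - real (r n) \<le> 0"
      using tendstoD[OF lim e] ev by (rule eventually_conj)
    then obtain n where "dist (\<phi> y (s - real (r n))) (\<phi> z s) < e \<and> s - real (r n) \<le> 0"
      using eventually_happens'[OF sequentially_bot] by blast
    then show ?thesis by (intro exI[of _ "s - real (r n)"]) simp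
  qed
  show ?thesis using 1 2 by (intro exI[of _ z]) simp
qed

text \<open>Somewhere in the past the orbit of \<open>y\<close> was as close to \<open>S\<close> as
  desired, since it accumulates on full orbits which come near \<open>S\<close>. By stability it has
  remained close up to time 0, so \<open>y\<close> has distance zero from \<open>S\<close>.\<close>

lemma backward_in_stable:
  assumes S: "compact S" "S \<noteq> {}" and st: "stable_on M S" and B: "compact B" "B \<subseteq> M"
    and y: "\<And>t. t \<le> 0 \<Longrightarrow> \<phi> y t \<in> B"
    and near: "\<And>z e. (\<And>s. \<phi> z s \<in> B) \<Longrightarrow> 0 < e \<Longrightarrow> \<exists>t. infdist (\<phi> z t) S < e"
  shows "y \<in> S"
proof -
  have "\<exists>z. (\<forall>s. \<phi> z s \<in> B) \<and> (\<forall>s. \<forall>e>0. \<exists>t\<le>0. dist (\<phi> y t) (\<phi> z s) < e)"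
    by (rule backward_limit[OF B(1)]) (rule y)
  then obtain z where "(\<forall>s. \<phi> z s \<in> B) \<and> (\<forall>s. \<forall>e>0. \<exists>t\<le>0. dist (\<phi> y t) (\<phi> z s) < e)" ..
  then have z: "\<And>s. \<phi> z s \<in> B" "\<And>s e. 0 < e \<Longrightarrow> \<exists>t\<le>0. dist (\<phi> y t) (\<phi> z s) < e" by auto
  have "infdist y S \<le> e" if e: "0 < e" for e
  proof -
    obtain d where d: "0 < d" "\<forall>x\<in>M. infdist x S \<le> d \<longrightarrow> (\<forall>t\<ge>0. infdist (\<phi> x t) S \<le> e)"
      using st e unfolding stable_on_def by blast
    have "0 < d / 2" using d(1) by simp
    have "\<exists>s. infdist (\<phi> z s) S < d / 2" by (rule near) (rule z(1), fact)
    then obtain s where s: "infdist (\<phi> z s) S < d / 2" ..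
    obtain t where t: "t \<le> 0" "dist (\<phi> y t) (\<phi> z s) < d / 2" using z(2)[of "d / 2" s] d(1) by auto
    have "infdist (\<phi> y t) S \<le> d" using infdist_triangle[of "\<phi> y t" S "\<phi> z s"] s t(2) by linarith
    moreover have "\<phi> y t \<in> M" using y[OF t(1)] B(2) by blast
    ultimately have "\<forall>u\<ge>0. infdist (\<phi> (\<phi> y t) u) S \<le> e" using d(2) by blast
    then have "infdist (\<phi> (\<phi> y t) (- t)) S \<le> e" using t(1) by (metis neg_0_le_iff_le)
    then show ?thesis by simp
  qed
  then have "infdist y S \<le> 0" by (rule field_le_epsilon) simp
  then have "infdist y S = 0" using infdist_nonneg[of y S] by linarith
  then show ?thesis by (rule in_closed_iff_infdist_zero[OF compact_imp_closed[OF S(1)] S(2), THEN iffD2])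
qed

lemma global_attractorD:
  assumes "global_attractor \<phi> \<Omega>" "\<Omega> \<noteq> {}"
  shows "compact \<Omega>" "invariant \<phi> \<Omega>" "stable_on UNIV \<Omega>" "\<And>x e. 0 < e \<Longrightarrow> \<exists>t\<ge>0. infdist (\<phi> x t) \<Omega> < e"
proof -
  show "compact \<Omega>" "invariant \<phi> \<Omega>" using assms by (auto simp: global_attractor_def attractor_in_def)
  then show "stable_on UNIV \<Omega>"
    using assms by (intro stable_in_stable_on) (auto simp: global_attractor_def attractor_in_def)
  show "\<exists>t\<ge>0. infdist (\<phi> x t) \<Omega> < e" if "0 < e" for x e
    using assms(1) that unfolding global_attractor_def by (intro omega_limit_infdist) auto
qed

lemma backward_bounded_in_global_attractor:
  assumes "global_attractor \<phi> \<Omega>" "\<Omega> \<noteq> {}" and "compact B" "\<And>t. t \<le> 0 \<Longrightarrow> \<phi> y t \<in> B"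
  shows "y \<in> \<Omega>"
proof (rule backward_in_stable[where B = B and M = UNIV])
  show "\<exists>t. infdist (\<phi> z t) \<Omega> < e" if "0 < e" for z e
    using global_attractorD(4)[OF assms(1,2) that, of z] by blast
qed (use assms global_attractorD[OF assms(1,2)] in auto)

lemma captures_backward_global:
  assumes "global_attractor \<phi> \<Omega>" "\<Omega> \<noteq> {}"
  shows "captures_backward \<Omega> 1"
  unfolding captures_backward_def
proof (intro conjI allI impI)
  fix y assume y: "\<forall>t\<le>0. infdist (\<phi> y t) \<Omega> \<le> 1"
  show "y \<in> \<Omega>"
  proof (rule backward_bounded_in_global_attractor[OF assms])
    show "compact {x. infdist x \<Omega> \<le> 1}"
      by (rule compact_infdist_le[OF assms(2) global_attractorD(1)[OF assms]]) simp
  qed (use y in auto)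
qed (use global_attractorD[OF assms] assms(2) in auto)

text \<open>A backward orbit near \<open>A\<close> is bounded and therefore contained in
  \<open>\<Omega>\<close>, where stability and attraction of \<open>A\<close> in the restricted flow
  apply to it.\<close>

lemma attractor_in_global:
  assumes \<Omega>: "global_attractor \<phi> \<Omega>" and A: "attractor_in \<Omega> \<phi> A" "A \<noteq> {}"
  shows "\<exists>\<delta>. captures_backward A \<delta> \<and> (\<forall>x\<in>\<Omega>. infdist x A \<le> \<delta> \<longrightarrow> x \<in> basin_in \<Omega> \<phi> A)"
proof -
  have A': "A \<subseteq> \<Omega>" "compact A" "invariant \<phi> A" "stable_in \<Omega> \<phi> A" "attracting_in \<Omega> \<phi> A"
    using A(1) by (auto simp: attractor_in_def)
  have \<Omega>0: "\<Omega> \<noteq> {}" using A'(1) A(2) by blast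
  note \<Omega>' = global_attractorD[OF \<Omega> \<Omega>0]
  have st: "stable_on \<Omega> A" by (rule stable_in_stable_on[OF A'(2) A(2) A'(1,4)])
  obtain U where U: "nbhd_in \<Omega> A U" "\<forall>x\<in>U. omega_limit \<phi> x \<noteq> {} \<and> omega_limit \<phi> x \<subseteq> A"
    using A'(5) unfolding attracting_in_def by blast
  obtain W where W: "openin (top_of_set \<Omega>) W" "A \<subseteq> W" "W \<subseteq> U" using U(1) unfolding nbhd_in_def by blast
  obtain G where G: "open G" "W = \<Omega> \<inter> G" using W(1) by (auto simp: openin_open)
  have "A \<subseteq> G" using W(2) G(2) by blast
  obtain \<delta> where \<delta>: "0 < \<delta>" "\<And>x. infdist x A \<le> \<delta> \<Longrightarrow> x \<in> G"
    by (rule open_infdist_subset[OF A'(2) A(2) G(1) \<open>A \<subseteq> G\<close>]) (rule that)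
  have basin: "omega_limit \<phi> x \<noteq> {} \<and> omega_limit \<phi> x \<subseteq> A" if "x \<in> \<Omega>" "infdist x A \<le> \<delta>" for x
    using \<delta>(2)[OF that(2)] that(1) G(2) W(3) U(2) by blast
  let ?K = "{x. infdist x A \<le> \<delta>}"
  have K: "compact ?K" by (rule compact_infdist_le[OF A(2) A'(2) \<delta>(1)])
  have "y \<in> A" if y: "\<forall>t\<le>0. infdist (\<phi> y t) A \<le> \<delta>" for y
  proof (rule backward_in_stable[where B = "?K \<inter> \<Omega>" and M = \<Omega>])
    show "compact A" "A \<noteq> {}" "stable_on \<Omega> A" "compact (?K \<inter> \<Omega>)" "?K \<inter> \<Omega> \<subseteq> \<Omega>"
      using A'(2) A(2) st K \<Omega>'(1) by (auto intro: compact_Int)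
    have "y \<in> \<Omega>" by (rule backward_bounded_in_global_attractor[OF \<Omega> \<Omega>0 K]) (use y in simp)
    then show "\<phi> y t \<in> ?K \<inter> \<Omega>" if "t \<le> 0" for t using y that \<Omega>'(2) by (simp add: invariant_def)
    fix z e assume z: "\<And>s. \<phi> z s \<in> ?K \<inter> \<Omega>" and e: "0 < (e::real)"
    have "omega_limit \<phi> z \<noteq> {} \<and> omega_limit \<phi> z \<subseteq> A" using basin[of z] z[of 0] by simp
    then show "\<exists>t. infdist (\<phi> z t) A < e" using omega_limit_infdist[OF _ _ e] by blast
  qed
  then have "captures_backward A \<delta>" using A' A(2) \<delta>(1) by (simp add: captures_backward_def)
  moreover have "x \<in> basin_in \<Omega> \<phi> A" if "x \<in> \<Omega>" "infdist x A \<le> \<delta>" for x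
    using basin[OF that] that(1) by (simp add: basin_in_def)
  ultimately show ?thesis by blast
qed

lemma captures_backward_mono: "captures_backward A \<delta> \<Longrightarrow> 0 < \<epsilon> \<Longrightarrow> \<epsilon> \<le> \<delta> \<Longrightarrow> captures_backward A \<epsilon>"
  unfolding captures_backward_def using order_trans by blast

lemma captures_backward_escape:
  assumes A: "captures_backward A \<delta>" and Q: "compact Q" "Q \<inter> A = {}"
  obtains T where "0 \<le> T" "\<And>y. y \<in> Q \<Longrightarrow> \<exists>t. - T \<le> t \<and> t \<le> 0 \<and> \<delta> < infdist (\<phi> y t) A"
proof -
  have "open {x. \<delta> < infdist x A}" by (intro open_Collect_less continuous_intros)
  moreover have "\<exists>t\<in>{..0}. \<phi> y t \<in> {x. \<delta> < infdist x A}" if "y \<in> Q" for y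
  proof (rule ccontr)
    assume "\<not> ?thesis"
    then have "\<forall>t\<le>0. infdist (\<phi> y t) A \<le> \<delta>" by (auto simp: not_less)
    then have "y \<in> A" using A by (auto simp: captures_backward_def)
    then show False using that Q(2) by blast
  qed
  ultimately obtain T where T: "0 \<le> T" "\<And>y. y \<in> Q \<Longrightarrow> \<exists>t\<in>{..0}. \<bar>t\<bar> \<le> T \<and> \<phi> y t \<in> {x. \<delta> < infdist x A}"
    by (rule compact_hit_time[OF Q(1)]) (assumption, rule that)
  have "\<exists>t. - T \<le> t \<and> t \<le> 0 \<and> \<delta> < infdist (\<phi> y t) A" if y: "y \<in> Q" for y
  proof -
    obtain t where "t \<le> 0" "\<bar>t\<bar> \<le> T" "\<delta> < infdist (\<phi> y t) A" using T(2)[OF y] by auto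
    then show ?thesis by (intro exI[of _ t]) simp
  qed
  then show ?thesis by (rule that[OF T(1)])
qed

text \<open>A point at distance exactly \<open>\<epsilon>\<close> was farther away within the last
  \<open>T\<close> units of time. An orbit starting so close to \<open>A\<close> that it stays
  within \<open>\<epsilon>\<close> up to time \<open>T\<close> can therefore have no first time at
  which it reaches that distance.\<close>

lemma captures_backward_stable:
  assumes A: "captures_backward A \<delta>"
  shows "stable_on UNIV A"
  unfolding stable_on_def
proof (intro allI impI)
  have A': "compact A" "A \<noteq> {}" "invariant \<phi> A" "0 < \<delta>" using A by (auto simp: captures_backward_def)
  fix e :: real assume "0 < e"
  define \<epsilon> where "\<epsilon> = min e \<delta>"
  have \<epsilon>: "0 < \<epsilon>" "\<epsilon> \<le> \<delta>" "\<epsilon> \<le> e" using \<open>0 < e\<close> A'(4) by (auto simp: \<epsilon>_def)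
  note A\<epsilon> = captures_backward_mono[OF A \<epsilon>(1,2)]
  let ?Q = "{x. infdist x A \<le> \<epsilon>} \<inter> {x. \<epsilon> \<le> infdist x A}"
  have "compact ?Q"
    by (intro compact_Int_closed compact_infdist_le A' \<epsilon>(1) closed_Collect_le continuous_intros)
  moreover have "?Q \<inter> A = {}" using \<epsilon>(1) by auto
  ultimately obtain T where T: "0 \<le> T" "\<And>y. y \<in> ?Q \<Longrightarrow> \<exists>t. - T \<le> t \<and> t \<le> 0 \<and> \<epsilon> < infdist (\<phi> y t) A"
    by (rule captures_backward_escape[OF A\<epsilon>]) (rule that)
  obtain d where d: "0 < d" "\<forall>x. infdist x A \<le> d \<longrightarrow> (\<forall>t\<in>{-T..T}. infdist (\<phi> x t) A < \<epsilon>)"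
    using compact_stay_near[OF A'(1-3) \<epsilon>(1), of T] by blast
  have "infdist (\<phi> x t0) A \<le> \<epsilon>" if x: "infdist x A \<le> d" and t0: "0 \<le> t0" for x t0
  proof (rule ccontr)
    let ?g = "\<lambda>t. infdist (\<phi> x t) A"
    assume "\<not> ?g t0 \<le> \<epsilon>"
    have cont: "continuous_on I ?g" for I by (intro continuous_intros)
    let ?S = "{0..t0} \<inter> {t. \<epsilon> \<le> ?g t}"
    have "compact ?S" by (intro compact_Int_closed closed_Collect_le continuous_intros) auto
    moreover have "?S \<noteq> {}" using \<open>\<not> ?g t0 \<le> \<epsilon>\<close> t0 by force
    ultimately obtain s where s: "s \<in> ?S" "\<forall>t\<in>?S. s \<le> t" using compact_attains_inf by metis
    have before: "?g t < \<epsilon>" if "0 \<le> t" "t < s" for t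
    proof (rule ccontr)
      assume "\<not> ?g t < \<epsilon>"
      then have "t \<in> ?S" using that s(1) by auto
      then have "s \<le> t" using s(2) by blast
      then show False using that(2) by simp
    qed
    have near: "?g t < \<epsilon>" if "t \<in> {-T..T}" for t using d(2) x that by blast
    have "?g 0 < \<epsilon>" using T(1) by (intro near) simp
    obtain s' where s': "0 \<le> s'" "s' \<le> s" "?g s' = \<epsilon>"
      using IVT'[of ?g 0 \<epsilon> s, OF _ _ _ cont] s(1) \<open>?g 0 < \<epsilon>\<close> by auto
    then have "s' = s" using before[of s'] by (cases "s' = s") auto
    then have gs: "?g s = \<epsilon>" using s'(3) by simp
    then have "\<phi> x s \<in> ?Q" by simp
    then obtain t where t: "- T \<le> t" "t \<le> 0" "\<epsilon> < infdist (\<phi> (\<phi> x s) t) A" using T(2) by blast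
    have "T < s"
    proof (rule ccontr)
      assume "\<not> T < s"
      then have "?g s < \<epsilon>" using s(1) T(1) by (intro near) auto
      then show False using gs by simp
    qed
    then have "0 \<le> s + t" "s + t \<le> s" using t by auto
    then have "?g (s + t) \<le> \<epsilon>" using before[of "s + t"] gs by (cases "s + t = s") auto
    then show False using t(3) by simp
  qed
  then show "\<exists>d>0. \<forall>x\<in>UNIV. infdist x A \<le> d \<longrightarrow> (\<forall>t\<ge>0. infdist (\<phi> x t) A \<le> e)"
    using d(1) \<epsilon>(3) by (meson order_trans)
qed

text \<open>Points at distance between \<open>d\<close> and \<open>\<delta>\<close> were outside the
  \<open>\<delta>\<close>-neighbourhood within the last \<open>T\<close> units of time. Orbits
  starting within \<open>\<eta>\<close> never leave that neighbourhood, so after time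
  \<open>T\<close> they are closer than \<open>d\<close>.\<close>

lemma captures_backward_attracts:
  assumes A: "captures_backward A \<delta>"
  obtains \<eta> where "0 < \<eta>" "\<eta> \<le> \<delta>" "\<And>x t. infdist x A \<le> \<eta> \<Longrightarrow> 0 \<le> t \<Longrightarrow> infdist (\<phi> x t) A \<le> \<delta>"
    "\<And>e. 0 < e \<Longrightarrow> \<exists>T\<ge>0. \<forall>x. infdist x A \<le> \<eta> \<longrightarrow> (\<forall>t\<ge>T. infdist (\<phi> x t) A \<le> e)"
proof -
  have A': "compact A" "A \<noteq> {}" "invariant \<phi> A" "0 < \<delta>" using A by (auto simp: captures_backward_def)
  note st = captures_backward_stable[OF A, unfolded stable_on_def]
  obtain \<eta>0 where \<eta>0: "0 < \<eta>0" "\<forall>x\<in>UNIV. infdist x A \<le> \<eta>0 \<longrightarrow> (\<forall>t\<ge>0. infdist (\<phi> x t) A \<le> \<delta>)"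
    using st A'(4) by blast
  define \<eta> where "\<eta> = min \<eta>0 \<delta>"
  have \<eta>: "0 < \<eta>" "\<eta> \<le> \<delta>" and stay: "\<And>x t. infdist x A \<le> \<eta> \<Longrightarrow> 0 \<le> t \<Longrightarrow> infdist (\<phi> x t) A \<le> \<delta>"
    using \<eta>0 A'(4) by (auto simp: \<eta>_def)
  have att: "\<exists>T\<ge>0. \<forall>x. infdist x A \<le> \<eta> \<longrightarrow> (\<forall>t\<ge>T. infdist (\<phi> x t) A \<le> e)" if e: "0 < e" for e
  proof -
    obtain d where d: "0 < d" "\<forall>x\<in>UNIV. infdist x A \<le> d \<longrightarrow> (\<forall>t\<ge>0. infdist (\<phi> x t) A \<le> e)"
      using st e by blast
    let ?Q = "{x. infdist x A \<le> \<delta>} \<inter> {x. d \<le> infdist x A}"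
    have "compact ?Q"
      by (intro compact_Int_closed compact_infdist_le A' closed_Collect_le continuous_intros)
    moreover have "?Q \<inter> A = {}" using d(1) by auto
    ultimately obtain T where T: "0 \<le> T" "\<And>y. y \<in> ?Q \<Longrightarrow> \<exists>t. - T \<le> t \<and> t \<le> 0 \<and> \<delta> < infdist (\<phi> y t) A"
      by (rule captures_backward_escape[OF A]) (rule that)
    have "infdist (\<phi> x s) A \<le> e" if x: "infdist x A \<le> \<eta>" and s: "T \<le> s" for x s
    proof -
      have "infdist (\<phi> x s) A \<le> \<delta>" using stay[OF x] s T(1) by simp
      have "\<phi> x s \<notin> ?Q"
      proof
        assume "\<phi> x s \<in> ?Q"
        then obtain t where "- T \<le> t" "\<delta> < infdist (\<phi> (\<phi> x s) t) A" using T(2) by blast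
        then show False using stay[OF x, of "s + t"] s by simp
      qed
      then have "infdist (\<phi> x s) A \<le> d" using \<open>infdist (\<phi> x s) A \<le> \<delta>\<close> by auto
      then have "infdist (\<phi> (\<phi> x s) 0) A \<le> e" using d(2) by blast
      then show ?thesis by simp
    qed
    then show ?thesis using T(1) by blast
  qed
  show ?thesis by (rule that[OF \<eta> stay att])
qed

text \<open>By compactness all orbits enter the region controlled by stability before a common time,
  and from then on they stay near \<open>S\<close>.\<close>

lemma compact_uniformly_attracted:
  assumes st: "stable_on M S" and inv: "\<And>x t. x \<in> M \<Longrightarrow> 0 \<le> t \<Longrightarrow> \<phi> x t \<in> M" and Q: "compact Q" "Q \<subseteq> M"
    and hit: "\<And>x e. x \<in> Q \<Longrightarrow> 0 < e \<Longrightarrow> \<exists>t\<ge>0. infdist (\<phi> x t) S < e"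
  shows "uniformly_attracts S Q"
  unfolding uniformly_attracts_def
proof (intro allI impI)
  fix e :: real assume "0 < e"
  then obtain d where d: "0 < d" "\<forall>x\<in>M. infdist x S \<le> d \<longrightarrow> (\<forall>t\<ge>0. infdist (\<phi> x t) S \<le> e)"
    using st unfolding stable_on_def by blast
  have "open {x. infdist x S < d}" by (intro open_Collect_less continuous_intros)
  moreover have "\<exists>t\<in>{0..}. \<phi> x t \<in> {x. infdist x S < d}" if "x \<in> Q" for x using hit[OF that d(1)] by auto
  ultimately obtain T where T: "0 \<le> T" "\<And>x. x \<in> Q \<Longrightarrow> \<exists>t\<in>{0..}. \<bar>t\<bar> \<le> T \<and> \<phi> x t \<in> {x. infdist x S < d}"
    by (rule compact_hit_time[OF Q(1)]) (assumption, rule that)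
  have "infdist (\<phi> x T) S \<le> e" if x: "x \<in> Q" for x
  proof -
    obtain t where t: "0 \<le> t" "\<bar>t\<bar> \<le> T" "infdist (\<phi> x t) S < d" using T(2)[OF x] by auto
    have "\<phi> x t \<in> M" using inv x Q(2) t(1) by blast
    then have "\<forall>u\<ge>0. infdist (\<phi> (\<phi> x t) u) S \<le> e" using d(2) less_imp_le[OF t(3)] by blast
    moreover have "0 \<le> T - t" using t(1,2) by simp
    ultimately have "infdist (\<phi> (\<phi> x t) (T - t)) S \<le> e" by blast
    then show ?thesis by simp
  qed
  then show "\<exists>T\<ge>0. \<forall>y\<in>Q. infdist (\<phi> y T) S \<le> e" using T(1) by blast
qed

end

section \<open>Lyapunov functions\<close>

context continuous_flow
begin

text \<open>The bound \<open>infdist x A \<le> f x\<close> keeps sublevel sets for levels below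
  \<open>\<eta>\<close> away from the edge of the region in which \<open>f\<close> is
  controlled.\<close>

definition lyapunov :: "'a set \<Rightarrow> real \<Rightarrow> ('a \<Rightarrow> real) \<Rightarrow> bool" where
  "lyapunov A \<eta> f \<longleftrightarrow> 0 < \<eta> \<and> continuous_on {x. infdist x A \<le> \<eta>} f \<and>
     (\<forall>x. infdist x A \<le> \<eta> \<longrightarrow> infdist x A \<le> f x) \<and> (\<forall>x\<in>A. f x = 0) \<and>
     (\<forall>x t. x \<notin> A \<longrightarrow> 0 < t \<longrightarrow> infdist x A \<le> \<eta> \<longrightarrow> infdist (\<phi> x t) A \<le> \<eta> \<longrightarrow> f (\<phi> x t) < f x)"

text \<open>The supremum of the distances to \<open>A\<close> along the forward orbit is only weakly decreasing; the increasing
  weight \<open>w\<close> makes it strictly decreasing outside \<open>A\<close>.\<close>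

lemma lyapunov_exists:
  assumes A: "captures_backward A \<delta>"
  shows "\<exists>\<eta> f. \<eta> \<le> \<delta> \<and> lyapunov A \<eta> f"
proof -
  have A': "compact A" "A \<noteq> {}" "invariant \<phi> A" "0 < \<delta>" using A by (auto simp: captures_backward_def)
  obtain \<eta> where \<eta>: "0 < \<eta>" "\<eta> \<le> \<delta>"
    and stay: "\<And>x t. infdist x A \<le> \<eta> \<Longrightarrow> 0 \<le> t \<Longrightarrow> infdist (\<phi> x t) A \<le> \<delta>"
    and att: "\<And>e. 0 < e \<Longrightarrow> \<exists>T\<ge>0. \<forall>x. infdist x A \<le> \<eta> \<longrightarrow> (\<forall>t\<ge>T. infdist (\<phi> x t) A \<le> e)"
    by (rule captures_backward_attracts[OF A]) blast
  let ?X = "{x. infdist x A \<le> \<eta>}"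
  have X: "compact ?X" by (rule compact_infdist_le[OF A'(2,1) \<eta>(1)])
  \<comment> \<open>The weight increases strictly from 1 towards 2, so it distorts distances by at
    most a factor 2.\<close>
  define w where "w t = 2 - 1 / (1 + t)" for t :: real
  define f where "f x = (SUP t\<in>{0..}. w t * infdist (\<phi> x t) A)" for x
  have w: "1 \<le> w t" "w t \<le> 2" if "0 \<le> t" for t using that by (auto simp: w_def field_simps)
  have bound: "w t * infdist (\<phi> x t) A \<le> 2 * \<delta>" if "x \<in> ?X" "0 \<le> t" for x t
    using w[OF that(2)] stay[of x t] that by (intro mult_mono) (auto simp: infdist_nonneg)
  have bdd: "bdd_above ((\<lambda>t. w t * infdist (\<phi> x t) A) ` {0..})" if "x \<in> ?X" for x
    using bound[OF that] by (intro bdd_aboveI[of _ "2 * \<delta>"]) auto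
  have upper: "w t * infdist (\<phi> x t) A \<le> f x" if "x \<in> ?X" "0 \<le> t" for x t
    unfolding f_def by (rule cSUP_upper[OF _ bdd[OF that(1)]]) (use that in simp)
  have lower: "infdist x A \<le> f x" if "x \<in> ?X" for x
    using upper[OF that, of 0] by (simp add: w_def)
  have least: "f x \<le> c" if "\<And>t. 0 \<le> t \<Longrightarrow> w t * infdist (\<phi> x t) A \<le> c" for x c
    unfolding f_def by (rule cSUP_least) (use that in auto)
  have cont: "continuous_on ?X f"
  proof (rule uniformly_continuous_imp_continuous, unfold uniformly_continuous_on_def, intro allI impI)
    fix e :: real assume e: "0 < e"
    have "0 < e / 4" using e by simp
    then obtain T where T: "0 \<le> T" "\<forall>x. infdist x A \<le> \<eta> \<longrightarrow> (\<forall>t\<ge>T. infdist (\<phi> x t) A \<le> e / 4)"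
      using att by blast
    obtain d where d: "0 < d" "\<forall>x\<in>?X. \<forall>y\<in>?X. \<forall>s\<in>{-T..T}. \<forall>t\<in>{-T..T}.
        dist x y < d \<longrightarrow> \<bar>s - t\<bar> < d \<longrightarrow> dist (\<phi> x s) (\<phi> y t) < e / 4"
      using flow_uniform[OF X \<open>0 < e / 4\<close>, of T] by blast
    have le: "f y \<le> f x + e / 2" if xy: "x \<in> ?X" "y \<in> ?X" "dist x y < d" for x y
    proof (rule least)
      fix t :: real assume t: "0 \<le> t"
      have pos: "0 \<le> f x" using lower[OF xy(1)] infdist_nonneg[of x A] by linarith
      have small: "w t * s \<le> e / 2" if "0 \<le> s" "s \<le> e / 4" for s
      proof -
        have "w t * s \<le> 2 * (e / 4)" using w[OF t] that by (intro mult_mono) auto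
        then show ?thesis by simp
      qed
      show "w t * infdist (\<phi> y t) A \<le> f x + e / 2"
      proof (cases "t \<le> T")
        case True
        have "\<bar>t - t\<bar> < d" "t \<in> {-T..T}" using True t T(1) d(1) by auto
        then have "dist (\<phi> x t) (\<phi> y t) < e / 4" using d(2) xy by blast
        then have "infdist (\<phi> y t) A \<le> infdist (\<phi> x t) A + e / 4"
          using infdist_triangle[of "\<phi> y t" A "\<phi> x t"] by (simp add: dist_commute)
        then have "w t * infdist (\<phi> y t) A \<le> w t * (infdist (\<phi> x t) A + e / 4)"
          using w(1)[OF t] by (intro mult_left_mono) auto
        also have "\<dots> = w t * infdist (\<phi> x t) A + w t * (e / 4)" by (rule distrib_left)
        also have "\<dots> \<le> f x + e / 2" using upper[OF xy(1) t] small[of "e / 4"] e by (intro add_mono) auto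
        finally show ?thesis .
      next
        case False
        have "infdist (\<phi> y t) A \<le> e / 4" using T(2) xy(2) False by auto
        then have "w t * infdist (\<phi> y t) A \<le> e / 2" by (intro small infdist_nonneg)
        then show ?thesis using pos by linarith
      qed
    qed
    have "dist (f y) (f x) < e" if "x \<in> ?X" "y \<in> ?X" "dist y x < d" for x y
      using le[of x y] le[of y x] that e by (auto simp: dist_real_def dist_commute abs_less_iff)
    then show "\<exists>d>0. \<forall>x\<in>?X. \<forall>x'\<in>?X. dist x' x < d \<longrightarrow> dist (f x') (f x) < e" using d(1) by blast
  qed
  have zero: "f x = 0" if x: "x \<in> A" for x
  proof -
    have "infdist (\<phi> x t) A = 0" for t
      using A'(3) x by (simp add: invariant_def)
    then show ?thesis by (simp add: f_def)
  qed
  have decr: "f (\<phi> x t) < f x" if x: "x \<notin> A" "0 < t" "infdist x A \<le> \<eta>" "infdist (\<phi> x t) A \<le> \<eta>" for x t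
  proof -
    let ?y = "\<phi> x t"
    have "?y \<notin> A"
    proof
      assume "?y \<in> A"
      then have "\<phi> ?y (- t) \<in> A" using A'(3) unfolding invariant_def by blast
      then show False using x(1) by simp
    qed
    then have "0 < infdist ?y A"
      using in_closed_iff_infdist_zero[OF compact_imp_closed[OF A'(1)] A'(2), of ?y] infdist_nonneg[of ?y A] by linarith
    then have pos: "0 < f ?y" using lower[of ?y] x(4) by simp
    then have "0 < f ?y / 4" by simp
    then obtain T where T: "0 \<le> T" "\<forall>x. infdist x A \<le> \<eta> \<longrightarrow> (\<forall>t\<ge>T. infdist (\<phi> x t) A \<le> f ?y / 4)"
      using att by blast
    \<comment> \<open>A lower bound for the gain \<open>w (t + s) - w s\<close> over all
      \<open>s\<close> up to \<open>T\<close>; after that time the orbit is too close to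
      \<open>A\<close> to matter.\<close>
    define c where "c = t / ((1 + T) * (1 + T + t))"
    have c: "0 < c" using x(2) T(1) by (simp add: c_def)
    \<comment> \<open>Times at which the orbit is within \<open>f ?y / 4\<close> of \<open>A\<close>
      contribute at most \<open>f ?y / 2\<close>. At all others the weight counted from
      \<open>x\<close> exceeds the one counted from \<open>?y\<close> by at least
      \<open>c\<close>.\<close>
    have "f ?y \<le> max (f ?y / 2) (f x - c * (f ?y / 4))"
    proof (rule least)
      fix s :: real assume s: "0 \<le> s"
      let ?d = "infdist (\<phi> ?y s) A"
      show "w s * ?d \<le> max (f ?y / 2) (f x - c * (f ?y / 4))"
      proof (cases "?d \<le> f ?y / 4")
        case True
        have "w s * ?d \<le> 2 * (f ?y / 4)" using w[OF s] True pos by (intro mult_mono) (auto simp: infdist_nonneg)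
        then show ?thesis by simp
      next
        case False
        then have "s < T" using T(2) x(4) by (meson not_less)
        have "(1 + s) * (1 + s + t) \<le> (1 + T) * (1 + T + t)"
          using \<open>s < T\<close> s x(2) T(1) by (intro mult_mono) auto
        then have "c \<le> t / ((1 + s) * (1 + s + t))"
          unfolding c_def using s x(2) T(1) by (intro divide_left_mono mult_pos_pos) auto
        also have "\<dots> = w (t + s) - w s" using s x(2) by (simp add: w_def field_simps)
        finally have "c * (f ?y / 4) \<le> (w (t + s) - w s) * ?d"
          using False pos c by (intro mult_mono) auto
        then have "w s * ?d \<le> w (t + s) * infdist (\<phi> x (t + s)) A - c * (f ?y / 4)"
          by (simp add: left_diff_distrib)
        also have "\<dots> \<le> f x - c * (f ?y / 4)" using upper[of x "t + s"] x s by simp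
        finally show ?thesis by simp
      qed
    qed
    moreover have "0 < c * (f ?y / 4)" using c pos by simp
    ultimately show ?thesis using pos by linarith
  qed
  have "lyapunov A \<eta> f" unfolding lyapunov_def using \<eta>(1) cont lower zero decr by blast
  then show ?thesis using \<eta>(2) by blast
qed

lemma lyapunov_open:
  assumes "lyapunov A \<eta> f" "open B"
  shows "open {x. infdist x A < \<eta> \<and> f x \<in> B}"
proof -
  have "open {x. infdist x A < \<eta>}" by (intro open_Collect_less continuous_intros)
  moreover have "continuous_on {x. infdist x A < \<eta>} f"
    using assms(1) unfolding lyapunov_def by (elim conjE continuous_on_subset) auto
  ultimately have "open ({x. infdist x A < \<eta>} \<inter> f -` B)" using assms(2) by (intro continuous_open_preimage)
  then show ?thesis by (simp add: vimage_def Collect_conj_eq[symmetric])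
qed

lemma lyapunov_compact:
  assumes f: "lyapunov A \<eta> f" and A: "compact A" "A \<noteq> {}" and B: "closed B"
  shows "compact {x. infdist x A \<le> \<eta> \<and> f x \<in> B}"
proof -
  let ?X = "{x. infdist x A \<le> \<eta>}"
  have f': "0 < \<eta>" "continuous_on ?X f" using f by (auto simp: lyapunov_def)
  have X: "compact ?X" by (rule compact_infdist_le[OF A(2,1) f'(1)])
  have "closed (?X \<inter> f -` B)" by (rule continuous_on_closed_vimage[THEN iffD1, rule_format, OF compact_imp_closed[OF X] f'(2) B, unfolded Int_commute[of "f -` B"]])
  then have "compact (?X \<inter> (?X \<inter> f -` B))" by (rule compact_Int_closed[OF X])
  moreover have "?X \<inter> (?X \<inter> f -` B) = {x. infdist x A \<le> \<eta> \<and> f x \<in> B}" by auto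
  ultimately show ?thesis by simp
qed

lemma lyapunov_forward:
  assumes f: "lyapunov A \<eta> f" and x: "x \<notin> A" "infdist x A < \<eta>"
  shows "\<exists>e>0. \<forall>t\<in>{0<..e}. infdist (\<phi> x t) A < \<eta> \<and> f (\<phi> x t) < f x"
proof -
  have "open {x. infdist x A < \<eta>}" by (intro open_Collect_less continuous_intros)
  moreover have "x \<in> {x. infdist x A < \<eta>}" using x by simp
  ultimately obtain e where e: "0 < e" "\<And>t. \<bar>t\<bar> \<le> e \<Longrightarrow> \<phi> x t \<in> {x. infdist x A < \<eta>}"
    by (rule flow_persists) (rule that)
  have "infdist (\<phi> x t) A < \<eta> \<and> f (\<phi> x t) < f x" if "t \<in> {0<..e}" for t
    using e(2)[of t] f x that unfolding lyapunov_def by simp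
  then show ?thesis using e(1) by blast
qed

text \<open>Decrease is applied from the earlier point \<open>\<phi> x t\<close>, which lies off
  \<open>A\<close> by invariance.\<close>

lemma lyapunov_backward:
  assumes f: "lyapunov A \<eta> f" and inv: "invariant \<phi> A" and x: "x \<notin> A" "infdist x A < \<eta>"
  shows "\<exists>e>0. \<forall>t\<in>{-e..<0}. infdist (\<phi> x t) A < \<eta> \<and> f x < f (\<phi> x t)"
proof -
  have "open {x. infdist x A < \<eta>}" by (intro open_Collect_less continuous_intros)
  moreover have "x \<in> {x. infdist x A < \<eta>}" using x by simp
  ultimately obtain e where e: "0 < e" "\<And>t. \<bar>t\<bar> \<le> e \<Longrightarrow> \<phi> x t \<in> {x. infdist x A < \<eta>}"
    by (rule flow_persists) (rule that)
  have "infdist (\<phi> x t) A < \<eta> \<and> f x < f (\<phi> x t)" if t: "t \<in> {-e..<0}" for t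
  proof -
    have near: "infdist (\<phi> x t) A < \<eta>" using e(2)[of t] t by simp
    have "\<phi> x t \<notin> A"
    proof
      assume "\<phi> x t \<in> A"
      then have "\<phi> (\<phi> x t) (- t) \<in> A" using inv unfolding invariant_def by blast
      then show False using x(1) by simp
    qed
    moreover have "infdist (\<phi> (\<phi> x t) (- t)) A \<le> \<eta>" using x(2) by simp
    moreover have "0 < - t" using t by simp
    ultimately have "f (\<phi> (\<phi> x t) (- t)) < f (\<phi> x t)"
      using f near unfolding lyapunov_def by (meson less_imp_le)
    then show ?thesis using near by simp
  qed
  then show ?thesis using e(1) by blast
qed

section \<open>Isolating blocks of an attractor and of its dual repeller\<close>

lemma maximal_invariantI:
  assumes "invariant \<phi> S" "S \<subseteq> N" "\<And>y. (\<And>t. \<phi> y t \<in> N) \<Longrightarrow> y \<in> S"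
  shows "S = maximal_invariant \<phi> N"
proof
  show "S \<subseteq> maximal_invariant \<phi> N" using assms(1,2) by (auto simp: maximal_invariant_def)
  show "maximal_invariant \<phi> N \<subseteq> S"
  proof
    fix y assume "y \<in> maximal_invariant \<phi> N"
    then obtain T where "T \<subseteq> N" "invariant \<phi> T" "y \<in> T" by (auto simp: maximal_invariant_def)
    then show "y \<in> S" by (intro assms(3)) (auto simp: invariant_def)
  qed
qed

text \<open>A sublevel set of a Lyapunov function: its frontier lies on one level, which orbits
  cross inwards only, so the exit set is empty.\<close>

lemma attractor_block:
  assumes A: "captures_backward A \<delta>"
  shows "\<exists>N Ni. isolating_block \<phi> A N Ni {}"
proof -
  have A': "compact A" "A \<noteq> {}" "invariant \<phi> A" "0 < \<delta>" using A by (auto simp: captures_backward_def)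
  obtain \<eta> f where f: "\<eta> \<le> \<delta>" "lyapunov A \<eta> f" using lyapunov_exists[OF A] by blast
  have f': "0 < \<eta>" "\<And>x. infdist x A \<le> \<eta> \<Longrightarrow> infdist x A \<le> f x" "\<And>x. x \<in> A \<Longrightarrow> f x = 0"
    using f(2) by (auto simp: lyapunov_def)
  \<comment> \<open>Any level strictly between 0 and \<open>\<eta>\<close> would do;
    \<open>N\<close> then lies in the open \<open>\<eta>\<close>-neighbourhood of
    \<open>A\<close>.\<close>
  define a where "a = \<eta> / 2"
  have a: "0 < a" "a < \<eta>" using f'(1) by (auto simp: a_def)
  define N where "N = {x. infdist x A \<le> \<eta> \<and> f x \<in> {..a}}"
  define I where "I = {x. infdist x A < \<eta> \<and> f x \<in> {..<a}}"
  have "open I" unfolding I_def by (intro lyapunov_open f) auto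
  moreover have "I \<subseteq> N" by (auto simp: I_def N_def)
  ultimately have I: "I \<subseteq> interior N" by (simp add: interior_maximal)
  have N: "compact N" unfolding N_def by (intro lyapunov_compact[OF f(2)] A') auto
  have near: "infdist x A < \<eta>" if "x \<in> N" for x using f'(2)[of x] that a(2) by (auto simp: N_def)
  have fr: "f x = a" "x \<notin> A" "infdist x A < \<eta>" if "x \<in> frontier N" for x
  proof -
    have x: "x \<in> N" "x \<notin> interior N"
      using that compact_imp_closed[OF N] by (auto simp: frontier_def)
    show "infdist x A < \<eta>" by (rule near[OF x(1)])
    then have "\<not> f x < a" using x(2) I by (auto simp: I_def)
    then show "f x = a" using x(1) by (simp add: N_def)
    then show "x \<notin> A" using f'(3)[of x] a(1) by auto
  qed
  have "A \<subseteq> I" using f'(1,3) a(1) by (auto simp: I_def)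
  have "isolating_block \<phi> A N (frontier N) {}"
    unfolding isolating_block_def
  proof (intro conjI ballI)
    show "compact N" by (rule N)
    show "A \<subseteq> interior N" using \<open>A \<subseteq> I\<close> I by blast
    show "A = maximal_invariant \<phi> N"
    proof (rule maximal_invariantI)
      fix y assume y: "\<And>t. \<phi> y t \<in> N"
      have "infdist (\<phi> y t) A \<le> \<delta>" for t using y[of t] f(1) by (simp add: N_def)
      then show "y \<in> A" using A by (simp add: captures_backward_def)
    qed (use A' \<open>A \<subseteq> I\<close> \<open>I \<subseteq> N\<close> in auto)
    show "compact (frontier N)" by (rule compact_frontier[OF N])
    show "\<exists>e>0. \<forall>t\<in>{-e..<0}. \<phi> x t \<notin> N" if x: "x \<in> frontier N" for x
      using lyapunov_backward[OF f(2) A'(3) fr(2,3)[OF x]] fr(1)[OF x] by (fastforce simp: N_def)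
    show "\<exists>e>0. \<forall>t\<in>{0<..e}. \<phi> x t \<in> interior N" if x: "x \<in> frontier N - {}" for x
    proof -
      have x': "x \<in> frontier N" using x by simp
      obtain e where e: "0 < e" "\<forall>t\<in>{0<..e}. infdist (\<phi> x t) A < \<eta> \<and> f (\<phi> x t) < f x"
        using lyapunov_forward[OF f(2) fr(2,3)[OF x']] by blast
      have "\<phi> x t \<in> interior N" if "t \<in> {0<..e}" for t
        using e(2) that fr(1)[OF x'] I by (auto simp: I_def)
      then show ?thesis using e(1) by blast
    qed
  qed auto
  then show ?thesis by blast
qed

text \<open>The block is a sublevel set of a Lyapunov function \<open>g\<close> of
  \<open>\<Omega>\<close> with an open sublevel set of a Lyapunov function \<open>f\<close> of
  \<open>A\<close> removed. Orbits enter through the level of \<open>g\<close> and leave through the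
  level of \<open>f\<close>.\<close>

lemma repeller_block:
  assumes \<Omega>: "captures_backward \<Omega> \<beta>" and A: "captures_backward A \<alpha>" "A \<subseteq> \<Omega>"
    and basin: "\<And>x. x \<in> \<Omega> \<Longrightarrow> infdist x A \<le> \<alpha> \<Longrightarrow> x \<in> basin_in \<Omega> \<phi> A"
    and R: "R = \<Omega> - basin_in \<Omega> \<phi> A" "invariant \<phi> R"
  shows "\<exists>N Ni No. isolating_block \<phi> R N Ni No"
proof -
  have A': "compact A" "A \<noteq> {}" "invariant \<phi> A" "0 < \<alpha>" using A by (auto simp: captures_backward_def)
  have \<Omega>': "compact \<Omega>" "\<Omega> \<noteq> {}" "invariant \<phi> \<Omega>" "0 < \<beta>" using \<Omega> by (auto simp: captures_backward_def)
  obtain \<eta> f where f: "\<eta> \<le> \<alpha>" "lyapunov A \<eta> f" using lyapunov_exists[OF A(1)] by blast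
  have f': "0 < \<eta>" "\<And>x. infdist x A \<le> \<eta> \<Longrightarrow> infdist x A \<le> f x" "\<And>x. x \<in> A \<Longrightarrow> f x = 0"
    using f(2) by (auto simp: lyapunov_def)
  obtain \<theta> g where g: "\<theta> \<le> \<beta>" "lyapunov \<Omega> \<theta> g" using lyapunov_exists[OF \<Omega>] by blast
  have g': "0 < \<theta>" "\<And>x. infdist x \<Omega> \<le> \<theta> \<Longrightarrow> infdist x \<Omega> \<le> g x" "\<And>x. x \<in> \<Omega> \<Longrightarrow> g x = 0"
    using g(2) by (auto simp: lyapunov_def)
  define a where "a = \<eta> / 2"
  have a: "0 < a" "a < \<eta>" using f'(1) by (auto simp: a_def)
  define b where "b = \<theta> / 2"
  have b: "0 < b" "b < \<theta>" using g'(1) by (auto simp: b_def)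
  define V where "V = {x. infdist x A < \<eta> \<and> f x \<in> {..<a}}"
  \<comment> \<open>The open region beyond the level \<open>a\<close> of \<open>f\<close>. Far from
    \<open>A\<close>, where nothing is known about \<open>f\<close>, it is described by the
    distance, which is consistent because \<open>f\<close> dominates the distance near
    \<open>A\<close>.\<close>
  define W where "W = {x. a < infdist x A} \<union> {x. infdist x A < \<eta> \<and> f x \<in> {a<..}}"
  define G where "G = {x. infdist x \<Omega> < \<theta> \<and> g x \<in> {..<b}}"
  define N where "N = {x. infdist x \<Omega> \<le> \<theta> \<and> g x \<in> {..b}} - V"
  define Ni where "Ni = {x. infdist x \<Omega> \<le> \<theta> \<and> g x \<in> {b}} - V"
  define No where "No = N \<inter> {x. infdist x A \<le> \<eta> \<and> f x \<in> {a}}"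
  have V: "open V" unfolding V_def by (intro lyapunov_open f) auto
  have W: "open W" unfolding W_def by (intro open_Un lyapunov_open f open_Collect_less continuous_intros)
  have G: "open G" unfolding G_def by (intro lyapunov_open g) auto
  have VW: "x \<notin> W" if "x \<in> V" for x using f'(2)[of x] that by (auto simp: V_def W_def)
  have "G \<inter> W \<subseteq> N" using VW by (auto simp: G_def N_def)
  then have int: "G \<inter> W \<subseteq> interior N" using V W G by (simp add: interior_maximal open_Int)
  have N: "compact N" and Ni: "compact Ni"
    unfolding N_def Ni_def by (intro compact_diff V lyapunov_compact[OF g(2)] \<Omega>'; simp)+
  have No: "compact No"
    unfolding No_def by (intro compact_Int N lyapunov_compact[OF f(2)] A') auto
  have near: "infdist x \<Omega> < \<theta>" if "infdist x \<Omega> \<le> \<theta>" "g x \<le> b" for x using g'(2)[of x] that b(2) by auto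
  have nearA: "infdist x A < \<eta>" if "infdist x A \<le> \<eta>" "f x = a" for x using f'(2)[of x] that a(2) by auto
  have notV: "x \<in> W \<or> (infdist x A \<le> \<eta> \<and> f x = a)" if "x \<notin> V" for x
    using that a(2) by (auto simp: V_def W_def)
  have entry: "\<exists>e>0. \<forall>t\<in>{-e..<0}. \<phi> x t \<notin> N" if x: "x \<in> Ni" for x
  proof -
    have x': "g x = b" "infdist x \<Omega> < \<theta>" using x near[of x] by (auto simp: Ni_def)
    then have "x \<notin> \<Omega>" using g'(3)[of x] b(1) by auto
    obtain e where "0 < e" "\<forall>t\<in>{-e..<0}. infdist (\<phi> x t) \<Omega> < \<theta> \<and> g x < g (\<phi> x t)"
      using lyapunov_backward[OF g(2) \<Omega>'(3) \<open>x \<notin> \<Omega>\<close> x'(2)] by blast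
    then show ?thesis using x'(1) by (intro exI[of _ e]) (auto simp: N_def)
  qed
  have A_out: "x \<notin> A" if "f x = a" for x using f'(3)[of x] a(1) that by auto
  have exit: "\<exists>e>0. \<forall>t\<in>{0<..e}. \<phi> x t \<notin> N" if x: "x \<in> No" for x
  proof -
    have x': "f x = a" "infdist x A < \<eta>" using x nearA[of x] by (auto simp: No_def)
    obtain e where "0 < e" "\<forall>t\<in>{0<..e}. infdist (\<phi> x t) A < \<eta> \<and> f (\<phi> x t) < f x"
      using lyapunov_forward[OF f(2) A_out[OF x'(1)] x'(2)] by blast
    then show ?thesis using x'(1) by (intro exI[of _ e]) (auto simp: N_def V_def)
  qed
  have sub: "Ni \<subseteq> N" "No \<subseteq> N" by (auto simp: Ni_def N_def No_def)
  \<comment> \<open>An interior point cannot leave \<open>N\<close> within arbitrarily short time,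
    so immediate entry or exit detects the frontier.\<close>
  have frontierI: "x \<in> frontier N" if x: "x \<in> N" "\<And>e. 0 < e \<Longrightarrow> \<exists>t. \<bar>t\<bar> \<le> e \<and> \<phi> x t \<notin> N" for x
  proof -
    have "x \<notin> interior N"
    proof
      assume "x \<in> interior N"
      then obtain e where "0 < e" "\<And>t. \<bar>t\<bar> \<le> e \<Longrightarrow> \<phi> x t \<in> interior N"
        by (rule flow_persists[OF open_interior]) (rule that)
      then show False using x(2)[of e] interior_subset[of N] by blast
    qed
    then show ?thesis using x(1) closure_subset[of N] by (auto simp: frontier_def)
  qed
  have fr: "x \<in> N" "x \<notin> G \<inter> W" if "x \<in> frontier N" for x
    using that compact_imp_closed[OF N] int by (auto simp: frontier_def)
  have frontier: "frontier N = Ni \<union> No"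
  proof
    show "frontier N \<subseteq> Ni \<union> No"
    proof
      fix x assume "x \<in> frontier N"
      note x = fr[OF this]
      then have "infdist x \<Omega> < \<theta>" "x \<notin> V" using near[of x] by (auto simp: N_def)
      then show "x \<in> Ni \<union> No" using x notV[of x] by (auto simp: G_def N_def Ni_def No_def)
    qed
    show "Ni \<union> No \<subseteq> frontier N"
    proof
      fix x assume "x \<in> Ni \<union> No"
      then show "x \<in> frontier N"
      proof
        assume x: "x \<in> Ni"
        obtain d where d: "0 < d" "\<forall>t\<in>{-d..<0}. \<phi> x t \<notin> N" using entry[OF x] by blast
        show ?thesis
        proof (rule frontierI)
          show "\<exists>t. \<bar>t\<bar> \<le> e \<and> \<phi> x t \<notin> N" if "0 < e" for e
            using d that by (intro exI[of _ "- min d e"]) auto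
        qed (use x sub in auto)
      next
        assume x: "x \<in> No"
        obtain d where d: "0 < d" "\<forall>t\<in>{0<..d}. \<phi> x t \<notin> N" using exit[OF x] by blast
        show ?thesis
        proof (rule frontierI)
          show "\<exists>t. \<bar>t\<bar> \<le> e \<and> \<phi> x t \<notin> N" if "0 < e" for e
            using d that by (intro exI[of _ "min d e"]) auto
        qed (use x sub in auto)
      qed
    qed
  qed
  have RGW: "R \<subseteq> G \<inter> W"
  proof
    fix x assume "x \<in> R"
    then have x: "x \<in> \<Omega>" "\<not> infdist x A \<le> \<alpha>" using R(1) basin by auto
    then show "x \<in> G \<inter> W" using g'(1,3) b(1) a(2) f(1) by (auto simp: G_def W_def)
  qed
  have "isolating_block \<phi> R N Ni No"
    unfolding isolating_block_def
  proof (intro conjI ballI)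
    show "R \<subseteq> interior N" using RGW int by blast
    show "R = maximal_invariant \<phi> N"
    proof (rule maximal_invariantI[OF R(2)])
      fix y assume y: "\<And>t. \<phi> y t \<in> N"
      have "infdist (\<phi> y t) \<Omega> \<le> \<beta>" for t using y[of t] g(1) by (simp add: N_def)
      then have "y \<in> \<Omega>" using \<Omega> by (simp add: captures_backward_def)
      \<comment> \<open>An orbit in the basin comes arbitrarily close to \<open>A\<close> and thus
        enters \<open>V\<close>, which was cut out of \<open>N\<close>.\<close>
      moreover have "y \<notin> basin_in \<Omega> \<phi> A"
      proof
        assume y': "y \<in> basin_in \<Omega> \<phi> A"
        have "A \<subseteq> V" using f'(1,3) a(1) by (auto simp: V_def)
        obtain e where e: "0 < e" "\<And>x. infdist x A \<le> e \<Longrightarrow> x \<in> V"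
          by (rule open_infdist_subset[OF A'(1,2) V \<open>A \<subseteq> V\<close>]) (rule that)
        obtain t where "infdist (\<phi> y t) A < e"
          using omega_limit_infdist[OF _ _ e(1), of y A] y' by (auto simp: basin_in_def)
        then have "\<phi> y t \<in> V" by (intro e(2)) simp
        then show False using y[of t] by (simp add: N_def)
      qed
      ultimately show "y \<in> R" using R(1) by simp
    qed (use RGW \<open>G \<inter> W \<subseteq> N\<close> in blast)
    show "\<exists>e>0. \<forall>t\<in>{-e..<0}. \<phi> x t \<in> interior N" if x: "x \<in> frontier N - Ni" for x
    proof -
      have x': "x \<in> No" "x \<notin> Ni" "x \<in> N" using x frontier sub by auto
      then have fx: "f x = a" "infdist x A < \<eta>" using nearA[of x] by (auto simp: No_def)
      have "x \<in> G" using x'(2,3) near[of x] by (auto simp: G_def N_def Ni_def)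
      obtain e1 where e1: "0 < e1" "\<And>t. \<bar>t\<bar> \<le> e1 \<Longrightarrow> \<phi> x t \<in> G"
        by (rule flow_persists[OF G \<open>x \<in> G\<close>]) (rule that)
      obtain e2 where e2: "0 < e2" "\<forall>t\<in>{-e2..<0}. infdist (\<phi> x t) A < \<eta> \<and> f x < f (\<phi> x t)"
        using lyapunov_backward[OF f(2) A'(3) A_out[OF fx(1)] fx(2)] by blast
      have "\<phi> x t \<in> interior N" if "t \<in> {- min e1 e2..<0}" for t
      proof -
        have "\<phi> x t \<in> G" using that by (intro e1(2)) auto
        moreover have "\<phi> x t \<in> W" using e2(2) that fx(1) by (auto simp: W_def)
        ultimately show ?thesis using int by blast
      qed
      then show ?thesis using e1(1) e2(1) by (intro exI[of _ "min e1 e2"]) auto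
    qed
    show "\<exists>e>0. \<forall>t\<in>{0<..e}. \<phi> x t \<in> interior N" if x: "x \<in> frontier N - No" for x
    proof -
      have x': "x \<in> Ni" "x \<notin> No" "x \<in> N" using x frontier sub by auto
      then have gx: "g x = b" "infdist x \<Omega> < \<theta>" using near[of x] by (auto simp: Ni_def)
      then have "x \<notin> \<Omega>" using g'(3)[of x] b(1) by auto
      have "x \<in> W" using x'(2,3) notV[of x] by (auto simp: N_def No_def)
      obtain e1 where e1: "0 < e1" "\<And>t. \<bar>t\<bar> \<le> e1 \<Longrightarrow> \<phi> x t \<in> W"
        by (rule flow_persists[OF W \<open>x \<in> W\<close>]) (rule that)
      obtain e2 where e2: "0 < e2" "\<forall>t\<in>{0<..e2}. infdist (\<phi> x t) \<Omega> < \<theta> \<and> g (\<phi> x t) < g x"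
        using lyapunov_forward[OF g(2) \<open>x \<notin> \<Omega>\<close> gx(2)] by blast
      have "\<phi> x t \<in> interior N" if "t \<in> {0<..min e1 e2}" for t
      proof -
        have "\<phi> x t \<in> W" using that by (intro e1(2)) auto
        moreover have "\<phi> x t \<in> G" using e2(2) that gx(1) by (auto simp: G_def)
        ultimately show ?thesis using int by blast
      qed
      then show ?thesis using e1(1) e2(1) by (intro exI[of _ "min e1 e2"]) auto
    qed
  qed (use N Ni No frontier entry exit in auto)
  then show ?thesis by blast
qed

end

section \<open>Homotopies and cover systems\<close>

lemma cover_scale_contiguousI:
  assumes "f x0 = y0" "g x0 = y0" "\<And>u. u \<in> U \<Longrightarrow> u \<noteq> {} \<Longrightarrow> \<exists>v\<in>V. f ` u \<union> g ` u \<subseteq> v"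
  shows "contiguous (cover_scale {x0} U) (cover_scale {y0} V) f g"
proof -
  have *: "\<exists>v\<in>V. f ` \<sigma> \<union> g ` \<sigma> \<subseteq> v" if "\<sigma> \<noteq> {}" "u \<in> U" "\<sigma> \<subseteq> u" for \<sigma> u
  proof -
    obtain v where v: "v \<in> V" "f ` u \<union> g ` u \<subseteq> v" using assms(3)[OF \<open>u \<in> U\<close>] \<open>\<sigma> \<noteq> {}\<close> \<open>\<sigma> \<subseteq> u\<close> by blast
    have "f ` \<sigma> \<union> g ` \<sigma> \<subseteq> v" using v(2) \<open>\<sigma> \<subseteq> u\<close> by blast
    then show ?thesis using v(1) by blast
  qed
  show ?thesis
    unfolding contiguous_def
  proof (intro conjI ballI)
    fix \<sigma> assume "\<sigma> \<in> fst (cover_scale {x0} U)"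
    then show "f ` \<sigma> \<union> g ` \<sigma> \<in> fst (cover_scale {y0} V)" using *[of \<sigma>] by (auto simp: cover_scale_def)
  next
    fix \<sigma> assume \<sigma>: "\<sigma> \<in> snd (cover_scale {x0} U)"
    show "f ` \<sigma> \<union> g ` \<sigma> \<in> snd (cover_scale {y0} V)"
    proof (cases "\<sigma> = {}")
      case False
      then obtain u where u: "\<sigma> \<subseteq> {x0}" "u \<in> U" "\<sigma> \<subseteq> u" using \<sigma> by (auto simp: cover_scale_def)
      have "f ` \<sigma> \<union> g ` \<sigma> \<subseteq> {y0}" using u(1) assms(1,2) by auto
      then show ?thesis using *[OF False u(2,3)] by (simp add: cover_scale_def)
    qed (simp add: cover_scale_def)
  qed
qed

lemma cover_scale_refine:
  assumes "\<And>u. u \<in> U \<Longrightarrow> \<exists>v\<in>V. u \<subseteq> v"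
  shows "fst (cover_scale A U) \<subseteq> fst (cover_scale A V)" "snd (cover_scale A U) \<subseteq> snd (cover_scale A V)"
proof -
  have "\<exists>v\<in>V. \<sigma> \<subseteq> v" if "\<exists>u\<in>U. \<sigma> \<subseteq> u" for \<sigma> using that assms by (meson order_trans)
  then show "fst (cover_scale A U) \<subseteq> fst (cover_scale A V)" "snd (cover_scale A U) \<subseteq> snd (cover_scale A V)"
    by (auto simp: cover_scale_def)
qed

lemma contiguous_mono:
  "contiguous p q f g \<Longrightarrow> fst p' \<subseteq> fst p \<Longrightarrow> snd p' \<subseteq> snd p \<Longrightarrow> contiguous p' q f g"
  unfolding contiguous_def by blast

lemma cover_scale_homotopic_refine:
  assumes "scale_homotopic (cover_scale A V) q f g" "\<And>u. u \<in> U \<Longrightarrow> \<exists>v\<in>V. u \<subseteq> v"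
  shows "scale_homotopic (cover_scale A U) q f g"
  by (rule scale_homotopic_mono[OF assms(1)]) (rule cover_scale_refine[OF assms(2)], assumption)+

lemma cover_scale_contiguous_refine:
  assumes "contiguous (cover_scale A V) q f g" "\<And>u. u \<in> U \<Longrightarrow> \<exists>v\<in>V. u \<subseteq> v"
  shows "contiguous (cover_scale A U) q f g"
  by (rule contiguous_mono[OF assms(1)]) (rule cover_scale_refine[OF assms(2)], assumption)+

text \<open>Joint continuity written with neighbourhoods. The same notion serves for homotopies over
  the unit interval and for a semiflow over all nonnegative times.\<close>

definition homotopy_on :: "real set \<Rightarrow> 'a topology \<Rightarrow> 'b topology \<Rightarrow> (real \<Rightarrow> 'a \<Rightarrow> 'b) \<Rightarrow> bool" where
  "homotopy_on I X Y F \<longleftrightarrow> (\<forall>t\<in>I. \<forall>x\<in>topspace X. F t x \<in> topspace Y) \<and>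
     (\<forall>t\<in>I. \<forall>x\<in>topspace X. \<forall>U. openin Y U \<longrightarrow> F t x \<in> U \<longrightarrow>
       (\<exists>d>0. \<exists>W. openin X W \<and> x \<in> W \<and> (\<forall>s\<in>I. \<bar>s - t\<bar> < d \<longrightarrow> (\<forall>y\<in>W. F s y \<in> U))))"

text \<open>Each point has a neighbourhood and a time tolerance for which one member of
  \<open>V\<close> works; a finite subcover provides a common tolerance.\<close>

lemma homotopy_locally_contiguous:
  assumes X: "compact_space X" and F: "homotopy_on I X Y F" and F0: "\<And>t. t \<in> I \<Longrightarrow> F t x0 = y0"
    and t: "t \<in> I" and V: "V \<in> open_covers Y"
  shows "\<exists>d>0. \<exists>U\<in>open_covers X. \<forall>s\<in>I. \<bar>s - t\<bar> < d \<longrightarrow> contiguous (cover_scale {x0} U) (cover_scale {y0} V) (F t) (F s)"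
proof -
  have "\<forall>x\<in>topspace X. \<exists>w. openin X (fst w) \<and> x \<in> fst w \<and> 0 < snd w \<and>
      (\<exists>v\<in>V. \<forall>s\<in>I. \<bar>s - t\<bar> < snd w \<longrightarrow> (\<forall>y\<in>fst w. F s y \<in> v))"
  proof
    fix x assume x: "x \<in> topspace X"
    have "F t x \<in> topspace Y" using F t x by (auto simp: homotopy_on_def)
    then obtain v where v: "v \<in> V" "openin Y v" "F t x \<in> v" using V by (auto simp: open_covers_def)
    obtain d W where "0 < d" "openin X W" "x \<in> W" "\<forall>s\<in>I. \<bar>s - t\<bar> < d \<longrightarrow> (\<forall>y\<in>W. F s y \<in> v)"
      using F t x v(2,3) unfolding homotopy_on_def by blast
    then show "\<exists>w. openin X (fst w) \<and> x \<in> fst w \<and> 0 < snd w \<and>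
      (\<exists>v\<in>V. \<forall>s\<in>I. \<bar>s - t\<bar> < snd w \<longrightarrow> (\<forall>y\<in>fst w. F s y \<in> v))"
      using v(1) by (intro exI[of _ "(W, d)"]) auto
  qed
  then obtain w where w: "\<forall>x\<in>topspace X. openin X (fst (w x)) \<and> x \<in> fst (w x) \<and> 0 < snd (w x) \<and>
      (\<exists>v\<in>V. \<forall>s\<in>I. \<bar>s - t\<bar> < snd (w x) \<longrightarrow> (\<forall>y\<in>fst (w x). F s y \<in> v))"
    unfolding bchoice_iff ..
  let ?C = "(\<lambda>x. fst (w x)) ` topspace X"
  have "\<forall>U\<in>?C. openin X U" "topspace X \<subseteq> \<Union>?C" using w by auto
  then have "\<exists>\<F>. finite \<F> \<and> \<F> \<subseteq> ?C \<and> topspace X \<subseteq> \<Union>\<F>"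
    using X[unfolded compact_space_alt, rule_format, of ?C] by simp
  then obtain \<F> where "finite \<F>" "\<F> \<subseteq> ?C" and cov: "topspace X \<subseteq> \<Union>\<F>" by blast
  then obtain P where P: "P \<subseteq> topspace X" "finite P" "\<F> = (\<lambda>x. fst (w x)) ` P" by (meson finite_subset_image)
  define d where "d = Min (insert 1 ((\<lambda>x. snd (w x)) ` P))"
  have d: "0 < d" "\<And>x. x \<in> P \<Longrightarrow> d \<le> snd (w x)"
    using P(1,2) w by (auto simp: d_def)
  have "\<F> \<in> open_covers X"
  proof -
    have "openin X U" if "U \<in> \<F>" for U using w P(1,3) that by auto
    then show ?thesis using cov openin_subset unfolding open_covers_def by blast
  qed
  moreover have "contiguous (cover_scale {x0} \<F>) (cover_scale {y0} V) (F t) (F s)" if s: "s \<in> I" "\<bar>s - t\<bar> < d" for s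
  proof (rule cover_scale_contiguousI)
    show "F t x0 = y0" "F s x0 = y0" using F0 t s(1) by auto
    fix u assume "u \<in> \<F>"
    then obtain x where x: "x \<in> P" "u = fst (w x)" using P(3) by blast
    have "x \<in> topspace X" using x(1) P(1) by blast
    then have "\<exists>v\<in>V. \<forall>s\<in>I. \<bar>s - t\<bar> < snd (w x) \<longrightarrow> (\<forall>y\<in>u. F s y \<in> v)"
      using w unfolding x(2) by simp
    then obtain v where v: "v \<in> V" "\<forall>s\<in>I. \<bar>s - t\<bar> < snd (w x) \<longrightarrow> (\<forall>y\<in>u. F s y \<in> v)" ..
    have "0 < snd (w x)" "\<bar>s - t\<bar> < snd (w x)" using d(2)[OF x(1)] d(1) s(2) by auto
    then have "F t ` u \<union> F s ` u \<subseteq> v" using v(2) t s(1) by auto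
    then show "\<exists>v\<in>V. F t ` u \<union> F s ` u \<subseteq> v" using v(1) by blast
  qed
  ultimately show ?thesis using d(1) by blast
qed

text \<open>Being scale homotopic over some cover is an equivalence relation on times, and near each
  time it holds. Connectedness of \<open>I\<close> then relates any two times, also when
  \<open>I\<close> is unbounded.\<close>

lemma homotopy_scale_homotopic:
  assumes X: "compact_space X" and F: "homotopy_on I X Y F" and F0: "\<And>t. t \<in> I \<Longrightarrow> F t x0 = y0"
    and I: "connected I" "a \<in> I" "b \<in> I" and V: "V \<in> open_covers Y"
  shows "\<exists>U\<in>open_covers X. scale_homotopic (cover_scale {x0} U) (cover_scale {y0} V) (F a) (F b)"
proof -
  define R where "R s t \<longleftrightarrow> (\<exists>U\<in>open_covers X. scale_homotopic (cover_scale {x0} U) (cover_scale {y0} V) (F s) (F t))" for s t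
  have sym: "contiguous p q f g \<Longrightarrow> contiguous p q g f" for p q and f g :: "'a \<Rightarrow> 'b"
    unfolding contiguous_def by (simp add: Un_commute)
  have sym': "scale_homotopic p q g f" if "scale_homotopic p q f g" for p q and f g :: "'a \<Rightarrow> 'b"
    using that unfolding scale_homotopic_def
    by (induction rule: rtranclp_induct) (auto intro: converse_rtranclp_into_rtranclp sym)
  have "R a b"
  proof (rule connected_equivalence_relation[OF I])
    show "R t s" if "R s t" for s t using that sym' unfolding R_def by blast
    show "R r t" if r: "R r s" "R s t" for r s t
    proof -
      obtain U where U: "U \<in> open_covers X" "scale_homotopic (cover_scale {x0} U) (cover_scale {y0} V) (F r) (F s)"
        using r(1) unfolding R_def ..
      obtain W where W: "W \<in> open_covers X" "scale_homotopic (cover_scale {x0} W) (cover_scale {y0} V) (F s) (F t)"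
        using r(2) unfolding R_def ..
      obtain Z where Z: "Z \<in> open_covers X" "\<And>z. z \<in> Z \<Longrightarrow> \<exists>u\<in>U. z \<subseteq> u" "\<And>z. z \<in> Z \<Longrightarrow> \<exists>u\<in>W. z \<subseteq> u"
        by (rule open_covers_refine[OF U(1) W(1)]) (rule that)
      have "scale_homotopic (cover_scale {x0} Z) (cover_scale {y0} V) (F r) (F t)"
        using cover_scale_homotopic_refine[OF U(2) Z(2)] cover_scale_homotopic_refine[OF W(2) Z(3)]
        by (rule scale_homotopic_trans)
      then show ?thesis using Z(1) by (auto simp: R_def)
    qed
    show "\<exists>T. openin (top_of_set I) T \<and> t \<in> T \<and> (\<forall>s\<in>T. R t s)" if t: "t \<in> I" for t
    proof -
      obtain d U where d: "0 < d" "U \<in> open_covers X"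
        "\<forall>s\<in>I. \<bar>s - t\<bar> < d \<longrightarrow> contiguous (cover_scale {x0} U) (cover_scale {y0} V) (F t) (F s)"
        using homotopy_locally_contiguous[OF X F F0 t V] by blast
      have "R t s" if "s \<in> I \<inter> ball t d" for s
        using d(2,3) that contiguous_imp_homotopic unfolding R_def by (fastforce simp: dist_real_def)
      then show ?thesis using d(1) t by (intro exI[of _ "I \<inter> ball t d"]) auto
    qed
  qed
  then show ?thesis by (simp add: R_def)
qed

lemma homotopic_with_homotopy_on:
  assumes "homotopic_with P X Y f g"
  obtains F where "homotopy_on {0..1} X Y F" "F 0 = f" "F 1 = g" "\<And>t. t \<in> {0..1} \<Longrightarrow> P (F t)"
proof -
  obtain h where h: "continuous_map (prod_topology (top_of_set {0..1::real}) X) Y h"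
    "\<forall>x. h (0, x) = f x" "\<forall>x. h (1, x) = g x" "\<forall>t\<in>{0..1}. P (\<lambda>x. h (t, x))"
    using assms unfolding homotopic_with_def by blast
  have "homotopy_on {0..1} X Y (\<lambda>t x. h (t, x))"
    unfolding homotopy_on_def
  proof (intro conjI ballI allI impI)
    fix t :: real and x assume t: "t \<in> {0..1}" and x: "x \<in> topspace X"
    show "h (t, x) \<in> topspace Y" using continuous_map_funspace[OF h(1)] t x by (auto simp: Pi_iff)
    fix U assume U: "openin Y U" "h (t, x) \<in> U"
    let ?S = "{p \<in> topspace (prod_topology (top_of_set {0..1}) X). h p \<in> U}"
    have "openin (prod_topology (top_of_set {0..1}) X) ?S"
      by (rule openin_continuous_map_preimage[OF h(1) U(1)])
    moreover have "(t, x) \<in> ?S" using t x U(2) by simp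
    ultimately have "\<exists>J W. openin (top_of_set {0..1}) J \<and> openin X W \<and> t \<in> J \<and> x \<in> W \<and> J \<times> W \<subseteq> ?S"
      by (rule openin_prod_topology_alt[THEN iffD1, rule_format])
    then obtain J W where JW: "openin (top_of_set {0..1}) J" "openin X W" "t \<in> J" "x \<in> W" "J \<times> W \<subseteq> ?S"
      by (elim exE conjE)
    obtain d where d: "0 < d" "\<forall>s\<in>{0..1}. dist s t < d \<longrightarrow> s \<in> J"
      using JW(1,3) unfolding openin_euclidean_subtopology_iff by blast
    have "h (s, y) \<in> U" if "s \<in> {0..1}" "\<bar>s - t\<bar> < d" "y \<in> W" for s y
    proof -
      have "s \<in> J" using d(2) that by (simp add: dist_real_def)
      then show ?thesis using JW(5) that(3) by blast
    qed
    then show "\<exists>d>0. \<exists>W. openin X W \<and> x \<in> W \<and> (\<forall>s\<in>{0..1}. \<bar>s - t\<bar> < d \<longrightarrow> (\<forall>y\<in>W. h (s, y) \<in> U))"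
      using d(1) JW(2,4) by blast
  qed
  then show ?thesis
    by (rule that[of "\<lambda>t x. h (t, x)"]) (use h(2-4) in simp_all)
qed

lemma homotopic_with_scale_homotopic:
  assumes "compact_space X" "homotopic_with (\<lambda>k. k x0 = y0) X Y f g" "V \<in> open_covers Y"
  shows "\<exists>U\<in>open_covers X. scale_homotopic (cover_scale {x0} U) (cover_scale {y0} V) f g"
proof -
  obtain F where F: "homotopy_on {0..1} X Y F" "F 0 = f" "F 1 = g" "\<And>t. t \<in> {0..1} \<Longrightarrow> F t x0 = y0"
    by (rule homotopic_with_homotopy_on[OF assms(2)]) (rule that)
  have "\<exists>U\<in>open_covers X. scale_homotopic (cover_scale {x0} U) (cover_scale {y0} V) (F 0) (F 1)"
    by (rule homotopy_scale_homotopic[OF assms(1) F(1,4) _ _ _ assms(3)]) auto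
  then show ?thesis unfolding F(2,3) .
qed

lemma open_covers_vimage:
  assumes "continuous_map X Y f" "V \<in> open_covers Y"
  shows "(\<lambda>v. {x \<in> topspace X. f x \<in> v}) ` V \<in> open_covers X"
proof -
  have "openin X {x \<in> topspace X. f x \<in> v}" if "v \<in> V" for v
    using openin_continuous_map_preimage[OF assms(1)] assms(2) that by (auto simp: open_covers_def)
  moreover have "topspace X \<subseteq> \<Union>((\<lambda>v. {x \<in> topspace X. f x \<in> v}) ` V)"
    using continuous_map_funspace[OF assms(1)] assms(2) by (fastforce simp: open_covers_def Pi_iff)
  ultimately show ?thesis by (auto simp: open_covers_def)
qed

lemma continuous_scale_map:
  assumes "f x0 = y0"
  shows "scale_map (cover_scale {x0} ((\<lambda>v. {x \<in> topspace X. f x \<in> v}) ` V)) (cover_scale {y0} V) f"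
  by (rule cover_scale_contiguousI) (use assms in auto)

text \<open>A homotopy inverse is an approximate inverse at all scales at once.\<close>

lemma hrank_pointed_homotopy_equivalent:
  assumes X: "compact_space X" and Y: "compact_space Y" and eq: "pointed_homotopy_equivalent (X, x0) (Y, y0)"
  shows "hrank m (cover_system X {x0}) = hrank m (cover_system Y {y0})"
proof -
  obtain f g where f: "continuous_map X Y f" "f x0 = y0" and g: "continuous_map Y X g" "g y0 = x0"
    and gf: "homotopic_with (\<lambda>k. k x0 = x0) X X (g \<circ> f) id"
    and fg: "homotopic_with (\<lambda>k. k y0 = y0) Y Y (f \<circ> g) id"
    using eq unfolding pointed_homotopy_equivalent_def by blast
  show ?thesis
  proof (rule hrank_approximate_equivalence[where i = f, OF scale_system_cover_system scale_system_cover_system])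
    fix q assume "q \<in> cover_system Y {y0}"
    then obtain V where V: "V \<in> open_covers Y" "q = cover_scale {y0} V" by (auto simp: cover_system_def)
    show "\<exists>p\<in>cover_system X {x0}. scale_map p q f"
      unfolding V(2) using continuous_scale_map[of f x0 y0 X V, OF f(2)] open_covers_vimage[OF f(1) V(1)]
      by (auto simp: cover_system_def)
  next
    fix p q assume "p \<in> cover_system X {x0}" "q \<in> cover_system Y {y0}"
    then obtain U V where U: "U \<in> open_covers X" "p = cover_scale {x0} U" and V: "V \<in> open_covers Y" "q = cover_scale {y0} V"
      by (auto simp: cover_system_def)
    obtain V1 where V1: "V1 \<in> open_covers Y" "scale_homotopic (cover_scale {y0} V1) q id (f \<circ> g)"
      using homotopic_with_scale_homotopic[OF Y homotopic_with_symD[OF fg] V(1)] V(2) by blast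
    obtain U1 where U1: "U1 \<in> open_covers X" "scale_homotopic (cover_scale {x0} U1) p id (g \<circ> f)"
      using homotopic_with_scale_homotopic[OF X homotopic_with_symD[OF gf] U(1)] U(2) by blast
    obtain V2 where V2: "V2 \<in> open_covers Y" "\<And>v. v \<in> V2 \<Longrightarrow> \<exists>w\<in>V1. v \<subseteq> w"
      "\<And>v. v \<in> V2 \<Longrightarrow> \<exists>w\<in>(\<lambda>v. {x \<in> topspace Y. g x \<in> v}) ` U. v \<subseteq> w"
      by (rule open_covers_refine[OF V1(1) open_covers_vimage[OF g(1) U(1)]]) (rule that)
    have 1: "scale_map (cover_scale {y0} V2) p g"
      unfolding U(2) by (rule cover_scale_contiguous_refine[OF continuous_scale_map[of g y0 x0, OF g(2)] V2(3)])
    have 2: "scale_homotopic (cover_scale {y0} V2) q (\<lambda>x. x) (\<lambda>x. f (g x))"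
      using cover_scale_homotopic_refine[OF V1(2) V2(2)] by (simp add: id_def comp_def)
    have 3: "scale_homotopic (cover_scale {x0} U1) p (\<lambda>x. x) (\<lambda>x. g (f x))"
      using U1(2) by (simp add: id_def comp_def)
    have "cover_scale {y0} V2 \<in> cover_system Y {y0}" "cover_scale {x0} U1 \<in> cover_system X {x0}"
      using V2(1) U1(1) by (auto simp: cover_system_def)
    then show "approximate_inverse (cover_system X {x0}) (cover_system Y {y0}) f p q"
      by (rule approximate_inverseI[where i = f, OF _ _ 1 2 3])
  qed
qed

section \<open>Deformation onto an attracting closed subset\<close>

text \<open>Two barycentric refinements in succession: the members through a point of
  \<open>z\<close> lie in one set containing \<open>z\<close>, and all such sets contain a fixed
  point of \<open>z\<close>.\<close>

lemma star_refinement: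
  assumes X: "compact_space X" "Hausdorff_space X" and U: "U \<in> open_covers X"
  obtains Z where "Z \<in> open_covers X" "\<And>z. z \<in> Z \<Longrightarrow> z \<noteq> {} \<Longrightarrow> \<exists>u\<in>U. \<forall>z'\<in>Z. z \<inter> z' \<noteq> {} \<longrightarrow> z' \<subseteq> u"
proof -
  obtain V where V: "V \<in> open_covers X" "\<And>y. y \<in> topspace X \<Longrightarrow> \<exists>u\<in>U. \<forall>v\<in>V. y \<in> v \<longrightarrow> v \<subseteq> u"
    by (rule barycentric_refinement[OF X U]) (rule that)
  obtain Z where Z: "Z \<in> open_covers X" "\<And>y. y \<in> topspace X \<Longrightarrow> \<exists>v\<in>V. \<forall>z\<in>Z. y \<in> z \<longrightarrow> z \<subseteq> v"
    by (rule barycentric_refinement[OF X V(1)]) (rule that)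
  have "\<exists>u\<in>U. \<forall>z'\<in>Z. z \<inter> z' \<noteq> {} \<longrightarrow> z' \<subseteq> u" if z: "z \<in> Z" "z \<noteq> {}" for z
  proof -
    have sub: "z \<subseteq> topspace X" using Z(1) z(1) by (auto simp: open_covers_def)
    obtain p where p: "p \<in> z" using z(2) by blast
    then obtain u where u: "u \<in> U" "\<forall>v\<in>V. p \<in> v \<longrightarrow> v \<subseteq> u" using V(2) sub by blast
    have "z' \<subseteq> u" if z': "z' \<in> Z" "z \<inter> z' \<noteq> {}" for z'
    proof -
      obtain q where q: "q \<in> z" "q \<in> z'" using z'(2) by blast
      then obtain v where v: "v \<in> V" "\<forall>z\<in>Z. q \<in> z \<longrightarrow> z \<subseteq> v" using Z(2) sub by blast
      have "z \<subseteq> v" "z' \<subseteq> v" using v(2) q z(1) z'(1) by auto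
      then show ?thesis using u(2) v(1) p by blast
    qed
    then show ?thesis using u(1) by blast
  qed
  then show ?thesis by (rule that[OF Z(1)])
qed

lemma homotopy_on_continuous:
  assumes F: "homotopy_on I X Y F" and t: "t \<in> I"
  shows "continuous_map X Y (F t)"
  unfolding continuous_map
proof (intro conjI allI impI)
  show "F t ` topspace X \<subseteq> topspace Y" using F t by (auto simp: homotopy_on_def)
  fix U assume U: "openin Y U"
  show "openin X {x \<in> topspace X. F t x \<in> U}"
  proof (subst openin_subopen, intro ballI)
    fix x assume "x \<in> {x \<in> topspace X. F t x \<in> U}"
    then obtain d W where d: "0 < d" "openin X W" "x \<in> W" "\<forall>s\<in>I. \<bar>s - t\<bar> < d \<longrightarrow> (\<forall>y\<in>W. F s y \<in> U)"
      using F t U unfolding homotopy_on_def by blast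
    have "\<bar>t - t\<bar> < d" using d(1) by simp
    then have "\<forall>y\<in>W. F t y \<in> U" using d(4) t by blast
    then have "W \<subseteq> {x \<in> topspace X. F t x \<in> U}" using openin_subset[OF d(2)] by blast
    then show "\<exists>T. openin X T \<and> x \<in> T \<and> T \<subseteq> {x \<in> topspace X. F t x \<in> U}" using d(2,3) by blast
  qed
qed

lemma homotopy_on_subtopology:
  assumes F: "homotopy_on I X X F" and Y: "\<And>t y. t \<in> I \<Longrightarrow> y \<in> Y \<Longrightarrow> F t y \<in> Y"
  shows "homotopy_on I (subtopology X Y) (subtopology X Y) F"
  unfolding homotopy_on_def
proof (intro conjI ballI allI impI)
  fix t x assume t: "t \<in> I" and x: "x \<in> topspace (subtopology X Y)"
  then show "F t x \<in> topspace (subtopology X Y)" using F Y by (auto simp: homotopy_on_def)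
  fix U assume U: "openin (subtopology X Y) U" "F t x \<in> U"
  then obtain U' where U': "openin X U'" "U = U' \<inter> Y" unfolding openin_subtopology by blast
  have "F t x \<in> U'" using U(2) U'(2) by blast
  then obtain d W where d: "0 < d" "openin X W" "x \<in> W" "\<forall>s\<in>I. \<bar>s - t\<bar> < d \<longrightarrow> (\<forall>y\<in>W. F s y \<in> U')"
    using F t x U'(1) unfolding homotopy_on_def topspace_subtopology by blast
  have "openin (subtopology X Y) (W \<inter> Y)" using d(2) unfolding openin_subtopology by blast
  moreover have "x \<in> W \<inter> Y" using d(3) x by simp
  moreover have "\<forall>s\<in>I. \<bar>s - t\<bar> < d \<longrightarrow> (\<forall>y\<in>W \<inter> Y. F s y \<in> U)" using d(4) Y U'(2) by blast
  ultimately show "\<exists>d>0. \<exists>W. openin (subtopology X Y) W \<and> x \<in> W \<and> (\<forall>s\<in>I. \<bar>s - t\<bar> < d \<longrightarrow> (\<forall>y\<in>W. F s y \<in> U))"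
    using d(1) by blast
qed

text \<open>The approximate inverse of the inclusion follows \<open>F\<close> for a long time and then moves to a nearby point of \<open>Y\<close>.\<close>

theorem hrank_deformation:
  assumes X: "compact_space X" "Hausdorff_space X" and Y: "closedin X Y" "x0 \<in> Y"
    and F: "homotopy_on {0..} X X F" "\<And>x. F 0 x = x" "\<And>t. 0 \<le> t \<Longrightarrow> F t x0 = x0"
    and inv: "\<And>t y. 0 \<le> t \<Longrightarrow> y \<in> Y \<Longrightarrow> F t y \<in> Y"
    and att: "\<And>U. openin X U \<Longrightarrow> Y \<subseteq> U \<Longrightarrow> \<exists>T\<ge>0. \<forall>x\<in>topspace X. F T x \<in> U"
  shows "hrank m (cover_system (subtopology X Y) {x0}) = hrank m (cover_system X {x0})"
proof (rule hrank_approximate_equivalence[where i = "\<lambda>x. x", OF scale_system_cover_system scale_system_cover_system])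
  have YX: "Y \<subseteq> topspace X" by (rule closedin_subset[OF Y(1)])
  have topY: "topspace (subtopology X Y) = Y" using YX by auto
  have restrict: "(\<lambda>v. v \<inter> Y) ` V \<in> open_covers (subtopology X Y)" if "V \<in> open_covers X" for V
    using that YX by (auto simp: open_covers_def openin_subtopology)
  {
    fix q assume "q \<in> cover_system X {x0}"
    then obtain V where V: "V \<in> open_covers X" "q = cover_scale {x0} V" by (auto simp: cover_system_def)
    have "scale_map (cover_scale {x0} ((\<lambda>v. v \<inter> Y) ` V)) q (\<lambda>x. x)"
      unfolding V(2) by (rule cover_scale_contiguousI) auto
    then show "\<exists>p\<in>cover_system (subtopology X Y) {x0}. scale_map p q (\<lambda>x. x)"
      using restrict[OF V(1)] by (auto simp: cover_system_def)
  }
  fix p q assume "p \<in> cover_system (subtopology X Y) {x0}" "q \<in> cover_system X {x0}"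
  then obtain W V where W: "W \<in> open_covers (subtopology X Y)" "p = cover_scale {x0} W"
    and V: "V \<in> open_covers X" "q = cover_scale {x0} V"
    by (auto simp: cover_system_def)
  \<comment> \<open>A cover of \<open>X\<close> that extends \<open>W\<close>: every member which
    meets \<open>Y\<close> has its trace on \<open>Y\<close> in \<open>W\<close>.\<close>
  let ?W = "{w. openin X w \<and> w \<inter> Y \<in> W} \<union> {topspace X - Y}"
  have "?W \<in> open_covers X"
  proof -
    have "x \<in> \<Union>?W" if x: "x \<in> topspace X" for x
    proof (cases "x \<in> Y")
      case True
      then obtain w where w: "w \<in> W" "x \<in> w" using W(1) topY by (auto simp: open_covers_def)
      then have "openin (subtopology X Y) w" using W(1) by (simp add: open_covers_def)
      then obtain w' where w': "openin X w'" "w = w' \<inter> Y" unfolding openin_subtopology by blast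
      then have "w' \<in> ?W" using w(1) by simp
      then show ?thesis using w(2) w'(2) by blast
    qed (use x in blast)
    moreover have "openin X (topspace X - Y)" using Y(1) by blast
    ultimately show ?thesis using openin_subset unfolding open_covers_def by fastforce
  qed
  then obtain U where U: "U \<in> open_covers X" "\<And>u. u \<in> U \<Longrightarrow> \<exists>v\<in>V. u \<subseteq> v" "\<And>u. u \<in> U \<Longrightarrow> \<exists>w\<in>?W. u \<subseteq> w"
    by (rule open_covers_refine[OF V(1)]) (rule that)
  obtain Z where Z: "Z \<in> open_covers X"
    and star: "\<And>z. z \<in> Z \<Longrightarrow> z \<noteq> {} \<Longrightarrow> \<exists>u\<in>U. \<forall>z'\<in>Z. z \<inter> z' \<noteq> {} \<longrightarrow> z' \<subseteq> u"
    by (rule star_refinement[OF X U(1)]) (rule that)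
  have in_W: "\<exists>w\<in>W. u \<inter> Y \<subseteq> w" if u: "u \<in> U" "u \<inter> Y \<noteq> {}" for u
  proof -
    obtain w where w: "w \<in> ?W" "u \<subseteq> w" using U(3)[OF u(1)] ..
    then have "w \<inter> Y \<in> W" using u(2) by blast
    then show ?thesis using w(2) by blast
  qed
  \<comment> \<open>The members of \<open>Z\<close> which meet \<open>Y\<close> form a neighbourhood
    of \<open>Y\<close> that contains the image of \<open>X\<close> under \<open>F T\<close> for a
    suitable \<open>T\<close>; a nearby point of \<open>Y\<close> can then be picked in the same
    member.\<close>
  have "openin X (\<Union>{z \<in> Z. z \<inter> Y \<noteq> {}})" using Z by (auto simp: open_covers_def)
  moreover have "Y \<subseteq> \<Union>{z \<in> Z. z \<inter> Y \<noteq> {}}" using Z YX by (fastforce simp: open_covers_def)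
  ultimately obtain T where T: "0 \<le> T" "\<forall>x\<in>topspace X. F T x \<in> \<Union>{z \<in> Z. z \<inter> Y \<noteq> {}}"
    using att by blast
  \<comment> \<open>Insisting on \<open>y = F T x\<close> whenever that is a point of
    \<open>Y\<close> makes \<open>r\<close> fix the base point.\<close>
  have "\<forall>x\<in>topspace X. \<exists>y. y \<in> Y \<and> (\<exists>z\<in>Z. F T x \<in> z \<and> y \<in> z) \<and> (F T x \<in> Y \<longrightarrow> y = F T x)"
  proof
    fix x assume "x \<in> topspace X"
    then obtain z where z: "z \<in> Z" "z \<inter> Y \<noteq> {}" "F T x \<in> z" using T(2) by blast
    show "\<exists>y. y \<in> Y \<and> (\<exists>z\<in>Z. F T x \<in> z \<and> y \<in> z) \<and> (F T x \<in> Y \<longrightarrow> y = F T x)"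
      using z by (cases "F T x \<in> Y") blast+
  qed
  then obtain r where r: "\<forall>x\<in>topspace X. r x \<in> Y \<and> (\<exists>z\<in>Z. F T x \<in> z \<and> r x \<in> z) \<and> (F T x \<in> Y \<longrightarrow> r x = F T x)"
    unfolding bchoice_iff ..
  have r0: "r x0 = x0" using r YX Y(2) F(3)[OF T(1)] by auto
  let ?Q = "(\<lambda>z. {x \<in> topspace X. F T x \<in> z}) ` Z"
  have Tpos: "T \<in> {0..}" using T(1) by simp
  have Q: "?Q \<in> open_covers X" by (rule open_covers_vimage[OF homotopy_on_continuous[OF F(1) Tpos] Z])
  have close: "\<exists>u\<in>U. r ` c \<union> F T ` c \<subseteq> u" if c: "c \<in> ?Q" "c \<noteq> {}" for c
  proof -
    obtain z where z: "z \<in> Z" "c = {x \<in> topspace X. F T x \<in> z}" using c(1) by blast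
    then have "z \<noteq> {}" using c(2) by blast
    then obtain u where u: "u \<in> U" "\<forall>z'\<in>Z. z \<inter> z' \<noteq> {} \<longrightarrow> z' \<subseteq> u" using star[OF z(1)] by blast
    have "z \<subseteq> u" using u(2) z(1) \<open>z \<noteq> {}\<close> by blast
    have "r x \<in> u \<and> F T x \<in> u" if "x \<in> c" for x
    proof -
      have x: "x \<in> topspace X" "F T x \<in> z" using that z(2) by auto
      then obtain z' where "z' \<in> Z" "F T x \<in> z'" "r x \<in> z'" using r by blast
      then show ?thesis using u(2) x(2) \<open>z \<subseteq> u\<close> by blast
    qed
    then show ?thesis using u(1) by blast
  qed
  have rY: "r x \<in> Y" if "x \<in> c" "c \<in> ?Q" for x c using r that by blast
  have 1: "scale_map (cover_scale {x0} ?Q) p r"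
    unfolding W(2)
  proof (rule cover_scale_contiguousI[of r x0 x0 r, OF r0 r0])
    fix c assume c: "c \<in> ?Q" "c \<noteq> {}"
    obtain u where u: "u \<in> U" "r ` c \<union> F T ` c \<subseteq> u" using close[OF c] ..
    have "r ` c \<subseteq> u \<inter> Y" using u(2) rY[OF _ c(1)] by blast
    then have "u \<inter> Y \<noteq> {}" using c(2) by blast
    then obtain w where "w \<in> W" "u \<inter> Y \<subseteq> w" using in_W[OF u(1)] by blast
    then show "\<exists>w\<in>W. r ` c \<union> r ` c \<subseteq> w" using \<open>r ` c \<subseteq> u \<inter> Y\<close> by blast
  qed
  have 2: "contiguous (cover_scale {x0} ?Q) q (F T) r"
    unfolding V(2)
  proof (rule cover_scale_contiguousI[of "F T" x0 x0 r, OF F(3)[OF T(1)] r0])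
    fix c assume c: "c \<in> ?Q" "c \<noteq> {}"
    obtain u where u: "u \<in> U" "r ` c \<union> F T ` c \<subseteq> u" using close[OF c] ..
    then show "\<exists>v\<in>V. F T ` c \<union> r ` c \<subseteq> v" using U(2)[OF u(1)] by blast
  qed
  have 3: "contiguous (cover_scale {x0} ((\<lambda>c. c \<inter> Y) ` ?Q)) p (F T) r"
    unfolding W(2)
  proof (rule cover_scale_contiguousI[of "F T" x0 x0 r, OF F(3)[OF T(1)] r0])
    fix c' assume "c' \<in> (\<lambda>c. c \<inter> Y) ` ?Q" "c' \<noteq> {}"
    then obtain c where c: "c \<in> ?Q" "c' = c \<inter> Y" by blast
    then have "c \<noteq> {}" using \<open>c' \<noteq> {}\<close> by blast
    then obtain u where u: "u \<in> U" "r ` c \<union> F T ` c \<subseteq> u" using close[OF c(1)] by blast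
    have sub: "F T ` c' \<union> r ` c' \<subseteq> u \<inter> Y" using u(2) rY[OF _ c(1)] inv[OF T(1)] c(2) by blast
    then have "u \<inter> Y \<noteq> {}" using \<open>c' \<noteq> {}\<close> by blast
    then obtain w where "w \<in> W" "u \<inter> Y \<subseteq> w" using in_W[OF u(1)] by blast
    then show "\<exists>w\<in>W. F T ` c' \<union> r ` c' \<subseteq> w" using sub by blast
  qed
  have F_id: "F 0 = (\<lambda>x. x)" using F(2) by auto
  have conn: "connected {0::real..}" by (simp add: connected_iff_interval)
  have fix0: "F t x0 = x0" if "t \<in> {0..}" for t using F(3) that by simp
  obtain V1 where V1: "V1 \<in> open_covers X" "scale_homotopic (cover_scale {x0} V1) q (\<lambda>x. x) (F T)"
    using homotopy_scale_homotopic[OF X(1) F(1) fix0 conn _ Tpos V(1)] unfolding V(2) F_id[symmetric] by auto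
  have compY: "compact_space (subtopology X Y)"
    using closedin_compact_space[OF X(1) Y(1)] compact_space_subtopology by blast
  have FY: "homotopy_on {0..} (subtopology X Y) (subtopology X Y) F"
    by (rule homotopy_on_subtopology[OF F(1)]) (use inv in auto)
  obtain W1 where W1: "W1 \<in> open_covers (subtopology X Y)" "scale_homotopic (cover_scale {x0} W1) p (\<lambda>x. x) (F T)"
    using homotopy_scale_homotopic[OF compY FY fix0 conn _ Tpos W(1)] unfolding W(2) F_id[symmetric] by auto
  obtain V2 where V2: "V2 \<in> open_covers X" "\<And>v. v \<in> V2 \<Longrightarrow> \<exists>w\<in>V1. v \<subseteq> w" "\<And>v. v \<in> V2 \<Longrightarrow> \<exists>w\<in>?Q. v \<subseteq> w"
    by (rule open_covers_refine[OF V1(1) Q]) (rule that)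
  obtain W2 where W2: "W2 \<in> open_covers (subtopology X Y)" "\<And>v. v \<in> W2 \<Longrightarrow> \<exists>w\<in>W1. v \<subseteq> w"
    "\<And>v. v \<in> W2 \<Longrightarrow> \<exists>w\<in>(\<lambda>c. c \<inter> Y) ` ?Q. v \<subseteq> w"
    by (rule open_covers_refine[OF W1(1) restrict[OF Q]]) (rule that)
  have r1: "scale_map (cover_scale {x0} V2) p r" by (rule cover_scale_contiguous_refine[OF 1 V2(3)])
  have r2: "scale_homotopic (cover_scale {x0} V2) q (\<lambda>x. x) (\<lambda>x. r x)"
    using cover_scale_homotopic_refine[OF V1(2) V2(2)]
      contiguous_imp_homotopic[OF cover_scale_contiguous_refine[OF 2 V2(3)]] by (rule scale_homotopic_trans)
  have r3: "scale_homotopic (cover_scale {x0} W2) p (\<lambda>x. x) (\<lambda>x. r x)"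
    using cover_scale_homotopic_refine[OF W1(2) W2(2)]
      contiguous_imp_homotopic[OF cover_scale_contiguous_refine[OF 3 W2(3)]] by (rule scale_homotopic_trans)
  have "cover_scale {x0} V2 \<in> cover_system X {x0}" "cover_scale {x0} W2 \<in> cover_system (subtopology X Y) {x0}"
    using V2(1) W2(1) by (auto simp: cover_system_def)
  then show "approximate_inverse (cover_system (subtopology X Y) {x0}) (cover_system X {x0}) (\<lambda>x. x) p q"
    by (rule approximate_inverseI[where i = "\<lambda>x. x", OF _ _ r1 r2 r3])
qed

section \<open>The index space of an isolating block\<close>

locale flow_block = continuous_flow +
  fixes S N Ni No :: "'a set"
  assumes block: "isolating_block \<phi> S N Ni No"
begin

lemma compact_N: "compact N" and compact_No: "compact No" and closed_N: "closed N" and closed_No: "closed No"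
proof -
  show N: "compact N" "compact No" using block by (auto simp: isolating_block_def)
  then show "closed N" "closed No" by (auto intro: compact_imp_closed)
qed

lemma exit_from_No:
  assumes "x \<in> No"
  obtains e where "0 < e" "\<And>t. 0 < t \<Longrightarrow> t \<le> e \<Longrightarrow> \<phi> x t \<notin> N"
proof -
  have "\<exists>e>0. \<forall>t\<in>{0<..e}. \<phi> x t \<notin> N" using block assms unfolding isolating_block_def by blast
  then obtain e where "0 < e" "\<forall>t\<in>{0<..e}. \<phi> x t \<notin> N" by blast
  then show ?thesis by (intro that[of e]) auto
qed

lemma stay_outside_No:
  assumes x: "x \<in> N - No" shows "\<exists>e>0. \<forall>t\<in>{0..e}. \<phi> x t \<in> N"
proof (cases "x \<in> interior N")
  case True
  obtain e where e: "0 < e" "\<And>t. \<bar>t\<bar> \<le> e \<Longrightarrow> \<phi> x t \<in> interior N"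
    by (rule flow_persists[OF open_interior True]) (rule that)
  have "\<phi> x t \<in> N" if "t \<in> {0..e}" for t using e(2)[of t] that interior_subset[of N] by auto
  then show ?thesis using e(1) by blast
next
  case False
  then have "x \<in> frontier N - No" using x closed_N by (auto simp: frontier_def)
  then obtain e where e: "0 < e" "\<forall>t\<in>{0<..e}. \<phi> x t \<in> interior N"
    using block unfolding isolating_block_def by blast
  have "\<phi> x t \<in> N" if "t \<in> {0..e}" for t
    using e(2) that x interior_subset[of N] by (cases "t = 0") auto
  then show ?thesis using e(1) by blast
qed

text \<open>At the infimum \<open>u\<close> of the times outside \<open>N\<close> the orbit is still
  in \<open>N\<close> because \<open>N\<close> is closed. It is not in \<open>No\<close>, so it
  stays in \<open>N\<close> a little longer, which contradicts the choice of
  \<open>u\<close>.\<close>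

lemma stay_in_N:
  assumes x: "x \<in> N" and out: "\<And>s. 0 \<le> s \<Longrightarrow> s \<le> t \<Longrightarrow> \<phi> x s \<notin> No" and s: "0 \<le> s" "s \<le> t"
  shows "\<phi> x s \<in> N"
proof (rule ccontr)
  assume s_out: "\<phi> x s \<notin> N"
  let ?B = "{u. 0 \<le> u \<and> u \<le> s \<and> \<phi> x u \<notin> N}"
  define u where "u = Inf ?B"
  have B: "?B \<noteq> {}" "bdd_below ?B" using s s_out by (auto intro: bdd_belowI[of _ 0])
  have u0: "0 \<le> u" unfolding u_def by (rule cInf_greatest[OF B(1)]) simp
  have us: "u \<le> s" unfolding u_def by (rule cInf_lower[OF _ B(2)]) (use s s_out in simp)
  have before: "\<phi> x v \<in> N" if "0 \<le> v" "v < u" for v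
    using cInf_lower[OF _ B(2), of v] that us by (auto simp: u_def[symmetric])
  have "\<phi> x u \<in> N"
  proof (cases "u = 0")
    case False
    then have "0 < u" using u0 by simp
    show ?thesis
    proof (rule ccontr)
      assume "\<phi> x u \<notin> N"
      then obtain e where e: "0 < e" "\<And>t. \<bar>t\<bar> \<le> e \<Longrightarrow> \<phi> (\<phi> x u) t \<in> - N"
        using flow_persists[of "- N" "\<phi> x u"] closed_N by (metis Compl_iff open_Compl)
      define d where "d = min e (u / 2)"
      have "0 < d" "d \<le> e" "d < u" using e(1) \<open>0 < u\<close> by (auto simp: d_def)
      then have "\<phi> x (u - d) \<notin> N" using e(2)[of "- d"] by simp
      then show False using before[of "u - d"] \<open>0 < d\<close> \<open>d < u\<close> by simp
    qed
  qed (use x in simp)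
  then have "\<phi> x u \<in> N - No" using out[OF u0] us s(2) by simp
  then obtain e where e: "0 < e" "\<forall>t\<in>{0..e}. \<phi> (\<phi> x u) t \<in> N" using stay_outside_No by blast
  have "u + e \<le> v" if v: "v \<in> ?B" for v
  proof (rule ccontr)
    assume "\<not> u + e \<le> v"
    moreover have "u \<le> v" unfolding u_def by (rule cInf_lower[OF v B(2)])
    ultimately have "v - u \<in> {0..e}" by simp
    then have "\<phi> (\<phi> x u) (v - u) \<in> N" using e(2) by blast
    then show False using v by simp
  qed
  then have "u + e \<le> u" unfolding u_def by (intro cInf_greatest[OF B(1)])
  then show False using e(1) by simp
qed

text \<open>A compact orbit segment has positive distance from the closed set \<open>No\<close>, and
  by uniform continuity nearby slightly longer segments stay within that distance.\<close>

lemma avoid_No_open: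
  assumes t: "0 \<le> t" and out: "\<And>s. 0 \<le> s \<Longrightarrow> s \<le> t \<Longrightarrow> \<phi> x s \<notin> No"
  shows "\<exists>d>0. \<forall>y s. dist x y < d \<longrightarrow> 0 \<le> s \<longrightarrow> s < t + d \<longrightarrow> \<phi> y s \<notin> No"
proof -
  have "compact ((\<lambda>s. \<phi> x s) ` {0..t})" by (intro compact_continuous_image continuous_intros) auto
  moreover have "(\<lambda>s. \<phi> x s) ` {0..t} \<inter> No = {}" using out by auto
  ultimately obtain e where e: "0 < e" "\<forall>y\<in>(\<lambda>s. \<phi> x s) ` {0..t}. \<forall>z\<in>No. e \<le> dist y z"
    using separate_compact_closed[OF _ closed_No] by metis
  obtain d where d: "0 < d" "\<forall>y\<in>cball x 1. \<forall>z\<in>cball x 1. \<forall>s\<in>{-(t+1)..t+1}. \<forall>s'\<in>{-(t+1)..t+1}.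
      dist y z < d \<longrightarrow> \<bar>s - s'\<bar> < d \<longrightarrow> dist (\<phi> y s) (\<phi> z s') < e"
    using flow_uniform[OF compact_cball[of x 1] e(1), of "t + 1"] by blast
  have "\<phi> y s \<notin> No" if y: "dist x y < min d 1" and s: "0 \<le> s" "s < t + min d 1" for y s
  proof
    assume "\<phi> y s \<in> No"
    have "\<phi> x (min s t) \<in> (\<lambda>s. \<phi> x s) ` {0..t}" using s(1) t by simp
    then have "e \<le> dist (\<phi> x (min s t)) (\<phi> y s)" using e(2) \<open>\<phi> y s \<in> No\<close> by blast
    moreover have "\<bar>min s t - s\<bar> < d" "min s t \<in> {-(t+1)..t+1}" "s \<in> {-(t+1)..t+1}" "x \<in> cball x 1" "y \<in> cball x 1" "dist x y < d"
      using s t d(1) y by (auto simp: min_def split: if_splits)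
    then have "dist (\<phi> x (min s t)) (\<phi> y s) < e" using d(2) by blast
    ultimately show False by simp
  qed
  then show ?thesis using d(1) by (intro exI[of _ "min d 1"]) auto
qed

section \<open>The topology of N/No\<close>

abbreviation index_space :: "'a option topology" where "index_space \<equiv> quotient_space N No"

lemma topspace_X: "topspace index_space = insert None (Some ` (N - No))"
  unfolding topspace_quotient_space by (auto simp: collapse_def image_iff split: if_splits)

lemma openin_X_Some:
  assumes "open G" "G \<inter> No = {}"
  shows "openin index_space (Some ` (N \<inter> G))"
proof -
  have "{x \<in> N. collapse No x \<in> Some ` (N \<inter> G)} = N \<inter> G" using assms(2) by (auto simp: collapse_def split: if_splits)
  moreover have "Some ` (N \<inter> G) \<subseteq> insert None (collapse No ` N)"
    using assms(2) topspace_X unfolding topspace_quotient_space by blast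
  ultimately show ?thesis using assms(1) by (auto simp: openin_quotient_space)
qed

text \<open>Neighbourhoods of the base point are complements of compact sets missing
  \<open>No\<close>: the quotient is the one-point compactification of
  \<open>N - No\<close>.\<close>

lemma openin_X_None:
  assumes "compact Z" "Z \<inter> No = {}"
  shows "openin index_space (insert None (Some ` (N - No - Z)))"
proof -
  have "{x \<in> N. collapse No x \<in> insert None (Some ` (N - No - Z))} = N \<inter> - Z"
    using assms(2) by (auto simp: collapse_def split: if_splits)
  moreover have "insert None (Some ` (N - No - Z)) \<subseteq> insert None (collapse No ` N)"
    using topspace_X unfolding topspace_quotient_space by blast
  moreover have "openin (top_of_set N) (N \<inter> - Z)" using compact_imp_closed[OF assms(1)] by (intro openin_open_Int) auto
  ultimately show ?thesis by (simp add: openin_quotient_space)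
qed

lemma openin_X_SomeD:
  assumes "openin index_space U" "Some x \<in> U"
  obtains G where "open G" "x \<in> G" "G \<inter> No = {}" "Some ` (N \<inter> G) \<subseteq> U"
proof -
  obtain G where G: "open G" "{x \<in> N. collapse No x \<in> U} = N \<inter> G"
    using assms(1) unfolding openin_quotient_space openin_open by blast
  have x: "x \<in> N" "x \<notin> No" using openin_subset[OF assms(1)] assms(2) unfolding topspace_X by auto
  then have "x \<in> {x \<in> N. collapse No x \<in> U}" using assms(2) by (simp add: collapse_def)
  then have 1: "x \<in> G - No" using x(2) unfolding G(2) by simp
  have 2: "Some ` (N \<inter> (G - No)) \<subseteq> U"
  proof
    fix y assume "y \<in> Some ` (N \<inter> (G - No))"
    then obtain z where z: "y = Some z" "z \<in> N" "z \<in> G" "z \<notin> No" by blast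
    then have "z \<in> {x \<in> N. collapse No x \<in> U}" unfolding G(2) by simp
    then show "y \<in> U" using z by (simp add: collapse_def)
  qed
  have 3: "open (G - No)" by (rule open_Diff[OF G(1) closed_No])
  show ?thesis by (rule that[OF 3 1 _ 2]) blast
qed

lemma openin_X_NoneD:
  assumes "openin index_space U" "None \<in> U"
  obtains Z where "compact Z" "Z \<subseteq> N" "Z \<inter> No = {}" "\<And>x. x \<in> N \<Longrightarrow> x \<notin> No \<Longrightarrow> Some x \<in> U \<longleftrightarrow> x \<notin> Z"
proof -
  obtain G where G: "open G" "{x \<in> N. collapse No x \<in> U} = N \<inter> G"
    using assms(1) unfolding openin_quotient_space openin_open by blast
  have mem: "x \<in> G \<longleftrightarrow> collapse No x \<in> U" if "x \<in> N" for x using G(2) that by blast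
  show ?thesis
  proof (rule that[of "N - G"])
    show "compact (N - G)" by (rule compact_diff[OF compact_N G(1)])
    show "(N - G) \<inter> No = {}" using mem assms(2) by (auto simp: collapse_def)
    show "Some x \<in> U \<longleftrightarrow> x \<notin> N - G" if "x \<in> N" "x \<notin> No" for x
      using mem[OF that(1)] that by (simp add: collapse_def)
  qed auto
qed

lemma compact_space_X: "compact_space index_space"
proof -
  have "compactin index_space (collapse No ` N)"
  proof (rule image_compactin[of "top_of_set N"])
    show "compactin (top_of_set N) N" using compact_N by (simp add: compactin_subtopology)
    show "continuous_map (top_of_set N) index_space (collapse No)"
      unfolding continuous_map by (auto simp: openin_quotient_space topspace_quotient_space)
  qed
  moreover have "compactin index_space {None}" by (simp add: topspace_X)
  ultimately have "compactin index_space ({None} \<union> collapse No ` N)" by (intro compactin_Un)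
  then show ?thesis by (simp add: compact_space_def topspace_quotient_space)
qed

lemma separate_Some_None:
  assumes x: "x \<in> N - No"
  obtains U V where "openin index_space U" "openin index_space V" "Some x \<in> U" "None \<in> V" "U \<inter> V = {}"
proof -
  have "x \<in> - No" "open (- No)" using x closed_No by auto
  then obtain e where e: "0 < e" "cball x e \<subseteq> - No" by (meson open_contains_cball)
  have e': "ball x e \<inter> No = {}" "cball x e \<inter> No = {}" using e(2) ball_subset_cball[of x e] by blast+
  show ?thesis
  proof (rule that)
    show "openin index_space (Some ` (N \<inter> ball x e))" using e' by (intro openin_X_Some) auto
    show "openin index_space (insert None (Some ` (N - No - cball x e)))" using e' by (intro openin_X_None) auto
    show "Some ` (N \<inter> ball x e) \<inter> insert None (Some ` (N - No - cball x e)) = {}" by auto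
  qed (use x e(1) in auto)
qed

lemma Hausdorff_space_X: "Hausdorff_space index_space"
  unfolding Hausdorff_space_def
proof (intro allI impI)
  fix p q assume pq: "p \<in> topspace index_space \<and> q \<in> topspace index_space \<and> p \<noteq> q"
  then consider x where "p = Some x" "x \<in> N - No" "q = None" | x where "q = Some x" "x \<in> N - No" "p = None"
    | x y where "p = Some x" "q = Some y" "x \<in> N - No" "y \<in> N - No" "x \<noteq> y"
    unfolding topspace_X by blast
  then show "\<exists>U V. openin index_space U \<and> openin index_space V \<and> p \<in> U \<and> q \<in> V \<and> disjnt U V"
  proof cases
    case (1 x)
    obtain U V where "openin index_space U" "openin index_space V" "Some x \<in> U" "None \<in> V" "U \<inter> V = {}"
      by (rule separate_Some_None[OF 1(2)]) (rule that)
    then show ?thesis unfolding 1(1,3) disjnt_def by blast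
  next
    case (2 x)
    obtain U V where "openin index_space U" "openin index_space V" "Some x \<in> U" "None \<in> V" "U \<inter> V = {}"
      by (rule separate_Some_None[OF 2(2)]) (rule that)
    then show ?thesis unfolding 2(1,3) disjnt_def by blast
  next
    case (3 x y)
    obtain U V where UV: "open U" "open V" "x \<in> U" "y \<in> V" "U \<inter> V = {}"
      using hausdorff[OF 3(5)] by blast
    have "openin index_space (Some ` (N \<inter> (U - No)))" "openin index_space (Some ` (N \<inter> (V - No)))"
      using UV closed_No by (auto intro!: openin_X_Some)
    moreover have "p \<in> Some ` (N \<inter> (U - No))" "q \<in> Some ` (N \<inter> (V - No))"
      using 3 UV by auto
    moreover have "disjnt (Some ` (N \<inter> (U - No))) (Some ` (N \<inter> (V - No)))"
      using UV(5) by (auto simp: disjnt_def)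
    ultimately show ?thesis by blast
  qed
qed

text \<open>This is the semiflow induced by \<open>\<phi>\<close> on \<open>N/No\<close>: an orbit starting in \<open>N - No\<close> leaves \<open>N\<close> only through
  \<open>No\<close>, so only visits to \<open>No\<close> have to be tested.\<close>

definition index_flow :: "real \<Rightarrow> 'a option \<Rightarrow> 'a option" where
  "index_flow t p = (case p of None \<Rightarrow> None | Some x \<Rightarrow> if \<exists>s\<in>{0<..t}. \<phi> x s \<in> No then None else Some (\<phi> x t))"

lemma index_flow_None [simp]: "index_flow t None = None"
  and index_flow_0 [simp]: "index_flow 0 p = p"
  by (auto simp: index_flow_def split: option.split)

lemma index_flow_SomeD:
  assumes "index_flow t (Some x) = Some z" "x \<in> N - No" "0 \<le> t"
  shows "z = \<phi> x t" "\<And>s. 0 \<le> s \<Longrightarrow> s \<le> t \<Longrightarrow> \<phi> x s \<in> N - No"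
proof -
  have F: "\<forall>s\<in>{0<..t}. \<phi> x s \<notin> No" "z = \<phi> x t" using assms(1) by (auto simp: index_flow_def split: if_splits)
  show "z = \<phi> x t" by (rule F(2))
  have out: "\<phi> x s \<notin> No" if "0 \<le> s" "s \<le> t" for s
    using F(1) assms(2) that by (cases "s = 0") auto
  then show "\<phi> x s \<in> N - No" if "0 \<le> s" "s \<le> t" for s
    using stay_in_N[of x t s] assms(2) that by auto
qed

lemma index_flow_Some:
  assumes "\<And>s. 0 \<le> s \<Longrightarrow> s \<le> t \<Longrightarrow> \<phi> x s \<notin> No"
  shows "index_flow t (Some x) = Some (\<phi> x t)"
  using assms by (auto simp: index_flow_def)

lemma index_flow_topspace: "p \<in> topspace index_space \<Longrightarrow> 0 \<le> t \<Longrightarrow> index_flow t p \<in> topspace index_space"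
proof (cases "index_flow t p")
  case (Some z)
  assume p: "p \<in> topspace index_space" and t: "0 \<le> t"
  then obtain x where "p = Some x" "x \<in> N - No" using Some by (auto simp: topspace_X)
  then have "z \<in> N - No" using index_flow_SomeD[of t x z] Some t by auto
  then show "index_flow t p \<in> topspace index_space" by (simp add: Some topspace_X)
qed (simp add: topspace_X)

lemma long_orbits_compact:
  assumes Z: "compact Z"
  shows "compact {(s, x). s \<in> {0..T} \<and> x \<in> N \<and> \<phi> x s \<in> Z \<and> (\<forall>u\<in>{0..s}. \<phi> x u \<in> N)}"
proof -
  \<comment> \<open>Rescaling the time by \<open>l\<close> in the unit interval makes the index set
    independent of \<open>s\<close>, so the condition on the whole segment is an intersection of
    closed conditions.\<close>
  let ?E = "({0..T} \<times> N) \<inter> ((\<lambda>p. \<phi> (snd p) (fst p)) -` Z \<inter> (\<Inter>l\<in>{0..1}. (\<lambda>p. \<phi> (snd p) (l * fst p)) -` N))"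
  have "closed ((\<lambda>p. \<phi> (snd p) (fst p)) -` Z \<inter> (\<Inter>l\<in>{0..1}. (\<lambda>p. \<phi> (snd p) (l * fst p)) -` N))"
    by (intro closed_Int closed_INT ballI closed_vimage compact_imp_closed[OF Z] closed_N continuous_intros)
  then have "compact ?E" by (intro compact_Int_closed compact_Times compact_N) auto
  moreover have "?E = {(s, x). s \<in> {0..T} \<and> x \<in> N \<and> \<phi> x s \<in> Z \<and> (\<forall>u\<in>{0..s}. \<phi> x u \<in> N)}"
  proof -
    have iff: "(\<forall>l\<in>{0..1}. \<phi> x (l * s) \<in> N) \<longleftrightarrow> (\<forall>u\<in>{0..s}. \<phi> x u \<in> N)" if s: "0 \<le> s" for s x
    proof
      assume *: "\<forall>l\<in>{0..1}. \<phi> x (l * s) \<in> N"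
      show "\<forall>u\<in>{0..s}. \<phi> x u \<in> N"
      proof
        fix u assume u: "u \<in> {0..s}"
        show "\<phi> x u \<in> N"
        proof (cases "s = 0")
          case True
          then show ?thesis using * u by (auto dest: bspec[of _ _ 0])
        next
          case False
          then have "u / s \<in> {0..1}" "u / s * s = u" using u by auto
          then show ?thesis using * by metis
        qed
      qed
    next
      assume *: "\<forall>u\<in>{0..s}. \<phi> x u \<in> N"
      have "l * s \<in> {0..s}" if "l \<in> {0..1}" for l using that s mult_left_le_one_le[of s l] by simp
      then show "\<forall>l\<in>{0..1}. \<phi> x (l * s) \<in> N" using * by blast
    qed
    have E: "(s, x) \<in> ?E \<longleftrightarrow> s \<in> {0..T} \<and> x \<in> N \<and> \<phi> x s \<in> Z \<and> (\<forall>l\<in>{0..1}. \<phi> x (l * s) \<in> N)" for s x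
      by simp
    show ?thesis
    proof (rule Set.set_eqI)
      fix p :: "real \<times> 'a"
      obtain s x where p: "p = (s, x)" by (cases p)
      show "p \<in> ?E \<longleftrightarrow> p \<in> {(s, x). s \<in> {0..T} \<and> x \<in> N \<and> \<phi> x s \<in> Z \<and> (\<forall>u\<in>{0..s}. \<phi> x u \<in> N)}"
        unfolding p E mem_Collect_eq prod.case using iff[of s x] by (cases "0 \<le> s") simp_all
    qed
  qed
  ultimately show ?thesis by simp
qed

text \<open>If the value is a point of \<open>N - No\<close>, the segment avoids \<open>No\<close>
  and so do nearby ones. If it is \<open>None\<close>, the complement of \<open>U\<close> gives a
  compact set \<open>Z\<close>; the segments that stay in \<open>N\<close> and end in
  \<open>Z\<close> form a compact set, and a neighbourhood that avoids it is mapped into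
  \<open>U\<close>.\<close>

lemma homotopy_on_index_flow: "homotopy_on {0..} index_space index_space index_flow"
  unfolding homotopy_on_def
proof (intro conjI ballI allI impI)
  fix t :: real and p assume "t \<in> {0..}" and p: "p \<in> topspace index_space"
  then have t: "0 \<le> t" by simp
  show "index_flow t p \<in> topspace index_space" by (rule index_flow_topspace[OF p t])
  fix U assume U: "openin index_space U" "index_flow t p \<in> U"
  show "\<exists>d>0. \<exists>W. openin index_space W \<and> p \<in> W \<and> (\<forall>s\<in>{0..}. \<bar>s - t\<bar> < d \<longrightarrow> (\<forall>y\<in>W. index_flow s y \<in> U))"
  proof (cases "index_flow t p")
    case (Some z)
    then obtain x where x: "p = Some x" "x \<in> N - No" using p by (auto simp: topspace_X)
    note z = index_flow_SomeD[OF Some[unfolded x(1)] x(2) t]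
    obtain G where G: "open G" "z \<in> G" "G \<inter> No = {}" "Some ` (N \<inter> G) \<subseteq> U"
      by (rule openin_X_SomeD[OF U(1) U(2)[unfolded Some]]) (rule that)
    obtain d1 where d1: "0 < d1" "\<forall>y s. dist x y < d1 \<longrightarrow> 0 \<le> s \<longrightarrow> s < t + d1 \<longrightarrow> \<phi> y s \<notin> No"
      using avoid_No_open[OF t, of x] z(2) by blast
    have "open ((\<lambda>q. \<phi> (fst q) (snd q)) -` G)" by (intro open_vimage G(1) continuous_intros)
    moreover have "(x, t) \<in> (\<lambda>q. \<phi> (fst q) (snd q)) -` G" using G(2) z(1) by simp
    ultimately obtain A B where AB: "open A" "open B" "x \<in> A" "t \<in> B" "A \<times> B \<subseteq> (\<lambda>q. \<phi> (fst q) (snd q)) -` G"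
      by (auto elim!: open_prod_elim)
    obtain d2 where d2: "0 < d2" "ball t d2 \<subseteq> B" using AB(2,4) by (meson open_contains_ball)
    let ?W = "Some ` (N \<inter> (A \<inter> ball x d1 - No))"
    have "openin index_space ?W" using AB(1) closed_No by (intro openin_X_Some) auto
    moreover have "p \<in> ?W" using x AB(3) d1(1) by simp
    moreover have "index_flow s y \<in> U" if s: "s \<in> {0..}" "\<bar>s - t\<bar> < min d1 d2" and y: "y \<in> ?W" for s y
    proof -
      obtain x' where x': "y = Some x'" "x' \<in> N" "x' \<in> A" "dist x x' < d1" "x' \<notin> No" using y by auto
      have out: "\<phi> x' u \<notin> No" if "0 \<le> u" "u \<le> s" for u
      proof -
        have "u < t + d1" using that s by auto
        then show ?thesis using d1(2) x'(4) that(1) by blast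
      qed
      have "s \<in> B" using d2(2) s(2) by (auto simp: dist_real_def)
      then have "\<phi> x' s \<in> G" using AB(5) x'(3) by auto
      moreover have "\<phi> x' s \<in> N" using stay_in_N[OF x'(2) out] s(1) by simp
      moreover have "index_flow s y = Some (\<phi> x' s)" unfolding x'(1) by (rule index_flow_Some) (rule out)
      ultimately show ?thesis using G(4) by auto
    qed
    ultimately show ?thesis using d1(1) d2(1) by (intro exI[of _ "min d1 d2"]) auto
  next
    case None
    obtain Z where Z: "compact Z" "Z \<subseteq> N" "Z \<inter> No = {}" "\<And>x. x \<in> N \<Longrightarrow> x \<notin> No \<Longrightarrow> Some x \<in> U \<longleftrightarrow> x \<notin> Z"
      by (rule openin_X_NoneD[OF U(1) U(2)[unfolded None]]) (rule that)
    let ?E = "{(s, x). s \<in> {0..t + 1} \<and> x \<in> N \<and> \<phi> x s \<in> Z \<and> (\<forall>u\<in>{0..s}. \<phi> x u \<in> N)}"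
    have E: "compact ?E" by (rule long_orbits_compact[OF Z(1)])
    have in_E: "(s, x) \<in> ?E" if x: "x \<in> N - No" "0 \<le> s" "s \<le> t + 1" and out: "index_flow s (Some x) \<notin> U" for s x
    proof -
      have "index_flow s (Some x) \<noteq> None" using out U(2) None by metis
      then obtain z where z: "index_flow s (Some x) = Some z" by blast
      note z' = index_flow_SomeD[OF z x(1,2)]
      have "z \<in> N" "z \<notin> No" using z'(2)[of s] x(2) unfolding z'(1) by auto
      then have "z \<in> Z" using Z(4)[of z] out unfolding z by blast
      then show ?thesis using x z'(2) unfolding z'(1) by auto
    qed
    \<comment> \<open>A visit to \<open>No\<close> before time \<open>s\<close> is followed at once
      by an exit from \<open>N\<close>, and a visit at time \<open>s\<close> is excluded because
      \<open>Z\<close> misses \<open>No\<close>.\<close>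
    have out_E: "(s, x) \<notin> ?E" if u: "0 \<le> u" "u \<le> s" "\<phi> x u \<in> No" for s x u
    proof
      assume e: "(s, x) \<in> ?E"
      obtain e where e': "0 < e" "\<And>t. 0 < t \<Longrightarrow> t \<le> e \<Longrightarrow> \<phi> (\<phi> x u) t \<notin> N"
        by (rule exit_from_No[OF u(3)]) (rule that)
      show False
      proof (cases "u = s")
        case True
        then show False using e u(3) Z(3) by auto
      next
        case False
        then have "0 < min e (s - u)" "min e (s - u) \<le> e" "u + min e (s - u) \<in> {0..s}" using e'(1) u(1,2) by auto
        then show False using e'(2)[of "min e (s - u)"] e by auto
      qed
    qed
    show ?thesis
    proof (cases p)
      case p: None
      let ?W = "insert None (Some ` (N - No - snd ` ?E))"
      have "compact (snd ` ?E)" by (intro compact_continuous_image E continuous_intros)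
      moreover have "snd ` ?E \<inter> No = {}"
      proof -
        have "x \<notin> No" if "(s, x) \<in> ?E" for s x
          using out_E[of 0 s x] that by auto
        then show ?thesis by auto
      qed
      ultimately have "openin index_space ?W" by (rule openin_X_None)
      moreover have "index_flow s y \<in> U" if s: "s \<in> {0..}" "\<bar>s - t\<bar> < 1" and y: "y \<in> ?W" for s y
      proof (rule ccontr)
        assume *: "index_flow s y \<notin> U"
        have "None \<in> U" using U(2) unfolding None .
        then have "y \<noteq> None" using * by (cases y) simp_all
        then obtain x where x: "y = Some x" "x \<in> N - No" "x \<notin> snd ` ?E" using y by auto
        have "(s, x) \<in> ?E" by (rule in_E) (use x * s in auto)
        then have "x \<in> snd ` ?E" by (rule image_eqI[rotated]) simp
        then show False using x(3) by contradiction
      qed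
      ultimately show ?thesis unfolding p by (intro exI[of _ 1] conjI exI[of _ ?W]) auto
    next
      case (Some x)
      then have x: "x \<in> N - No" using p by (auto simp: topspace_X)
      obtain u where "u \<in> {0<..t}" "\<phi> x u \<in> No" using None unfolding Some index_flow_def by (auto split: if_splits)
      then have "0 \<le> u" "u \<le> t" "\<phi> x u \<in> No" by auto
      then have "(t, x) \<in> - ?E" using out_E by blast
      moreover have "open (- ?E)" using compact_imp_closed[OF E] by (rule open_Compl)
      ultimately obtain A B where AB: "open A" "open B" "t \<in> A" "x \<in> B" "A \<times> B \<subseteq> - ?E"
        by (auto elim!: open_prod_elim)
      obtain d where d: "0 < d" "ball t d \<subseteq> A" using AB(1,3) by (meson open_contains_ball)
      let ?W = "Some ` (N \<inter> (B - No))"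
      have "openin index_space ?W" using AB(2) closed_No by (intro openin_X_Some) auto
      moreover have "p \<in> ?W" using Some x AB(4) by auto
      moreover have "index_flow s y \<in> U" if s: "s \<in> {0..}" "\<bar>s - t\<bar> < min d 1" and y: "y \<in> ?W" for s y
      proof (rule ccontr)
        assume *: "index_flow s y \<notin> U"
        obtain x' where x': "y = Some x'" "x' \<in> N - No" "x' \<in> B" using y by auto
        have "(s, x') \<in> ?E" by (rule in_E) (use x' * s in auto)
        moreover have "s \<in> A" using d(2) s(2) by (auto simp: dist_real_def)
        ultimately show False using AB(5) x'(3) by blast
      qed
      ultimately show ?thesis using d(1) by (intro exI[of _ "min d 1"]) auto
    qed
  qed
qed

section \<open>The unstable set and its image in the quotient\<close>

text \<open>The unstable set of \<open>S\<close> in \<open>N\<close>: exactly the part of the index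
  space that can still be reached after arbitrarily long times, apart from the base point.\<close>

definition backward_set :: "'a set" where
  "backward_set = {x. \<forall>t\<le>0. \<phi> x t \<in> N}"

lemma backward_set_subset: "backward_set \<subseteq> N"
  unfolding backward_set_def by (auto dest: spec[of _ 0])

lemma compact_backward_set: "compact backward_set"
proof -
  have "backward_set = (\<Inter>t\<in>{..0}. (\<lambda>x. \<phi> x t) -` N)" by (auto simp: backward_set_def)
  moreover have "closed (\<Inter>t\<in>{..0}. (\<lambda>x. \<phi> x t) -` N)"
    by (intro closed_INT ballI closed_vimage closed_N continuous_intros)
  ultimately have "closed backward_set" by simp
  from compact_Int_closed[OF compact_N this] backward_set_subset show ?thesis by (simp add: Int_absorb1)
qed

abbreviation unstable_space :: "'a option set" where "unstable_space \<equiv> insert None (Some ` (backward_set - No))"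

lemma closedin_Y: "closedin index_space unstable_space"
proof -
  have "open (- (No \<union> backward_set))" using closed_No compact_imp_closed[OF compact_backward_set] by auto
  then have "openin index_space (Some ` (N \<inter> - (No \<union> backward_set)))" by (rule openin_X_Some) auto
  moreover have "topspace index_space - unstable_space = Some ` (N \<inter> - (No \<union> backward_set))" by (auto simp: topspace_X)
  moreover have "unstable_space \<subseteq> topspace index_space" using backward_set_subset by (auto simp: topspace_X)
  ultimately show ?thesis by (simp add: closedin_def)
qed

lemma index_flow_Y:
  assumes t: "0 \<le> t" and p: "p \<in> unstable_space"
  shows "index_flow t p \<in> unstable_space"
proof (cases "index_flow t p")
  case (Some z)
  then obtain x where x: "p = Some x" "x \<in> backward_set" "x \<notin> No" using p by (cases p) auto
  then have "x \<in> N - No" using backward_set_subset by blast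
  note z = index_flow_SomeD[OF Some[unfolded x(1)] this t]
  have "\<phi> z s \<in> N" if "s \<le> 0" for s
  proof (cases "t + s \<le> 0")
    case True
    then show ?thesis using x(2) by (simp add: z(1) backward_set_def)
  next
    case False
    then show ?thesis using z(2)[of "t + s"] that by (simp add: z(1))
  qed
  moreover have "z \<notin> No" using z(2)[of t] t by (simp add: z(1))
  ultimately show ?thesis by (simp add: Some backward_set_def)
qed simp

text \<open>The complement of \<open>U\<close> is a compact set of points that leave
  \<open>N\<close> in backward time, hence within a common time \<open>T\<close>. No segment of
  length \<open>T\<close> inside \<open>N\<close> ends there.\<close>

lemma index_flow_attracted:
  assumes U: "openin index_space U" "unstable_space \<subseteq> U"
  shows "\<exists>T\<ge>0. \<forall>p\<in>topspace index_space. index_flow T p \<in> U"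
proof -
  have None: "None \<in> U" using U(2) by blast
  obtain Z where Z: "compact Z" "Z \<subseteq> N" "Z \<inter> No = {}" "\<And>x. x \<in> N \<Longrightarrow> x \<notin> No \<Longrightarrow> Some x \<in> U \<longleftrightarrow> x \<notin> Z"
    by (rule openin_X_NoneD[OF U(1) None]) (rule that)
  have "open (- N)" using closed_N by auto
  moreover have "\<exists>t\<in>{..0}. \<phi> z t \<in> - N" if z: "z \<in> Z" for z
  proof (rule ccontr)
    assume "\<not> ?thesis"
    then have "z \<in> backward_set" by (auto simp: backward_set_def)
    then have "Some z \<in> U" using U(2) z Z(3) by blast
    then show False using Z z by blast
  qed
  ultimately obtain T where T: "0 \<le> T" "\<And>z. z \<in> Z \<Longrightarrow> \<exists>t\<in>{..0}. \<bar>t\<bar> \<le> T \<and> \<phi> z t \<in> - N"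
    by (rule compact_hit_time[OF Z(1)]) (assumption, rule that)
  have "index_flow T p \<in> U" if p: "p \<in> topspace index_space" for p
  proof (cases "index_flow T p")
    case (Some z)
    then obtain x where x: "p = Some x" "x \<in> N - No" using p by (auto simp: topspace_X)
    note z = index_flow_SomeD[OF Some[unfolded x(1)] x(2) T(1)]
    have "z \<notin> Z"
    proof
      assume "z \<in> Z"
      then obtain t where "t \<le> 0" "\<bar>t\<bar> \<le> T" "\<phi> z t \<notin> N" using T(2) by fastforce
      then show False using z(2)[of "T + t"] unfolding z(1) by simp
    qed
    moreover have "z \<in> N - No" using z(2)[of T] T(1) unfolding z(1) by simp
    ultimately show ?thesis using Z(4) by (simp add: Some)
  qed (use None in simp)
  then show ?thesis using T(1) by blast
qed

lemma hrank_index_space: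
  "hrank m (cover_system (subtopology index_space unstable_space) {None}) = hrank m (cover_system index_space {None})"
  by (rule hrank_deformation[OF compact_space_X Hausdorff_space_X closedin_Y _ homotopy_on_index_flow])
     (use index_flow_Y index_flow_attracted in auto)

text \<open>Both sides describe the one-point compactification of \<open>M - D\<close>: one by the
  metric of \<open>M\<close> with \<open>D\<close> collapsed, the other as a subspace of N/No. The
  pair (M, D) can thus be chosen without reference to the block.\<close>

lemma hrank_unstable_space:
  assumes M: "compact M" and D: "closed D" "D \<subseteq> M" and MD: "M - D = backward_set - No"
  shows "hrank m (pointed_system M D) = hrank m (cover_system (subtopology index_space unstable_space) {None})"
proof -
  define i where "i p = (case p of None \<Rightarrow> None | Some x \<Rightarrow> collapse D x)" for p
  have i_None: "i None = None" and i_Some: "i (Some x) = collapse D x" for x by (simp_all add: i_def)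
  have MD': "x \<in> backward_set - No \<longleftrightarrow> x \<in> M \<and> x \<notin> D" for x using MD by blast
  have topY: "topspace (subtopology index_space unstable_space) = unstable_space" using closedin_subset[OF closedin_Y] by (simp add: Int_absorb1)
  have collapse_Y: "collapse D x \<in> unstable_space" if "x \<in> M" for x using that MD' by (auto simp: collapse_def)
  have preimage: "openin (top_of_set M) {x \<in> M. collapse D x \<in> v}" if v: "openin (subtopology index_space unstable_space) v" for v
  proof -
    obtain v' where v': "openin index_space v'" "v = v' \<inter> unstable_space" using v unfolding openin_subtopology by blast
    have eq: "{x \<in> M. collapse D x \<in> v} = {x \<in> M. collapse D x \<in> v'}" using collapse_Y v'(2) by blast
    show ?thesis
    proof (cases "None \<in> v'")
      case True
      obtain Z where Z: "compact Z" "Z \<subseteq> N" "Z \<inter> No = {}" "\<And>x. x \<in> N \<Longrightarrow> x \<notin> No \<Longrightarrow> Some x \<in> v' \<longleftrightarrow> x \<notin> Z"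
        by (rule openin_X_NoneD[OF v'(1) True]) (rule that)
      have "collapse D x \<in> v' \<longleftrightarrow> x \<notin> Z \<inter> backward_set" if x: "x \<in> M" for x
      proof (cases "x \<in> D")
        case True
        then have "x \<notin> backward_set - No" using MD' by blast
        then show ?thesis using True \<open>None \<in> v'\<close> Z(3) by (auto simp: collapse_def)
      next
        case False
        then have "x \<in> backward_set - No" using MD' x by blast
        then show ?thesis using False Z(4)[of x] backward_set_subset by (auto simp: collapse_def)
      qed
      then have "{x \<in> M. collapse D x \<in> v'} = M \<inter> - (Z \<inter> backward_set)" by blast
      moreover have "open (- (Z \<inter> backward_set))"
        using Z(1) compact_backward_set by (auto intro: compact_imp_closed)
      ultimately show ?thesis unfolding eq by (simp add: openin_open_Int)
    next
      case False
      obtain G where G: "open G" "{x \<in> N. collapse No x \<in> v'} = N \<inter> G"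
        using v'(1) unfolding openin_quotient_space openin_open by blast
      have "collapse D x \<in> v' \<longleftrightarrow> x \<in> G \<and> x \<notin> D" if x: "x \<in> M" for x
      proof (cases "x \<in> D")
        case True
        then show ?thesis using False by (simp add: collapse_def)
      next
        case nD: False
        then have "x \<in> backward_set - No" using MD' x by blast
        then have "x \<in> N" "x \<notin> No" using backward_set_subset by auto
        then have "x \<in> G \<longleftrightarrow> collapse No x \<in> v'" using G(2) by blast
        then show ?thesis using nD \<open>x \<notin> No\<close> by (simp add: collapse_def)
      qed
      then have "{x \<in> M. collapse D x \<in> v'} = M \<inter> (G - D)" by blast
      moreover have "open (G - D)" using G(1) D(1) by auto
      ultimately show ?thesis unfolding eq by (simp add: openin_open_Int)
    qed
  qed
  show ?thesis
  proof (rule hrank_approximate_equivalence[where i = i, OF scale_system_pointed scale_system_cover_system])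
    fix q assume "q \<in> cover_system (subtopology index_space unstable_space) {None}"
    then obtain V where V: "V \<in> open_covers (subtopology index_space unstable_space)" "q = cover_scale {None} V"
      by (auto simp: cover_system_def)
    let ?P = "(\<lambda>v. {x \<in> M. collapse D x \<in> v}) ` V"
    have "?P \<in> open_covers (top_of_set M)"
    proof -
      have "openin (top_of_set M) P" if "P \<in> ?P" for P
        using preimage V(1) that unfolding open_covers_def by blast
      moreover have "x \<in> \<Union>?P" if "x \<in> M" for x
      proof -
        have "collapse D x \<in> \<Union>V" using collapse_Y[OF that] V(1) topY by (auto simp: open_covers_def)
        then show ?thesis using that by blast
      qed
      ultimately show ?thesis by (auto simp: open_covers_def)
    qed
    then obtain e1 where e1: "0 < e1" "\<And>\<sigma>. \<sigma> \<in> small M e1 \<Longrightarrow> \<sigma> = {} \<or> (\<exists>w\<in>?P. \<sigma> \<subseteq> w)"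
      by (rule open_cover_small[OF M]) (rule that)
    have "None \<in> \<Union>V" using V(1) unfolding open_covers_def topY by blast
    then obtain v0 where v0: "v0 \<in> V" "None \<in> v0" by blast
    have "openin (subtopology index_space unstable_space) v0" using V(1) v0(1) by (simp add: open_covers_def)
    from preimage[OF this] obtain G where G: "open G" "{x \<in> M. collapse D x \<in> v0} = M \<inter> G"
      unfolding openin_open by blast
    have "compact D" using compact_Int_closed[OF M D(1)] D(2) by (simp add: Int_absorb1)
    have "D \<subseteq> M \<inter> G" unfolding G(2)[symmetric] using D(2) v0(2) by (auto simp: collapse_def)
    then obtain e2 where e2: "0 < e2" "(\<Union>x\<in>D. ball x e2) \<subseteq> G"
      using compact_subset_open_imp_ball_epsilon_subset[OF \<open>compact D\<close> G(1)] by blast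
    define e where "e = min e1 e2"
    have e: "0 < e" "e \<le> e1" "e \<le> e2" using e1(1) e2(1) by (auto simp: e_def)
    have "contiguous (pointed_small M D e, Pow {None}) (cover_scale {None} V) i i"
      unfolding contiguous_def fst_conv snd_conv Un_absorb
    proof (intro conjI ballI)
      fix \<sigma> assume "\<sigma> \<in> pointed_small M D e"
      then show "i ` \<sigma> \<in> fst (cover_scale {None} V)"
      proof
        assume "\<sigma> \<in> (`) Some ` small M e"
        then obtain \<tau> where \<tau>: "\<tau> \<in> small M e" "\<sigma> = Some ` \<tau>" by blast
        have "\<tau> = {} \<or> (\<exists>w\<in>?P. \<tau> \<subseteq> w)" using e1(2) small_mono[OF e(2) subset_refl \<tau>(1)] by blast
        moreover have "i ` \<sigma> = collapse D ` \<tau>" using \<tau>(2) by (simp add: image_image i_Some)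
        ultimately show ?thesis by (auto simp: cover_scale_def)
      next
        assume \<sigma>: "\<sigma> \<in> collapsed M D e"
        have "i p \<in> v0" if "p \<in> \<sigma>" for p
        proof (cases p)
          case (Some x)
          then have x: "x \<in> M" "x \<in> near D e" using \<sigma> that by (auto simp: collapsed_def)
          then obtain z where "z \<in> D" "dist x z < e" by (auto simp: near_def)
          then have "x \<in> ball z e2" using e(3) by (simp add: dist_commute)
          then have "x \<in> G" using e2(2) \<open>z \<in> D\<close> by blast
          then show ?thesis using G(2) x(1) by (auto simp: Some i_Some)
        qed (use v0(2) i_None in simp)
        then have "i ` \<sigma> \<subseteq> v0" by blast
        then show ?thesis using v0(1) by (auto simp: cover_scale_def)
      qed
    next
      fix \<sigma> :: "'a option set" assume "\<sigma> \<in> Pow {None}"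
      then have 1: "i ` \<sigma> \<subseteq> {None}" using i_None by auto
      have "i ` \<sigma> \<subseteq> v0" by (rule order_trans[OF 1]) (simp add: v0(2))
      with 1 v0(1) have "i ` \<sigma> \<subseteq> {None} \<and> (\<exists>w\<in>V. i ` \<sigma> \<subseteq> w)" by (intro conjI bexI[of _ v0])
      then show "i ` \<sigma> \<in> snd (cover_scale {None} V)" by (simp add: cover_scale_def)
    qed
    then show "\<exists>p\<in>pointed_system M D. scale_map p q i"
      using e(1) V(2) by (auto simp: pointed_system_def)
  next
    fix p q assume "p \<in> pointed_system M D" "q \<in> cover_system (subtopology index_space unstable_space) {None}"
    then obtain e V where e: "0 < e" "p = (pointed_small M D e, Pow {None})"
      and V: "V \<in> open_covers (subtopology index_space unstable_space)" "q = cover_scale {None} V"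
      by (auto simp: cover_system_def pointed_system_def)
    \<comment> \<open>The sets \<open>Qx x\<close> have size below \<open>e\<close>, and
      \<open>Q0\<close> is a neighbourhood of the base point whose other points are near
      \<open>D\<close>; both kinds are small in the pointed system.\<close>
    define Qx where "Qx x = Some ` (N \<inter> (ball x (e/2) - No)) \<inter> unstable_space" for x
    define Q0 where "Q0 = insert None (Some ` (N - No - (M - near D e))) \<inter> unstable_space"
    have near_open: "open (near D e)"
    proof -
      have "near D e = (\<Union>x\<in>D. ball x e)" by (auto simp: near_def dist_commute)
      then show ?thesis by auto
    qed
    have "openin index_space (Some ` (N \<inter> (ball x (e/2) - No)))" for x using closed_No by (intro openin_X_Some) auto
    then have "openin (subtopology index_space unstable_space) (Qx x)" for x unfolding Qx_def by (rule openin_subtopology_Int)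
    moreover have "openin index_space (insert None (Some ` (N - No - (M - near D e))))"
    proof (rule openin_X_None)
      show "compact (M - near D e)" by (rule compact_diff[OF M near_open])
      show "(M - near D e) \<inter> No = {}" using MD' near_self[OF e(1), of D] by blast
    qed
    then have "openin (subtopology index_space unstable_space) Q0" unfolding Q0_def by (rule openin_subtopology_Int)
    moreover have "y \<in> \<Union>(insert Q0 (range Qx))" if y: "y \<in> unstable_space" for y
    proof (cases y)
      case (Some x)
      then have "x \<in> N" "x \<notin> No" using y backward_set_subset by auto
      then have "y \<in> Qx x" using Some y e(1) by (auto simp: Qx_def)
      then show ?thesis by blast
    qed (simp add: Q0_def)
    then have "unstable_space \<subseteq> \<Union>(insert Q0 (range Qx))" by (rule subsetI)
    moreover have "Q0 \<subseteq> unstable_space" "Qx x \<subseteq> unstable_space" for x by (auto simp: Q0_def Qx_def)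
    ultimately have Q: "insert Q0 (range Qx) \<in> open_covers (subtopology index_space unstable_space)"
      unfolding open_covers_def topY by blast
    obtain W where W: "W \<in> open_covers (subtopology index_space unstable_space)" "\<And>w. w \<in> W \<Longrightarrow> \<exists>u\<in>insert Q0 (range Qx). w \<subseteq> u"
      "\<And>w. w \<in> W \<Longrightarrow> \<exists>v\<in>V. w \<subseteq> v"
      by (rule open_covers_refine[OF Q V(1)]) (rule that)
    have Y_M: "x \<in> M" "x \<notin> D" if "Some x \<in> unstable_space" for x using that MD' by auto
    have in_p: "\<sigma> \<in> fst p" if w: "w \<in> W" "\<sigma> \<subseteq> w" for \<sigma> w
    proof -
      consider "w \<subseteq> Q0" | x where "w \<subseteq> Qx x" using W(2)[OF w(1)] by blast
      then show ?thesis
      proof cases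
        case 1
        have "p \<in> insert None (Some ` (M \<inter> near D e))" if "p \<in> \<sigma>" for p
        proof (cases p)
          case (Some x)
          have "p \<in> Q0" using 1 w(2) that by blast
          then have "Some x \<in> unstable_space" "x \<notin> M - near D e" by (auto simp: Some Q0_def)
          then show ?thesis using Y_M(1)[of x] by (simp add: Some)
        qed simp
        then have "\<sigma> \<in> collapsed M D e" unfolding collapsed_def by blast
        then show ?thesis by (simp add: e(2))
      next
        case (2 x)
        let ?\<tau> = "{z. Some z \<in> \<sigma>}"
        have sub: "\<sigma> \<subseteq> Qx x" using 2 w(2) by blast
        have "Qx x \<subseteq> range Some" by (auto simp: Qx_def)
        then have \<sigma>: "\<sigma> = Some ` ?\<tau>" using sub by blast
        have \<tau>: "z \<in> M" "dist x z < e/2" if "Some z \<in> \<sigma>" for z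
        proof -
          have z: "Some z \<in> Qx x" using that sub by blast
          show "z \<in> M" by (rule Y_M(1)) (use z in \<open>simp add: Qx_def\<close>)
          show "dist x z < e/2" using z by (auto simp: Qx_def)
        qed
        have "dist y z < e" if "Some y \<in> \<sigma>" "Some z \<in> \<sigma>" for y z
          by (rule dist_triangle_half_r[OF \<tau>(2)[OF that(1)] \<tau>(2)[OF that(2)]])
        then have "?\<tau> \<in> small M e" using \<tau>(1) by (simp add: small_def subset_iff)
        then have "\<sigma> \<in> (`) Some ` small M e" using \<sigma> by (rule image_eqI[rotated])
        then show ?thesis by (simp add: e(2))
      qed
    qed
    have 1: "scale_map (cover_scale {None} W) p (\<lambda>x. x)"
      unfolding contiguous_def
    proof (intro conjI ballI)
      fix \<sigma> assume "\<sigma> \<in> fst (cover_scale {None} W)"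
      moreover have "{} \<in> fst p" by (auto simp: e(2) collapsed_def)
      ultimately show "(\<lambda>x. x) ` \<sigma> \<union> (\<lambda>x. x) ` \<sigma> \<in> fst p" using in_p by (auto simp: cover_scale_def)
    qed (auto simp: e(2) cover_scale_def)
    have W_Y: "w \<subseteq> unstable_space" if "w \<in> W" for w
    proof -
      have "openin (subtopology index_space unstable_space) w" using W(1) that by (simp add: open_covers_def)
      from openin_subset[OF this] show ?thesis by (simp add: topY)
    qed
    have i_Y: "i y = y" if "y \<in> unstable_space" for y
      using that Y_M(2) by (cases y) (auto simp: i_None i_Some collapse_def)
    have 2: "contiguous (cover_scale {None} W) q (\<lambda>x. x) (\<lambda>x. i x)"
      unfolding V(2)
    proof (rule cover_scale_contiguousI)
      fix w assume w: "w \<in> W"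
      obtain v where v: "v \<in> V" "w \<subseteq> v" using W(3)[OF w] ..
      have "i ` w = w" using i_Y W_Y[OF w] by (auto simp: image_iff subset_iff)
      then show "\<exists>v\<in>V. (\<lambda>x. x) ` w \<union> (\<lambda>x. i x) ` w \<subseteq> v" using v by (intro bexI[of _ v]) auto
    qed (simp_all add: i_None)
    have 3: "contiguous p p (\<lambda>x. x) (\<lambda>x. i x)"
      unfolding contiguous_def
    proof (intro conjI ballI)
      fix \<sigma> assume "\<sigma> \<in> fst p"
      then have "\<sigma> \<in> pointed_small M D e" by (simp add: e(2))
      then show "(\<lambda>x. x) ` \<sigma> \<union> (\<lambda>x. i x) ` \<sigma> \<in> fst p"
      proof
        assume "\<sigma> \<in> (`) Some ` small M e"
        then obtain \<tau> where \<tau>: "\<tau> \<in> small M e" "\<sigma> = Some ` \<tau>" by blast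
        show ?thesis
        proof (cases "\<tau> \<inter> D = {}")
          case True
          then have "(\<lambda>x. i x) ` \<sigma> = \<sigma>"
            unfolding \<tau>(2) image_image i_Some by (intro image_cong) (auto simp: collapse_def)
          then show ?thesis using \<open>\<sigma> \<in> fst p\<close> by simp
        next
          case False
          then obtain z where z: "z \<in> \<tau>" "z \<in> D" by blast
          have \<tau>': "x \<in> M \<inter> near D e" if "x \<in> \<tau>" for x
            using smallD(1)[OF \<tau>(1) that z(1)] z(2) smallD(2)[OF \<tau>(1)] that by (auto simp: near_def)
          then have sub: "\<sigma> \<subseteq> insert None (Some ` (M \<inter> near D e))" using \<tau>(2) by blast
          have "i ` \<sigma> \<subseteq> insert None (Some ` (M \<inter> near D e))"
            unfolding \<tau>(2) image_image i_Some collapse_def using \<tau>' by (intro image_subsetI) simp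
          then have "(\<lambda>x. x) ` \<sigma> \<union> (\<lambda>x. i x) ` \<sigma> \<in> collapsed M D e" using sub by (simp add: collapsed_def)
          then show ?thesis by (simp add: e(2))
        qed
      next
        assume \<sigma>: "\<sigma> \<in> collapsed M D e"
        have "i p \<in> insert None (Some ` (M \<inter> near D e))" if "p \<in> \<sigma>" for p
          using that \<sigma> by (cases p) (auto simp: i_None i_Some collapse_def collapsed_def)
        then have "(\<lambda>x. x) ` \<sigma> \<union> (\<lambda>x. i x) ` \<sigma> \<in> collapsed M D e" using \<sigma> by (auto simp: collapsed_def)
        then show ?thesis by (simp add: e(2))
      qed
    next
      fix \<sigma> assume "\<sigma> \<in> snd p"
      then have "\<sigma> \<subseteq> {None}" by (simp add: e(2))
      then have "i ` \<sigma> \<subseteq> {None}" using i_None by auto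
      then show "(\<lambda>x. x) ` \<sigma> \<union> (\<lambda>x. i x) ` \<sigma> \<in> snd p" using \<open>\<sigma> \<subseteq> {None}\<close> by (simp add: e(2))
    qed
    have "cover_scale {None} W \<in> cover_system (subtopology index_space unstable_space) {None}" "p \<in> pointed_system M D"
      using W(1) e by (auto simp: cover_system_def pointed_system_def)
    then show "approximate_inverse (pointed_system M D) (cover_system (subtopology index_space unstable_space) {None}) i p q"
      by (rule approximate_inverseI[where i = i, OF _ _ 1 contiguous_imp_homotopic[OF 2] contiguous_imp_homotopic[OF 3]])
  qed
qed

text \<open>The space \<open>Z\<close> is arbitrary because the member of the index used in
  \<open>poincare_series\<close> is. Its cohomology passes to N/No by homotopy invariance, to the
  unstable set by deformation, and finally to the pair (M, D).\<close>

theorem group_rank_index: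
  assumes Z: "compact_space Z" "Hausdorff_space Z" and eq: "pointed_homotopy_equivalent (index_space, None) (Z, z)"
    and M: "compact M" and D: "closed D" "D \<subseteq> M" and MD: "M - D = backward_set - No"
  shows "group_rank (cech_cohomology k Z {z}) = hrank (Suc k) (metric_system M D)"
proof -
  have "group_rank (cech_cohomology k Z {z}) = hrank (Suc k) (cover_system Z {z})"
    by (rule group_rank_cech_cohomology[OF Z])
  also have "\<dots> = hrank (Suc k) (cover_system index_space {None})"
    by (rule hrank_pointed_homotopy_equivalent[OF compact_space_X Z(1) eq, symmetric])
  also have "\<dots> = hrank (Suc k) (pointed_system M D)"
    by (simp add: hrank_index_space hrank_unstable_space[OF M D MD])
  also have "\<dots> = hrank (Suc k) (metric_system M D)" by (rule hrank_pointed_system[OF D(2)])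
  finally show ?thesis .
qed

lemma index_space_in_conley_index: "(index_space, None) \<in> conley_index \<phi> S"
proof -
  have "pointed_homotopy_equivalent (index_space, None) (index_space, None)"
    unfolding pointed_homotopy_equivalent_def by (auto intro!: exI[of _ id])
  then show ?thesis
    unfolding conley_index_def using block compact_space_X Hausdorff_space_X topspace_X by auto
qed

end

section \<open>The Conley indices of an attractor and of its dual repeller\<close>

lemma attracting_in_basin:
  assumes "attractor_in \<Omega> \<phi> A" shows "A \<subseteq> basin_in \<Omega> \<phi> A"
proof
  fix x assume x: "x \<in> A"
  obtain U where U: "nbhd_in \<Omega> A U" "\<forall>x\<in>U. omega_limit \<phi> x \<noteq> {} \<and> omega_limit \<phi> x \<subseteq> A"
    using assms unfolding attractor_in_def attracting_in_def by blast
  have "x \<in> U" using U(1) x unfolding nbhd_in_def by blast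
  moreover have "x \<in> \<Omega>" using assms x unfolding attractor_in_def by blast
  ultimately show "x \<in> basin_in \<Omega> \<phi> A" using U(2) by (simp add: basin_in_def)
qed

context flow_block
begin

lemma S_subset_N: "S \<subseteq> N" and S_No: "S \<inter> No = {}"
proof -
  have "S \<subseteq> interior N" "No \<subseteq> frontier N" using block by (auto simp: isolating_block_def)
  then show "S \<subseteq> N" "S \<inter> No = {}" using interior_subset[of N] by (auto simp: frontier_def)
qed

lemma full_orbit_in_S:
  assumes "\<And>t. \<phi> z t \<in> N" shows "z \<in> S"
proof -
  have "range (\<phi> z) \<subseteq> N" "invariant \<phi> (range (\<phi> z))" using assms by (auto simp: invariant_def)
  moreover have "z \<in> range (\<phi> z)" by (rule range_eqI[of _ _ 0]) simp
  ultimately have "z \<in> maximal_invariant \<phi> N" unfolding maximal_invariant_def by blast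
  then show ?thesis using block by (simp add: isolating_block_def)
qed

lemma S_in_backward_set: "invariant \<phi> S \<Longrightarrow> S \<subseteq> backward_set - No"
  using S_subset_N S_No unfolding backward_set_def invariant_def by blast

text \<open>The backward orbit accumulates on points whose full orbits lie in \<open>N\<close>, and
  these belong to \<open>S\<close>.\<close>

lemma backward_set_limit:
  assumes S: "S \<noteq> {}" and y: "y \<in> backward_set" and e: "0 < e"
  shows "\<exists>t\<le>0. infdist (\<phi> y t) S < e"
proof -
  have "\<exists>z. (\<forall>s. \<phi> z s \<in> N) \<and> (\<forall>s. \<forall>e>0. \<exists>t\<le>0. dist (\<phi> y t) (\<phi> z s) < e)"
    by (rule backward_limit[OF compact_N]) (use y in \<open>simp add: backward_set_def\<close>)
  then obtain z where z: "\<forall>s. \<phi> z s \<in> N" "\<forall>s. \<forall>e>0. \<exists>t\<le>0. dist (\<phi> y t) (\<phi> z s) < e" by blast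
  obtain t where t: "t \<le> 0" "dist (\<phi> y t) (\<phi> z 0) < e" using z(2) e by blast
  have "z \<in> S" using full_orbit_in_S z(1) by blast
  then have "infdist (\<phi> y t) S < e" using infdist_le[of z S "\<phi> y t"] t(2) by simp
  then show ?thesis using t(1) by blast
qed

text \<open>A backward orbit in \<open>N\<close> comes near \<open>S\<close> in the past, and
  stability keeps it near \<open>S\<close> ever after; so nothing outside \<open>S\<close> has
  one.\<close>

lemma backward_set_attractor:
  assumes S: "captures_backward S \<delta>"
  shows "backward_set - No = S"
proof
  have S': "compact S" "S \<noteq> {}" "invariant \<phi> S" using S by (auto simp: captures_backward_def)
  show "S \<subseteq> backward_set - No" by (rule S_in_backward_set[OF S'(3)])
  show "backward_set - No \<subseteq> S"
  proof
    fix y assume y: "y \<in> backward_set - No"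
    show "y \<in> S"
    proof (rule backward_in_stable[OF S'(1,2) captures_backward_stable[OF S] compact_N])
      show "\<phi> y t \<in> N" if "t \<le> 0" for t using y that by (simp add: backward_set_def)
      show "\<exists>t. infdist (\<phi> z t) S < e" if z: "\<And>s. \<phi> z s \<in> N" and e: "0 < e" for z e
      proof (intro exI)
        show "infdist (\<phi> z 0) S < e" using full_orbit_in_S[OF z] e by simp
      qed
    qed simp
  qed
qed

lemma group_rank_index_attractor:
  assumes S: "captures_backward S \<delta>"
    and Z: "compact_space Z" "Hausdorff_space Z" "pointed_homotopy_equivalent (index_space, None) (Z, z)"
  shows "group_rank (cech_cohomology k Z {z}) = hrank (Suc k) (metric_system S {})"
  using S backward_set_attractor[OF S]
  by (intro group_rank_index[OF Z]) (auto simp: captures_backward_def)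

section \<open>The unstable set of the dual repeller\<close>

text \<open>If the backward orbit of a point near \<open>S\<close> left \<open>N\<close>, it would
  meet the frontier at some time \<open>u\<close> before \<open>-T\<close>, as it stays near
  \<open>S\<close> during the last \<open>T\<close> units. Starting from the frontier it is caught
  near \<open>A\<close> within time \<open>T\<close>, so the point itself would be near both
  \<open>A\<close> and \<open>S\<close>.\<close>

lemma near_repeller_in_backward_set:
  assumes \<Omega>: "compact \<Omega>" "invariant \<phi> \<Omega>" and S: "compact S" "S \<noteq> {}" "invariant \<phi> S" "S \<subseteq> \<Omega>"
    and A: "compact A" "A \<noteq> {}" "A \<inter> S = {}" "stable_on \<Omega> A"
    and hit: "\<And>x e. x \<in> \<Omega> \<Longrightarrow> x \<notin> S \<Longrightarrow> 0 < e \<Longrightarrow> \<exists>t\<ge>0. infdist (\<phi> x t) A < e"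
  shows "\<exists>d>0. \<forall>y\<in>\<Omega>. infdist y S \<le> d \<longrightarrow> y \<in> backward_set"
proof -
  have sub: "S \<subseteq> interior N" using block unfolding isolating_block_def by blast
  obtain c where c: "0 < c" "\<forall>x\<in>A. \<forall>y\<in>S. c \<le> dist x y"
    using separate_compact_closed[OF A(1) compact_imp_closed[OF S(1)] A(3)] by blast
  have apart: "\<not> infdist y S \<le> c / 3" if "infdist y A \<le> c / 3" for y
  proof
    assume "infdist y S \<le> c / 3"
    then have "dist y (nearest A y) \<le> c / 3" "dist y (nearest S y) \<le> c / 3"
      using nearest(2)[OF A(1,2), of y] nearest(2)[OF S(1,2), of y] that by auto
    moreover have "c \<le> dist (nearest A y) (nearest S y)"
      using c(2) nearest(1)[OF A(1,2), of y] nearest(1)[OF S(1,2), of y] by blast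
    moreover have "dist (nearest A y) (nearest S y) \<le> dist y (nearest A y) + dist y (nearest S y)"
      by (rule dist_triangle3)
    ultimately show False using c(1) by linarith
  qed
  have "0 < c / 3" using c(1) by simp
  then obtain a where a: "0 < a" "\<forall>x\<in>\<Omega>. infdist x A \<le> a \<longrightarrow> (\<forall>t\<ge>0. infdist (\<phi> x t) A \<le> c / 3)"
    using A(4) unfolding stable_on_def by blast
  let ?Q = "\<Omega> \<inter> frontier N"
  have Q: "compact ?Q" by (rule compact_Int_closed[OF \<Omega>(1) frontier_closed])
  have "open {x. infdist x A < a}" by (intro open_Collect_less continuous_intros)
  moreover have "\<exists>t\<in>{0..}. \<phi> x t \<in> {x. infdist x A < a}" if x: "x \<in> ?Q" for x
  proof -
    have "x \<in> \<Omega>" "x \<notin> S" using x sub by (auto simp: frontier_def)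
    then show ?thesis using hit[of x a] a(1) by auto
  qed
  ultimately obtain T where T: "0 \<le> T" "\<And>x. x \<in> ?Q \<Longrightarrow> \<exists>t\<in>{0..}. \<bar>t\<bar> \<le> T \<and> \<phi> x t \<in> {x. infdist x A < a}"
    by (rule compact_hit_time[OF Q]) (assumption, rule that)
  obtain e where e: "0 < e" "\<And>x. infdist x S \<le> e \<Longrightarrow> x \<in> interior N"
    by (rule open_infdist_subset[OF S(1,2) open_interior sub]) (rule that)
  obtain d where d: "0 < d" "\<forall>x. infdist x S \<le> d \<longrightarrow> (\<forall>t\<in>{-T..T}. infdist (\<phi> x t) S < e)"
    using compact_stay_near[OF S(1-3) e(1), of T] by blast
  define d' where "d' = min d (c / 3)"
  have d': "0 < d'" "d' \<le> d" "d' \<le> c / 3" using d(1) c(1) by (auto simp: d'_def)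
  have "\<phi> y s \<in> N" if y: "y \<in> \<Omega>" "infdist y S \<le> d'" and s: "s \<le> 0" for y s
  proof (rule ccontr)
    assume out: "\<phi> y s \<notin> N"
    have near: "\<phi> y t \<in> interior N" if "t \<in> {-T..T}" for t
      using d(2) y(2) d'(2) e(2)[of "\<phi> y t"] that by (meson less_imp_le order_trans)
    have "connected ((\<lambda>t. \<phi> y t) ` {s..0})" by (intro connected_continuous_image continuous_intros) simp
    moreover have "(\<lambda>t. \<phi> y t) ` {s..0} \<inter> N \<noteq> {}"
      using near[of 0] T(1) s interior_subset[of N] by force
    moreover have "(\<lambda>t. \<phi> y t) ` {s..0} - N \<noteq> {}" using out s by force
    ultimately have "(\<lambda>t. \<phi> y t) ` {s..0} \<inter> frontier N \<noteq> {}" by (rule connected_Int_frontier)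
    then obtain u where u: "s \<le> u" "u \<le> 0" "\<phi> y u \<in> frontier N" by auto
    have "u < - T"
    proof (rule ccontr)
      assume "\<not> u < - T"
      then have "\<phi> y u \<in> interior N" using u(2) T(1) by (intro near) simp
      then show False using u(3) by (simp add: frontier_def)
    qed
    have "\<phi> y u \<in> \<Omega>" using \<Omega>(2) y(1) by (simp add: invariant_def)
    then obtain t where t: "0 \<le> t" "t \<le> T" "infdist (\<phi> (\<phi> y u) t) A < a" using T(2)[of "\<phi> y u"] u(3) by auto
    have "\<phi> (\<phi> y u) t \<in> \<Omega>" using \<Omega>(2) y(1) by (simp add: invariant_def)
    then have "\<forall>v\<ge>0. infdist (\<phi> (\<phi> (\<phi> y u) t) v) A \<le> c / 3" using a(2) less_imp_le[OF t(3)] by blast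
    moreover have "0 \<le> - u - t" using \<open>u < - T\<close> t(2) by simp
    ultimately have "infdist (\<phi> (\<phi> (\<phi> y u) t) (- u - t)) A \<le> c / 3" by blast
    then have "infdist y A \<le> c / 3" by simp
    then show False using apart y(2) d'(3) by (meson order_trans)
  qed
  then show ?thesis using d'(1) unfolding backward_set_def by blast
qed

text \<open>Follow the orbit back until it is near \<open>S\<close>, where all points of
  \<open>\<Omega>\<close> are in the unstable set. Nearby points arrive there too, and their way
  forward avoids \<open>No\<close> and hence stays in \<open>N\<close>.\<close>

lemma open_unstable_part:
  assumes \<Omega>: "invariant \<phi> \<Omega>" and S: "S \<noteq> {}" and sub: "backward_set \<subseteq> \<Omega>"
    and d: "0 < d" "\<forall>y\<in>\<Omega>. infdist y S \<le> d \<longrightarrow> y \<in> backward_set"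
  shows "openin (top_of_set \<Omega>) (backward_set - No)"
  unfolding openin_euclidean_subtopology_iff
proof (intro conjI ballI)
  show "backward_set - No \<subseteq> \<Omega>" using sub by blast
  fix x assume x: "x \<in> backward_set - No"
  obtain t where t: "t \<le> 0" "infdist (\<phi> x t) S < d" using backward_set_limit[OF S _ d(1)] x by blast
  have "\<phi> (\<phi> x t) s \<notin> No" if s: "0 \<le> s" "s \<le> - t" for s
  proof
    assume *: "\<phi> (\<phi> x t) s \<in> No"
    obtain e where e: "0 < e" "\<And>u. 0 < u \<Longrightarrow> u \<le> e \<Longrightarrow> \<phi> (\<phi> (\<phi> x t) s) u \<notin> N"
      by (rule exit_from_No[OF *]) (rule that)
    show False
    proof (cases "s = - t")
      case True
      then show False using * x by simp
    next
      case False
      define u where "u = min e (- t - s)"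
      have "0 < u" "u \<le> e" "t + s + u \<le> 0" using False s e(1) by (auto simp: u_def)
      then show False using e(2)[of u] x by (simp add: backward_set_def)
    qed
  qed
  then obtain r where r: "0 < r" "\<forall>y s. dist (\<phi> x t) y < r \<longrightarrow> 0 \<le> s \<longrightarrow> s < - t + r \<longrightarrow> \<phi> y s \<notin> No"
    using avoid_No_open[of "- t" "\<phi> x t"] t(1) by auto
  let ?G = "{y. dist (\<phi> x t) (\<phi> y t) < r} \<inter> {y. infdist (\<phi> y t) S < d}"
  have "open ?G" by (intro open_Int open_Collect_less continuous_intros)
  moreover have "x \<in> ?G" using r(1) t(2) by simp
  ultimately obtain e where e: "0 < e" "ball x e \<subseteq> ?G" by (meson open_contains_ball)
  have "y \<in> backward_set - No" if y: "y \<in> \<Omega>" "dist y x < e" for y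
  proof -
    have "y \<in> ?G" using e(2) y(2) by (auto simp: dist_commute)
    then have y': "dist (\<phi> x t) (\<phi> y t) < r" "infdist (\<phi> y t) S \<le> d" by auto
    have "\<phi> y t \<in> \<Omega>" using \<Omega> y(1) by (simp add: invariant_def)
    then have bwd: "\<phi> y t \<in> backward_set" using d(2) y'(2) by blast
    have out: "\<phi> (\<phi> y t) s \<notin> No" if "0 \<le> s" "s \<le> - t" for s
    proof -
      have "s < - t + r" using that(2) r(1) by simp
      then show ?thesis using r(2) y'(1) that(1) by blast
    qed
    have "\<phi> y s \<in> N" if "s \<le> 0" for s
    proof (cases "s \<le> t")
      case True
      then have "s - t \<le> 0" by simp
      then have "\<phi> (\<phi> y t) (s - t) \<in> N" using bwd unfolding backward_set_def by blast
      then show ?thesis by simp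
    next
      case False
      have "\<phi> (\<phi> y t) (s - t) \<in> N"
        by (rule stay_in_N[of _ "- t"]) (use bwd backward_set_subset out False that in auto)
      then show ?thesis by simp
    qed
    moreover have "y \<notin> No" using out[of "- t"] t(1) by simp
    ultimately show ?thesis by (simp add: backward_set_def)
  qed
  then show "\<exists>e>0. \<forall>y\<in>\<Omega>. dist y x < e \<longrightarrow> y \<in> backward_set - No" using e(1) by blast
qed

lemma group_rank_index_repeller:
  assumes \<Omega>: "global_attractor \<phi> \<Omega>" "acyclic_set \<Omega>" and A: "attractor_in \<Omega> \<phi> A" "A \<noteq> {}"
    and S: "S = \<Omega> - basin_in \<Omega> \<phi> A" "compact S" "invariant \<phi> S" "S \<noteq> {}"
    and Z: "compact_space Z" "Hausdorff_space Z" "pointed_homotopy_equivalent (index_space, None) (Z, z)"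
  shows "group_rank (cech_cohomology k Z {z}) = hrank k (reduced_system A)"
proof -
  have A': "A \<subseteq> \<Omega>" "compact A" "invariant \<phi> A" "stable_in \<Omega> \<phi> A" using A(1) by (auto simp: attractor_in_def)
  have "\<Omega> \<noteq> {}" using A'(1) A(2) by blast
  note \<Omega>' = global_attractorD[OF \<Omega>(1) this]
  have stable: "stable_on \<Omega> A" by (rule stable_in_stable_on[OF A'(2) A(2) A'(1,4)])
  have AS: "A \<inter> S = {}" using attracting_in_basin[OF A(1)] S(1) by blast
  have hit: "\<exists>t\<ge>0. infdist (\<phi> x t) A < e" if "x \<in> \<Omega>" "x \<notin> S" "0 < e" for x e
    using that S(1) by (intro omega_limit_infdist) (auto simp: basin_in_def)
  have sub: "backward_set \<subseteq> \<Omega>"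
  proof
    fix y assume "y \<in> backward_set"
    then have "\<phi> y t \<in> N" if "t \<le> 0" for t using that by (simp add: backward_set_def)
    then show "y \<in> \<Omega>" by (rule backward_bounded_in_global_attractor[OF \<Omega>(1) \<open>\<Omega> \<noteq> {}\<close> compact_N])
  qed
  have "S \<subseteq> \<Omega>" using S(1) by blast
  obtain d where d: "0 < d" "\<forall>y\<in>\<Omega>. infdist y S \<le> d \<longrightarrow> y \<in> backward_set"
    using near_repeller_in_backward_set[OF \<Omega>'(1,2) S(2,4,3) \<open>S \<subseteq> \<Omega>\<close> A'(2) A(2) AS stable hit] by blast
  \<comment> \<open>Collapsing \<open>D\<close> in \<open>\<Omega>\<close> leaves precisely the
    unstable set outside \<open>No\<close>, as the comparison with the index space demands.\<close>
  define D where "D = \<Omega> - (backward_set - No)"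
  have "closedin (top_of_set \<Omega>) D"
    using open_unstable_part[OF \<Omega>'(2) S(4) sub d] sub unfolding D_def by (simp add: closedin_def Diff_Diff_Int Int_absorb1 subset_eq)
  then have "closed D" using compact_imp_closed[OF \<Omega>'(1)] by (rule closedin_closed_trans)
  have D: "D \<subseteq> \<Omega>" "\<Omega> - D = backward_set - No" using sub by (auto simp: D_def)
  have compact_D: "compact D" using compact_Int_closed[OF \<Omega>'(1) \<open>closed D\<close>] D(1) by (simp add: Int_absorb1)
  have pos: "\<phi> y t \<in> D" if y: "y \<in> D" and t: "0 \<le> t" for y t
  proof -
    have "\<phi> y t \<in> \<Omega>" using \<Omega>'(2) y D(1) by (auto simp: invariant_def)
    moreover have "\<phi> y t \<notin> backward_set - No"
    proof
      assume *: "\<phi> y t \<in> backward_set - No"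
      have bwd: "\<phi> y s \<in> N" if "s \<le> t" for s
      proof -
        have "s - t \<le> 0" using that by simp
        then have "\<phi> (\<phi> y t) (s - t) \<in> N" using * unfolding backward_set_def by blast
        then show ?thesis by simp
      qed
      then have "y \<in> backward_set" using t by (simp add: backward_set_def)
      moreover have "y \<notin> No"
      proof
        assume yNo: "y \<in> No"
        obtain e where e: "0 < e" "\<And>u. 0 < u \<Longrightarrow> u \<le> e \<Longrightarrow> \<phi> y u \<notin> N"
          by (rule exit_from_No[OF yNo]) (rule that)
        have "t \<noteq> 0" using * yNo by auto
        then have "0 < min e t" "min e t \<le> e" "min e t \<le> t" using e(1) t by auto
        then show False using e(2) bwd by blast
      qed
      ultimately show False using y by (simp add: D_def)
    qed
    ultimately show ?thesis by (simp add: D_def)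
  qed
  \<comment> \<open>A point of \<open>A\<close> in the unstable set would have a backward orbit
    approaching \<open>S\<close>, but this orbit remains in \<open>A\<close>, at positive distance
    from \<open>S\<close>.\<close>
  have "A \<subseteq> D"
  proof
    fix x assume x: "x \<in> A"
    have "x \<notin> backward_set"
    proof
      assume "x \<in> backward_set"
      obtain c where c: "0 < c" "\<forall>x\<in>A. \<forall>y\<in>S. c \<le> dist x y"
        using separate_compact_closed[OF A'(2) compact_imp_closed[OF S(2)] AS] by blast
      obtain t where t: "infdist (\<phi> x t) S < c" using backward_set_limit[OF S(4) \<open>x \<in> backward_set\<close> c(1)] by blast
      have "\<phi> x t \<in> A" using A'(3) x by (simp add: invariant_def)
      then show False using c(2) nearest[OF S(2,4), of "\<phi> x t"] t by fastforce
    qed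
    then show "x \<in> D" using x A'(1) by (auto simp: D_def)
  qed
  have "uniformly_attracts A D"
  proof (rule compact_uniformly_attracted[OF stable _ compact_D D(1)])
    show "\<phi> x t \<in> \<Omega>" if "x \<in> \<Omega>" for x t using \<Omega>'(2) that by (simp add: invariant_def)
    have "x \<notin> S" if "x \<in> D" for x using S_in_backward_set[OF S(3)] that by (auto simp: D_def)
    then show "\<exists>t\<ge>0. infdist (\<phi> x t) A < e" if "x \<in> D" "0 < e" for x e using hit that D(1) by blast
  qed
  then have retract: "hrank k (reduced_system D) = hrank k (reduced_system A)"
    using hrank_reduced_retract[OF A'(2) A(2) A'(3) compact_D \<open>A \<subseteq> D\<close> _ pos] by blast
  have "group_rank (cech_cohomology k Z {z}) = hrank (Suc k) (metric_system \<Omega> D)"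
    by (rule group_rank_index[OF Z \<Omega>'(1) \<open>closed D\<close> D])
  also have "\<dots> = hrank k (reduced_system D)" by (rule hrank_pair_acyclic[OF \<Omega>(2) D(1)])
  finally show ?thesis using retract by simp
qed

end

context continuous_flow
begin

section \<open>Finiteness of ranks and Poincare series\<close>

lemma acyclic_global_attractor:
  assumes \<Omega>: "global_attractor \<phi> \<Omega>" "\<Omega> \<noteq> {}"
  shows "acyclic_set \<Omega>"
proof -
  note \<Omega>' = global_attractorD[OF \<Omega>]
  have hull: "compact (convex hull \<Omega>)" by (rule compact_convex_hull[OF \<Omega>'(1)])
  have "uniformly_attracts \<Omega> (convex hull \<Omega>)"
    by (rule compact_uniformly_attracted[OF \<Omega>'(3) _ hull]) (use \<Omega>'(4) in auto)
  then show ?thesis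
    by (rule acyclic_dominated[OF \<Omega>'(1) \<Omega>(2) \<Omega>'(2) hull hull_subset])
       (rule acyclic_convex, use \<Omega>(2) hull in auto)
qed

lemma finite_hrank_attractor:
  assumes A: "captures_backward A \<delta>"
  shows "\<exists>q. finite_hrank A q"
proof -
  have A': "compact A" "A \<noteq> {}" "invariant \<phi> A" using A by (auto simp: captures_backward_def)
  obtain \<eta> where \<eta>: "0 < \<eta>" "\<eta> \<le> \<delta>" "\<And>x t. infdist x A \<le> \<eta> \<Longrightarrow> 0 \<le> t \<Longrightarrow> infdist (\<phi> x t) A \<le> \<delta>"
    and att: "\<And>e. 0 < e \<Longrightarrow> \<exists>T\<ge>0. \<forall>x. infdist x A \<le> \<eta> \<longrightarrow> (\<forall>t\<ge>T. infdist (\<phi> x t) A \<le> e)"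
    by (rule captures_backward_attracts[OF A]) blast
  \<comment> \<open>Balls of radius \<open>\<eta>\<close> about points of \<open>A\<close> stay in
    the region which \<open>A\<close> attracts uniformly.\<close>
  have "A \<subseteq> (\<Union>x\<in>A. ball x \<eta>)" using \<eta>(1) by auto
  then obtain K where K: "K \<subseteq> A" "finite K" "A \<subseteq> (\<Union>x\<in>K. ball x \<eta>)"
    by (rule compactE_image[OF A'(1), rotated]) auto
  define P where "P = \<Union>((\<lambda>x. cball x \<eta>) ` K)"
  have "compact P" unfolding P_def using K(2) by (intro compact_Union) auto
  have "A \<subseteq> P" using K(3) ball_subset_cball unfolding P_def by blast
  have near: "infdist x A \<le> \<eta>" if x: "x \<in> P" for x
  proof -
    obtain y where y: "y \<in> A" "dist x y \<le> \<eta>" using x K(1) by (auto simp: P_def dist_commute)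
    show ?thesis using infdist_le[OF y(1), of x] y(2) by simp
  qed
  have "uniformly_attracts A P"
    unfolding uniformly_attracts_def
  proof (intro allI impI)
    fix e :: real assume "0 < e"
    then obtain T where "0 \<le> T" "\<forall>x. infdist x A \<le> \<eta> \<longrightarrow> (\<forall>t\<ge>T. infdist (\<phi> x t) A \<le> e)" using att by blast
    then show "\<exists>T\<ge>0. \<forall>y\<in>P. infdist (\<phi> y T) A \<le> e" using near by (intro exI[of _ T]) simp
  qed
  then have le: "hrank m (metric_system A {}) \<le> hrank m (metric_system P {})" for m
    by (rule hrank_dominated_metric[OF A' \<open>compact P\<close> \<open>A \<subseteq> P\<close>])
  have "finite_hrank P (card ((\<lambda>x. cball x \<eta>) ` K))"
    unfolding P_def by (rule finite_hrank_union_convex) (use K(2) in auto)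
  then have "finite_hrank A (card ((\<lambda>x. cball x \<eta>) ` K))"
    using le unfolding finite_hrank_def by (metis le_zero_eq order_le_less_trans)
  then show ?thesis by blast
qed

text \<open>The hypothesis on \<open>c\<close> covers all blocks and all members of the index,
  whichever \<open>SOME\<close> selects; existence of one block guarantees that it selects a member
  at all.\<close>

lemma poincare_series_eq:
  assumes block: "\<exists>N Ni No. isolating_block \<phi> S N Ni No"
    and c: "\<And>N Ni No Z (z :: 'a option) k. flow_block \<phi> S N Ni No \<Longrightarrow> compact_space Z \<Longrightarrow> Hausdorff_space Z \<Longrightarrow>
      pointed_homotopy_equivalent (quotient_space N No, None) (Z, z) \<Longrightarrow> group_rank (cech_cohomology k Z {z}) = c k"
  shows "poincare_series (conley_index \<phi> S) = Abs_fps c"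
proof -
  obtain Z z where Zz: "(SOME p. p \<in> conley_index \<phi> S) = (Z, z)" by (cases "SOME p. p \<in> conley_index \<phi> S")
  obtain N Ni No where "isolating_block \<phi> S N Ni No" using block by blast
  then have "flow_block \<phi> S N Ni No" by unfold_locales
  then have "conley_index \<phi> S \<noteq> {}" using flow_block.index_space_in_conley_index by blast
  then have "(Z, z) \<in> conley_index \<phi> S" unfolding Zz[symmetric] by (simp add: some_in_eq)
  then obtain N Ni No where Z: "compact_space Z" "Hausdorff_space Z" "isolating_block \<phi> S N Ni No"
    "pointed_homotopy_equivalent (quotient_space N No, None) (Z, z)"
    unfolding conley_index_def by blast
  then have "flow_block \<phi> S N Ni No" by unfold_locales
  then have "group_rank (cech_cohomology k Z {z}) = c k" for k by (rule c[OF _ Z(1,2,4)])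
  then show ?thesis by (simp add: poincare_series_def Zz)
qed

lemma poincare_series_attractor:
  assumes A: "captures_backward A \<delta>"
  shows "poincare_series (conley_index \<phi> A) = Abs_fps (\<lambda>k. hrank (Suc k) (metric_system A {}))"
  using attractor_block[OF A] flow_block.group_rank_index_attractor[OF _ A]
  by (intro poincare_series_eq) blast+

lemma poincare_series_global_attractor:
  assumes \<Omega>: "global_attractor \<phi> \<Omega>" "\<Omega> \<noteq> {}"
  shows "poincare_series (conley_index \<phi> \<Omega>) = 1"
  unfolding poincare_series_attractor[OF captures_backward_global[OF \<Omega>]]
    hrank_acyclic[OF acyclic_global_attractor[OF \<Omega>] \<Omega>(2)]
  by (simp add: fps_eq_iff)

lemma poincare_series_repeller:
  assumes \<Omega>: "global_attractor \<phi> \<Omega>" and A: "attractor_in \<Omega> \<phi> A" "A \<noteq> {}"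
    and R: "R = \<Omega> - basin_in \<Omega> \<phi> A" "compact R" "invariant \<phi> R" "R \<noteq> {}"
  shows "poincare_series (conley_index \<phi> R) = Abs_fps (\<lambda>k. hrank k (reduced_system A))"
proof (rule poincare_series_eq)
  have "A \<subseteq> \<Omega>" using A(1) by (simp add: attractor_in_def)
  then have \<Omega>0: "\<Omega> \<noteq> {}" using A(2) by blast
  obtain \<delta> where \<delta>: "captures_backward A \<delta>" "\<forall>x\<in>\<Omega>. infdist x A \<le> \<delta> \<longrightarrow> x \<in> basin_in \<Omega> \<phi> A"
    using attractor_in_global[OF \<Omega> A] by blast
  show "\<exists>N Ni No. isolating_block \<phi> R N Ni No"
    by (rule repeller_block[OF captures_backward_global[OF \<Omega> \<Omega>0] \<delta>(1) \<open>A \<subseteq> \<Omega>\<close> _ R(1,3)]) (use \<delta>(2) in blast)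
  show "group_rank (cech_cohomology k Z {z}) = hrank k (reduced_system A)"
    if "flow_block \<phi> R N Ni No" "compact_space Z" "Hausdorff_space Z"
      "pointed_homotopy_equivalent (quotient_space N No, None) (Z, z)" for N Ni No Z z k
    by (rule flow_block.group_rank_index_repeller[OF that(1) \<Omega> acyclic_global_attractor[OF \<Omega> \<Omega>0] A R that(2-4)])
qed

end

section \<open>The Morse equations\<close>

text \<open>The common form of the three left-hand sides: \<open>b\<close> is the sequence of ranks
  of the attractor. The truncated subtraction is exact as soon as
  \<open>1 \<le> b 0\<close>.\<close>

definition morse_series :: "(nat \<Rightarrow> enat) \<Rightarrow> enat fps" where
  "morse_series b = fps_const (b 0) + fps_const (b 1 + b 0 - 1) * fps_X +
     Abs_fps (\<lambda>k. if k \<ge> 2 then b k + b (k - 1) else 0)"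

lemma morse_series_nth:
  "fps_nth (morse_series b) n = (if n = 0 then b 0 else if n = 1 then b 1 + b 0 - 1 else b n + b (n - 1))"
proof -
  consider "n = 0" | "n = 1" | m where "n = Suc (Suc m)" by (metis One_nat_def not0_implies_Suc)
  then show ?thesis by cases (simp_all add: morse_series_def)
qed

lemma morse_series_eq:
  assumes fin: "\<And>k. b k < \<infinity>" and zero: "\<And>k. q \<le> k \<Longrightarrow> b k = 0" and b0: "1 \<le> b 0"
  shows "\<exists>Q. morse_series b = 1 + (1 + fps_X) * natpoly_series Q"
proof -
  define c where "c k = the_enat (if k = 0 then b 0 - 1 else b k)" for k
  have c0: "enat (c 0) = b 0 - 1" and c: "k \<noteq> 0 \<Longrightarrow> enat (c k) = b k" for k
    using fin[of k] fin[of 0] by (cases "b k"; cases "b 0"; simp add: c_def one_enat_def)+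
  define Q where "Q = Poly (map c [0..<Suc q])"
  have "coeff Q k = c k" for k
  proof (cases "k < Suc q")
    case False
    then have "c k = 0" using zero[of k] by (simp add: c_def zero_enat_def)
    then show ?thesis using False by (simp add: Q_def nth_default_def)
  qed (simp add: Q_def nth_default_def del: upt_Suc)
  then have Q: "fps_nth (natpoly_series Q) k = enat (c k)" for k
    by (simp add: natpoly_series_def coeff_map_poly zero_enat_def)
  have "fps_nth (morse_series b) n = fps_nth (1 + (1 + fps_X) * natpoly_series Q) n" for n
  proof -
    obtain m where m: "b 0 = enat (Suc m)"
      using fin[of 0] b0 by (cases "b 0") (auto simp: one_enat_def Suc_le_eq gr0_conv_Suc)
    then have c0': "enat (c 0) = enat m" unfolding c0 by (simp add: one_enat_def)
    have "fps_nth (1 + (1 + fps_X) * natpoly_series Q) n =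
        (if n = 0 then 1 else 0) + enat (c n) + (if n = 0 then 0 else enat (c (n - 1)))"
      by (simp add: distrib_right Q fps_one_nth add.assoc)
    also have "\<dots> = fps_nth (morse_series b) n"
    proof -
      consider "n = 0" | "n = 1" | "n \<noteq> 0" "n \<noteq> 1" by blast
      then show ?thesis
      proof cases
        case 1
        then show ?thesis unfolding 1 c0' by (simp add: morse_series_nth m one_enat_def)
      next
        case 2
        obtain l where "b 1 = enat l" using fin[of 1] by (cases "b 1") auto
        then show ?thesis using c[of 1] by (simp add: 2 c0' morse_series_nth m one_enat_def)
      next
        case 3
        then show ?thesis using c[of n] c[of "n - 1"] by (simp add: morse_series_nth)
      qed
    qed
    finally show ?thesis ..
  qed
  then show ?thesis by (intro exI[of _ Q]) (rule fps_ext)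
qed

context continuous_flow
begin

lemma morse_series_decomposition:
  assumes \<Omega>: "global_attractor \<phi> \<Omega>" and dec: "attractor_repeller_decomposition \<phi> \<Omega> A R" "A \<noteq> {}"
    and R: "isolated_invariant \<phi> R" "R \<noteq> {}"
  shows "poincare_series (conley_index \<phi> A) + poincare_series (conley_index \<phi> R) =
      morse_series (\<lambda>k. hrank (Suc k) (metric_system A {}))"
    and "\<exists>q. finite_hrank A q" "1 \<le> hrank 1 (metric_system A {})"
proof -
  have A: "attractor_in \<Omega> \<phi> A" and R': "R = \<Omega> - basin_in \<Omega> \<phi> A" "compact R" "invariant \<phi> R"
    using dec R by (auto simp: attractor_repeller_decomposition_def isolated_invariant_def)
  obtain \<delta> where \<delta>: "captures_backward A \<delta>" using attractor_in_global[OF \<Omega> A dec(2)] by blast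
  show "\<exists>q. finite_hrank A q" by (rule finite_hrank_attractor[OF \<delta>])
  then obtain q where q: "finite_hrank A q" ..
  have h1: "hrank 1 (metric_system A {}) = hrank 1 (reduced_system A) + 1" by (rule hrank_reduced_1[OF dec(2)])
  then show "1 \<le> hrank 1 (metric_system A {})" by simp
  have "hrank (Suc 0) (metric_system A {}) < \<infinity>" using q unfolding finite_hrank_def by blast
  then have "hrank (Suc 0) (reduced_system A) \<noteq> \<infinity>" using h1 by (metis One_nat_def less_irrefl plus_enat_simps(2))
  \<comment> \<open>Naming the finite reduced rank reduces the truncated subtraction in the
    coefficient of degree 1 to arithmetic with a natural number.\<close>
  then obtain m where m: "hrank (Suc 0) (reduced_system A) = enat m" by (cases "hrank (Suc 0) (reduced_system A)") simp_all
  \<comment> \<open>Lists of length \<open>k\<close> belong to degree \<open>k - 1\<close>, which is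
    what puts \<open>b (k - 1)\<close> next to \<open>b k\<close>. The reduced rank is 0 in degree
    -1 and \<open>b 0 - 1\<close> in degree 0.\<close>
  have red: "hrank k (reduced_system A) + hrank (Suc k) (metric_system A {}) =
      fps_nth (morse_series (\<lambda>k. hrank (Suc k) (metric_system A {}))) k" for k
  proof -
    consider "k = 0" | "k = 1" | j where "k = Suc (Suc j)" by (metis One_nat_def not0_implies_Suc)
    then show ?thesis
    proof cases
      case 1
      then show ?thesis by (simp add: morse_series_nth hrank_reduced_zero[OF dec(2)])
    next
      case 2
      have "hrank (Suc 0) (metric_system A {}) = enat m + 1" using h1 m by simp
      then show ?thesis unfolding 2
        by (cases "hrank 2 (metric_system A {})") (simp_all add: morse_series_nth m numeral_2_eq_2 one_enat_def)
    next
      case (3 j)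
      then show ?thesis by (simp add: morse_series_nth hrank_reduced_ge_2 add.commute)
    qed
  qed
  show "poincare_series (conley_index \<phi> A) + poincare_series (conley_index \<phi> R) =
      morse_series (\<lambda>k. hrank (Suc k) (metric_system A {}))"
    unfolding poincare_series_attractor[OF \<delta>] poincare_series_repeller[OF \<Omega> A dec(2) R' R(2)]
    by (rule fps_ext) (simp add: red[symmetric] add.commute)
qed

end

lemma group_rank_cech_compact:
  fixes S :: "'a::metric_space set"
  assumes "compact S"
  shows "group_rank (cech_cohomology k (top_of_set S) {}) = hrank (Suc k) (metric_system S {})"
proof -
  have "compact_space (top_of_set S)" "Hausdorff_space (top_of_set S)"
    using assms by (auto simp: compact_space_subtopology Hausdorff_space_subtopology)
  then show ?thesis by (simp add: group_rank_cech_cohomology cover_system_compact_metric[OF assms])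
qed

theorem theorem5:
  fixes \<Phi> :: "real \<Rightarrow> (real ^ 'n) \<Rightarrow> real \<Rightarrow> (real ^ 'n)"
    and \<Omega> K C :: "(real ^ 'n) set"
    and R :: "real \<Rightarrow> (real ^ 'n) set"
    and l0 l1 :: real
    and r r' :: "nat \<Rightarrow> enat"
  assumes family: "continuous_flow_family \<Phi>"
    and global: "\<And>l. global_attractor (\<Phi> l) \<Omega>"
    and K_isolated: "\<And>l. isolated_invariant (\<Phi> l) K"
    and C_isolated: "\<And>l. isolated_invariant (\<Phi> l) C"
    and nonempty: "K \<noteq> {}" "C \<noteq> {}" "\<And>l. l0 < l \<Longrightarrow> l < l1 \<Longrightarrow> R l \<noteq> {}"
    and l0_l1: "l0 < l1"
    and at_l0: "repeller_attractor_decomposition (\<Phi> l0) \<Omega> K C"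
    and at_l1: "attractor_repeller_decomposition (\<Phi> l1) \<Omega> K C"
    and R_isolated: "\<And>l. l0 < l \<Longrightarrow> l < l1 \<Longrightarrow> isolated_invariant (\<Phi> l) (R l)"
    and R_repeller: "\<And>l. l0 < l \<Longrightarrow> l < l1 \<Longrightarrow> repeller_in UNIV (\<Phi> l) (R l)"
    and between: "\<And>l. l0 < l \<Longrightarrow> l < l1 \<Longrightarrow>
          attractor_repeller_decomposition (\<Phi> l) \<Omega> (K \<union> C) (R l)"
    and r: "\<And>k. r k = group_rank (cech_cohomology k (top_of_set K) {})"
    and r': "\<And>k. r' k = group_rank (cech_cohomology k (top_of_set C) {})"
  shows "\<exists>Q1 Q2 Q3 :: nat poly.
     (let P = (\<lambda>l S. poincare_series (conley_index (\<Phi> l) S));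
          E1 = fps_const (r' 0) + fps_const (r' 1 + r' 0 - 1) * fps_X
                 + Abs_fps (\<lambda>k. if k \<ge> 2 then r' k + r' (k - 1) else 0);
          E2 = fps_const (r 0 + r' 0) + fps_const (r 1 + r 0 + r' 1 + r' 0 - 1) * fps_X
                 + Abs_fps (\<lambda>k. if k \<ge> 2 then r k + r (k - 1) + r' k + r' (k - 1) else 0);
          E3 = fps_const (r 0) + fps_const (r 1 + r 0 - 1) * fps_X
                 + Abs_fps (\<lambda>k. if k \<ge> 2 then r k + r (k - 1) else 0)
      in (P l0 C + P l0 K = E1 \<and> P l0 \<Omega> = 1 \<and>
            E1 = 1 + (1 + fps_X) * natpoly_series Q1) \<and>
         (\<forall>l. l0 < l \<and> l < l1 \<longrightarrow>
            P l (K \<union> C) + P l (R l) = E2 \<and> P l \<Omega> = 1 \<and>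
            E2 = 1 + (1 + fps_X) * natpoly_series Q2) \<and>
         (P l1 K + P l1 C = E3 \<and> P l1 \<Omega> = 1 \<and>
            E3 = 1 + (1 + fps_X) * natpoly_series Q3))"
proof -
  have flow: "continuous_flow (\<Phi> l)" for l
    using family by unfold_locales (simp add: continuous_flow_family_def)
  have comp: "compact K" "compact C"
    using K_isolated[of l0] C_isolated[of l0] by (auto simp: isolated_invariant_def)
  have rK: "r = (\<lambda>k. hrank (Suc k) (metric_system K {}))" by (rule ext) (simp add: r group_rank_cech_compact comp)
  have rC: "r' = (\<lambda>k. hrank (Suc k) (metric_system C {}))" by (rule ext) (simp add: r' group_rank_cech_compact comp)
  have l0': "attractor_repeller_decomposition (\<Phi> l0) \<Omega> C K"
    using at_l0 by (simp add: repeller_attractor_decomposition_def)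
  have "attractor_in \<Omega> (\<Phi> l0) C" "K = \<Omega> - basin_in \<Omega> (\<Phi> l0) C"
    using l0' by (auto simp: attractor_repeller_decomposition_def)
  \<comment> \<open>The dual repeller misses the basin of \<open>C\<close>, and an attractor lies in
    its own basin.\<close>
  then have KC: "K \<inter> C = {}" using attracting_in_basin by blast
  have \<Omega>: "\<Omega> \<noteq> {}"
    using l0' nonempty(2) by (auto simp: attractor_repeller_decomposition_def attractor_in_def)
  note D0 = continuous_flow.morse_series_decomposition[OF flow global l0' nonempty(2) K_isolated nonempty(1)]
  note D1 = continuous_flow.morse_series_decomposition[OF flow global at_l1 nonempty(1) C_isolated nonempty(2)]
  have P\<Omega>: "poincare_series (conley_index (\<Phi> l) \<Omega>) = 1" for l
    by (rule continuous_flow.poincare_series_global_attractor[OF flow global \<Omega>])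
  \<comment> \<open>The union is disjoint, so its ranks add up, and the middle equation is the one
    for the sequence of the sums \<open>r k + r' k\<close>.\<close>
  have rKC: "(\<lambda>k. hrank (Suc k) (metric_system (K \<union> C) {})) = (\<lambda>k. r k + r' k)"
    unfolding rK rC using hrank_disjoint_union[OF comp KC] by auto
  have D: "poincare_series (conley_index (\<Phi> l) (K \<union> C)) + poincare_series (conley_index (\<Phi> l) (R l)) =
      morse_series (\<lambda>k. r k + r' k)" if l: "l0 < l" "l < l1" for l
    using continuous_flow.morse_series_decomposition(1)[OF flow global between[OF l] _ R_isolated[OF l] nonempty(3)[OF l]]
      nonempty(1) unfolding rKC by simp
  obtain p where p: "finite_hrank K p" using D1(2) ..
  obtain q where q: "finite_hrank C q" using D0(2) ..
  have K: "r k < \<infinity>" "p \<le> k \<Longrightarrow> r k = 0" "1 \<le> r 0" for k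
    using p D1(3) unfolding rK finite_hrank_def by auto
  have C: "r' k < \<infinity>" "q \<le> k \<Longrightarrow> r' k = 0" "1 \<le> r' 0" for k
    using q D0(3) unfolding rC finite_hrank_def by auto
  obtain Q1 where Q1: "morse_series r' = 1 + (1 + fps_X) * natpoly_series Q1"
    using morse_series_eq[of r' q] C by blast
  obtain Q3 where Q3: "morse_series r = 1 + (1 + fps_X) * natpoly_series Q3"
    using morse_series_eq[of r p] K by blast
  have "r k + r' k < \<infinity>" for k using K(1)[of k] C(1)[of k] by (cases "r k"; cases "r' k") auto
  moreover have "r k + r' k = 0" if "max p q \<le> k" for k using K(2) C(2) that by simp
  moreover have "1 \<le> r 0 + r' 0" using K(3) by (rule order_trans) simp
  ultimately obtain Q2 where Q2: "morse_series (\<lambda>k. r k + r' k) = 1 + (1 + fps_X) * natpoly_series Q2"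
    using morse_series_eq[of "\<lambda>k. r k + r' k" "max p q"] by blast
  have "morse_series (\<lambda>k. r k + r' k) = fps_const (r 0 + r' 0) + fps_const (r 1 + r 0 + r' 1 + r' 0 - 1) * fps_X
      + Abs_fps (\<lambda>k. if k \<ge> 2 then r k + r (k - 1) + r' k + r' (k - 1) else 0)"
    unfolding morse_series_def by (simp add: ac_simps cong: if_cong)
  note E = morse_series_def[of r, symmetric] morse_series_def[of r', symmetric] this[symmetric]
  show ?thesis
    unfolding Let_def E
    using D0(1)[folded rC] D1(1)[folded rK] D P\<Omega> Q1 Q2 Q3
    by (intro exI[of _ Q1] exI[of _ Q2] exI[of _ Q3]) simp
qed

end
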